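(* Let $\Gamma^{+}$ be the positive cone in a totally ordered abelian group $\Gamma$. Then the following commutative diagram, with exact rows and columns, exists: $$\begin{array}{ccccccccc} &&0&&0&&0&&\\ &&\downarrow&&\downarrow&&\downarrow&&\\ 0&\to&\ker\varphi_{T}\cap\ker\varphi_{T^{*}}&\to&\ker\varphi_{T^{*}}&\overset{\varphi_T|}{\to}&\mathcal C_{\Gamma}&\to&0\\ &&\downarrow&&\downarrow&&\downarrow&&\\ 0&\to&\ker\varphi_{T}&\to&B_{\Gamma^{+}}\times_{\tau}^{\mathrm{piso}}\Gamma^{+}&\overset{\varphi_T}{\to}&\mathcal T(\Gamma)&\to&0\\ &&\downarrow&&\downarrow{\scriptstyle\varphi_{T^*}}&&\downarrow{\scriptstyle\psi_{T^*}}&&\\ 0&\to&\mathcal C_{\Gamma}&\to&\mathcal T(\Gamma)&\overset{\psi_T}{\to}&C(\hat\Gamma)&\to&0\\ &&\downarrow&&\downarrow&&\downarrow&&\\ &&0&&0&&0&& \end{array}$$ together with a diagonal homomorphism $\Psi:B_{\Gamma^{+}}\times_{\tau}^{\mathrm{piso}}\Gamma^{+}\to C(\hat\Gamma)$ across the lower right square (so that $\Psi=\psi_{T^*}\circ\varphi_T=\psi_T\circ\varphi_{T^*}$), where $\Psi$ maps each generator $v_x\in B_{\Gamma^{+}}\times_{\tau}^{\mathrm{piso}}\Gamma^{+}$ to $\delta_x^{*}\in C^{*}(\Gamma)\simeq C(\hat\Gamma)$.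
   Context: $B_{\Gamma^+}$ is the unital $C^*$-subalgebra of $\ell^\infty(\Gamma^+)$ spanned (as closed span) by $\{1_s:s\in\Gamma^+\}$, where $1_s$ is the characteristic function of $\{x\in\Gamma^+:x\ge s\}$; $\tau$ is the action of $\Gamma^+$ on $B_{\Gamma^+}$ by endomorphisms with $\tau_x(1_s)=1_{s+x}$. A partial-isometric representation of $\Gamma^+$ (in a unital $C^*$-algebra) is a map $V$ on $\Gamma^+$ with each $V_x$ a partial isometry and $V_{x+y}=V_xV_y$. The partial-isometric crossed product $B_{\Gamma^+}\times_\tau^{\mathrm{piso}}\Gamma^+$ is the $C^*$-algebra universal for pairs $(\pi,V)$ of a nondegenerate representation $\pi$ of $B_{\Gamma^+}$ and a partial-isometric representation $V$ of $\Gamma^+$ satisfying $\pi(\tau_x(a))=V_x\pi(a)V_x^*$. It is a known fact that it is the universal $C^*$-algebra generated by a partial-isometric representation $v:x\mapsto v_x$ of $\Gamma^+$: every (unital) partial-isometric representation $w$ of $\Gamma^+$ determines a homomorphism $\pi_w\times w$ with $v_x\mapsto w_x$, where $\pi_w(1_x)=w_xw_x^*$. With $\{\varepsilon_x:x\in\Gamma^+\}$ the standard orthonormal basis of $\ell^2(\Gamma^+)$, let $T_s\varepsilon_x=\varepsilon_{x+s}$ for $s\in\Gamma^+$. The Toeplitz algebra $\mathcal T(\Gamma)$ is the $C^*$-subalgebra of $B(\ell^2(\Gamma^+))$ generated by $\{T_s:s\in\Gamma^+\}$, and $\mathcal C_\Gamma$ is its commutator ideal, $\mathcal C_\Gamma=\overline{\operatorname{span}}\{T_x(1-T_zT_z^*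 )T_y^*:x,y,z\in\Gamma^+\}$. The surjections $\varphi_T,\varphi_{T^*}:B_{\Gamma^+}\times_\tau^{\mathrm{piso}}\Gamma^+\to\mathcal T(\Gamma)$ are the homomorphisms with $\varphi_T(v_x)=T_x$ and $\varphi_{T^*}(v_x)=T_x^*$. $\hat\Gamma$ is the dual group of the discrete group $\Gamma$, $\lambda_x(\xi)=\xi(x)$ for $x\in\Gamma$, $\xi\in\hat\Gamma$, and $\psi_T,\psi_{T^*}:\mathcal T(\Gamma)\to C(\hat\Gamma)$ are the surjections with $\psi_T(T_x)=\lambda_x$ and $\psi_{T^*}(T_x)=\lambda_{-x}$. $\delta_x$ ($x\in\Gamma$) are the canonical unitary generators of $C^*(\Gamma)$, identified with $\lambda_x$ under the Fourier transform $C^*(\Gamma)\simeq C(\hat\Gamma)$. Unlabelled arrows are inclusions, except that the arrow $\ker\varphi_T\to\mathcal C_\Gamma$ in the left column is the restriction of $\varphi_{T^*}$; $\varphi_T|$ denotes the restriction of $\varphi_T$. *)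

theory Defs
  imports "HOL-Analysis.Analysis" "HOL-Algebra.Module" "HOL-Algebra.Ideal"
begin

section \<open>C*-algebras\<close>

definition complex_ring :: "complex ring" where
  "complex_ring = \<lparr>carrier = UNIV, mult = (*), one = 1, zero = 0, add = (+)\<rparr>"

record 'a cstar = "(complex, 'a) module" +
  star :: "'a \<Rightarrow> 'a"
  nrm :: "'a \<Rightarrow> real"

text \<open>C*-algebras are not assumed to be unital, so that ideals and kernels are C*-algebras
  in their own right; the field \<open>one\<close> of the record is meaningful only in the unital case.\<close>

locale cstar_algebra = module complex_ring A for A :: "'a cstar" (structure) +
  assumes mult_closed: "\<lbrakk>x \<in> carrier A; y \<in> carrier A\<rbrakk> \<Longrightarrow> x \<otimes> y \<in> carrier A"
    and mult_assoc: "\<lbrakk>x \<in> carrier A; y \<in> carrier A; z \<in> carrier A\<rbrakk> \<Longrightarrow>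
          (x \<otimes> y) \<otimes> z = x \<otimes> (y \<otimes> z)"
    and distr_left: "\<lbrakk>x \<in> carrier A; y \<in> carrier A; z \<in> carrier A\<rbrakk> \<Longrightarrow>
          (x \<oplus> y) \<otimes> z = (x \<otimes> z) \<oplus> (y \<otimes> z)"
    and distr_right: "\<lbrakk>x \<in> carrier A; y \<in> carrier A; z \<in> carrier A\<rbrakk> \<Longrightarrow>
          z \<otimes> (x \<oplus> y) = (z \<otimes> x) \<oplus> (z \<otimes> y)"
    and smult_mult_left: "\<lbrakk>x \<in> carrier A; y \<in> carrier A\<rbrakk> \<Longrightarrow>
          (c \<odot> x) \<otimes> y = c \<odot> (x \<otimes> y)"
    and smult_mult_right: "\<lbrakk>x \<in> carrier A; y \<in> carrier A\<rbrakk> \<Longrightarrow>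
          x \<otimes> (c \<odot> y) = c \<odot> (x \<otimes> y)"
    and star_closed: "x \<in> carrier A \<Longrightarrow> star A x \<in> carrier A"
    and star_star: "x \<in> carrier A \<Longrightarrow> star A (star A x) = x"
    and star_add: "\<lbrakk>x \<in> carrier A; y \<in> carrier A\<rbrakk> \<Longrightarrow>
          star A (x \<oplus> y) = star A x \<oplus> star A y"
    and star_smult: "x \<in> carrier A \<Longrightarrow> star A (c \<odot> x) = cnj c \<odot> star A x"
    and star_mult: "\<lbrakk>x \<in> carrier A; y \<in> carrier A\<rbrakk> \<Longrightarrow>
          star A (x \<otimes> y) = star A y \<otimes> star A x"
    and nrm_nonneg: "x \<in> carrier A \<Longrightarrow> 0 \<le> nrm A x"
    and nrm_eq_0: "x \<in> carrier A \<Longrightarrow> nrm A x = 0 \<longleftrightarrow> x = \<zero>"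
    and nrm_triangle: "\<lbrakk>x \<in> carrier A; y \<in> carrier A\<rbrakk> \<Longrightarrow>
          nrm A (x \<oplus> y) \<le> nrm A x + nrm A y"
    and nrm_smult: "x \<in> carrier A \<Longrightarrow> nrm A (c \<odot> x) = cmod c * nrm A x"
    and nrm_mult: "\<lbrakk>x \<in> carrier A; y \<in> carrier A\<rbrakk> \<Longrightarrow>
          nrm A (x \<otimes> y) \<le> nrm A x * nrm A y"
    and nrm_cstar: "x \<in> carrier A \<Longrightarrow> nrm A (star A x \<otimes> x) = (nrm A x)\<^sup>2"
    and nrm_complete: "\<And>\<sigma> :: nat \<Rightarrow> 'a. \<lbrakk>range \<sigma> \<subseteq> carrier A;
            \<forall>e>0. \<exists>N. \<forall>m\<ge>N. \<forall>n\<ge>N. nrm A (\<sigma> m \<ominus> \<sigma> n) < e\<rbrakk> \<Longrightarrow>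
          \<exists>x\<in>carrier A. (\<lambda>n. nrm A (\<sigma> n \<ominus> x)) \<longlonglongrightarrow> 0"

locale unital_cstar_algebra = cstar_algebra +
  assumes one_closed: "\<one> \<in> carrier A"
    and one_left: "x \<in> carrier A \<Longrightarrow> \<one> \<otimes> x = x"
    and one_right: "x \<in> carrier A \<Longrightarrow> x \<otimes> \<one> = x"

definition cstar_hom :: "'a cstar \<Rightarrow> 'b cstar \<Rightarrow> ('a \<Rightarrow> 'b) set" where
  "cstar_hom A B = {\<phi>. \<phi> \<in> carrier A \<rightarrow> carrier B \<and>
     (\<forall>x\<in>carrier A. \<forall>y\<in>carrier A. \<phi> (x \<oplus>\<^bsub>A\<^esub> y) = \<phi> x \<oplus>\<^bsub>B\<^esub> \<phi> y) \<and>
     (\<forall>c. \<forall>x\<in>carrier A. \<phi> (c \<odot>\<^bsub>A\<^esub> x) = c \<odot>\<^bsub>B\<^esub> \<phi> x) \<and>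
     (\<forall>x\<in>carrier A. \<forall>y\<in>carrier A. \<phi> (x \<otimes>\<^bsub>A\<^esub> y) = \<phi> x \<otimes>\<^bsub>B\<^esub> \<phi> y) \<and>
     (\<forall>x\<in>carrier A. \<phi> (star A x) = star B (\<phi> x))}"

definition norm_closed :: "'a set \<Rightarrow> 'a cstar \<Rightarrow> bool" where
  "norm_closed S A \<longleftrightarrow> (\<forall>\<sigma> :: nat \<Rightarrow> 'a. \<forall>x\<in>carrier A.
     range \<sigma> \<subseteq> S \<and> (\<lambda>n. nrm A (\<sigma> n \<ominus>\<^bsub>A\<^esub> x)) \<longlonglongrightarrow> 0 \<longrightarrow> x \<in> S)"

definition closed_span :: "'a cstar \<Rightarrow> 'a set \<Rightarrow> 'a set" where
  "closed_span A X = \<Inter> {S. submodule S complex_ring A \<and> norm_closed S A \<and> X \<subseteq> S}"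

definition cstar_subalgebra :: "'a set \<Rightarrow> 'a cstar \<Rightarrow> bool" where
  "cstar_subalgebra S A \<longleftrightarrow> submodule S complex_ring A \<and> norm_closed S A \<and>
     (\<forall>x\<in>S. \<forall>y\<in>S. x \<otimes>\<^bsub>A\<^esub> y \<in> S) \<and> (\<forall>x\<in>S. star A x \<in> S)"

definition cstar_generated :: "'a cstar \<Rightarrow> 'a set \<Rightarrow> 'a set" where
  "cstar_generated A X = \<Inter> {S. cstar_subalgebra S A \<and> X \<subseteq> S}"

definition commutator_ideal :: "'a cstar \<Rightarrow> 'a set" where
  "commutator_ideal A = \<Inter> {I. ideal I A \<and> norm_closed I A \<and>
     (\<forall>x\<in>carrier A. \<forall>y\<in>carrier A. (x \<otimes>\<^bsub>A\<^esub> y) \<ominus>\<^bsub>A\<^esub> (y \<otimes>\<^bsub>A\<^esub> x) \<in> I)}"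

definition cstar_short_exact ::
  "'a cstar \<Rightarrow> ('a \<Rightarrow> 'b) \<Rightarrow> 'b cstar \<Rightarrow> ('b \<Rightarrow> 'c) \<Rightarrow> 'c cstar \<Rightarrow> bool" where
  "cstar_short_exact A f B g C \<longleftrightarrow>
     cstar_algebra A \<and> cstar_algebra B \<and> cstar_algebra C \<and>
     f \<in> cstar_hom A B \<and> g \<in> cstar_hom B C \<and>
     inj_on f (carrier A) \<and> f ` carrier A = a_kernel B C g \<and> g ` carrier B = carrier C"

section \<open>Function algebras and bounded operators\<close>

text \<open>Complex functions on a set \<open>X\<close> are represented by functions on the whole type that vanish
  off \<open>X\<close>, which makes the representation unique.\<close>

definition function_cstar :: "'x set \<Rightarrow> ('x \<Rightarrow> complex) set \<Rightarrow> ('x \<Rightarrow> complex) cstar" where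
  "function_cstar X F =
     \<lparr>carrier = {f \<in> F. \<forall>x. x \<notin> X \<longrightarrow> f x = 0},
      mult = (\<lambda>f g x. f x * g x),
      one = (\<lambda>x. if x \<in> X then 1 else 0),
      zero = (\<lambda>x. 0),
      add = (\<lambda>f g x. f x + g x),
      smult = (\<lambda>c f x. c * f x),
      star = (\<lambda>f x. cnj (f x)),
      nrm = (\<lambda>f. SUP x\<in>X. cmod (f x))\<rparr>"

definition ell_infinity :: "'x set \<Rightarrow> ('x \<Rightarrow> complex) cstar" where
  "ell_infinity X = function_cstar X {f. bounded (f ` X)}"

text \<open>The norm below is meaningful for compact \<open>X\<close>, which is the only case in which this is used.\<close>

definition continuous_functions :: "'x::topological_space set \<Rightarrow> ('x \<Rightarrow> complex) cstar" where
  "continuous_functions X = function_cstar X {f. continuous_on X f}"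

definition ell2 :: "'x set \<Rightarrow> ('x \<Rightarrow> complex) set" where
  "ell2 X = {f. (\<forall>x. x \<notin> X \<longrightarrow> f x = 0) \<and> (\<lambda>x. (cmod (f x))\<^sup>2) summable_on X}"

definition ell2_inner :: "'x set \<Rightarrow> ('x \<Rightarrow> complex) \<Rightarrow> ('x \<Rightarrow> complex) \<Rightarrow> complex" where
  "ell2_inner X f g = (\<Sum>\<^sub>\<infinity>x\<in>X. f x * cnj (g x))"

definition ell2_norm :: "'x set \<Rightarrow> ('x \<Rightarrow> complex) \<Rightarrow> real" where
  "ell2_norm X f = sqrt (\<Sum>\<^sub>\<infinity>x\<in>X. (cmod (f x))\<^sup>2)"

text \<open>Operators on \<open>\<ell>\<^sup>2(X)\<close> are normalised to be \<open>0\<close> on arguments that do not lie in \<open>\<ell>\<^sup>2(X)\<close>.\<close>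

definition bounded_operators :: "'x set \<Rightarrow> (('x \<Rightarrow> complex) \<Rightarrow> ('x \<Rightarrow> complex)) set" where
  "bounded_operators X = {T.
     (\<forall>f. f \<notin> ell2 X \<longrightarrow> T f = (\<lambda>x. 0)) \<and>
     (\<forall>f\<in>ell2 X. T f \<in> ell2 X) \<and>
     (\<forall>f\<in>ell2 X. \<forall>g\<in>ell2 X. T (\<lambda>x. f x + g x) = (\<lambda>x. T f x + T g x)) \<and>
     (\<forall>c. \<forall>f\<in>ell2 X. T (\<lambda>x. c * f x) = (\<lambda>x. c * T f x)) \<and>
     (\<exists>K. \<forall>f\<in>ell2 X. ell2_norm X (T f) \<le> K * ell2_norm X f)}"

definition operator_cstar :: "'x set \<Rightarrow> (('x \<Rightarrow> complex) \<Rightarrow> ('x \<Rightarrow> complex)) cstar" where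
  "operator_cstar X =
     \<lparr>carrier = bounded_operators X,
      mult = (\<lambda>S T. S \<circ> T),
      one = (\<lambda>f. if f \<in> ell2 X then f else (\<lambda>x. 0)),
      zero = (\<lambda>f x. 0),
      add = (\<lambda>S T f x. S f x + T f x),
      smult = (\<lambda>c T f x. c * T f x),
      star = (\<lambda>T. THE S. S \<in> bounded_operators X \<and>
        (\<forall>f\<in>ell2 X. \<forall>g\<in>ell2 X. ell2_inner X (T f) g = ell2_inner X f (S g))),
      nrm = (\<lambda>T. SUP f\<in>{f \<in> ell2 X. ell2_norm X f \<le> 1}. ell2_norm X (T f))\<rparr>"

definition point_mass :: "'x \<Rightarrow> 'x \<Rightarrow> complex" where
  "point_mass x = (\<lambda>y. if y = x then 1 else 0)"

section \<open>The partial-isometric crossed product\<close>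

definition cone_indicator :: "'g::linordered_ab_group_add \<Rightarrow> 'g \<Rightarrow> complex" where
  "cone_indicator s = (\<lambda>x. if 0 \<le> x \<and> s \<le> x then 1 else 0)"

definition B_cone :: "('g::linordered_ab_group_add \<Rightarrow> complex) cstar" where
  "B_cone = (ell_infinity {0..})
     \<lparr>carrier := closed_span (ell_infinity {0..}) {cone_indicator s | s. 0 \<le> s}\<rparr>"

text \<open>For \<open>0 \<le> x\<close> the action is given by translation: since \<open>f\<close> vanishes off the positive cone,
  \<open>\<tau>\<^sub>x f\<close> vanishes off \<open>{x..}\<close>.\<close>

definition tau :: "'g::linordered_ab_group_add \<Rightarrow> ('g \<Rightarrow> complex) \<Rightarrow> ('g \<Rightarrow> complex)" where
  "tau x f = (\<lambda>y. f (y - x))"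

lemma tau_cone_indicator:
  assumes "0 \<le> x" "0 \<le> s"
  shows "tau x (cone_indicator s) = cone_indicator (s + x)"
proof
  fix y
  have "0 \<le> y" if "s + x \<le> y"
    using assms that by (meson add_nonneg_nonneg order_trans)
  moreover have "0 \<le> y - x" if "s \<le> y - x"
    using assms that by (meson order_trans)
  ultimately show "tau x (cone_indicator s) y = cone_indicator (s + x) y"
    by (auto simp: tau_def cone_indicator_def le_diff_eq)
qed

definition partial_isometry :: "'a cstar \<Rightarrow> 'a \<Rightarrow> bool" where
  "partial_isometry D w \<longleftrightarrow> w \<in> carrier D \<and> w \<otimes>\<^bsub>D\<^esub> star D w \<otimes>\<^bsub>D\<^esub> w = w"

definition piso_rep :: "'a cstar \<Rightarrow> ('g::linordered_ab_group_add \<Rightarrow> 'a) \<Rightarrow> bool" where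
  "piso_rep D V \<longleftrightarrow> (\<forall>x\<ge>0. partial_isometry D (V x)) \<and>
     (\<forall>x\<ge>0. \<forall>y\<ge>0. V (x + y) = V x \<otimes>\<^bsub>D\<^esub> V y)"

definition nondegenerate_rep :: "'b cstar \<Rightarrow> 'a cstar \<Rightarrow> ('b \<Rightarrow> 'a) \<Rightarrow> bool" where
  "nondegenerate_rep B D \<pi> \<longleftrightarrow> \<pi> \<in> cstar_hom B D \<and>
     closed_span D {\<pi> b \<otimes>\<^bsub>D\<^esub> d | b d. b \<in> carrier B \<and> d \<in> carrier D} = carrier D"

definition covariant_pair ::
  "'a cstar \<Rightarrow> (('g::linordered_ab_group_add \<Rightarrow> complex) \<Rightarrow> 'a) \<Rightarrow> ('g \<Rightarrow> 'a) \<Rightarrow> bool" where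
  "covariant_pair D \<pi> V \<longleftrightarrow> unital_cstar_algebra D \<and> nondegenerate_rep B_cone D \<pi> \<and> piso_rep D V \<and>
     (\<forall>x\<ge>0. \<forall>b\<in>carrier B_cone. \<pi> (tau x b) = V x \<otimes>\<^bsub>D\<^esub> \<pi> b \<otimes>\<^bsub>D\<^esub> star D (V x))"

text \<open>The crossed product \<open>A\<close> comes with its universal pair \<open>(iB, v)\<close>. Uniqueness of the induced
  homomorphism is a consequence of the generation clause. A definition cannot quantify over types,
  so the carriers of the C*-algebras tested lie in a type \<open>'u\<close>, given by the first argument. A
  C*-algebra generated by a covariant pair has a dense subset of cardinality at most
  \<open>max \<bar>\<Gamma>\<bar> \<aleph>\<^sub>0\<close>; if \<open>'u\<close> has at least as many elements as there are sequences in
  such a set, then every such C*-algebra has a copy with carrier in \<open>'u\<close> and the condition is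
  the universal property for all unital C*-algebras. The type
  \<open>('g \<Rightarrow> complex) \<Rightarrow> ('g \<Rightarrow> complex)\<close> of the operators on \<open>\<ell>\<^sup>2(\<Gamma>\<^sup>+)\<close> is large enough.\<close>

definition is_piso_crossed_product ::
  "'u itself \<Rightarrow> 'a cstar \<Rightarrow> (('g::linordered_ab_group_add \<Rightarrow> complex) \<Rightarrow> 'a) \<Rightarrow> ('g \<Rightarrow> 'a) \<Rightarrow> bool"
  where
  "is_piso_crossed_product _ A iB v \<longleftrightarrow>
     covariant_pair A iB v \<and>
     cstar_generated A (iB ` carrier B_cone \<union> v ` {0..}) = carrier A \<and>
     (\<forall>(D :: 'u cstar) \<pi> V. covariant_pair D \<pi> V \<longrightarrow>
        (\<exists>\<phi>\<in>cstar_hom A D. (\<forall>b\<in>carrier B_cone. \<phi> (iB b) = \<pi> b) \<and> (\<forall>x\<ge>0. \<phi> (v x) = V x)))"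

section \<open>The Toeplitz algebra and the dual group\<close>

text \<open>As for \<open>\<tau>\<close>, translation by \<open>s \<ge> 0\<close> needs no case distinction.\<close>

definition toeplitz_op ::
  "'g::linordered_ab_group_add \<Rightarrow> ('g \<Rightarrow> complex) \<Rightarrow> ('g \<Rightarrow> complex)" where
  "toeplitz_op s = (\<lambda>f. if f \<in> ell2 {0..} then (\<lambda>y. f (y - s)) else (\<lambda>y. 0))"

lemma toeplitz_op_point_mass:
  assumes "0 \<le> x"
  shows "toeplitz_op s (point_mass x) = point_mass (x + s)"
proof -
  have "(\<lambda>y. (cmod (point_mass x y))\<^sup>2) summable_on {0..}"
    by (rule summable_on_cong_neutral[THEN iffD1, OF _ _ _ summable_on_finite[of "{x}"]])
       (use assms in \<open>auto simp: point_mass_def\<close>)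
  then have "point_mass x \<in> ell2 {0..}"
    using assms by (auto simp: ell2_def point_mass_def)
  then show ?thesis
    by (auto simp: toeplitz_op_def point_mass_def diff_eq_eq fun_eq_iff)
qed

definition toeplitz_algebra ::
  "(('g::linordered_ab_group_add \<Rightarrow> complex) \<Rightarrow> ('g \<Rightarrow> complex)) cstar" where
  "toeplitz_algebra = (operator_cstar {0..})
     \<lparr>carrier := cstar_generated (operator_cstar {0..}) {toeplitz_op s | s. 0 \<le> s}\<rparr>"

definition toeplitz_commutator_ideal ::
  "(('g::linordered_ab_group_add \<Rightarrow> complex) \<Rightarrow> ('g \<Rightarrow> complex)) cstar" where
  "toeplitz_commutator_ideal =
     toeplitz_algebra\<lparr>carrier := commutator_ideal toeplitz_algebra\<rparr>"

text \<open>The group is discrete, so all characters are continuous and the topology of the dual group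
  is that of pointwise convergence, i.e. the one induced by the function type.\<close>

definition dual_group :: "('g::ab_group_add \<Rightarrow> complex) set" where
  "dual_group = {\<xi>. (\<forall>x y. \<xi> (x + y) = \<xi> x * \<xi> y) \<and> (\<forall>x. cmod (\<xi> x) = 1)}"

definition dual_eval :: "'g::ab_group_add \<Rightarrow> ('g \<Rightarrow> complex) \<Rightarrow> complex" where
  "dual_eval x = (\<lambda>\<xi>. if \<xi> \<in> dual_group then \<xi> x else 0)"

abbreviation C_dual :: "(('g::ab_group_add \<Rightarrow> complex) \<Rightarrow> complex) cstar" where
  "C_dual \<equiv> continuous_functions dual_group"

text \<open>The identification of the group C*-algebra with \<open>C_dual\<close>, on the dense subalgebra
  \<open>\<ell>\<^sup>1(\<Gamma>)\<close>, in which the canonical unitary \<open>\<delta>\<^sub>x\<close> is the point mass at \<open>x\<close>.\<close>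

definition fourier_transform :: "('g::ab_group_add \<Rightarrow> complex) \<Rightarrow> ('g \<Rightarrow> complex) \<Rightarrow> complex" where
  "fourier_transform f = (\<lambda>\<xi>. if \<xi> \<in> dual_group then \<Sum>\<^sub>\<infinity>x. f x * \<xi> x else 0)"

lemma fourier_transform_point_mass: "fourier_transform (point_mass x) = dual_eval x"
proof -
  have "(\<Sum>\<^sub>\<infinity>y. point_mass x y * \<xi> y) = (\<Sum>\<^sub>\<infinity>y\<in>{x}. point_mass x y * \<xi> y)"
    for \<xi> :: "'a \<Rightarrow> complex"
    by (rule infsum_cong_neutral) (auto simp: point_mass_def)
  then show ?thesis
    by (auto simp: fourier_transform_def dual_eval_def point_mass_def)
qed

end

theory Submission
  imports Defs "HOL-Library.Poly_Mapping" "HOL-Real_Asymp.Real_Asymp"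
begin

text \<open>
  Write \<open>T\<^sub>x\<close> for the shifts on \<open>\<ell>\<^sup>2(\<Gamma>\<^sup>+)\<close>, \<open>\<T>\<close> for the Toeplitz algebra and \<open>\<C>\<close> for its commutator
  ideal. Everything rests on an understanding of the lower right corner. Elements of the
  *-algebra generated by the shifts act on \<open>\<delta>\<^sub>z\<close> with large \<open>z\<close> as convolution by an element of
  the group algebra, their symbol, and the Fourier transform of the symbol extends to a
  homomorphism \<open>\<psi>\<^sub>T\<close> from \<open>\<T>\<close> to the continuous functions on the dual group. Two norm
  estimates carry this: the Fourier transform of the symbol of \<open>S\<close> is bounded by \<open>\<parallel>S\<parallel>\<close>
  (\<open>char_sum_le_norm\<close>), and \<open>\<parallel>S T\<^sub>z\<parallel>\<close> comes down to the supremum of that transform as \<open>z\<close> grows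
  (\<open>symbol_hom_lift\<close>). Both compare powers in the group algebra, whose supports grow only
  polynomially because the group is abelian. The second one also needs that characters separate
  the points of \<open>\<Gamma>\<close>, which holds by Zorn's lemma, and that coefficients are bounded by the
  supremum over all characters (\<open>lookup_le_sup\<close>).

  The second estimate gives both exactness statements for \<open>\<psi>\<^sub>T\<close>. If \<open>\<psi>\<^sub>T S = 0\<close>, then \<open>S\<close> is the
  limit of \<open>S (1 - T\<^sub>z T\<^sub>z\<^sup>*)\<close> (\<open>kernel_symbol_hom_approx\<close>), and \<open>1 - T\<^sub>z T\<^sub>z\<^sup>*\<close> is a commutator; so the
  kernel is \<open>\<C>\<close>. Moreover the range of \<open>\<psi>\<^sub>T\<close> is closed, and it contains the evaluations, so it is
  everything by the Stone-Weierstrass theorem. The other homomorphism \<open>\<psi>\<close> with \<open>T\<^sub>x \<mapsto> \<lambda>\<^bsub>-x\<^esub>\<close> is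
  \<open>\<psi>\<^sub>T\<close> followed by inversion in the dual group.

  The homomorphisms \<open>\<phi>\<close> from the crossed product come from the universal property. The
  covariant pairs are \<open>(M, T)\<close>, with \<open>M\<close> the representation by multiplication operators, and
  \<open>(L, T\<^sup>*)\<close>, where \<open>L b\<close> is the scalar \<open>lim b\<close> at infinity. They are surjective because a unital
  homomorphism of C*-algebras maps closed ideals, in particular the whole algebra, onto closed sets
  (\<open>norm_closed_image_ideal\<close>). This is proved without spectral theory: a self-adjoint \<open>x\<close> is
  truncated to \<open>x (1 + (x/2r)\<^sup>2)\<^bsup>-1\<^esup>\<close>, and the inverse and the norm estimates come from fixed points
  of contractions and from unitaries \<open>a + ic\<close>.

  Finally, the two composites to the functions on the dual group agree on generators
  (\<open>diagonal_agree\<close>). Hence each \<open>\<phi>\<close> maps the kernel of the other one into the kernel of \<open>\<psi>\<^sub>T\<close>,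
  which is \<open>\<C>\<close>. The image is a closed ideal that contains all \<open>1 - T\<^sub>z T\<^sub>z\<^sup>*\<close>, as images of
  \<open>1 - v\<^sub>z v\<^sub>z\<^sup>*\<close> and \<open>1 - v\<^sub>z\<^sup>* v\<^sub>z\<close>, so it is all of \<open>\<C>\<close> (\<open>image_kernel\<close>).
\<close>

section \<open>Norm limits in unital C*-algebras\<close>

lemma complex_ring_simps [simp]:
  "carrier complex_ring = UNIV" "mult complex_ring = (*)" "one complex_ring = 1"
  "zero complex_ring = 0" "add complex_ring = (+)"
  by (simp_all add: complex_ring_def)

lemma cring_complex_ring: "cring complex_ring"
proof (rule cringI)
  show "abelian_group complex_ring"
  proof (rule abelian_groupI)
    show "\<exists>y\<in>carrier complex_ring. y \<oplus>\<^bsub>complex_ring\<^esub> x = \<zero>\<^bsub>complex_ring\<^esub>" for x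
      by (rule bexI[of _ "-x"]) auto
  qed auto
  show "comm_monoid complex_ring"
    by (rule comm_monoidI) auto
qed (auto simp: algebra_simps)

lemma a_inv_complex_ring [simp]: "\<ominus>\<^bsub>complex_ring\<^esub> c = - c"
proof -
  interpret cring complex_ring by (rule cring_complex_ring)
  have "- c \<oplus>\<^bsub>complex_ring\<^esub> c = \<zero>\<^bsub>complex_ring\<^esub>" by simp
  then show ?thesis using minus_equality[of "-c" c] by simp
qed

definition norm_lim :: "'a cstar \<Rightarrow> (nat \<Rightarrow> 'a) \<Rightarrow> 'a \<Rightarrow> bool" where
  "norm_lim A \<sigma> x \<longleftrightarrow> (\<lambda>n. nrm A (\<sigma> n \<ominus>\<^bsub>A\<^esub> x)) \<longlonglongrightarrow> 0"

lemma norm_closed_iff: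
  "norm_closed S A \<longleftrightarrow>
    (\<forall>\<sigma> x. x \<in> carrier A \<longrightarrow> (\<forall>n. \<sigma> n \<in> S) \<longrightarrow> norm_lim A \<sigma> x \<longrightarrow> x \<in> S)"
  unfolding norm_closed_def norm_lim_def by (auto simp: image_subset_iff)

context unital_cstar_algebra
begin

sublocale U: ring A
proof (rule ringI)
  show "abelian_group A" by unfold_locales
  show "monoid A"
    by (rule monoidI) (simp_all add: mult_closed one_closed mult_assoc one_left one_right)
qed (simp_all add: distr_left distr_right)

lemma smult_carrier [simp, intro]: "x \<in> carrier A \<Longrightarrow> c \<odot> x \<in> carrier A"
  by (simp add: smult_closed)

lemma smult_add_left: "x \<in> carrier A \<Longrightarrow> (a + b) \<odot> x = a \<odot> x \<oplus> b \<odot> x"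
  using smult_l_distr[of a b x] by simp

lemma smult_add_right:
  "\<lbrakk>x \<in> carrier A; y \<in> carrier A\<rbrakk> \<Longrightarrow> a \<odot> (x \<oplus> y) = a \<odot> x \<oplus> a \<odot> y"
  using smult_r_distr[of a x y] by simp

lemma smult_smult [simp]: "x \<in> carrier A \<Longrightarrow> a \<odot> (b \<odot> x) = (a * b) \<odot> x"
  using smult_assoc1[of a b x] by simp

lemma smult_1 [simp]: "x \<in> carrier A \<Longrightarrow> 1 \<odot> x = x"
  using smult_one by simp

lemma smult_0 [simp]: "x \<in> carrier A \<Longrightarrow> 0 \<odot> x = \<zero>"
  using smult_l_null by simp

lemma smult_zero [simp]: "c \<odot> \<zero> = \<zero>"
  using smult_r_null by simp

lemma uminus_smult: "x \<in> carrier A \<Longrightarrow> \<ominus> x = (- 1) \<odot> x"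
  using smult_l_minus[of 1 x] by simp

lemma smult_minus:
  "\<lbrakk>x \<in> carrier A; y \<in> carrier A\<rbrakk> \<Longrightarrow> c \<odot> (x \<ominus> y) = c \<odot> x \<ominus> c \<odot> y"
  by (simp add: a_minus_def smult_add_right smult_r_minus)

lemma smult_double: "x \<in> carrier A \<Longrightarrow> 2 \<odot> x = x \<oplus> x"
  using smult_add_left[of x 1 1] by simp

lemma nrm_zero [simp]: "nrm A \<zero> = 0"
  by (simp add: nrm_eq_0)

lemma nrm_uminus [simp]: "x \<in> carrier A \<Longrightarrow> nrm A (\<ominus> x) = nrm A x"
  by (simp add: uminus_smult nrm_smult)

lemma nrm_minus_commute:
  assumes "x \<in> carrier A" "y \<in> carrier A"
  shows "nrm A (x \<ominus> y) = nrm A (y \<ominus> x)"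
proof -
  have "x \<ominus> y = \<ominus> (y \<ominus> x)" using assms by algebra
  then show ?thesis using assms by simp
qed

lemma nrm_minus_triangle:
  assumes "x \<in> carrier A" "y \<in> carrier A" "z \<in> carrier A"
  shows "nrm A (x \<ominus> z) \<le> nrm A (x \<ominus> y) + nrm A (y \<ominus> z)"
proof -
  have "x \<ominus> z = (x \<ominus> y) \<oplus> (y \<ominus> z)" using assms by algebra
  then show ?thesis using assms nrm_triangle[of "x \<ominus> y" "y \<ominus> z"] by simp
qed

lemma nrm_minus_le:
  assumes "x \<in> carrier A" "y \<in> carrier A"
  shows "nrm A (x \<ominus> y) \<le> nrm A x + nrm A y"
  using nrm_triangle[of x "\<ominus> y"] assms by (simp add: a_minus_def)

lemma nrm_le_minus:
  assumes "x \<in> carrier A" "y \<in> carrier A"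
  shows "nrm A x \<le> nrm A y + nrm A (x \<ominus> y)"
proof -
  have "x = y \<oplus> (x \<ominus> y)" using assms by algebra
  then show ?thesis using nrm_triangle[of y "x \<ominus> y"] assms by simp
qed

lemma star_carrier [simp, intro]: "x \<in> carrier A \<Longrightarrow> star A x \<in> carrier A"
  by (rule star_closed)

lemma star_uminus: "x \<in> carrier A \<Longrightarrow> star A (\<ominus> x) = \<ominus> star A x"
  by (simp add: uminus_smult star_smult)

lemma star_minus:
  "\<lbrakk>x \<in> carrier A; y \<in> carrier A\<rbrakk> \<Longrightarrow> star A (x \<ominus> y) = star A x \<ominus> star A y"
  by (simp add: a_minus_def star_add star_uminus)

lemma star_zero [simp]: "star A \<zero> = \<zero>"
  using star_smult[of \<zero> 0] by simp

lemma star_one [simp]: "star A \<one> = \<one>"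
proof -
  have "star A \<one> = star A \<one> \<otimes> star A (star A \<one>)" by (simp add: star_star)
  also have "\<dots> = star A (star A \<one> \<otimes> \<one>)" by (subst star_mult) auto
  also have "\<dots> = \<one>" by (simp add: star_star)
  finally show ?thesis .
qed

lemma nrm_star [simp]:
  assumes "x \<in> carrier A" shows "nrm A (star A x) = nrm A x"
proof -
  have le: "nrm A y \<le> nrm A (star A y)" if y: "y \<in> carrier A" for y
  proof (cases "nrm A y = 0")
    case True then show ?thesis using nrm_nonneg y by simp
  next
    case False
    then have "nrm A y * nrm A y \<le> nrm A (star A y) * nrm A y" "0 < nrm A y"
      using nrm_cstar[OF y] nrm_mult[of "star A y" y] nrm_nonneg[OF y] y
      by (simp_all add: power2_eq_square)
    then show ?thesis by simp
  qed
  show ?thesis using le[OF assms] le[of "star A x"] assms by (simp add: star_star)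
qed

lemma nrm_one_le: "nrm A \<one> \<le> 1"
proof (rule ccontr)
  assume "\<not> ?thesis"
  moreover have "nrm A \<one> = (nrm A \<one>)\<^sup>2" using nrm_cstar[of \<one>] by simp
  ultimately show False by (simp add: power2_eq_square)
qed

lemma norm_lim_iff: "norm_lim A \<sigma> x \<longleftrightarrow> (\<forall>e>0. \<exists>N. \<forall>n\<ge>N. \<bar>nrm A (\<sigma> n \<ominus> x)\<bar> < e)"
  unfolding norm_lim_def LIMSEQ_iff by simp

lemma norm_limI:
  assumes "\<And>n. nrm A (\<sigma> n \<ominus> x) \<le> b n" "b \<longlonglongrightarrow> 0" "\<And>n. \<sigma> n \<in> carrier A" "x \<in> carrier A"
  shows "norm_lim A \<sigma> x"
  unfolding norm_lim_def
  by (rule tendsto_sandwich[OF _ _ tendsto_const assms(2)])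
     (use assms in \<open>auto intro!: nrm_nonneg always_eventually\<close>)

lemma norm_lim_const [simp]: "x \<in> carrier A \<Longrightarrow> norm_lim A (\<lambda>n. x) x"
  by (simp add: norm_lim_def a_minus_def M.r_neg)

lemma norm_lim_unique:
  assumes "norm_lim A \<sigma> x" "norm_lim A \<sigma> y" "\<And>n. \<sigma> n \<in> carrier A"
    and xy: "x \<in> carrier A" "y \<in> carrier A"
  shows "x = y"
proof -
  have "(\<lambda>n. nrm A (\<sigma> n \<ominus> x) + nrm A (\<sigma> n \<ominus> y)) \<longlonglongrightarrow> 0 + 0"
    using assms unfolding norm_lim_def by (intro tendsto_add)
  moreover have "nrm A (x \<ominus> y) \<le> nrm A (\<sigma> n \<ominus> x) + nrm A (\<sigma> n \<ominus> y)" for n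
    using nrm_minus_triangle[of x "\<sigma> n" y] nrm_minus_commute[of x "\<sigma> n"] assms by simp
  ultimately have "nrm A (x \<ominus> y) \<le> 0" by (intro LIMSEQ_le_const) auto
  then have "nrm A (x \<ominus> y) = 0" using nrm_nonneg[of "x \<ominus> y"] xy by simp
  then have "x \<ominus> y = \<zero>" using nrm_eq_0[of "x \<ominus> y"] xy by simp
  moreover have "x = (x \<ominus> y) \<oplus> y" using xy by algebra
  ultimately show ?thesis using xy by simp
qed

lemma norm_lim_add:
  assumes "norm_lim A \<sigma> x" "norm_lim A \<rho> y" "\<And>n. \<sigma> n \<in> carrier A" "\<And>n. \<rho> n \<in> carrier A"
    and "x \<in> carrier A" "y \<in> carrier A"
  shows "norm_lim A (\<lambda>n. \<sigma> n \<oplus> \<rho> n) (x \<oplus> y)"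
proof (rule norm_limI)
  show "nrm A (\<sigma> n \<oplus> \<rho> n \<ominus> (x \<oplus> y)) \<le> nrm A (\<sigma> n \<ominus> x) + nrm A (\<rho> n \<ominus> y)" for n
  proof -
    have "\<sigma> n \<oplus> \<rho> n \<ominus> (x \<oplus> y) = (\<sigma> n \<ominus> x) \<oplus> (\<rho> n \<ominus> y)" using assms(3)[of n] assms(4)[of n] assms(5,6) by algebra
    then show ?thesis using assms nrm_triangle[of "\<sigma> n \<ominus> x" "\<rho> n \<ominus> y"] by simp
  qed
  show "(\<lambda>n. nrm A (\<sigma> n \<ominus> x) + nrm A (\<rho> n \<ominus> y)) \<longlonglongrightarrow> 0"
    using tendsto_add[OF assms(1,2)[unfolded norm_lim_def]] by simp
qed (use assms in auto)

lemma norm_lim_smult: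
  assumes "norm_lim A \<sigma> x" "\<And>n. \<sigma> n \<in> carrier A" "x \<in> carrier A"
  shows "norm_lim A (\<lambda>n. c \<odot> \<sigma> n) (c \<odot> x)"
  using tendsto_mult_left[OF assms(1)[unfolded norm_lim_def], of "cmod c"] assms
  by (simp add: norm_lim_def smult_minus[symmetric] nrm_smult)

lemma norm_lim_star:
  assumes "norm_lim A \<sigma> x" "\<And>n. \<sigma> n \<in> carrier A" "x \<in> carrier A"
  shows "norm_lim A (\<lambda>n. star A (\<sigma> n)) (star A x)"
  using assms by (simp add: norm_lim_def star_minus[symmetric])

lemma norm_lim_nrm:
  assumes "norm_lim A \<sigma> x" "\<And>n. \<sigma> n \<in> carrier A" "x \<in> carrier A"
  shows "(\<lambda>n. nrm A (\<sigma> n)) \<longlonglongrightarrow> nrm A x"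
proof -
  have "\<bar>nrm A (\<sigma> n) - nrm A x\<bar> \<le> nrm A (\<sigma> n \<ominus> x)" for n
    using nrm_le_minus[of "\<sigma> n" x] nrm_le_minus[of x "\<sigma> n"] nrm_minus_commute[of x "\<sigma> n"] assms
    by auto
  then have "(\<lambda>n. nrm A (\<sigma> n) - nrm A x) \<longlonglongrightarrow> 0"
    by (intro Lim_null_comparison[OF _ assms(1)[unfolded norm_lim_def]]) auto
  then show ?thesis by (rule LIM_zero_cancel)
qed

lemma norm_lim_mult:
  assumes "norm_lim A \<sigma> x" "norm_lim A \<rho> y" "\<And>n. \<sigma> n \<in> carrier A" "\<And>n. \<rho> n \<in> carrier A"
    and "x \<in> carrier A" "y \<in> carrier A"
  shows "norm_lim A (\<lambda>n. \<sigma> n \<otimes> \<rho> n) (x \<otimes> y)"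
proof (rule norm_limI)
  show "nrm A (\<sigma> n \<otimes> \<rho> n \<ominus> (x \<otimes> y))
    \<le> nrm A (\<sigma> n) * nrm A (\<rho> n \<ominus> y) + nrm A (\<sigma> n \<ominus> x) * nrm A y" for n
  proof -
    have "\<sigma> n \<otimes> \<rho> n \<ominus> (x \<otimes> y) = (\<sigma> n \<otimes> (\<rho> n \<ominus> y)) \<oplus> ((\<sigma> n \<ominus> x) \<otimes> y)" 
      using assms(3)[of n] assms(4)[of n] assms(5,6) by algebra
    then show ?thesis
      using assms nrm_triangle[of "\<sigma> n \<otimes> (\<rho> n \<ominus> y)" "(\<sigma> n \<ominus> x) \<otimes> y"]
        nrm_mult[of "\<sigma> n" "\<rho> n \<ominus> y"] nrm_mult[of "\<sigma> n \<ominus> x" y] by simp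
  qed
  have "(\<lambda>n. nrm A (\<sigma> n) * nrm A (\<rho> n \<ominus> y) + nrm A (\<sigma> n \<ominus> x) * nrm A y)
    \<longlonglongrightarrow> nrm A x * 0 + 0 * nrm A y"
    using assms norm_lim_nrm[OF assms(1,3,5)] unfolding norm_lim_def
    by (intro tendsto_intros) auto
  then show "(\<lambda>n. nrm A (\<sigma> n) * nrm A (\<rho> n \<ominus> y) + nrm A (\<sigma> n \<ominus> x) * nrm A y) \<longlonglongrightarrow> 0"
    by simp
qed (use assms in auto)

lemma norm_lim_nrm_le:
  assumes "norm_lim A \<sigma> x" "\<And>n. \<sigma> n \<in> carrier A" "x \<in> carrier A" "\<And>n. nrm A (\<sigma> n) \<le> r"
  shows "nrm A x \<le> r"
  by (rule LIMSEQ_le_const2[OF norm_lim_nrm[OF assms(1-3)]]) (use assms(4) in auto)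

lemma norm_lim_ex:
  assumes "x \<in> carrier A" "S \<subseteq> carrier A" "\<And>e. e > 0 \<Longrightarrow> \<exists>y\<in>S. nrm A (y \<ominus> x) < e"
  shows "\<exists>\<sigma>. (\<forall>n. \<sigma> n \<in> S) \<and> norm_lim A \<sigma> x"
proof -
  have "\<forall>n::nat. \<exists>y\<in>S. nrm A (y \<ominus> x) < inverse (real (Suc n))"
    using assms(3) by simp
  then obtain \<sigma> where \<sigma>: "\<And>n. \<sigma> n \<in> S" "\<And>n. nrm A (\<sigma> n \<ominus> x) < inverse (real (Suc n))"
    by metis
  have "norm_lim A \<sigma> x"
    by (rule norm_limI[where b = "\<lambda>n. inverse (real (Suc n))"])
       (use \<sigma> assms LIMSEQ_inverse_real_of_nat in \<open>auto intro: less_imp_le\<close>)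
  with \<sigma>(1) show ?thesis by blast
qed

lemma norm_lim_ball:
  assumes "norm_lim A \<sigma> x" "e > 0"
  shows "\<exists>n. nrm A (\<sigma> n \<ominus> x) < e"
proof -
  obtain N where "\<forall>n\<ge>N. \<bar>nrm A (\<sigma> n \<ominus> x)\<bar> < e"
    using assms unfolding norm_lim_iff by blast
  then have "nrm A (\<sigma> N \<ominus> x) < e" by force
  then show ?thesis by blast
qed

lemma norm_closedD:
  assumes "norm_closed S A" "x \<in> carrier A" "S \<subseteq> carrier A"
    and "\<And>e. e > 0 \<Longrightarrow> \<exists>y\<in>S. nrm A (y \<ominus> x) < e"
  shows "x \<in> S"
  using norm_lim_ex[OF assms(2-4)] assms(1,2) unfolding norm_closed_iff by blast

lemma convergent_of_geometric:
  assumes \<sigma>: "\<And>n. \<sigma> n \<in> carrier A" and step: "\<And>n. nrm A (\<sigma> (Suc n) \<ominus> \<sigma> n) \<le> K * r ^ n"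
    and r: "0 \<le> r" "r < 1"
  shows "\<exists>x\<in>carrier A. norm_lim A \<sigma> x"
proof -
  have K: "0 \<le> K"
    using order_trans[OF nrm_nonneg step[of 0]] \<sigma> by simp
  have est: "nrm A (\<sigma> (n + k) \<ominus> \<sigma> n) \<le> (\<Sum>i<k. K * r ^ (n + i))" for n k
  proof (induction k)
    case 0 then show ?case using \<sigma> by (simp add: a_minus_def M.r_neg)
  next
    case (Suc k)
    then show ?case
      using nrm_minus_triangle[OF \<sigma>[of "Suc (n + k)"] \<sigma>[of "n + k"] \<sigma>[of n]] step[of "n + k"] by simp
  qed
  have est': "nrm A (\<sigma> (n + k) \<ominus> \<sigma> n) \<le> K / (1 - r) * r ^ n" for n k
  proof -
    have "(\<Sum>i<k. K * r ^ (n + i)) = K * r ^ n * (\<Sum>i<k. r ^ i)"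
      by (simp add: power_add sum_distrib_left mult.assoc)
    moreover have "(\<Sum>i<k. r ^ i) \<le> 1 / (1 - r)"
      using r by (simp add: sum_gp_strict divide_simps)
    ultimately have "(\<Sum>i<k. K * r ^ (n + i)) \<le> K * r ^ n * (1 / (1 - r))"
      using K r mult_left_mono[of "\<Sum>i<k. r ^ i" "1 / (1 - r)" "K * r ^ n"] by simp
    then show ?thesis using est[of n k] by (simp add: mult.commute)
  qed
  have lim: "(\<lambda>n. K / (1 - r) * r ^ n) \<longlonglongrightarrow> 0"
    using r by (intro tendsto_mult_right_zero LIMSEQ_realpow_zero) auto
  have "\<forall>e>0. \<exists>N. \<forall>m\<ge>N. \<forall>n\<ge>N. nrm A (\<sigma> m \<ominus> \<sigma> n) < e"
  proof (intro allI impI)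
    fix e :: real assume "e > 0"
    then have "eventually (\<lambda>n. K / (1 - r) * r ^ n < e / 2) sequentially"
      using order_tendstoD(2)[OF lim, of "e/2"] by simp
    then obtain N where N: "K / (1 - r) * r ^ N < e / 2"
      by (auto simp: eventually_sequentially)
    have *: "nrm A (\<sigma> m \<ominus> \<sigma> N) < e / 2" if "m \<ge> N" for m
      using order.strict_trans1[OF est'[of N "m - N"] N] that by simp
    have "nrm A (\<sigma> m \<ominus> \<sigma> n) < e" if "m \<ge> N" "n \<ge> N" for m n
      using nrm_minus_triangle[OF \<sigma>[of m] \<sigma>[of N] \<sigma>[of n]] nrm_minus_commute[OF \<sigma>[of N] \<sigma>[of n]]
        *[OF that(1)] *[OF that(2)] by simp
    then show "\<exists>N. \<forall>m\<ge>N. \<forall>n\<ge>N. nrm A (\<sigma> m \<ominus> \<sigma> n) < e" by blast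
  qed
  then show ?thesis
    using nrm_complete[of \<sigma>] \<sigma> unfolding norm_lim_def by blast
qed

text \<open>Banach's fixed point theorem replaces the functional calculus: square roots and inverses
  of self-adjoint elements are constructed below as fixed points of contractions, on closed sets
  that force the solution to be self-adjoint and to commute with the given element.\<close>
lemma contraction_fixed_point:
  assumes C: "C \<subseteq> carrier A" "C \<noteq> {}" "norm_closed C A"
    and F: "\<And>x. x \<in> C \<Longrightarrow> F x \<in> C"
    and contr: "\<And>x y. \<lbrakk>x \<in> C; y \<in> C\<rbrakk> \<Longrightarrow> nrm A (F x \<ominus> F y) \<le> r * nrm A (x \<ominus> y)"
    and r: "0 \<le> r" "r < 1"
  shows "\<exists>x\<in>C. F x = x"
proof -
  obtain x0 where x0: "x0 \<in> C" using C by blast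
  define \<sigma> where "\<sigma> n = (F ^^ n) x0" for n
  have \<sigma>C: "\<sigma> n \<in> C" for n by (induction n) (simp_all add: \<sigma>_def x0 F)
  then have \<sigma>A: "\<sigma> n \<in> carrier A" for n using C by blast
  have step: "nrm A (\<sigma> (Suc n) \<ominus> \<sigma> n) \<le> nrm A (\<sigma> 1 \<ominus> \<sigma> 0) * r ^ n" for n
  proof (induction n)
    case (Suc n)
    have "nrm A (\<sigma> (Suc (Suc n)) \<ominus> \<sigma> (Suc n)) \<le> r * nrm A (\<sigma> (Suc n) \<ominus> \<sigma> n)"
      using contr[OF \<sigma>C[of "Suc n"] \<sigma>C[of n]] by (simp add: \<sigma>_def)
    also have "\<dots> \<le> r * (nrm A (\<sigma> 1 \<ominus> \<sigma> 0) * r ^ n)" using Suc r by (intro mult_left_mono)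
    finally show ?case by (simp add: ac_simps)
  qed simp
  obtain x where x: "x \<in> carrier A" "norm_lim A \<sigma> x"
    using convergent_of_geometric[OF \<sigma>A step r] by blast
  then have xC: "x \<in> C" using C(3) \<sigma>C unfolding norm_closed_iff by blast
  have "norm_lim A (\<lambda>n. \<sigma> (Suc n)) (F x)"
  proof (rule norm_limI[where b = "\<lambda>n. r * nrm A (\<sigma> n \<ominus> x)"])
    show "(\<lambda>n. r * nrm A (\<sigma> n \<ominus> x)) \<longlonglongrightarrow> 0"
      using tendsto_mult_left[OF x(2)[unfolded norm_lim_def], of r] by simp
    show "nrm A (\<sigma> (Suc n) \<ominus> F x) \<le> r * nrm A (\<sigma> n \<ominus> x)" for n
      using contr[OF \<sigma>C xC] by (simp add: \<sigma>_def)
  qed (use \<sigma>A F[OF xC] C in auto)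
  moreover have "norm_lim A (\<lambda>n. \<sigma> (Suc n)) x"
    using x(2) unfolding norm_lim_def by (rule LIMSEQ_Suc)
  ultimately have "F x = x"
    by (rule norm_lim_unique) (use \<sigma>A x F[OF xC] C in auto)
  with xC show ?thesis by blast
qed

lemma norm_closed_self_adjoint_commutant:
  assumes a: "a \<in> carrier A"
  shows "norm_closed {y \<in> carrier A. star A y = y \<and> y \<otimes> a = a \<otimes> y \<and> nrm A y \<le> r} A"
  unfolding norm_closed_iff
proof (intro allI impI)
  fix \<sigma> x assume x: "x \<in> carrier A" and
    \<sigma>: "\<forall>n. \<sigma> n \<in> {y \<in> carrier A. star A y = y \<and> y \<otimes> a = a \<otimes> y \<and> nrm A y \<le> r}"
    and lim: "norm_lim A \<sigma> x"
  have \<sigma>A: "\<sigma> n \<in> carrier A" for n using \<sigma> by blast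
  have s: "(\<lambda>n. star A (\<sigma> n)) = \<sigma>" and c: "(\<lambda>n. a \<otimes> \<sigma> n) = (\<lambda>n. \<sigma> n \<otimes> a)" using \<sigma> by auto
  have "star A x = x"
    using norm_lim_unique[OF norm_lim_star[OF lim \<sigma>A x, unfolded s] lim \<sigma>A] x by simp
  moreover have "x \<otimes> a = a \<otimes> x"
    using norm_lim_unique[OF norm_lim_mult[OF lim norm_lim_const[OF a]]
        norm_lim_mult[OF norm_lim_const[OF a] lim, unfolded c]] \<sigma>A x a by simp
  moreover have "nrm A x \<le> r" using norm_lim_nrm_le[OF lim \<sigma>A x] \<sigma> by blast
  ultimately show "x \<in> {y \<in> carrier A. star A y = y \<and> y \<otimes> a = a \<otimes> y \<and> nrm A y \<le> r}"
    using x by blast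
qed

text \<open>If \<open>c = 1 - y\<close>, then \<open>a\<^sup>2 + c\<^sup>2 = 1\<close> says that
  \<open>y = (a\<^sup>2 + y\<^sup>2) / 2\<close>. On the ball of radius \<open>r = \<parallel>a\<parallel> < 1\<close> the right-hand side is a
  contraction with constant \<open>r\<close>.\<close>
lemma sqrt_one_minus_square:
  assumes a: "a \<in> carrier A" "star A a = a" "nrm A a < 1"
  shows "\<exists>c\<in>carrier A. star A c = c \<and> c \<otimes> a = a \<otimes> c \<and> a \<otimes> a \<oplus> c \<otimes> c = \<one>"
proof -
  let ?r = "nrm A a"
  define C where "C = {y \<in> carrier A. star A y = y \<and> y \<otimes> a = a \<otimes> y \<and> nrm A y \<le> ?r}"
  define F where "F y = (1/2) \<odot> (a \<otimes> a \<oplus> y \<otimes> y)" for y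
  have r0: "0 \<le> ?r" using a by (simp add: nrm_nonneg)
  have half: "nrm A ((1/2) \<odot> x) = nrm A x / 2" if "x \<in> carrier A" for x
    using that by (simp add: nrm_smult)
  have "\<exists>x\<in>C. F x = x"
  proof (rule contraction_fixed_point[where r = ?r])
    show "C \<subseteq> carrier A" "norm_closed C A"
      unfolding C_def using norm_closed_self_adjoint_commutant[OF a(1)] by auto
    show "C \<noteq> {}" using a unfolding C_def by blast
    show "F y \<in> C" if y: "y \<in> C" for y
    proof -
      note y' = y[unfolded C_def, simplified]
      have "star A (F y) = F y" using y' a by (simp add: F_def star_smult star_add star_mult)
      moreover have "F y \<otimes> a = a \<otimes> F y"
      proof -
        have "(a \<otimes> a \<oplus> y \<otimes> y) \<otimes> a = a \<otimes> (a \<otimes> a \<oplus> y \<otimes> y)"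
          using y' a by (simp add: distr_left distr_right) (metis mult_assoc)
        then show ?thesis using y' a by (simp add: F_def smult_mult_left smult_mult_right)
      qed
      moreover have "nrm A (F y) \<le> ?r"
      proof -
        have "nrm A (a \<otimes> a \<oplus> y \<otimes> y) \<le> nrm A (a \<otimes> a) + nrm A (y \<otimes> y)"
          using y' a by (intro nrm_triangle) auto
        also have "\<dots> \<le> ?r * ?r + nrm A y * nrm A y"
          using y' a by (intro add_mono nrm_mult) auto
        also have "\<dots> \<le> ?r * 1 + ?r * 1"
          using y' a r0 nrm_nonneg[of y] by (intro add_mono mult_mono) auto
        finally show ?thesis using y' a by (simp add: F_def half)
      qed
      ultimately show ?thesis using y' a by (simp add: C_def F_def)
    qed
    show "nrm A (F x \<ominus> F y) \<le> ?r * nrm A (x \<ominus> y)" if "x \<in> C" "y \<in> C" for x y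
    proof -
      have x: "x \<in> carrier A" "nrm A x \<le> ?r" and y: "y \<in> carrier A" "nrm A y \<le> ?r"
        using that by (auto simp: C_def)
      have "F x \<ominus> F y = (1/2) \<odot> ((a \<otimes> a \<oplus> x \<otimes> x) \<ominus> (a \<otimes> a \<oplus> y \<otimes> y))"
        using x y a by (simp add: F_def smult_minus)
      also have "(a \<otimes> a \<oplus> x \<otimes> x) \<ominus> (a \<otimes> a \<oplus> y \<otimes> y) = x \<otimes> (x \<ominus> y) \<oplus> (x \<ominus> y) \<otimes> y"
        using x(1) y(1) a(1) by algebra
      finally have "nrm A (F x \<ominus> F y) = nrm A (x \<otimes> (x \<ominus> y) \<oplus> (x \<ominus> y) \<otimes> y) / 2"
        using x y by (simp add: half)
      also have "nrm A (x \<otimes> (x \<ominus> y) \<oplus> (x \<ominus> y) \<otimes> y)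
          \<le> nrm A x * nrm A (x \<ominus> y) + nrm A (x \<ominus> y) * nrm A y"
        using nrm_triangle[of "x \<otimes> (x \<ominus> y)" "(x \<ominus> y) \<otimes> y"]
          nrm_mult[of x "x \<ominus> y"] nrm_mult[of "x \<ominus> y" y] x y by simp
      also have "\<dots> \<le> ?r * nrm A (x \<ominus> y) + nrm A (x \<ominus> y) * ?r"
        using x y by (intro add_mono mult_right_mono mult_left_mono nrm_nonneg) auto
      finally show ?thesis by simp
    qed
  qed (use a r0 in auto)
  then obtain y where y: "y \<in> carrier A" "star A y = y" "y \<otimes> a = a \<otimes> y" and fix': "F y = y"
    unfolding C_def by blast
  have "y \<oplus> y = 2 \<odot> F y" using fix' y smult_double by simp
  also have "\<dots> = a \<otimes> a \<oplus> y \<otimes> y" using y a by (simp add: F_def)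
  finally have yy: "y \<oplus> y = a \<otimes> a \<oplus> y \<otimes> y" .
  have "a \<otimes> a \<oplus> (\<one> \<ominus> y) \<otimes> (\<one> \<ominus> y) = (a \<otimes> a \<oplus> y \<otimes> y) \<ominus> (y \<oplus> y) \<oplus> \<one>"
    using y(1) a(1) one_right[OF y(1)] by algebra
  also have "\<dots> = \<one>" using yy y a by (simp add: a_minus_def M.r_neg)
  finally have "a \<otimes> a \<oplus> (\<one> \<ominus> y) \<otimes> (\<one> \<ominus> y) = \<one>" .
  moreover have "(\<one> \<ominus> y) \<otimes> a = a \<otimes> (\<one> \<ominus> y)"
  proof -
    have "(\<one> \<ominus> y) \<otimes> a = a \<ominus> y \<otimes> a" using y(1) a(1) by algebra
    also have "\<dots> = a \<otimes> (\<one> \<ominus> y)" unfolding y(3) using y(1) a(1) one_right[OF a(1)] by algebra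
    finally show ?thesis .
  qed
  ultimately show ?thesis using y by (intro bexI[of _ "\<one> \<ominus> y"]) (auto simp: star_minus)
qed

text \<open>The element \<open>u = a + ic\<close> satisfies \<open>u\<^sup>* u = a\<^sup>2 + c\<^sup>2 = 1\<close>, so it has norm at most
  \<open>1\<close>, and \<open>a\<close> is its real part. This is how norm bounds are obtained without spectra.\<close>
lemma nrm_le_one_of_squares:
  assumes a: "a \<in> carrier A" "star A a = a" and c: "c \<in> carrier A" "star A c = c"
    and comm: "c \<otimes> a = a \<otimes> c" and sq: "a \<otimes> a \<oplus> c \<otimes> c = \<one>"
  shows "nrm A a \<le> 1"
proof -
  define u where "u = a \<oplus> \<i> \<odot> c"
  have u: "u \<in> carrier A" using a c by (simp add: u_def)
  have su: "star A u = a \<ominus> \<i> \<odot> c"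
    using a c by (simp add: u_def star_add star_smult a_minus_def smult_l_minus[of \<i>, simplified])
  have "star A u \<otimes> u = (a \<otimes> a \<oplus> a \<otimes> (\<i> \<odot> c)) \<ominus> ((\<i> \<odot> c) \<otimes> a \<oplus> (\<i> \<odot> c) \<otimes> (\<i> \<odot> c))"
  proof -
    have ic: "\<i> \<odot> c \<in> carrier A" using c by simp
    show ?thesis unfolding su unfolding u_def using a(1) ic by algebra
  qed
  also have "\<dots> = (a \<otimes> a \<oplus> \<i> \<odot> (a \<otimes> c)) \<ominus> (\<i> \<odot> (a \<otimes> c) \<ominus> c \<otimes> c)"
    using a c comm by (simp add: smult_mult_left smult_mult_right uminus_smult a_minus_def)
  also have "\<dots> = a \<otimes> a \<oplus> c \<otimes> c"
  proof -
    have "\<i> \<odot> (a \<otimes> c) \<in> carrier A" using a c by simp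
    then show ?thesis using a(1) c(1) by algebra
  qed
  finally have "star A u \<otimes> u = \<one>" using sq by simp
  then have "(nrm A u)\<^sup>2 \<le> 1" using nrm_cstar[OF u] nrm_one_le by simp
  then have u1: "nrm A u \<le> 1" by (simp add: power_le_one_iff nrm_nonneg u abs_square_le_1)
  have "a = (1/2) \<odot> (u \<oplus> star A u)"
  proof -
    have "\<i> \<odot> c \<in> carrier A" using c by simp
    then have "u \<oplus> star A u = a \<oplus> a" unfolding su unfolding u_def using a(1) by algebra
    then show ?thesis using a by (simp add: smult_double[symmetric])
  qed
  then have "nrm A a = nrm A (u \<oplus> star A u) / 2"
    using u nrm_smult[of "u \<oplus> star A u" "1/2"] by simp
  also have "\<dots> \<le> 1" using nrm_triangle[of u "star A u"] u u1 by simp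
  finally show ?thesis .
qed

end

section \<open>Inverting one plus a square\<close>

context unital_cstar_algebra
begin

lemma norm_closed_Int:
  "norm_closed S A \<Longrightarrow> norm_closed T A \<Longrightarrow> norm_closed (S \<inter> T) A"
  unfolding norm_closed_iff by blast

lemma commute_mult:
  assumes "x \<in> carrier A" "y \<in> carrier A" "z \<in> carrier A" "x \<otimes> z = z \<otimes> x" "y \<otimes> z = z \<otimes> y"
  shows "x \<otimes> y \<otimes> z = z \<otimes> (x \<otimes> y)"
  using assms by (simp add: mult_assoc) (simp add: mult_assoc[symmetric])

text \<open>With \<open>p = (1 + q\<^sup>2)\<^bsup>-1\<^esup>\<close>, the elements \<open>2qp\<close> and \<open>(1 - q\<^sup>2)p\<close> parametrise the unit
  circle: their squares add up to \<open>1\<close>. So both have norm at most \<open>1\<close>, and \<open>p\<close> is the mean of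
  \<open>1\<close> and \<open>(1 - q\<^sup>2)p\<close>.\<close>
lemma nrm_self_adjoint_inverse_bounds:
  assumes q: "q \<in> carrier A" "star A q = q" and p: "p \<in> carrier A" "star A p = p"
    and comm: "p \<otimes> q = q \<otimes> p" and inv: "p \<otimes> (\<one> \<oplus> q \<otimes> q) = \<one>"
  shows "nrm A p \<le> 1" "nrm A (2 \<odot> (q \<otimes> p)) \<le> 1"
proof -
  define a where "a = q \<otimes> p \<oplus> q \<otimes> p"
  define c where "c = p \<ominus> q \<otimes> q \<otimes> p"
  have A: "a \<in> carrier A" "c \<in> carrier A" using p q by (auto simp: a_def c_def)
  have qp: "q \<otimes> p \<in> carrier A" "p \<otimes> p \<in> carrier A" "q \<otimes> q \<in> carrier A" using p q by auto
  have 1: "p \<otimes> (q \<otimes> x) = q \<otimes> (p \<otimes> x)" if "x \<in> carrier A" for x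
    using comm p q that by (metis mult_assoc)
  have sa: "star A a = a" using p q comm by (simp add: a_def star_add star_mult)
  have sc: "star A c = c" using p q comm 1 by (simp add: c_def star_minus star_mult mult_assoc)
  have ca: "c \<otimes> a = a \<otimes> c"
    unfolding a_def c_def using p(1) q(1)
    by (simp add: distr_left distr_right a_minus_def M.minus_add mult_assoc 1 comm U.l_minus U.r_minus
        M.a_ac)
  have "a \<otimes> a \<oplus> c \<otimes> c = (p \<otimes> (\<one> \<oplus> q \<otimes> q)) \<otimes> (p \<otimes> (\<one> \<oplus> q \<otimes> q))"
  proof -
    let ?x = "p \<otimes> p" and ?y = "q \<otimes> (q \<otimes> (p \<otimes> p))" and ?z = "q \<otimes> (q \<otimes> (q \<otimes> (q \<otimes> (p \<otimes> p))))"
    have xyz: "?x \<in> carrier A" "?y \<in> carrier A" "?z \<in> carrier A" using p q by auto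
    have "a \<otimes> a = (?y \<oplus> ?y) \<oplus> (?y \<oplus> ?y)"
      unfolding a_def using p(1) q(1) by (simp add: distr_left distr_right mult_assoc 1 comm)
    moreover have "c \<otimes> c = (?x \<ominus> ?y) \<ominus> (?y \<ominus> ?z)"
    proof -
      have "c \<otimes> c = (p \<otimes> p \<ominus> p \<otimes> (q \<otimes> q \<otimes> p)) \<ominus> (q \<otimes> q \<otimes> p \<otimes> p \<ominus> q \<otimes> q \<otimes> p \<otimes> (q \<otimes> q \<otimes> p))"
        unfolding c_def using p(1) q(1) by algebra
      also have "\<dots> = (?x \<ominus> ?y) \<ominus> (?y \<ominus> ?z)"
        using p(1) q(1) by (simp add: mult_assoc 1 comm)
      finally show ?thesis .
    qed
    moreover have "(p \<otimes> (\<one> \<oplus> q \<otimes> q)) \<otimes> (p \<otimes> (\<one> \<oplus> q \<otimes> q)) = (?x \<oplus> ?y) \<oplus> (?y \<oplus> ?z)"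
      using p(1) q(1) by (simp add: distr_left distr_right mult_assoc 1 comm M.a_assoc)
    ultimately show ?thesis using xyz by algebra
  qed
  then have sq: "a \<otimes> a \<oplus> c \<otimes> c = \<one>" by (simp add: inv)
  have a1: "nrm A a \<le> 1" by (rule nrm_le_one_of_squares[OF A(1) sa A(2) sc ca sq])
  have c1: "nrm A c \<le> 1"
    by (rule nrm_le_one_of_squares[OF A(2) sc A(1) sa ca[symmetric]])
       (use sq A in \<open>simp add: M.a_comm\<close>)
  show "nrm A (2 \<odot> (q \<otimes> p)) \<le> 1" using a1 qp by (simp add: a_def smult_double)
  have "p \<oplus> p = c \<oplus> \<one>"
  proof -
    have "p \<otimes> (\<one> \<oplus> q \<otimes> q) = p \<oplus> q \<otimes> q \<otimes> p"
      using p(1) q(1) by (simp add: distr_right mult_assoc 1 comm)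
    moreover have "p \<oplus> p = (p \<ominus> q \<otimes> q \<otimes> p) \<oplus> (p \<oplus> q \<otimes> q \<otimes> p)"
      using p(1) q(1) by algebra
    ultimately show ?thesis using inv by (simp add: c_def)
  qed
  then have "2 * nrm A p = nrm A (c \<oplus> \<one>)"
    using nrm_smult[of p 2] p by (simp add: smult_double)
  also have "\<dots> \<le> 2" using nrm_triangle[of c \<one>] A c1 nrm_one_le by simp
  finally show "nrm A p \<le> 1" by simp
qed

text \<open>Choose \<open>r\<close> larger than \<open>\<parallel>q\<parallel>\<close> and \<open>c\<close> with \<open>(q/r)\<^sup>2 + c\<^sup>2 = 1\<close>. Then
  \<open>1 + q\<^sup>2 = (1 + r\<^sup>2)(1 - y)\<close> with \<open>y = r\<^sup>2 c\<^sup>2 / (1 + r\<^sup>2)\<close> of norm less than \<open>1\<close>, and the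
  inverse is the fixed point of \<open>p \<mapsto> 1 / (1 + r\<^sup>2) + yp\<close>.\<close>
lemma one_plus_square_invertible:
  assumes q: "q \<in> carrier A" "star A q = q"
  shows "\<exists>p\<in>carrier A. star A p = p \<and> p \<otimes> q = q \<otimes> p \<and> p \<otimes> (\<one> \<oplus> q \<otimes> q) = \<one>"
proof -
  define r where "r = nrm A q + 1"
  have r: "r \<ge> 1" using nrm_nonneg q by (simp add: r_def)
  define a where "a = of_real (1 / r) \<odot> q"
  have a: "a \<in> carrier A" "star A a = a" using q by (simp_all add: a_def star_smult)
  have "nrm A a = nrm A q / r" using q r by (simp add: a_def nrm_smult norm_divide)
  then have a1: "nrm A a < 1" using r by (simp add: r_def)
  obtain c where c: "c \<in> carrier A" "star A c = c" "c \<otimes> a = a \<otimes> c" "a \<otimes> a \<oplus> c \<otimes> c = \<one>"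
    using sqrt_one_minus_square[OF a a1] by blast
  have c1: "nrm A c \<le> 1"
    by (rule nrm_le_one_of_squares[OF c(1,2) a c(3)[symmetric]])
       (use c a in \<open>simp add: M.a_comm\<close>)
  have qra: "q = of_real r \<odot> a" using q r by (simp add: a_def)
  have qa: "q \<otimes> a = a \<otimes> q"
    using a by (subst (1 2) qra) (simp add: smult_mult_left smult_mult_right)
  have cq: "c \<otimes> q = q \<otimes> c"
    using a c by (subst (1 2) qra) (simp add: smult_mult_left smult_mult_right)
  have qq: "q \<otimes> q \<oplus> of_real (r\<^sup>2) \<odot> (c \<otimes> c) = of_real (r\<^sup>2) \<odot> \<one>"
  proof -
    have "q \<otimes> q = of_real (r\<^sup>2) \<odot> (a \<otimes> a)"
      using a by (subst (1 2) qra) (simp add: smult_mult_left smult_mult_right power2_eq_square)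
    then show ?thesis using a c(1) by (simp add: smult_add_right[symmetric] c(4))
  qed
  define k where "k = 1 / (1 + r\<^sup>2)"
  have k: "0 < k" "k * (1 + r\<^sup>2) = 1" proof -
    have "0 < 1 + r\<^sup>2" by (simp add: add_pos_nonneg)
    then show "0 < k" "k * (1 + r\<^sup>2) = 1" by (simp_all add: k_def)
  qed
  define y where "y = of_real (k * r\<^sup>2) \<odot> (c \<otimes> c)"
  have y: "y \<in> carrier A" "star A y = y" using c by (simp_all add: y_def star_smult star_mult)
  have yq: "y \<otimes> q = q \<otimes> y"
  proof -
    have "c \<otimes> c \<otimes> q = q \<otimes> (c \<otimes> c)" using commute_mult[OF c(1) c(1) q(1) cq cq] .
    then show ?thesis using c q by (simp add: y_def smult_mult_left smult_mult_right)
  qed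
  have ynrm: "nrm A y \<le> k * r\<^sup>2"
  proof -
    have "nrm A (c \<otimes> c) \<le> 1 * 1"
      using nrm_mult[of c c] c c1 nrm_nonneg[of c] by (meson mult_mono order_trans zero_le_one)
    then show ?thesis using c k by (simp add: y_def nrm_smult norm_mult mult_left_le norm_power)
  qed
  have y_lt: "k * r\<^sup>2 < 1" "0 \<le> k * r\<^sup>2" using k by (simp_all add: distrib_left)
  define F where "F p = of_real k \<odot> \<one> \<oplus> y \<otimes> p" for p
  define C where "C = {p \<in> carrier A. star A p = p \<and> p \<otimes> q = q \<otimes> p \<and> nrm A p \<le> 1}"
  have "\<exists>p\<in>{p \<in> carrier A. p \<otimes> y = y \<otimes> p} \<inter> C. F p = p"
  proof (rule contraction_fixed_point[where r = "k * r\<^sup>2"])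
    show "{p \<in> carrier A. p \<otimes> y = y \<otimes> p} \<inter> C \<subseteq> carrier A" by blast
    have "\<zero> \<in> {p \<in> carrier A. p \<otimes> y = y \<otimes> p} \<inter> C" using q y by (simp add: C_def)
    then show "{p \<in> carrier A. p \<otimes> y = y \<otimes> p} \<inter> C \<noteq> {}" by blast
    have e: "{p \<in> carrier A. p \<otimes> y = y \<otimes> p} \<inter> C =
      {p \<in> carrier A. star A p = p \<and> p \<otimes> y = y \<otimes> p \<and> nrm A p \<le> 1} \<inter> C"
      by (auto simp: C_def)
    show "norm_closed ({p \<in> carrier A. p \<otimes> y = y \<otimes> p} \<inter> C) A"
      unfolding e unfolding C_def
      by (intro norm_closed_Int norm_closed_self_adjoint_commutant y q)
    show "nrm A (F p \<ominus> F p') \<le> k * r\<^sup>2 * nrm A (p \<ominus> p')"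
      if "p \<in> {p \<in> carrier A. p \<otimes> y = y \<otimes> p} \<inter> C" "p' \<in> {p \<in> carrier A. p \<otimes> y = y \<otimes> p} \<inter> C" for p p'
    proof -
      have p: "p \<in> carrier A" "p' \<in> carrier A" using that by auto
      have "of_real k \<odot> \<one> \<in> carrier A" by simp
      then have "F p \<ominus> F p' = y \<otimes> (p \<ominus> p')" unfolding F_def using y(1) p by algebra
      then have "nrm A (F p \<ominus> F p') \<le> nrm A y * nrm A (p \<ominus> p')"
        using nrm_mult[of y "p \<ominus> p'"] y p by simp
      also have "\<dots> \<le> k * r\<^sup>2 * nrm A (p \<ominus> p')"
        using ynrm p by (intro mult_right_mono nrm_nonneg) auto
      finally show ?thesis .
    qed
    show "F p \<in> {p \<in> carrier A. p \<otimes> y = y \<otimes> p} \<inter> C"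
      if "p \<in> {p \<in> carrier A. p \<otimes> y = y \<otimes> p} \<inter> C" for p
    proof -
      have p: "p \<in> carrier A" "star A p = p" "p \<otimes> q = q \<otimes> p" "nrm A p \<le> 1" "p \<otimes> y = y \<otimes> p"
        using that by (auto simp: C_def)
      have "star A (F p) = F p" using p y by (simp add: F_def star_add star_smult star_mult)
      moreover have "F p \<otimes> q = q \<otimes> F p"
      proof -
        have "y \<otimes> p \<otimes> q = q \<otimes> (y \<otimes> p)" using commute_mult[OF y(1) p(1) q(1) yq p(3)] .
        then show ?thesis
          using p y q by (simp add: F_def distr_left distr_right smult_mult_left smult_mult_right)
      qed
      moreover have "F p \<otimes> y = y \<otimes> F p"
      proof -
        have "y \<otimes> p \<otimes> y = y \<otimes> (y \<otimes> p)" using commute_mult[OF y(1) p(1) y(1) refl p(5)] .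
        then show ?thesis
          using p y q by (simp add: F_def distr_left distr_right smult_mult_left smult_mult_right)
      qed
      moreover have "nrm A (F p) \<le> 1"
      proof -
        have "nrm A (F p) \<le> k * nrm A \<one> + nrm A y * nrm A p"
          using nrm_triangle[of "of_real k \<odot> \<one>" "y \<otimes> p"] nrm_mult[of y p] y p k
          by (simp add: F_def nrm_smult)
        also have "\<dots> \<le> k * 1 + (k * r\<^sup>2) * 1"
          using k nrm_one_le ynrm p y_lt
          by (intro add_mono mult_mono nrm_nonneg) auto
        also have "\<dots> = 1" using k(2) by (simp add: distrib_left)
        finally show ?thesis .
      qed
      ultimately show ?thesis using p y by (simp add: C_def F_def)
    qed
  qed (use y_lt in auto)
  then obtain p where p: "p \<in> carrier A" "star A p = p" "p \<otimes> q = q \<otimes> p" "p \<otimes> y = y \<otimes> p" "F p = p"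
    unfolding C_def by blast
  have "p \<otimes> (\<one> \<oplus> q \<otimes> q) = of_real (1 + r\<^sup>2) \<odot> (p \<ominus> p \<otimes> y)"
  proof -
    have cc: "c \<otimes> c \<in> carrier A" using c by simp
    have "\<one> \<oplus> q \<otimes> q = of_real (1 + r\<^sup>2) \<odot> (\<one> \<ominus> y)"
    proof -
      have "q \<otimes> q = of_real (r\<^sup>2) \<odot> \<one> \<ominus> of_real (r\<^sup>2) \<odot> (c \<otimes> c)"
      proof -
        have "q \<otimes> q = (q \<otimes> q \<oplus> of_real (r\<^sup>2) \<odot> (c \<otimes> c)) \<ominus> of_real (r\<^sup>2) \<odot> (c \<otimes> c)"
        proof -
          have "of_real (r\<^sup>2) \<odot> (c \<otimes> c) \<in> carrier A" using cc by blast
          then show ?thesis using q(1) by algebra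
        qed
        then show ?thesis unfolding qq .
      qed
      moreover have "of_real (1 + r\<^sup>2) \<odot> y = of_real (r\<^sup>2) \<odot> (c \<otimes> c)"
      proof -
        have "(1 + r\<^sup>2) * (k * r\<^sup>2) = (k * (1 + r\<^sup>2)) * r\<^sup>2" by (simp only: ac_simps)
        then have "(1 + r\<^sup>2) * (k * r\<^sup>2) = r\<^sup>2" unfolding k(2) by simp
        then show ?thesis using cc unfolding y_def by (simp only: smult_smult of_real_mult[symmetric])
      qed
      moreover have "of_real (1 + r\<^sup>2) \<odot> \<one> = \<one> \<oplus> of_real (r\<^sup>2) \<odot> \<one>"
        using smult_add_left[of \<one> 1 "of_real (r\<^sup>2)"] by (simp only: of_real_add of_real_1 smult_1 one_closed)
      ultimately have "of_real (1 + r\<^sup>2) \<odot> (\<one> \<ominus> y) = (\<one> \<oplus> of_real (r\<^sup>2) \<odot> \<one>) \<ominus> of_real (r\<^sup>2) \<odot> (c \<otimes> c)"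
        using smult_minus[OF one_closed y(1)] by simp
      moreover have "of_real (r\<^sup>2) \<odot> \<one> \<in> carrier A" "of_real (r\<^sup>2) \<odot> (c \<otimes> c) \<in> carrier A"
        using cc by blast+
      ultimately show ?thesis using \<open>q \<otimes> q = _\<close> by (simp only: a_minus_def M.a_assoc one_closed M.a_inv_closed)
    qed
    then show ?thesis using p(1) y(1) by (simp add: smult_mult_right distr_right a_minus_def U.r_minus)
  qed
  also have "p \<ominus> p \<otimes> y = of_real k \<odot> \<one>"
  proof -
    have "p = of_real k \<odot> \<one> \<oplus> p \<otimes> y" using p(4,5) by (simp add: F_def)
    moreover have "(of_real k \<odot> \<one> \<oplus> p \<otimes> y) \<ominus> p \<otimes> y = of_real k \<odot> \<one>"
    proof -
      have "of_real k \<odot> \<one> \<in> carrier A" by simp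
      then show ?thesis using p(1) y(1) by algebra
    qed
    ultimately show ?thesis by simp
  qed
  also have "of_real (1 + r\<^sup>2) \<odot> (of_real k \<odot> \<one>) = \<one>"
    using k(2) by (simp only: smult_smult[OF one_closed] of_real_mult[symmetric] mult.commute) simp
  finally show ?thesis using p by blast
qed

end

section \<open>Subalgebras and generated subalgebras\<close>

lemma norm_closed_limD:
  "norm_closed S A \<Longrightarrow> norm_lim A \<sigma> x \<Longrightarrow> x \<in> carrier A \<Longrightarrow> (\<And>n. \<sigma> n \<in> S) \<Longrightarrow> x \<in> S"
  unfolding norm_closed_iff by (elim allE impE) auto

lemma (in unital_cstar_algebra) submodule_iff:
  "submodule S complex_ring A \<longleftrightarrow> S \<subseteq> carrier A \<and> \<zero> \<in> S \<and>
    (\<forall>x\<in>S. \<forall>y\<in>S. x \<oplus> y \<in> S) \<and> (\<forall>c. \<forall>x\<in>S. c \<odot> x \<in> S)"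
proof
  assume S: "submodule S complex_ring A"
  then interpret S: submodule S complex_ring A .
  show "S \<subseteq> carrier A \<and> \<zero> \<in> S \<and> (\<forall>x\<in>S. \<forall>y\<in>S. x \<oplus> y \<in> S) \<and> (\<forall>c. \<forall>x\<in>S. c \<odot> x \<in> S)"
    using S.subset S.one_closed S.m_closed S.smult_closed by auto
next
  assume *: "S \<subseteq> carrier A \<and> \<zero> \<in> S \<and>
    (\<forall>x\<in>S. \<forall>y\<in>S. x \<oplus> y \<in> S) \<and> (\<forall>c. \<forall>x\<in>S. c \<odot> x \<in> S)"
  show "submodule S complex_ring A"
  proof (rule submoduleI)
    show "\<ominus> x \<in> S" if "x \<in> S" for x
      using * that uminus_smult[of x] by auto
  qed (use * in auto)
qed

lemma (in unital_cstar_algebra) submodule_minus: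
  assumes "submodule S complex_ring A" "x \<in> S" "y \<in> S" shows "x \<ominus> y \<in> S"
  using submoduleE(3,5)[OF assms(1)] assms(2,3) by (simp add: a_minus_def)

text \<open>Subtraction in a record with a smaller carrier is defined through inverses in that
  carrier, so its agreement with the ambient subtraction has to be proved.\<close>
lemma (in unital_cstar_algebra) subalgebra_a_inv:
  assumes S: "submodule S complex_ring A" and x: "x \<in> S"
  shows "\<ominus>\<^bsub>A\<lparr>carrier := S\<rparr>\<^esub> x = \<ominus> x"
proof -
  interpret S: module complex_ring "A\<lparr>carrier := S\<rparr>"
    by (rule submodule.submodule_is_module[OF S]) unfold_locales
  have x': "x \<in> carrier A" "\<ominus> x \<in> S" using S x submoduleE(1,3)[OF S] by auto
  show ?thesis
    using S.M.minus_equality[of "\<ominus> x" x] x x' M.l_neg[of x] by simp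
qed

lemma (in unital_cstar_algebra) subalgebra_minus:
  assumes "submodule S complex_ring A" "x \<in> S" "y \<in> S"
  shows "x \<ominus>\<^bsub>A\<lparr>carrier := S\<rparr>\<^esub> y = x \<ominus> y"
  using subalgebra_a_inv[OF assms(1,3)] by (simp add: a_minus_def)

lemma (in unital_cstar_algebra) subalgebra_cstar_algebra:
  assumes "cstar_subalgebra S A"
  shows "cstar_algebra (A\<lparr>carrier := S\<rparr>)"
proof -
  from assms have S: "submodule S complex_ring A" and cl: "norm_closed S A"
    and mult: "\<And>x y. x \<in> S \<Longrightarrow> y \<in> S \<Longrightarrow> x \<otimes> y \<in> S" and st: "\<And>x. x \<in> S \<Longrightarrow> star A x \<in> S"
    by (auto simp: cstar_subalgebra_def)
  have sub: "x \<in> carrier A" if "x \<in> S" for x using submoduleE(1)[OF S] that by blast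
  have complete: "\<exists>x\<in>carrier (A\<lparr>carrier := S\<rparr>).
        (\<lambda>n. nrm (A\<lparr>carrier := S\<rparr>) (\<sigma> n \<ominus>\<^bsub>A\<lparr>carrier := S\<rparr>\<^esub> x)) \<longlonglongrightarrow> 0"
    if "range \<sigma> \<subseteq> carrier (A\<lparr>carrier := S\<rparr>)" and
      cau: "\<forall>e>0. \<exists>N. \<forall>m\<ge>N. \<forall>n\<ge>N. nrm (A\<lparr>carrier := S\<rparr>) (\<sigma> m \<ominus>\<^bsub>A\<lparr>carrier := S\<rparr>\<^esub> \<sigma> n) < e"
    for \<sigma> :: "nat \<Rightarrow> 'a"
  proof -
    have \<sigma>: "\<sigma> n \<in> S" for n using that by auto
    have eq: "nrm (A\<lparr>carrier := S\<rparr>) (\<sigma> m \<ominus>\<^bsub>A\<lparr>carrier := S\<rparr>\<^esub> y) = nrm A (\<sigma> m \<ominus> y)" if "y \<in> S" for m y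
      using subalgebra_minus[OF S \<sigma> that] by simp
    have cau': "\<forall>e>0. \<exists>N. \<forall>m\<ge>N. \<forall>n\<ge>N. nrm A (\<sigma> m \<ominus> \<sigma> n) < e"
      using cau by (simp only: eq[OF \<sigma>])
    have ran: "range \<sigma> \<subseteq> carrier A" using \<sigma> sub by blast
    obtain x where x: "x \<in> carrier A" "norm_lim A \<sigma> x"
      using nrm_complete[OF ran cau'] unfolding norm_lim_def by blast
    have xS: "x \<in> S" by (rule norm_closed_limD[OF cl x(2,1) \<sigma>])
    show ?thesis
    proof (rule bexI[of _ x])
      show "(\<lambda>n. nrm (A\<lparr>carrier := S\<rparr>) (\<sigma> n \<ominus>\<^bsub>A\<lparr>carrier := S\<rparr>\<^esub> x)) \<longlonglongrightarrow> 0"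
        using x(2) unfolding eq[OF xS] norm_lim_def .
    qed (simp add: xS)
  qed
  interpret S: module complex_ring "A\<lparr>carrier := S\<rparr>"
    by (rule submodule.submodule_is_module[OF S]) unfold_locales
  show ?thesis
  proof unfold_locales
    fix \<sigma> :: "nat \<Rightarrow> 'a"
    assume "range \<sigma> \<subseteq> carrier (A\<lparr>carrier := S\<rparr>)"
      "\<forall>e>0. \<exists>N. \<forall>m\<ge>N. \<forall>n\<ge>N. nrm (A\<lparr>carrier := S\<rparr>) (\<sigma> m \<ominus>\<^bsub>A\<lparr>carrier := S\<rparr>\<^esub> \<sigma> n) < e"
    then show "\<exists>x\<in>carrier (A\<lparr>carrier := S\<rparr>).
        (\<lambda>n. nrm (A\<lparr>carrier := S\<rparr>) (\<sigma> n \<ominus>\<^bsub>A\<lparr>carrier := S\<rparr>\<^esub> x)) \<longlonglongrightarrow> 0"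
      by (rule complete)
  qed (simp_all add: sub mult st mult_assoc distr_left distr_right smult_mult_left smult_mult_right
        star_star star_add star_smult star_mult nrm_nonneg nrm_eq_0 nrm_triangle nrm_smult
        nrm_mult nrm_cstar)
qed

lemma (in unital_cstar_algebra) subalgebra_unital:
  assumes "cstar_subalgebra S A" "\<one> \<in> S"
  shows "unital_cstar_algebra (A\<lparr>carrier := S\<rparr>)"
proof -
  interpret S: cstar_algebra "A\<lparr>carrier := S\<rparr>" by (rule subalgebra_cstar_algebra[OF assms(1)])
  have "S \<subseteq> carrier A" using assms(1) submodule_iff by (simp add: cstar_subalgebra_def)
  then show ?thesis by unfold_locales (use assms(2) in auto)
qed

lemma (in unital_cstar_algebra) norm_lim_subalgebra:
  assumes "submodule S complex_ring A" "\<And>n. \<sigma> n \<in> S" "x \<in> S"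
  shows "norm_lim (A\<lparr>carrier := S\<rparr>) \<sigma> x \<longleftrightarrow> norm_lim A \<sigma> x"
  using subalgebra_minus[OF assms(1) assms(2) assms(3)] by (simp add: norm_lim_def)

lemma (in unital_cstar_algebra) cstar_subalgebra_carrier: "cstar_subalgebra (carrier A) A"
  by (auto simp: cstar_subalgebra_def submodule_iff norm_closed_iff)

lemma (in unital_cstar_algebra) cstar_subalgebra_subset:
  "cstar_subalgebra S A \<Longrightarrow> S \<subseteq> carrier A"
  by (simp add: cstar_subalgebra_def submodule_iff)

lemma (in unital_cstar_algebra) cstar_subalgebra_Inter:
  assumes "\<And>S. S \<in> \<S> \<Longrightarrow> cstar_subalgebra S A" "\<S> \<noteq> {}"
  shows "cstar_subalgebra (\<Inter>\<S>) A"
proof -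
  have sub: "submodule S complex_ring A" "norm_closed S A" "\<forall>x\<in>S. \<forall>y\<in>S. x \<otimes> y \<in> S" "\<forall>x\<in>S. star A x \<in> S"
    if "S \<in> \<S>" for S
    using assms(1)[OF that] by (auto simp: cstar_subalgebra_def)
  have "submodule (\<Inter>\<S>) complex_ring A"
  proof -
    have *: "S \<subseteq> carrier A \<and> \<zero> \<in> S \<and> (\<forall>x\<in>S. \<forall>y\<in>S. x \<oplus> y \<in> S) \<and> (\<forall>c. \<forall>x\<in>S. c \<odot> x \<in> S)"
      if "S \<in> \<S>" for S using sub(1)[OF that] unfolding submodule_iff .
    show ?thesis unfolding submodule_iff
    proof (intro conjI ballI allI InterI)
      obtain S where "S \<in> \<S>" using assms(2) by blast
      then show "\<Inter>\<S> \<subseteq> carrier A" using * by blast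
    qed (use * in auto)
  qed
  moreover have "norm_closed (\<Inter>\<S>) A"
    unfolding norm_closed_iff
  proof (intro allI impI InterI)
    fix \<sigma> x S assume *: "x \<in> carrier A" "\<forall>n. \<sigma> n \<in> \<Inter>\<S>" "norm_lim A \<sigma> x" "S \<in> \<S>"
    then have "\<sigma> n \<in> S" for n by blast
    then show "x \<in> S" using norm_closed_limD[OF sub(2)[OF *(4)] *(3,1)] by blast
  qed
  ultimately show ?thesis unfolding cstar_subalgebra_def using sub(3,4) by simp
qed

lemma (in unital_cstar_algebra) cstar_generated_subalgebra:
  assumes "X \<subseteq> carrier A" shows "cstar_subalgebra (cstar_generated A X) A"
  unfolding cstar_generated_def
  by (rule cstar_subalgebra_Inter) (use assms cstar_subalgebra_carrier in auto)

lemma cstar_generated_superset: "X \<subseteq> cstar_generated A X"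
  by (auto simp: cstar_generated_def)

lemma cstar_generated_least: "cstar_subalgebra S A \<Longrightarrow> X \<subseteq> S \<Longrightarrow> cstar_generated A X \<subseteq> S"
  by (auto simp: cstar_generated_def)

lemma (in unital_cstar_algebra) closure_subalgebra:
  assumes P: "P \<subseteq> carrier A" "\<zero> \<in> P" "\<And>x y. x \<in> P \<Longrightarrow> y \<in> P \<Longrightarrow> x \<oplus> y \<in> P"
    "\<And>c x. x \<in> P \<Longrightarrow> c \<odot> x \<in> P" "\<And>x y. x \<in> P \<Longrightarrow> y \<in> P \<Longrightarrow> x \<otimes> y \<in> P"
    "\<And>x. x \<in> P \<Longrightarrow> star A x \<in> P"
  shows "cstar_subalgebra {x \<in> carrier A. \<forall>e>0. \<exists>p\<in>P. nrm A (p \<ominus> x) < e} A"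
    (is "cstar_subalgebra ?S A")
proof -
  have S_iff: "x \<in> ?S \<longleftrightarrow> x \<in> carrier A \<and> (\<exists>\<sigma>. (\<forall>n. \<sigma> n \<in> P) \<and> norm_lim A \<sigma> x)" for x
  proof
    assume "x \<in> ?S"
    then show "x \<in> carrier A \<and> (\<exists>\<sigma>. (\<forall>n. \<sigma> n \<in> P) \<and> norm_lim A \<sigma> x)"
      using norm_lim_ex[of x P] P(1) by simp
  next
    assume *: "x \<in> carrier A \<and> (\<exists>\<sigma>. (\<forall>n. \<sigma> n \<in> P) \<and> norm_lim A \<sigma> x)"
    then obtain \<sigma> where \<sigma>: "\<forall>n. \<sigma> n \<in> P" "norm_lim A \<sigma> x" by blast
    have "\<exists>p\<in>P. nrm A (p \<ominus> x) < e" if "e > 0" for e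
      using norm_lim_ball[OF \<sigma>(2) that] \<sigma>(1) by blast
    with * show "x \<in> ?S" by simp
  qed
  have S_I: "x \<in> ?S" if "x \<in> carrier A" "\<forall>n. \<sigma> n \<in> P" "norm_lim A \<sigma> x" for x \<sigma>
    unfolding S_iff using that by (intro conjI exI[of _ \<sigma>])
  have PA: "\<sigma> n \<in> carrier A" if "\<forall>n. \<sigma> n \<in> P" for \<sigma> :: "nat \<Rightarrow> 'a" and n using that P(1) by blast
  have add: "x \<oplus> y \<in> ?S" and mult: "x \<otimes> y \<in> ?S" if xy: "x \<in> ?S" "y \<in> ?S" for x y
  proof -
    obtain \<sigma> \<rho> where *: "\<forall>n. \<sigma> n \<in> P" "norm_lim A \<sigma> x" "\<forall>n. \<rho> n \<in> P" "norm_lim A \<rho> y"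
      using xy unfolding S_iff by blast
    have c: "\<And>n. \<sigma> n \<in> carrier A" "\<And>n. \<rho> n \<in> carrier A" "x \<in> carrier A" "y \<in> carrier A"
      using PA[OF *(1)] PA[OF *(3)] xy by auto
    have "norm_lim A (\<lambda>n. \<sigma> n \<oplus> \<rho> n) (x \<oplus> y)" "norm_lim A (\<lambda>n. \<sigma> n \<otimes> \<rho> n) (x \<otimes> y)"
      using norm_lim_add[OF *(2,4) c] norm_lim_mult[OF *(2,4) c] by auto
    note lim = this
    have mem: "\<forall>n. \<sigma> n \<oplus> \<rho> n \<in> P" "\<forall>n. \<sigma> n \<otimes> \<rho> n \<in> P" using *(1,3) P(3,5) by auto
    show "x \<oplus> y \<in> ?S" by (rule S_I[OF M.a_closed[OF c(3,4)] mem(1) lim(1)])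
    show "x \<otimes> y \<in> ?S" by (rule S_I[OF mult_closed[OF c(3,4)] mem(2) lim(2)])
  qed
  have sm: "c \<odot> x \<in> ?S" and st: "star A x \<in> ?S" if x: "x \<in> ?S" for c x
  proof -
    obtain \<sigma> where *: "\<forall>n. \<sigma> n \<in> P" "norm_lim A \<sigma> x" using x unfolding S_iff by blast
    have cc: "\<And>n. \<sigma> n \<in> carrier A" "x \<in> carrier A" using PA[OF *(1)] x by auto
    have "norm_lim A (\<lambda>n. c \<odot> \<sigma> n) (c \<odot> x)" "norm_lim A (\<lambda>n. star A (\<sigma> n)) (star A x)"
      using norm_lim_smult[OF *(2) cc] norm_lim_star[OF *(2) cc] by auto
    note lim = this
    have mem: "\<forall>n. c \<odot> \<sigma> n \<in> P" "\<forall>n. star A (\<sigma> n) \<in> P" using *(1) P(4,6) by auto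
    show "c \<odot> x \<in> ?S" by (rule S_I[OF smult_carrier[OF cc(2)] mem(1) lim(1)])
    show "star A x \<in> ?S" by (rule S_I[OF star_carrier[OF cc(2)] mem(2) lim(2)])
  qed
  have zero: "\<zero> \<in> ?S" using P(2) by (auto simp: a_minus_def intro!: bexI[of _ \<zero>])
  have closed: "norm_closed ?S A"
    unfolding norm_closed_iff
  proof (intro allI impI)
    fix \<sigma> x assume x: "x \<in> carrier A" and \<sigma>: "\<forall>n. \<sigma> n \<in> ?S" and lim: "norm_lim A \<sigma> x"
    have "\<exists>p\<in>P. nrm A (p \<ominus> x) < e" if "e > 0" for e
    proof -
      have "0 < e / 2" using that by simp
      then obtain n where n: "nrm A (\<sigma> n \<ominus> x) < e / 2" using norm_lim_ball[OF lim] by blast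
      have \<sigma>n: "\<sigma> n \<in> carrier A" "\<forall>e>0. \<exists>p\<in>P. nrm A (p \<ominus> \<sigma> n) < e" using spec[OF \<sigma>, of n] by simp_all
      obtain p where p: "p \<in> P" "nrm A (p \<ominus> \<sigma> n) < e / 2"
        using \<sigma>n(2) \<open>0 < e / 2\<close> by blast
      have pA: "p \<in> carrier A" using p(1) P(1) by (rule subsetD[rotated])
      have "nrm A (p \<ominus> x) < e"
        using nrm_minus_triangle[OF pA \<sigma>n(1) x] n p(2) by linarith
      with p(1) show ?thesis by blast
    qed
    then show "x \<in> ?S" using x by blast
  qed
  have "?S \<subseteq> carrier A" by blast
  then show ?thesis unfolding cstar_subalgebra_def submodule_iff
    using add mult sm st zero closed by (intro conjI ballI allI)
qed

lemma (in unital_cstar_algebra) closed_span_carrier: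
  assumes "\<And>S. submodule S complex_ring A \<Longrightarrow> norm_closed S A \<Longrightarrow> X \<subseteq> S \<Longrightarrow> carrier A \<subseteq> S"
    "X \<subseteq> carrier A"
  shows "closed_span A X = carrier A"
proof -
  have "submodule (carrier A) complex_ring A" "norm_closed (carrier A) A"
    using cstar_subalgebra_carrier by (auto simp: cstar_subalgebra_def)
  then have "closed_span A X \<subseteq> carrier A" using assms(2) unfolding closed_span_def by blast
  moreover have "carrier A \<subseteq> closed_span A X"
    unfolding closed_span_def by (rule Inter_greatest) (use assms(1) in simp)
  ultimately show ?thesis by (rule equalityI)
qed

section \<open>Unital homomorphisms of C*-algebras\<close>

locale cstar_morphism = A: unital_cstar_algebra A + B: unital_cstar_algebra B
  for A :: "'a cstar" and B :: "'b cstar" +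
  fixes \<phi> :: "'a \<Rightarrow> 'b"
  assumes hom: "\<phi> \<in> cstar_hom A B" and hom_one: "\<phi> \<one>\<^bsub>A\<^esub> = \<one>\<^bsub>B\<^esub>"
begin

lemma hom_closed [simp, intro]: "x \<in> carrier A \<Longrightarrow> \<phi> x \<in> carrier B"
  using hom by (auto simp: cstar_hom_def)

lemma hom_add: "\<lbrakk>x \<in> carrier A; y \<in> carrier A\<rbrakk> \<Longrightarrow> \<phi> (x \<oplus>\<^bsub>A\<^esub> y) = \<phi> x \<oplus>\<^bsub>B\<^esub> \<phi> y"
  and hom_smult: "x \<in> carrier A \<Longrightarrow> \<phi> (c \<odot>\<^bsub>A\<^esub> x) = c \<odot>\<^bsub>B\<^esub> \<phi> x"
  and hom_mult: "\<lbrakk>x \<in> carrier A; y \<in> carrier A\<rbrakk> \<Longrightarrow> \<phi> (x \<otimes>\<^bsub>A\<^esub> y) = \<phi> x \<otimes>\<^bsub>B\<^esub> \<phi> y"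
  and hom_star: "x \<in> carrier A \<Longrightarrow> \<phi> (star A x) = star B (\<phi> x)"
  using hom by (auto simp: cstar_hom_def)

lemma hom_zero [simp]: "\<phi> \<zero>\<^bsub>A\<^esub> = \<zero>\<^bsub>B\<^esub>"
  using hom_smult[of "\<zero>\<^bsub>A\<^esub>" 0] by simp

lemma hom_uminus: "x \<in> carrier A \<Longrightarrow> \<phi> (\<ominus>\<^bsub>A\<^esub> x) = \<ominus>\<^bsub>B\<^esub> \<phi> x"
  by (simp add: A.uminus_smult B.uminus_smult hom_smult)

lemma hom_minus:
  "\<lbrakk>x \<in> carrier A; y \<in> carrier A\<rbrakk> \<Longrightarrow> \<phi> (x \<ominus>\<^bsub>A\<^esub> y) = \<phi> x \<ominus>\<^bsub>B\<^esub> \<phi> y"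
  by (simp add: a_minus_def hom_add hom_uminus)

text \<open>For a self-adjoint \<open>a\<close> of norm less than \<open>1\<close>, a relation
  \<open>a\<^sup>2 + c\<^sup>2 = 1\<close> is carried over by the homomorphism, and it bounds the norm of the image.
  The general case follows by scaling and the C*-identity.\<close>
lemma hom_contractive:
  assumes x: "x \<in> carrier A" shows "nrm B (\<phi> x) \<le> nrm A x"
proof -
  have sa_lt: "nrm B (\<phi> a) \<le> 1" if a: "a \<in> carrier A" "star A a = a" "nrm A a < 1" for a
  proof -
    obtain c where c: "c \<in> carrier A" "star A c = c" "c \<otimes>\<^bsub>A\<^esub> a = a \<otimes>\<^bsub>A\<^esub> c"
      "a \<otimes>\<^bsub>A\<^esub> a \<oplus>\<^bsub>A\<^esub> c \<otimes>\<^bsub>A\<^esub> c = \<one>\<^bsub>A\<^esub>"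
      using A.sqrt_one_minus_square[OF a] by blast
    show ?thesis
    proof (rule B.nrm_le_one_of_squares[where c = "\<phi> c"])
      show "\<phi> c \<otimes>\<^bsub>B\<^esub> \<phi> a = \<phi> a \<otimes>\<^bsub>B\<^esub> \<phi> c" using a c by (simp add: hom_mult[symmetric])
      have "\<phi> (a \<otimes>\<^bsub>A\<^esub> a \<oplus>\<^bsub>A\<^esub> c \<otimes>\<^bsub>A\<^esub> c) = \<one>\<^bsub>B\<^esub>" using c(4) hom_one by simp
      then show "\<phi> a \<otimes>\<^bsub>B\<^esub> \<phi> a \<oplus>\<^bsub>B\<^esub> \<phi> c \<otimes>\<^bsub>B\<^esub> \<phi> c = \<one>\<^bsub>B\<^esub>"
        using a(1) c(1) by (simp only: hom_add hom_mult A.mult_closed)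
    qed (use a c in \<open>auto simp: hom_star[symmetric]\<close>)
  qed
  have sa: "nrm B (\<phi> a) \<le> nrm A a" if a: "a \<in> carrier A" "star A a = a" for a
  proof (rule field_le_epsilon)
    fix e :: real assume e: "0 < e"
    define r where "r = nrm A a + e"
    have r: "0 < r" using A.nrm_nonneg[OF a(1)] e by (simp add: r_def)
    have "nrm A (of_real (1/r) \<odot>\<^bsub>A\<^esub> a) = nrm A a / r"
      using a r by (simp add: A.nrm_smult norm_divide)
    also have "\<dots> < 1" using r e by (simp add: r_def)
    finally have "nrm B (\<phi> (of_real (1/r) \<odot>\<^bsub>A\<^esub> a)) \<le> 1"
      using a by (intro sa_lt) (simp_all add: A.star_smult)
    then have "nrm B (\<phi> a) \<le> r"
      using a r by (simp add: hom_smult B.nrm_smult norm_divide divide_simps)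
    then show "nrm B (\<phi> a) \<le> nrm A a + e" by (simp add: r_def)
  qed
  have "(nrm B (\<phi> x))\<^sup>2 = nrm B (\<phi> (star A x \<otimes>\<^bsub>A\<^esub> x))"
    using x by (simp add: hom_mult hom_star B.nrm_cstar)
  also have "\<dots> \<le> nrm A (star A x \<otimes>\<^bsub>A\<^esub> x)"
    using x by (intro sa) (simp_all add: A.star_mult A.star_star)
  also have "\<dots> = (nrm A x)\<^sup>2" using x by (rule A.nrm_cstar)
  finally show ?thesis by (rule power2_le_imp_le) (use x A.nrm_nonneg in simp)
qed

lemma norm_lim_hom:
  assumes "norm_lim A \<sigma> x" "\<And>n. \<sigma> n \<in> carrier A" "x \<in> carrier A"
  shows "norm_lim B (\<lambda>n. \<phi> (\<sigma> n)) (\<phi> x)"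
proof (rule B.norm_limI[OF _ assms(1)[unfolded norm_lim_def]])
  show "nrm B (\<phi> (\<sigma> n) \<ominus>\<^bsub>B\<^esub> \<phi> x) \<le> nrm A (\<sigma> n \<ominus>\<^bsub>A\<^esub> x)" for n
    using hom_contractive[of "\<sigma> n \<ominus>\<^bsub>A\<^esub> x"] assms by (simp add: hom_minus)
qed (use assms in auto)

lemma kernel_iff: "x \<in> a_kernel A B \<phi> \<longleftrightarrow> x \<in> carrier A \<and> \<phi> x = \<zero>\<^bsub>B\<^esub>"
  by (auto simp: a_kernel_def')

lemma kernel_mult_left: "\<lbrakk>x \<in> a_kernel A B \<phi>; a \<in> carrier A\<rbrakk> \<Longrightarrow> a \<otimes>\<^bsub>A\<^esub> x \<in> a_kernel A B \<phi>"
  and kernel_mult_right: "\<lbrakk>x \<in> a_kernel A B \<phi>; a \<in> carrier A\<rbrakk> \<Longrightarrow> x \<otimes>\<^bsub>A\<^esub> a \<in> a_kernel A B \<phi>"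
  by (auto simp: kernel_iff hom_mult)

lemma preimage_subalgebra:
  assumes "cstar_subalgebra S B" shows "cstar_subalgebra {x \<in> carrier A. \<phi> x \<in> S} A"
proof -
  have S: "norm_closed S B" "\<zero>\<^bsub>B\<^esub> \<in> S" "\<And>x y. x \<in> S \<Longrightarrow> y \<in> S \<Longrightarrow> x \<oplus>\<^bsub>B\<^esub> y \<in> S"
    "\<And>c x. x \<in> S \<Longrightarrow> c \<odot>\<^bsub>B\<^esub> x \<in> S" "\<And>x y. x \<in> S \<Longrightarrow> y \<in> S \<Longrightarrow> x \<otimes>\<^bsub>B\<^esub> y \<in> S" "\<And>x. x \<in> S \<Longrightarrow> star B x \<in> S"
    using assms by (auto simp: cstar_subalgebra_def B.submodule_iff)
  have "norm_closed {x \<in> carrier A. \<phi> x \<in> S} A"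
    unfolding norm_closed_iff
  proof (intro allI impI)
    fix \<sigma> x assume x: "x \<in> carrier A" and \<sigma>: "\<forall>n. \<sigma> n \<in> {x \<in> carrier A. \<phi> x \<in> S}" and lim: "norm_lim A \<sigma> x"
    have "norm_lim B (\<lambda>n. \<phi> (\<sigma> n)) (\<phi> x)" using norm_lim_hom[OF lim] \<sigma> x by blast
    then have "\<phi> x \<in> S" by (rule norm_closed_limD[OF S(1)]) (use \<sigma> x in auto)
    with x show "x \<in> {x \<in> carrier A. \<phi> x \<in> S}" by blast
  qed
  then show ?thesis
    unfolding cstar_subalgebra_def A.submodule_iff
    using S by (auto simp: hom_add hom_smult hom_mult hom_star)
qed

lemma kernel_subalgebra: "cstar_subalgebra (a_kernel A B \<phi>) A"
proof -
  have "cstar_subalgebra {\<zero>\<^bsub>B\<^esub>} B"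
    unfolding cstar_subalgebra_def B.submodule_iff norm_closed_iff
  proof (intro conjI allI impI)
    fix \<sigma> x assume x: "x \<in> carrier B" "\<forall>n::nat. \<sigma> n \<in> {\<zero>\<^bsub>B\<^esub>}" "norm_lim B \<sigma> x"
    then have "norm_lim B (\<lambda>n. \<zero>\<^bsub>B\<^esub>) x" by (simp add: norm_lim_def)
    then show "x \<in> {\<zero>\<^bsub>B\<^esub>}" using B.norm_lim_unique[OF _ B.norm_lim_const, of "\<zero>\<^bsub>B\<^esub>" x] x by simp
  qed auto
  from preimage_subalgebra[OF this] show ?thesis by (simp add: a_kernel_def')
qed

text \<open>Open mapping argument: if values on \<open>I\<close> can be reproduced up to half of their norm by
  elements of controlled norm, then repeating this for the error gives a geometric series in
  \<open>I\<close> that maps to any prescribed limit of values.\<close>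
lemma norm_closed_image:
  assumes I: "submodule I complex_ring A" "norm_closed I A"
    and lift: "\<And>x. x \<in> I \<Longrightarrow> \<exists>a\<in>I. nrm A a \<le> K * nrm B (\<phi> x) \<and>
      nrm B (\<phi> x \<ominus>\<^bsub>B\<^esub> \<phi> a) \<le> nrm B (\<phi> x) / 2" and K: "0 \<le> K"
  shows "norm_closed (\<phi> ` I) B"
proof -
  have IA: "I \<subseteq> carrier A" and I0: "\<zero>\<^bsub>A\<^esub> \<in> I" and Iadd: "\<And>x y. x \<in> I \<Longrightarrow> y \<in> I \<Longrightarrow> x \<oplus>\<^bsub>A\<^esub> y \<in> I"
    using I(1) by (auto simp: A.submodule_iff)
  define Cl where "Cl = {b \<in> carrier B. \<forall>e>0. \<exists>x\<in>I. nrm B (\<phi> x \<ominus>\<^bsub>B\<^esub> b) < e}"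
  have step: "\<exists>a\<in>I. nrm A a \<le> 2 * K * nrm B b \<and> nrm B (b \<ominus>\<^bsub>B\<^esub> \<phi> a) \<le> 7/8 * nrm B b \<and> b \<ominus>\<^bsub>B\<^esub> \<phi> a \<in> Cl"
    if b: "b \<in> Cl" for b
  proof -
    have bB: "b \<in> carrier B" using b by (simp add: Cl_def)
    have inCl: "b \<ominus>\<^bsub>B\<^esub> \<phi> a \<in> Cl" if a: "a \<in> I" for a
      unfolding Cl_def
    proof (intro CollectI conjI allI impI)
      show "b \<ominus>\<^bsub>B\<^esub> \<phi> a \<in> carrier B" using bB a IA by auto
      fix e :: real assume "e > 0"
      then obtain x where x: "x \<in> I" "nrm B (\<phi> x \<ominus>\<^bsub>B\<^esub> b) < e" using b by (auto simp: Cl_def)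
      have xa: "x \<in> carrier A" "a \<in> carrier A" using x a IA by auto
      have "\<phi> (x \<ominus>\<^bsub>A\<^esub> a) \<ominus>\<^bsub>B\<^esub> (b \<ominus>\<^bsub>B\<^esub> \<phi> a) = \<phi> x \<ominus>\<^bsub>B\<^esub> b"
      proof -
        have "\<phi> x \<in> carrier B" "\<phi> a \<in> carrier B" using xa by auto
        then have "(\<phi> x \<ominus>\<^bsub>B\<^esub> \<phi> a) \<ominus>\<^bsub>B\<^esub> (b \<ominus>\<^bsub>B\<^esub> \<phi> a) = \<phi> x \<ominus>\<^bsub>B\<^esub> b" using bB by algebra
        then show ?thesis using xa by (simp add: hom_minus)
      qed
      then show "\<exists>x\<in>I. nrm B (\<phi> x \<ominus>\<^bsub>B\<^esub> (b \<ominus>\<^bsub>B\<^esub> \<phi> a)) < e"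
        using x A.submodule_minus[OF I(1) x(1) a] by (intro bexI[of _ "x \<ominus>\<^bsub>A\<^esub> a"]) auto
    qed
    show ?thesis
    proof (cases "b = \<zero>\<^bsub>B\<^esub>")
      case True
      with inCl[OF I0] I0 show ?thesis by (intro bexI[of _ "\<zero>\<^bsub>A\<^esub>"]) (auto simp: a_minus_def)
    next
      case False
      then have pos: "0 < nrm B b" using B.nrm_eq_0[OF bB] B.nrm_nonneg[OF bB] by linarith
      then have "0 < nrm B b / 8" by simp
      moreover have "\<forall>e>0. \<exists>x\<in>I. nrm B (\<phi> x \<ominus>\<^bsub>B\<^esub> b) < e" using b by (simp add: Cl_def)
      ultimately obtain x where x: "x \<in> I" "nrm B (\<phi> x \<ominus>\<^bsub>B\<^esub> b) < nrm B b / 8" by blast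
      obtain a where a: "a \<in> I" "nrm A a \<le> K * nrm B (\<phi> x)" "nrm B (\<phi> x \<ominus>\<^bsub>B\<^esub> \<phi> a) \<le> nrm B (\<phi> x) / 2"
        using lift[OF x(1)] by blast
      have xa: "\<phi> x \<in> carrier B" "\<phi> a \<in> carrier B" using x a IA by auto
      have le: "nrm B (\<phi> x) \<le> 9/8 * nrm B b" using B.nrm_le_minus[OF xa(1) bB] x(2) by simp
      have "nrm A a \<le> K * (2 * nrm B b)"
        using a(2) mult_left_mono[OF le K] mult_left_mono[of "9/8 * nrm B b" "2 * nrm B b", OF _ K] pos
        by linarith
      moreover have "nrm B (b \<ominus>\<^bsub>B\<^esub> \<phi> a) \<le> 7/8 * nrm B b"
        using B.nrm_minus_triangle[OF bB xa] B.nrm_minus_commute[OF bB xa(1)] a(3) le x(2) pos by linarith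
      ultimately show ?thesis using a(1) inCl[OF a(1)] by (intro bexI[of _ a]) auto
    qed
  qed
  define f where "f b = (SOME a. a \<in> I \<and> nrm A a \<le> 2 * K * nrm B b \<and>
    nrm B (b \<ominus>\<^bsub>B\<^esub> \<phi> a) \<le> 7/8 * nrm B b \<and> b \<ominus>\<^bsub>B\<^esub> \<phi> a \<in> Cl)" for b
  have "f b \<in> I \<and> nrm A (f b) \<le> 2 * K * nrm B b \<and>
    nrm B (b \<ominus>\<^bsub>B\<^esub> \<phi> (f b)) \<le> 7/8 * nrm B b \<and> b \<ominus>\<^bsub>B\<^esub> \<phi> (f b) \<in> Cl" if "b \<in> Cl" for b
    unfolding f_def by (rule someI_ex) (use step[OF that] in blast)
  then have f: "\<And>b. b \<in> Cl \<Longrightarrow> f b \<in> I" "\<And>b. b \<in> Cl \<Longrightarrow> nrm A (f b) \<le> 2 * K * nrm B b"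
    "\<And>b. b \<in> Cl \<Longrightarrow> nrm B (b \<ominus>\<^bsub>B\<^esub> \<phi> (f b)) \<le> 7/8 * nrm B b" "\<And>b. b \<in> Cl \<Longrightarrow> b \<ominus>\<^bsub>B\<^esub> \<phi> (f b) \<in> Cl"
    by simp_all
  have "b \<in> \<phi> ` I" if b: "b \<in> Cl" for b
  proof -
    have bB: "b \<in> carrier B" using b by (simp add: Cl_def)
    define r where "r = rec_nat b (\<lambda>_ y. y \<ominus>\<^bsub>B\<^esub> \<phi> (f y))"
    have r: "r 0 = b" "\<And>n. r (Suc n) = r n \<ominus>\<^bsub>B\<^esub> \<phi> (f (r n))" by (simp_all add: r_def)
    have rCl: "r n \<in> Cl" for n by (induction n) (simp_all add: r b f)
    then have rB: "r n \<in> carrier B" for n by (auto simp: Cl_def)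
    have rnrm: "nrm B (r n) \<le> nrm B b * (7/8) ^ n" for n
    proof (induction n)
      case (Suc n) then show ?case using f(3)[OF rCl[of n]] by (simp add: r)
    qed (simp add: r)
    define s where "s = rec_nat \<zero>\<^bsub>A\<^esub> (\<lambda>n y. y \<oplus>\<^bsub>A\<^esub> f (r n))"
    have s: "s 0 = \<zero>\<^bsub>A\<^esub>" "\<And>n. s (Suc n) = s n \<oplus>\<^bsub>A\<^esub> f (r n)" by (simp_all add: s_def)
    have sI: "s n \<in> I" for n by (induction n) (simp_all add: s I0 Iadd f rCl)
    then have sA: "s n \<in> carrier A" for n using IA by blast
    have frA: "f (r n) \<in> carrier A" for n using f(1)[OF rCl] IA by blast
    have rs: "r n = b \<ominus>\<^bsub>B\<^esub> \<phi> (s n)" for n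
    proof (induction n)
      case (Suc n)
      have "\<phi> (s n) \<in> carrier B" "\<phi> (f (r n)) \<in> carrier B" using sA frA by auto
      then have "(b \<ominus>\<^bsub>B\<^esub> \<phi> (s n)) \<ominus>\<^bsub>B\<^esub> \<phi> (f (r n)) = b \<ominus>\<^bsub>B\<^esub> (\<phi> (s n) \<oplus>\<^bsub>B\<^esub> \<phi> (f (r n)))"
        using bB by algebra
      moreover have "r n \<ominus>\<^bsub>B\<^esub> \<phi> (f (r n)) = (b \<ominus>\<^bsub>B\<^esub> \<phi> (s n)) \<ominus>\<^bsub>B\<^esub> \<phi> (f (r n))"
        using arg_cong[OF Suc, of "\<lambda>z. z \<ominus>\<^bsub>B\<^esub> \<phi> (f (r n))"] .
      moreover have "\<phi> (s (Suc n)) = \<phi> (s n) \<oplus>\<^bsub>B\<^esub> \<phi> (f (r n))"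
        by (simp only: s hom_add[OF sA frA])
      ultimately show ?case by (simp only: r(2))
    qed (use bB in \<open>simp add: r s a_minus_def\<close>)
    have "\<exists>x\<in>carrier A. norm_lim A s x"
    proof (rule A.convergent_of_geometric[where r = "7/8"])
      show "nrm A (s (Suc n) \<ominus>\<^bsub>A\<^esub> s n) \<le> (2 * K * nrm B b) * (7/8) ^ n" for n
      proof -
        have "s (Suc n) \<ominus>\<^bsub>A\<^esub> s n = f (r n)" unfolding s using sA[of n] frA[of n] by algebra
        then show ?thesis
          using f(2)[OF rCl[of n]] mult_left_mono[OF rnrm[of n], of "2 * K"] K by (simp add: mult.assoc)
      qed
    qed (use sA in auto)
    then obtain x where x: "x \<in> carrier A" "norm_lim A s x" by blast
    have xI: "x \<in> I" by (rule norm_closed_limD[OF I(2) x(2,1) sI])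
    have "norm_lim B (\<lambda>n. \<phi> (s n)) (\<phi> x)" by (rule norm_lim_hom[OF x(2) sA x(1)])
    moreover have "norm_lim B (\<lambda>n. \<phi> (s n)) b"
    proof (rule B.norm_limI)
      show "nrm B (\<phi> (s n) \<ominus>\<^bsub>B\<^esub> b) \<le> nrm B b * (7/8) ^ n" for n
        using rnrm[of n] unfolding rs using B.nrm_minus_commute[of "\<phi> (s n)" b] sA bB by simp
      show "(\<lambda>n. nrm B b * (7/8) ^ n) \<longlonglongrightarrow> 0"
        by (intro tendsto_mult_right_zero LIMSEQ_realpow_zero) auto
    qed (use sA bB in auto)
    ultimately have "\<phi> x = b" by (rule B.norm_lim_unique) (use sA x bB in auto)
    with xI show ?thesis by blast
  qed
  note Cl_image = this
  show ?thesis unfolding norm_closed_iff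
  proof (intro allI impI)
    fix \<sigma> x assume x: "x \<in> carrier B" and \<sigma>: "\<forall>n. \<sigma> n \<in> \<phi> ` I" and lim: "norm_lim B \<sigma> x"
    have "\<exists>y\<in>I. nrm B (\<phi> y \<ominus>\<^bsub>B\<^esub> x) < e" if "e > 0" for e
    proof -
      obtain n where n: "nrm B (\<sigma> n \<ominus>\<^bsub>B\<^esub> x) < e" using B.norm_lim_ball[OF lim \<open>e > 0\<close>] by blast
      obtain y where "y \<in> I" "\<sigma> n = \<phi> y" using \<sigma> by blast
      with n show ?thesis by auto
    qed
    then have "x \<in> Cl" using x by (simp add: Cl_def)
    then show "x \<in> \<phi> ` I" by (rule Cl_image)
  qed
qed

text \<open>The truncation is \<open>a = x (1 + q\<^sup>2)\<^bsup>-1\<^esup>\<close> with \<open>q = x / 2r\<close>, an element of the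
  right ideal. It equals \<open>2r q (1 + q\<^sup>2)\<^bsup>-1\<^esup>\<close>, so its norm is at most \<open>r\<close> however large \<open>x\<close> is,
  while the error \<open>x - a = x q\<^sup>2 (1 + q\<^sup>2)\<^bsup>-1\<^esup>\<close> is small where the image of \<open>x\<close> is.\<close>
lemma hom_lift_self_adjoint:
  assumes I: "submodule I complex_ring A" "\<And>x a. x \<in> I \<Longrightarrow> a \<in> carrier A \<Longrightarrow> x \<otimes>\<^bsub>A\<^esub> a \<in> I"
    and x: "x \<in> I" "star A x = x" and r: "nrm B (\<phi> x) \<le> r" "0 < r"
  shows "\<exists>a\<in>I. nrm A a \<le> r \<and> nrm B (\<phi> x \<ominus>\<^bsub>B\<^esub> \<phi> a) \<le> r / 4"
proof -
  have xA: "x \<in> carrier A" using x I(1) by (auto simp: A.submodule_iff)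
  define q where "q = of_real (1 / (2 * r)) \<odot>\<^bsub>A\<^esub> x"
  have q: "q \<in> carrier A" "star A q = q" using xA x by (simp_all add: q_def A.star_smult)
  obtain p where p: "p \<in> carrier A" "star A p = p" "p \<otimes>\<^bsub>A\<^esub> q = q \<otimes>\<^bsub>A\<^esub> p"
    "p \<otimes>\<^bsub>A\<^esub> (\<one>\<^bsub>A\<^esub> \<oplus>\<^bsub>A\<^esub> q \<otimes>\<^bsub>A\<^esub> q) = \<one>\<^bsub>A\<^esub>"
    using A.one_plus_square_invertible[OF q] by blast
  note bd = A.nrm_self_adjoint_inverse_bounds[OF q p(1,2,3,4)]
  define a where "a = x \<otimes>\<^bsub>A\<^esub> p"
  have aI: "a \<in> I" using I(2) x p by (simp add: a_def)
  have aA: "a \<in> carrier A" using aI I(1) by (auto simp: A.submodule_iff)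
  have "a = of_real r \<odot>\<^bsub>A\<^esub> (2 \<odot>\<^bsub>A\<^esub> (q \<otimes>\<^bsub>A\<^esub> p))"
    using xA p r by (simp add: a_def q_def A.smult_mult_left)
  then have "nrm A a = r * nrm A (2 \<odot>\<^bsub>A\<^esub> (q \<otimes>\<^bsub>A\<^esub> p))"
    using q p r A.nrm_smult[of "2 \<odot>\<^bsub>A\<^esub> (q \<otimes>\<^bsub>A\<^esub> p)" "of_real r"] by simp
  then have a_le: "nrm A a \<le> r" using bd(2) r by simp
  have qp: "\<phi> q \<in> carrier B" "\<phi> p \<in> carrier B" "\<phi> x \<in> carrier B" using q p xA by auto
  have "x = x \<otimes>\<^bsub>A\<^esub> (p \<otimes>\<^bsub>A\<^esub> (\<one>\<^bsub>A\<^esub> \<oplus>\<^bsub>A\<^esub> q \<otimes>\<^bsub>A\<^esub> q))" using p(4) xA A.one_right by simp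
  also have "\<dots> = a \<oplus>\<^bsub>A\<^esub> x \<otimes>\<^bsub>A\<^esub> (q \<otimes>\<^bsub>A\<^esub> (q \<otimes>\<^bsub>A\<^esub> p))"
  proof -
    have "p \<otimes>\<^bsub>A\<^esub> (q \<otimes>\<^bsub>A\<^esub> q) = q \<otimes>\<^bsub>A\<^esub> (q \<otimes>\<^bsub>A\<^esub> p)"
      using A.commute_mult[OF q(1) q(1) p(1) p(3)[symmetric] p(3)[symmetric]] q p by (simp add: A.mult_assoc)
    then show ?thesis using xA p(1) q(1) by (simp add: a_def A.distr_right A.mult_assoc)
  qed
  finally have "\<phi> x = \<phi> (a \<oplus>\<^bsub>A\<^esub> x \<otimes>\<^bsub>A\<^esub> (q \<otimes>\<^bsub>A\<^esub> (q \<otimes>\<^bsub>A\<^esub> p)))"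
    by (rule arg_cong)
  also have "\<dots> = \<phi> a \<oplus>\<^bsub>B\<^esub> \<phi> x \<otimes>\<^bsub>B\<^esub> (\<phi> q \<otimes>\<^bsub>B\<^esub> (\<phi> q \<otimes>\<^bsub>B\<^esub> \<phi> p))"
    using aA xA q(1) p(1) by (simp only: hom_add hom_mult A.mult_closed)
  finally have "\<phi> x = \<phi> a \<oplus>\<^bsub>B\<^esub> \<phi> x \<otimes>\<^bsub>B\<^esub> (\<phi> q \<otimes>\<^bsub>B\<^esub> (\<phi> q \<otimes>\<^bsub>B\<^esub> \<phi> p))" .
  moreover have "(\<phi> a \<oplus>\<^bsub>B\<^esub> \<phi> x \<otimes>\<^bsub>B\<^esub> (\<phi> q \<otimes>\<^bsub>B\<^esub> (\<phi> q \<otimes>\<^bsub>B\<^esub> \<phi> p))) \<ominus>\<^bsub>B\<^esub> \<phi> a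
      = \<phi> x \<otimes>\<^bsub>B\<^esub> (\<phi> q \<otimes>\<^bsub>B\<^esub> (\<phi> q \<otimes>\<^bsub>B\<^esub> \<phi> p))"
  proof -
    have "\<phi> a \<in> carrier B" using aA by blast
    then show ?thesis using qp by algebra
  qed
  ultimately have eq: "\<phi> x \<ominus>\<^bsub>B\<^esub> \<phi> a = \<phi> x \<otimes>\<^bsub>B\<^esub> (\<phi> q \<otimes>\<^bsub>B\<^esub> (\<phi> q \<otimes>\<^bsub>B\<^esub> \<phi> p))" by simp
  have p1: "nrm B (\<phi> p) \<le> 1" using hom_contractive[OF p(1)] bd(1) by simp
  have q1: "nrm B (\<phi> q) \<le> 1/2"
    using xA r by (simp add: q_def hom_smult B.nrm_smult norm_divide norm_mult divide_simps)
  have "nrm B (\<phi> q \<otimes>\<^bsub>B\<^esub> \<phi> p) \<le> 1/2 * 1"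
    by (rule order_trans[OF B.nrm_mult[OF qp(1,2)] mult_mono[OF q1 p1]])
      (use B.nrm_nonneg[OF qp(2)] in auto)
  then have "nrm B (\<phi> q \<otimes>\<^bsub>B\<^esub> (\<phi> q \<otimes>\<^bsub>B\<^esub> \<phi> p)) \<le> 1/2 * (1/2)"
    using B.nrm_mult[of "\<phi> q" "\<phi> q \<otimes>\<^bsub>B\<^esub> \<phi> p"] qp q1 B.nrm_nonneg[of "\<phi> q \<otimes>\<^bsub>B\<^esub> \<phi> p"] B.nrm_nonneg[OF qp(1)]
      mult_mono[of "nrm B (\<phi> q)" "1/2" "nrm B (\<phi> q \<otimes>\<^bsub>B\<^esub> \<phi> p)" "1/2"] by simp
  then have "nrm B (\<phi> x \<ominus>\<^bsub>B\<^esub> \<phi> a) \<le> r * (1/4)"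
    unfolding eq using B.nrm_mult[of "\<phi> x" "\<phi> q \<otimes>\<^bsub>B\<^esub> (\<phi> q \<otimes>\<^bsub>B\<^esub> \<phi> p)"] qp r
      B.nrm_nonneg[of "\<phi> q \<otimes>\<^bsub>B\<^esub> (\<phi> q \<otimes>\<^bsub>B\<^esub> \<phi> p)"]
      mult_mono[of "nrm B (\<phi> x)" r "nrm B (\<phi> q \<otimes>\<^bsub>B\<^esub> (\<phi> q \<otimes>\<^bsub>B\<^esub> \<phi> p))" "1/4"] by simp
  with aI a_le show ?thesis by auto
qed

text \<open>Ideals enter because the exact sequences restrict the homomorphisms to kernels.
  The real and the imaginary part of an element are approximated separately.\<close>
lemma norm_closed_image_ideal:
  assumes I: "cstar_subalgebra I A" "\<And>x a. x \<in> I \<Longrightarrow> a \<in> carrier A \<Longrightarrow> x \<otimes>\<^bsub>A\<^esub> a \<in> I"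
  shows "norm_closed (\<phi> ` I) B"
proof (rule norm_closed_image[where K = 2])
  show sub: "submodule I complex_ring A" and "norm_closed I A"
    using I(1) by (auto simp: cstar_subalgebra_def)
  have Iadd: "\<And>x y. x \<in> I \<Longrightarrow> y \<in> I \<Longrightarrow> x \<oplus>\<^bsub>A\<^esub> y \<in> I" and Ism: "\<And>c x. x \<in> I \<Longrightarrow> c \<odot>\<^bsub>A\<^esub> x \<in> I"
    and Ist: "\<And>x. x \<in> I \<Longrightarrow> star A x \<in> I" and I0: "\<zero>\<^bsub>A\<^esub> \<in> I" and IA: "I \<subseteq> carrier A"
    using I(1) by (auto simp: cstar_subalgebra_def A.submodule_iff)
  fix x assume x: "x \<in> I"
  have xA: "x \<in> carrier A" using x IA by blast
  let ?r = "nrm B (\<phi> x)"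
  show "\<exists>a\<in>I. nrm A a \<le> 2 * nrm B (\<phi> x) \<and> nrm B (\<phi> x \<ominus>\<^bsub>B\<^esub> \<phi> a) \<le> nrm B (\<phi> x) / 2"
  proof (cases "?r = 0")
    case True
    then show ?thesis using I0 xA by (intro bexI[of _ "\<zero>\<^bsub>A\<^esub>"]) (auto simp: a_minus_def)
  next
    case False
    then have r: "0 < ?r" using B.nrm_nonneg xA by (simp add: order.strict_iff_order)
    define x1 where "x1 = (1/2) \<odot>\<^bsub>A\<^esub> (x \<oplus>\<^bsub>A\<^esub> star A x)"
    define x2 where "x2 = (- \<i>/2) \<odot>\<^bsub>A\<^esub> (x \<ominus>\<^bsub>A\<^esub> star A x)"
    have x12: "x1 \<in> I" "x2 \<in> I"
      using x Iadd Ism Ist A.submodule_minus[OF sub] by (auto simp: x1_def x2_def)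
    have sa1: "star A x1 = x1" using xA by (simp add: x1_def A.star_smult A.star_add A.star_star A.M.a_comm)
    have sa2: "star A x2 = x2"
    proof -
      have "star A x2 = (\<i>/2) \<odot>\<^bsub>A\<^esub> (star A x \<ominus>\<^bsub>A\<^esub> x)"
        using xA by (simp add: x2_def A.star_smult A.star_minus A.star_star)
      also have "star A x \<ominus>\<^bsub>A\<^esub> x = (-1) \<odot>\<^bsub>A\<^esub> (x \<ominus>\<^bsub>A\<^esub> star A x)"
      proof -
        have "star A x \<in> carrier A" using xA by blast
        then have "star A x \<ominus>\<^bsub>A\<^esub> x = \<ominus>\<^bsub>A\<^esub> (x \<ominus>\<^bsub>A\<^esub> star A x)" using xA by algebra
        then show ?thesis using xA by (simp add: A.uminus_smult)
      qed
      also have "(\<i>/2) \<odot>\<^bsub>A\<^esub> \<dots> = x2" using xA by (simp add: x2_def)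
      finally show ?thesis .
    qed
    have x_eq: "x = x1 \<oplus>\<^bsub>A\<^esub> \<i> \<odot>\<^bsub>A\<^esub> x2"
    proof -
      have xs: "star A x \<in> carrier A" using xA by blast
      have "x1 \<oplus>\<^bsub>A\<^esub> \<i> \<odot>\<^bsub>A\<^esub> x2 = (1/2) \<odot>\<^bsub>A\<^esub> ((x \<oplus>\<^bsub>A\<^esub> star A x) \<oplus>\<^bsub>A\<^esub> (x \<ominus>\<^bsub>A\<^esub> star A x))"
        using xA xs by (simp add: x1_def x2_def A.smult_add_right)
      also have "(x \<oplus>\<^bsub>A\<^esub> star A x) \<oplus>\<^bsub>A\<^esub> (x \<ominus>\<^bsub>A\<^esub> star A x) = x \<oplus>\<^bsub>A\<^esub> x" using xA xs by algebra
      finally show ?thesis using xA by (simp add: A.smult_double[symmetric])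
    qed
    have ps: "nrm B (star B (\<phi> x)) = ?r" using xA by simp
    have "nrm B (\<phi> x1) \<le> ?r"
      using xA B.nrm_triangle[of "\<phi> x" "star B (\<phi> x)"] ps
      by (simp add: x1_def hom_smult hom_add hom_star B.nrm_smult)
    from hom_lift_self_adjoint[OF sub I(2) x12(1) sa1 this r]
    obtain a1 where a1: "a1 \<in> I" "nrm A a1 \<le> ?r" "nrm B (\<phi> x1 \<ominus>\<^bsub>B\<^esub> \<phi> a1) \<le> ?r / 4" by blast
    have "nrm B (\<phi> x2) \<le> ?r"
      using xA B.nrm_minus_le[of "\<phi> x" "star B (\<phi> x)"] ps
      by (simp add: x2_def hom_smult hom_minus hom_star B.nrm_smult norm_divide)
    from hom_lift_self_adjoint[OF sub I(2) x12(2) sa2 this r]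
    obtain a2 where a2: "a2 \<in> I" "nrm A a2 \<le> ?r" "nrm B (\<phi> x2 \<ominus>\<^bsub>B\<^esub> \<phi> a2) \<le> ?r / 4" by blast
    define a where "a = a1 \<oplus>\<^bsub>A\<^esub> \<i> \<odot>\<^bsub>A\<^esub> a2"
    have A': "x1 \<in> carrier A" "x2 \<in> carrier A" "a1 \<in> carrier A" "a2 \<in> carrier A"
      using IA x12 a1 a2 by auto
    have "a \<in> I" using a1 a2 Iadd Ism by (simp add: a_def)
    moreover have "nrm A a \<le> 2 * ?r"
      using A.nrm_triangle[of a1 "\<i> \<odot>\<^bsub>A\<^esub> a2"] A' a1 a2 by (simp add: a_def A.nrm_smult)
    moreover have "nrm B (\<phi> x \<ominus>\<^bsub>B\<^esub> \<phi> a) \<le> ?r / 2"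
    proof -
      have "\<phi> x \<ominus>\<^bsub>B\<^esub> \<phi> a = (\<phi> x1 \<oplus>\<^bsub>B\<^esub> \<i> \<odot>\<^bsub>B\<^esub> \<phi> x2) \<ominus>\<^bsub>B\<^esub> (\<phi> a1 \<oplus>\<^bsub>B\<^esub> \<i> \<odot>\<^bsub>B\<^esub> \<phi> a2)"
        unfolding a_def using A' by (subst x_eq) (simp add: hom_add hom_smult)
      also have "\<dots> = (\<phi> x1 \<ominus>\<^bsub>B\<^esub> \<phi> a1) \<oplus>\<^bsub>B\<^esub> (\<i> \<odot>\<^bsub>B\<^esub> \<phi> x2 \<ominus>\<^bsub>B\<^esub> \<i> \<odot>\<^bsub>B\<^esub> \<phi> a2)"
      proof -
        have "\<phi> x1 \<in> carrier B" "\<i> \<odot>\<^bsub>B\<^esub> \<phi> x2 \<in> carrier B" "\<phi> a1 \<in> carrier B" "\<i> \<odot>\<^bsub>B\<^esub> \<phi> a2 \<in> carrier B"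
          using A' by auto
        then show ?thesis by algebra
      qed
      also have "\<dots> = (\<phi> x1 \<ominus>\<^bsub>B\<^esub> \<phi> a1) \<oplus>\<^bsub>B\<^esub> \<i> \<odot>\<^bsub>B\<^esub> (\<phi> x2 \<ominus>\<^bsub>B\<^esub> \<phi> a2)"
        using A' by (simp add: B.smult_minus)
      finally show ?thesis
        using B.nrm_triangle[of "\<phi> x1 \<ominus>\<^bsub>B\<^esub> \<phi> a1" "\<i> \<odot>\<^bsub>B\<^esub> (\<phi> x2 \<ominus>\<^bsub>B\<^esub> \<phi> a2)"] A' a1 a2
        by (simp add: B.nrm_smult)
    qed
    ultimately show ?thesis by blast
  qed
qed simp

end

section \<open>Square-summable functions\<close>

text \<open>Membership in \<open>\<ell>\<^sup>2\<close> and norm bounds are tested on finite sets, where the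
  inequalities for \<open>L2_set\<close> apply.\<close>
lemma ell2_bounded:
  assumes "\<And>x. x \<notin> X \<Longrightarrow> f x = 0" and K: "\<And>F. finite F \<Longrightarrow> F \<subseteq> X \<Longrightarrow> L2_set (\<lambda>x. cmod (f x)) F \<le> K"
  shows "f \<in> ell2 X" "ell2_norm X f \<le> K"
proof -
  have K0: "0 \<le> K" using K[of "{}"] by simp
  have b: "(\<Sum>x\<in>F. (cmod (f x))\<^sup>2) \<le> K\<^sup>2" if "finite F" "F \<subseteq> X" for F
    using K[OF that] K0 unfolding L2_set_def by (simp add: real_sqrt_le_iff' sqrt_le_D)
  have s: "(\<lambda>x. (cmod (f x))\<^sup>2) summable_on X"
    by (rule nonneg_bdd_above_summable_on) (auto intro!: bdd_aboveI[of _ "K\<^sup>2"] b)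
  then show "f \<in> ell2 X" using assms(1) by (simp add: ell2_def)
  have "(\<Sum>\<^sub>\<infinity>x\<in>X. (cmod (f x))\<^sup>2) \<le> K\<^sup>2" by (rule infsum_le_finite_sums[OF s b])
  then show "ell2_norm X f \<le> K" unfolding ell2_norm_def using K0 by (simp add: real_le_lsqrt)
qed

lemma L2_set_le_ell2_norm:
  assumes "f \<in> ell2 X" "finite F" "F \<subseteq> X"
  shows "L2_set (\<lambda>x. cmod (f x)) F \<le> ell2_norm X f"
  unfolding L2_set_def ell2_norm_def
  by (intro real_sqrt_le_mono finite_sum_le_infsum) (use assms in \<open>auto simp: ell2_def\<close>)

lemma ell2_norm_nonneg: "0 \<le> ell2_norm X f"
  unfolding ell2_norm_def by (simp add: infsum_nonneg)

lemma ell2_vanish: "f \<in> ell2 X \<Longrightarrow> x \<notin> X \<Longrightarrow> f x = 0"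
  by (simp add: ell2_def)

lemma cmod_le_ell2_norm:
  assumes "f \<in> ell2 X" shows "cmod (f x) \<le> ell2_norm X f"
proof (cases "x \<in> X")
  case True then show ?thesis using L2_set_le_ell2_norm[OF assms, of "{x}"] by simp
next
  case False then show ?thesis using ell2_vanish[OF assms] ell2_norm_nonneg by simp
qed

lemma ell2_norm_eq_0: "f \<in> ell2 X \<Longrightarrow> ell2_norm X f = 0 \<Longrightarrow> f = (\<lambda>x. 0)"
  using cmod_le_ell2_norm[of f X] by (auto simp: fun_eq_iff)

lemma ell2_power2_norm: "(ell2_norm X f)\<^sup>2 = (\<Sum>\<^sub>\<infinity>x\<in>X. (cmod (f x))\<^sup>2)"
  unfolding ell2_norm_def by (simp add: infsum_nonneg)

lemma ell2_add:
  assumes "f \<in> ell2 X" "g \<in> ell2 X"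
  shows "(\<lambda>x. f x + g x) \<in> ell2 X" "ell2_norm X (\<lambda>x. f x + g x) \<le> ell2_norm X f + ell2_norm X g"
proof -
  have "L2_set (\<lambda>x. cmod (f x + g x)) F \<le> ell2_norm X f + ell2_norm X g" if "finite F" "F \<subseteq> X" for F
  proof -
    have "L2_set (\<lambda>x. cmod (f x + g x)) F \<le> L2_set (\<lambda>x. cmod (f x) + cmod (g x)) F"
      by (intro L2_set_mono norm_triangle_ineq) auto
    also have "\<dots> \<le> L2_set (\<lambda>x. cmod (f x)) F + L2_set (\<lambda>x. cmod (g x)) F"
      by (rule L2_set_triangle_ineq)
    also have "\<dots> \<le> ell2_norm X f + ell2_norm X g"
      by (intro add_mono L2_set_le_ell2_norm assms that)
    finally show ?thesis .
  qed
  note * = ell2_bounded[of X "\<lambda>x. f x + g x", OF _ this]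
  show "(\<lambda>x. f x + g x) \<in> ell2 X" "ell2_norm X (\<lambda>x. f x + g x) \<le> ell2_norm X f + ell2_norm X g"
    using * assms ell2_vanish[of f X] ell2_vanish[of g X] by auto
qed

lemma ell2_scale:
  assumes "f \<in> ell2 X"
  shows "(\<lambda>x. c * f x) \<in> ell2 X" "ell2_norm X (\<lambda>x. c * f x) = cmod c * ell2_norm X f"
proof -
  show "(\<lambda>x. c * f x) \<in> ell2 X" using assms
    by (auto simp: ell2_def norm_mult power_mult_distrib intro: summable_on_cmult_right)
  show "ell2_norm X (\<lambda>x. c * f x) = cmod c * ell2_norm X f"
    by (simp add: ell2_norm_def norm_mult power_mult_distrib infsum_cmult_right' real_sqrt_mult)
qed

lemma ell2_zero [simp]: "(\<lambda>x. 0) \<in> ell2 X" "ell2_norm X (\<lambda>x. 0) = 0"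
  by (simp_all add: ell2_def ell2_norm_def)

lemma ell2_diff:
  assumes "f \<in> ell2 X" "g \<in> ell2 X" shows "(\<lambda>x. f x - g x) \<in> ell2 X"
  using ell2_add(1)[OF assms(1) ell2_scale(1)[OF assms(2), of "-1"]] by simp

lemma ell2_norm_diff_le:
  assumes "f \<in> ell2 X" "g \<in> ell2 X"
  shows "ell2_norm X f \<le> ell2_norm X g + ell2_norm X (\<lambda>x. f x - g x)"
  using ell2_add(2)[OF assms(2) ell2_diff[OF assms]] by simp

lemma ell2_finite_support:
  assumes "finite F" "F \<subseteq> X" "\<And>x. x \<notin> F \<Longrightarrow> f x = 0"
  shows "f \<in> ell2 X" "ell2_norm X f = L2_set (\<lambda>x. cmod (f x)) F"
proof -
  have "L2_set (\<lambda>x. cmod (f x)) G \<le> L2_set (\<lambda>x. cmod (f x)) F" if "finite G" "G \<subseteq> X" for G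
  proof -
    have "(\<Sum>x\<in>G. (cmod (f x))\<^sup>2) = (\<Sum>x\<in>G \<inter> F. (cmod (f x))\<^sup>2)"
      by (rule sum.mono_neutral_right) (use that assms in auto)
    also have "\<dots> \<le> (\<Sum>x\<in>F. (cmod (f x))\<^sup>2)" by (rule sum_mono2) (use assms in auto)
    finally show ?thesis by (simp add: L2_set_def)
  qed
  note * = ell2_bounded[of X f, OF _ this]
  show 1: "f \<in> ell2 X" by (rule *) (use assms in auto)
  have "ell2_norm X f \<le> L2_set (\<lambda>x. cmod (f x)) F" by (rule *) (use assms in auto)
  then show "ell2_norm X f = L2_set (\<lambda>x. cmod (f x)) F"
    using L2_set_le_ell2_norm[OF 1 assms(1,2)] by simp
qed

lemma point_mass_ell2 [simp]:
  assumes "x \<in> X" shows "point_mass x \<in> ell2 X" "ell2_norm X (point_mass x) = 1"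
  using ell2_finite_support[of "{x}" X "point_mass x"] assms by (auto simp: point_mass_def)

definition cut_off :: "'x set \<Rightarrow> ('x \<Rightarrow> complex) \<Rightarrow> 'x \<Rightarrow> complex" where
  "cut_off F f = (\<lambda>x. if x \<in> F then f x else 0)"

lemma cut_off_ell2:
  assumes "finite F" "F \<subseteq> X"
  shows "cut_off F f \<in> ell2 X" "ell2_norm X (cut_off F f) = L2_set (\<lambda>x. cmod (f x)) F"
proof -
  have "L2_set (\<lambda>x. cmod (cut_off F f x)) F = L2_set (\<lambda>x. cmod (f x)) F"
    by (intro L2_set_cong) (auto simp: cut_off_def)
  then show "cut_off F f \<in> ell2 X" "ell2_norm X (cut_off F f) = L2_set (\<lambda>x. cmod (f x)) F"
    using ell2_finite_support[OF assms, of "cut_off F f"] by (auto simp: cut_off_def)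
qed

lemma cut_off_approx:
  assumes f: "f \<in> ell2 X" and e: "0 < e"
  shows "\<exists>F. finite F \<and> F \<subseteq> X \<and> ell2_norm X (\<lambda>x. f x - cut_off F f x) < e"
proof -
  let ?h = "\<lambda>x. (cmod (f x))\<^sup>2"
  have s: "?h summable_on X" using f by (simp add: ell2_def)
  have "(?h has_sum infsum ?h X) X" using s by (rule has_sum_infsum)
  then have "(sum ?h \<longlongrightarrow> infsum ?h X) (finite_subsets_at_top X)" by (simp add: has_sum_def)
  then have "eventually (\<lambda>F. dist (sum ?h F) (infsum ?h X) < (e/2)\<^sup>2) (finite_subsets_at_top X)"
    by (rule tendstoD) (use e in simp)
  then obtain F where F: "finite F" "F \<subseteq> X" and d: "dist (sum ?h F) (infsum ?h X) < (e/2)\<^sup>2"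
    unfolding eventually_finite_subsets_at_top by blast
  have "L2_set (\<lambda>x. cmod (f x - cut_off F f x)) G \<le> e / 2" if G: "finite G" "G \<subseteq> X" for G
  proof -
    have "(\<Sum>x\<in>G. (cmod (f x - cut_off F f x))\<^sup>2) = (\<Sum>x\<in>G - F. ?h x)"
    proof -
      have "(\<Sum>x\<in>G - F. (cmod (f x - cut_off F f x))\<^sup>2) = (\<Sum>x\<in>G - F. ?h x)"
        by (rule sum.cong) (auto simp: cut_off_def)
      moreover have "(\<Sum>x\<in>G. (cmod (f x - cut_off F f x))\<^sup>2) = (\<Sum>x\<in>G - F. (cmod (f x - cut_off F f x))\<^sup>2)"
        by (rule sum.mono_neutral_right) (use G in \<open>auto simp: cut_off_def\<close>)
      ultimately show ?thesis by simp
    qed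
    also have "\<dots> = sum ?h (F \<union> (G - F)) - sum ?h F"
      by (subst sum.union_disjoint) (use F G in auto)
    also have "\<dots> \<le> infsum ?h X - sum ?h F"
      using finite_sum_le_infsum[OF s, of "F \<union> (G - F)"] F G by auto
    also have "\<dots> \<le> (e/2)\<^sup>2" using d by (simp add: dist_real_def)
    finally show ?thesis unfolding L2_set_def using e by (intro real_le_lsqrt) auto
  qed
  note * = ell2_bounded(2)[of X "\<lambda>x. f x - cut_off F f x", OF _ this]
  have "ell2_norm X (\<lambda>x. f x - cut_off F f x) \<le> e / 2"
    by (rule *) (use f F ell2_vanish in \<open>auto simp: cut_off_def\<close>)
  then show ?thesis using F e by (intro exI[of _ F]) auto
qed

lemma cut_off_insert:
  "x \<notin> F \<Longrightarrow> cut_off (insert x F) f = (\<lambda>y. cut_off F f y + f x * point_mass x y)"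
  by (auto simp: cut_off_def point_mass_def fun_eq_iff)

lemma ell2_inner_summable:
  assumes "f \<in> ell2 X" "g \<in> ell2 X"
  shows "(\<lambda>x. cmod (f x * cnj (g x))) summable_on X"
    and "cmod (ell2_inner X f g) \<le> ell2_norm X f * ell2_norm X g"
proof -
  have b: "(\<Sum>x\<in>F. cmod (f x * cnj (g x))) \<le> ell2_norm X f * ell2_norm X g"
    if "finite F" "F \<subseteq> X" for F
  proof -
    have "(\<Sum>x\<in>F. cmod (f x * cnj (g x))) = (\<Sum>x\<in>F. \<bar>cmod (f x)\<bar> * \<bar>cmod (g x)\<bar>)"
      by (simp add: norm_mult)
    also have "\<dots> \<le> L2_set (\<lambda>x. cmod (f x)) F * L2_set (\<lambda>x. cmod (g x)) F"
      by (rule L2_set_mult_ineq)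
    also have "\<dots> \<le> ell2_norm X f * ell2_norm X g"
      by (intro mult_mono L2_set_le_ell2_norm assms that L2_set_nonneg ell2_norm_nonneg)
    finally show ?thesis .
  qed
  show s: "(\<lambda>x. cmod (f x * cnj (g x))) summable_on X"
    by (rule nonneg_bdd_above_summable_on) (auto intro!: bdd_aboveI[of _ "ell2_norm X f * ell2_norm X g"] b)
  have "cmod (ell2_inner X f g) \<le> (\<Sum>\<^sub>\<infinity>x\<in>X. cmod (f x * cnj (g x)))"
    unfolding ell2_inner_def by (rule norm_infsum_bound[OF s])
  also have "\<dots> \<le> ell2_norm X f * ell2_norm X g" by (rule infsum_le_finite_sums[OF s b])
  finally show "cmod (ell2_inner X f g) \<le> ell2_norm X f * ell2_norm X g" .
qed

lemma ell2_inner_cnj: "ell2_inner X g f = cnj (ell2_inner X f g)"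
  unfolding ell2_inner_def by (subst infsum_cnj[symmetric]) (simp add: mult.commute)

lemma ell2_inner_add:
  assumes "f \<in> ell2 X" "g \<in> ell2 X" "h \<in> ell2 X"
  shows "ell2_inner X (\<lambda>x. f x + g x) h = ell2_inner X f h + ell2_inner X g h"
  unfolding ell2_inner_def distrib_right
  by (rule infsum_add; rule abs_summable_summable, rule ell2_inner_summable; rule assms)

lemma ell2_inner_scale: "ell2_inner X (\<lambda>x. c * f x) h = c * ell2_inner X f h"
  unfolding ell2_inner_def by (simp add: mult.assoc infsum_cmult_right')

lemma ell2_inner_diff:
  assumes "f \<in> ell2 X" "g \<in> ell2 X" "h \<in> ell2 X"
  shows "ell2_inner X (\<lambda>x. f x - g x) h = ell2_inner X f h - ell2_inner X g h"
  using ell2_inner_add[OF assms(1) ell2_scale(1)[OF assms(2)] assms(3), of "-1"]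
    ell2_inner_scale[of X "-1" g h] by simp

lemma ell2_inner_self:
  assumes "f \<in> ell2 X" shows "ell2_inner X f f = of_real ((ell2_norm X f)\<^sup>2)"
proof -
  have "((\<lambda>x. (cmod (f x))\<^sup>2) has_sum (ell2_norm X f)\<^sup>2) X"
    unfolding ell2_power2_norm using assms by (intro has_sum_infsum) (simp add: ell2_def)
  then have "((\<lambda>x. complex_of_real ((cmod (f x))\<^sup>2)) has_sum of_real ((ell2_norm X f)\<^sup>2)) X"
    by (simp only: has_sum_of_real_iff)
  then show ?thesis unfolding ell2_inner_def complex_norm_square by (rule infsumI)
qed

lemma ell2_inner_point_mass:
  assumes "x \<in> X" shows "ell2_inner X f (point_mass x) = f x"
proof -
  have "ell2_inner X f (point_mass x) = (\<Sum>\<^sub>\<infinity>y\<in>{x}. f y * cnj (point_mass x y))"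
    unfolding ell2_inner_def by (rule infsum_cong_neutral) (use assms in \<open>auto simp: point_mass_def\<close>)
  then show ?thesis by (simp add: point_mass_def)
qed

lemma ell2_inner_point_mass_left:
  assumes "x \<in> X" shows "ell2_inner X (point_mass x) f = cnj (f x)"
  using ell2_inner_point_mass[OF assms] ell2_inner_cnj[of X "point_mass x" f] by simp

section \<open>Bounded operators and adjoints\<close>

lemma bounded_operators_D:
  assumes "T \<in> bounded_operators X"
  shows "f \<notin> ell2 X \<Longrightarrow> T f = (\<lambda>x. 0)"
    and "f \<in> ell2 X \<Longrightarrow> T f \<in> ell2 X"
    and "f \<in> ell2 X \<Longrightarrow> g \<in> ell2 X \<Longrightarrow> T (\<lambda>x. f x + g x) = (\<lambda>x. T f x + T g x)"
    and "f \<in> ell2 X \<Longrightarrow> T (\<lambda>x. c * f x) = (\<lambda>x. c * T f x)"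
    and "\<exists>K. \<forall>f\<in>ell2 X. ell2_norm X (T f) \<le> K * ell2_norm X f"
  using assms by (simp_all add: bounded_operators_def)

lemma bounded_operators_I:
  assumes "\<And>f. f \<notin> ell2 X \<Longrightarrow> T f = (\<lambda>x. 0)"
    and "\<And>f. f \<in> ell2 X \<Longrightarrow> T f \<in> ell2 X"
    and "\<And>f g. f \<in> ell2 X \<Longrightarrow> g \<in> ell2 X \<Longrightarrow> T (\<lambda>x. f x + g x) = (\<lambda>x. T f x + T g x)"
    and "\<And>c f. f \<in> ell2 X \<Longrightarrow> T (\<lambda>x. c * f x) = (\<lambda>x. c * T f x)"
    and "\<And>f. f \<in> ell2 X \<Longrightarrow> ell2_norm X (T f) \<le> K * ell2_norm X f"
  shows "T \<in> bounded_operators X"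
  using assms unfolding bounded_operators_def by blast

lemma bounded_operators_zero_arg: "T \<in> bounded_operators X \<Longrightarrow> T (\<lambda>x. 0) = (\<lambda>x. 0)"
  using bounded_operators_D(4)[of T X "\<lambda>x. 0" 0] by simp

lemma bounded_operators_in_ell2: "T \<in> bounded_operators X \<Longrightarrow> T f \<in> ell2 X"
  using bounded_operators_D(1,2)[of T X f] by (cases "f \<in> ell2 X") auto

lemma bounded_operators_diff:
  assumes "T \<in> bounded_operators X" "f \<in> ell2 X" "g \<in> ell2 X"
  shows "T (\<lambda>x. f x - g x) = (\<lambda>x. T f x - T g x)"
  using bounded_operators_D(3)[OF assms(1,2) ell2_scale(1)[OF assms(3), of "-1"]]
    bounded_operators_D(4)[OF assms(1,3), of "-1"] by simp

lemma operator_cstar_simps [simp]: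
  "carrier (operator_cstar X) = bounded_operators X"
  "mult (operator_cstar X) = (\<lambda>S T. S \<circ> T)"
  "one (operator_cstar X) = (\<lambda>f. if f \<in> ell2 X then f else (\<lambda>x. 0))"
  "zero (operator_cstar X) = (\<lambda>f x. 0)"
  "add (operator_cstar X) = (\<lambda>S T f x. S f x + T f x)"
  "smult (operator_cstar X) = (\<lambda>c T f x. c * T f x)"
  by (simp_all add: operator_cstar_def)

lemma operator_norm:
  assumes T: "T \<in> bounded_operators X"
  shows operator_norm_bound: "f \<in> ell2 X \<Longrightarrow> ell2_norm X (T f) \<le> nrm (operator_cstar X) T * ell2_norm X f"
    and operator_norm_nonneg: "0 \<le> nrm (operator_cstar X) T"
    and operator_norm_le: "0 \<le> K \<Longrightarrow> (\<And>f. f \<in> ell2 X \<Longrightarrow> ell2_norm X (T f) \<le> K * ell2_norm X f) \<Longrightarrow>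
      nrm (operator_cstar X) T \<le> K"
proof -
  let ?U = "{f \<in> ell2 X. ell2_norm X f \<le> 1}"
  have nT: "nrm (operator_cstar X) T = (SUP f\<in>?U. ell2_norm X (T f))"
    by (simp add: operator_cstar_def)
  obtain K0 where K0: "\<And>f. f \<in> ell2 X \<Longrightarrow> ell2_norm X (T f) \<le> K0 * ell2_norm X f"
    using bounded_operators_D(5)[OF T] by blast
  have bdd: "bdd_above ((\<lambda>f. ell2_norm X (T f)) ` ?U)"
  proof (rule bdd_aboveI2)
    fix f assume "f \<in> ?U"
    then have f: "f \<in> ell2 X" "ell2_norm X f \<le> 1" by auto
    have "K0 * ell2_norm X f \<le> max K0 0 * 1"
      using f ell2_norm_nonneg[of X f] by (intro mult_mono) auto
    then show "ell2_norm X (T f) \<le> max K0 0" using K0[OF f(1)] by simp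
  qed
  have z: "(\<lambda>x. 0) \<in> ?U" by simp
  show nonneg: "0 \<le> nrm (operator_cstar X) T"
    unfolding nT using cSUP_upper[OF z bdd] bounded_operators_zero_arg[OF T] by simp
  show "nrm (operator_cstar X) T \<le> K"
    if K: "0 \<le> K" "\<And>f. f \<in> ell2 X \<Longrightarrow> ell2_norm X (T f) \<le> K * ell2_norm X f"
    unfolding nT
  proof (rule cSUP_least)
    show "?U \<noteq> {}" using z by blast
    fix f assume f: "f \<in> ?U"
    then have "K * ell2_norm X f \<le> K * 1" using K(1) by (intro mult_left_mono) auto
    then show "ell2_norm X (T f) \<le> K" using K(2)[of f] f by simp
  qed
  show "ell2_norm X (T f) \<le> nrm (operator_cstar X) T * ell2_norm X f" if f: "f \<in> ell2 X"
  proof (cases "ell2_norm X f = 0")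
    case True
    then have "f = (\<lambda>x. 0)" using ell2_norm_eq_0[OF f] by simp
    then show ?thesis using True bounded_operators_zero_arg[OF T] by simp
  next
    case False
    then have pos: "0 < ell2_norm X f" using ell2_norm_nonneg[of X f] by simp
    define c where "c = complex_of_real (1 / ell2_norm X f)"
    have cn: "cmod c = 1 / ell2_norm X f" using pos by (simp add: c_def norm_divide)
    have "(\<lambda>x. c * f x) \<in> ?U" using ell2_scale[OF f, of c] cn pos by simp
    from cSUP_upper[OF this bdd] have "ell2_norm X (\<lambda>x. c * T f x) \<le> nrm (operator_cstar X) T"
      unfolding nT bounded_operators_D(4)[OF T f] .
    then have "ell2_norm X (T f) / ell2_norm X f \<le> nrm (operator_cstar X) T"
      using ell2_scale(2)[OF bounded_operators_D(2)[OF T f], of c] cn by simp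
    then show ?thesis using pos by (simp add: divide_le_eq)
  qed
qed

lemma bounded_operators_add:
  assumes S: "S \<in> bounded_operators X" and T: "T \<in> bounded_operators X"
  shows "(\<lambda>f x. S f x + T f x) \<in> bounded_operators X"
    and "nrm (operator_cstar X) (\<lambda>f x. S f x + T f x) \<le> nrm (operator_cstar X) S + nrm (operator_cstar X) T"
proof -
  have b: "ell2_norm X (\<lambda>x. S f x + T f x) \<le> (nrm (operator_cstar X) S + nrm (operator_cstar X) T) * ell2_norm X f"
    if f: "f \<in> ell2 X" for f
    using ell2_add(2)[OF bounded_operators_D(2)[OF S f] bounded_operators_D(2)[OF T f]]
      operator_norm_bound[OF S f] operator_norm_bound[OF T f] by (simp add: distrib_right)
  show B: "(\<lambda>f x. S f x + T f x) \<in> bounded_operators X"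
    by (rule bounded_operators_I[OF _ _ _ _ b])
       (simp_all add: bounded_operators_D[OF S] bounded_operators_D[OF T] ell2_add algebra_simps)
  show "nrm (operator_cstar X) (\<lambda>f x. S f x + T f x) \<le> nrm (operator_cstar X) S + nrm (operator_cstar X) T"
    by (rule operator_norm_le[OF B _ b]) (simp add: operator_norm_nonneg S T)
qed

lemma bounded_operators_scale:
  assumes T: "T \<in> bounded_operators X"
  shows "(\<lambda>f x. c * T f x) \<in> bounded_operators X"
    and "nrm (operator_cstar X) (\<lambda>f x. c * T f x) = cmod c * nrm (operator_cstar X) T"
proof -
  have b: "ell2_norm X (\<lambda>x. c * S f x) \<le> (cmod c * nrm (operator_cstar X) S) * ell2_norm X f"
    if S: "S \<in> bounded_operators X" and f: "f \<in> ell2 X" for c f S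
    using ell2_scale(2)[OF bounded_operators_D(2)[OF S f]]
      mult_left_mono[OF operator_norm_bound[OF S f], of "cmod c"] by (simp add: mult.assoc)
  have B: "(\<lambda>f x. c * S f x) \<in> bounded_operators X" if S: "S \<in> bounded_operators X" for c S
    by (rule bounded_operators_I[OF _ _ _ _ b])
       (simp_all add: S bounded_operators_D[OF S] ell2_scale algebra_simps)
  have le: "nrm (operator_cstar X) (\<lambda>f x. c * S f x) \<le> cmod c * nrm (operator_cstar X) S"
    if S: "S \<in> bounded_operators X" for c S
    by (rule operator_norm_le[OF B[OF S] _ b[OF S]]) (simp_all add: operator_norm_nonneg S)
  show "(\<lambda>f x. c * T f x) \<in> bounded_operators X" by (rule B[OF T])
  show "nrm (operator_cstar X) (\<lambda>f x. c * T f x) = cmod c * nrm (operator_cstar X) T"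
  proof (cases "c = 0")
    case True
    then show ?thesis using le[OF T, of 0] operator_norm_nonneg[OF B[OF T, of 0]] by simp
  next
    case False
    have "nrm (operator_cstar X) T \<le> cmod (1/c) * nrm (operator_cstar X) (\<lambda>f x. c * T f x)"
      using le[OF B[OF T, of c], of "1/c"] False by simp
    then have "cmod c * nrm (operator_cstar X) T \<le> nrm (operator_cstar X) (\<lambda>f x. c * T f x)"
      using False by (simp add: norm_divide field_simps)
    then show ?thesis using le[OF T, of c] by simp
  qed
qed

lemma bounded_operators_comp:
  assumes S: "S \<in> bounded_operators X" and T: "T \<in> bounded_operators X"
  shows "S \<circ> T \<in> bounded_operators X"
    and "nrm (operator_cstar X) (S \<circ> T) \<le> nrm (operator_cstar X) S * nrm (operator_cstar X) T"
proof -
  have b: "ell2_norm X ((S \<circ> T) f) \<le> (nrm (operator_cstar X) S * nrm (operator_cstar X) T) * ell2_norm X f"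
    if f: "f \<in> ell2 X" for f
    using operator_norm_bound[OF S bounded_operators_D(2)[OF T f]]
      mult_left_mono[OF operator_norm_bound[OF T f] operator_norm_nonneg[OF S]]
    by (simp add: mult.assoc)
  show B: "S \<circ> T \<in> bounded_operators X"
    by (rule bounded_operators_I[OF _ _ _ _ b])
       (simp_all add: bounded_operators_D[OF S] bounded_operators_D[OF T] bounded_operators_zero_arg[OF S])
  show "nrm (operator_cstar X) (S \<circ> T) \<le> nrm (operator_cstar X) S * nrm (operator_cstar X) T"
    by (rule operator_norm_le[OF B _ b]) (simp_all add: operator_norm_nonneg S T)
qed

lemma bounded_operators_one: "(\<lambda>f. if f \<in> ell2 X then f else (\<lambda>x. 0)) \<in> bounded_operators X"
  by (rule bounded_operators_I[where K = 1]) (simp_all add: ell2_add ell2_scale)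

lemma bounded_operators_zero: "(\<lambda>f x. 0) \<in> bounded_operators X"
  by (rule bounded_operators_I[where K = 1]) (simp_all add: ell2_norm_nonneg)

lemma bounded_operator_ext:
  assumes "S \<in> bounded_operators X" "T \<in> bounded_operators X"
    and "\<And>f. f \<in> ell2 X \<Longrightarrow> S f = T f"
  shows "S = T"
proof
  fix f show "S f = T f"
    using assms(3) bounded_operators_D(1)[OF assms(1)] bounded_operators_D(1)[OF assms(2)]
    by (cases "f \<in> ell2 X") auto
qed

lemma bounded_operator_cut_off_inner:
  assumes T: "T \<in> bounded_operators X" and F: "finite F" "F \<subseteq> X" and g: "g \<in> ell2 X"
  shows "ell2_inner X (T (cut_off F f)) g = (\<Sum>x\<in>F. f x * ell2_inner X (T (point_mass x)) g)"
  using F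
proof (induction F rule: finite_induct)
  case empty
  have "cut_off {} f = (\<lambda>x. 0)" by (simp add: cut_off_def)
  then show ?case using bounded_operators_zero_arg[OF T] by (simp add: ell2_inner_def)
next
  case (insert x F)
  have tF: "cut_off F f \<in> ell2 X" by (rule cut_off_ell2(1)) (use insert.hyps insert.prems in auto)
  have px: "point_mass x \<in> ell2 X" by (rule point_mass_ell2(1)) (use insert.prems in simp)
  have eq: "T (cut_off (insert x F) f) = (\<lambda>y. T (cut_off F f) y + f x * T (point_mass x) y)"
    unfolding cut_off_insert[OF insert(2)]
    by (simp only: bounded_operators_D(3)[OF T tF ell2_scale(1)[OF px]] bounded_operators_D(4)[OF T px])
  have "ell2_inner X (T (cut_off (insert x F) f)) g =
      ell2_inner X (T (cut_off F f)) g + f x * ell2_inner X (T (point_mass x)) g"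
    unfolding eq
    by (simp only: ell2_inner_add[OF bounded_operators_D(2)[OF T tF] ell2_scale(1)[OF bounded_operators_D(2)[OF T px]] g]
        ell2_inner_scale)
  moreover have "ell2_inner X (T (cut_off F f)) g = (\<Sum>x\<in>F. f x * ell2_inner X (T (point_mass x)) g)"
    by (rule insert.IH) (use insert.prems in simp)
  ultimately show ?case using insert.hyps by simp
qed

text \<open>The adjoint is given by its matrix: \<open>(S g)(x) = \<langle>g, T \<delta>\<^sub>x\<rangle>\<close>. That \<open>S g\<close> is
  square-summable follows by applying \<open>T\<close> to the cut-offs of \<open>S g\<close> itself, and the adjoint
  relation extends from cut-offs by approximation.\<close>
lemma adjoint_exists:
  assumes T: "T \<in> bounded_operators X"
  shows "\<exists>S. S \<in> bounded_operators X \<and>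
    (\<forall>f\<in>ell2 X. \<forall>g\<in>ell2 X. ell2_inner X (T f) g = ell2_inner X f (S g))"
proof -
  let ?K = "nrm (operator_cstar X) T"
  define S where "S g = (\<lambda>x. if g \<in> ell2 X \<and> x \<in> X then ell2_inner X g (T (point_mass x)) else 0)" for g
  have S_cnj: "cnj (S g x) = ell2_inner X (T (point_mass x)) g" if "g \<in> ell2 X" "x \<in> X" for g x
    using that ell2_inner_cnj[of X "T (point_mass x)" g] by (simp add: S_def)
  have L2: "L2_set (\<lambda>x. cmod (S g x)) F \<le> ?K * ell2_norm X g"
    if g: "g \<in> ell2 X" and F: "finite F" "F \<subseteq> X" for g F
  proof -
    let ?l = "L2_set (\<lambda>x. cmod (S g x)) F"
    have "ell2_inner X (T (cut_off F (S g))) g = (\<Sum>x\<in>F. S g x * cnj (S g x))"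
      unfolding bounded_operator_cut_off_inner[OF T F g]
      by (rule sum.cong) (use F S_cnj[OF g] in auto)
    also have "\<dots> = of_real (\<Sum>x\<in>F. (cmod (S g x))\<^sup>2)" by (simp add: complex_norm_square[symmetric])
    also have "(\<Sum>x\<in>F. (cmod (S g x))\<^sup>2) = ?l * ?l" by (simp add: L2_set_def sum_nonneg)
    finally have "cmod (ell2_inner X (T (cut_off F (S g))) g) = ?l * ?l" by (simp add: L2_set_nonneg norm_mult)
    moreover have "cmod (ell2_inner X (T (cut_off F (S g))) g) \<le> ell2_norm X (T (cut_off F (S g))) * ell2_norm X g"
      using ell2_inner_summable(2)[OF bounded_operators_in_ell2[OF T] g] .
    moreover have "ell2_norm X (T (cut_off F (S g))) \<le> ?K * ?l"
      using operator_norm_bound[OF T cut_off_ell2(1)[OF F]] unfolding cut_off_ell2(2)[OF F] .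
    ultimately have "?l * ?l \<le> ?K * ?l * ell2_norm X g"
      using mult_right_mono[of "ell2_norm X (T (cut_off F (S g)))" "?K * ?l" "ell2_norm X g"]
        ell2_norm_nonneg[of X g] by linarith
    then have "?l * ?l \<le> (?K * ell2_norm X g) * ?l" by (simp add: ac_simps)
    then show ?thesis
    proof (cases "?l = 0")
      case True then show ?thesis using operator_norm_nonneg[OF T] ell2_norm_nonneg[of X g] by simp
    next
      case False
      then have "0 < ?l" by (simp add: order.strict_iff_order L2_set_nonneg)
      with \<open>?l * ?l \<le> (?K * ell2_norm X g) * ?l\<close> show ?thesis by (rule mult_right_le_imp_le)
    qed
  qed
  have Sv: "S g x = 0" if "x \<notin> X" for g x using that by (simp add: S_def)
  have S: "S \<in> bounded_operators X"
  proof (rule bounded_operators_I)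
    show "S f = (\<lambda>x. 0)" if "f \<notin> ell2 X" for f using that by (simp add: S_def)
    show "S f \<in> ell2 X" if "f \<in> ell2 X" for f by (rule ell2_bounded(1)[OF Sv L2[OF that]])
    show "ell2_norm X (S f) \<le> ?K * ell2_norm X f" if "f \<in> ell2 X" for f
      by (rule ell2_bounded(2)[OF Sv L2[OF that]])
    show "S (\<lambda>x. f x + g x) = (\<lambda>x. S f x + S g x)" if "f \<in> ell2 X" "g \<in> ell2 X" for f g
      using that ell2_add(1)[OF that] ell2_inner_add[OF that] bounded_operators_in_ell2[OF T]
      by (auto simp: S_def fun_eq_iff)
    show "S (\<lambda>x. c * f x) = (\<lambda>x. c * S f x)" if "f \<in> ell2 X" for c f
      using that ell2_scale(1)[OF that] by (auto simp: S_def fun_eq_iff ell2_inner_scale)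
  qed
  have "ell2_inner X (T f) g = ell2_inner X f (S g)" if f: "f \<in> ell2 X" and g: "g \<in> ell2 X" for f g
  proof -
    have Sg: "S g \<in> ell2 X" by (rule bounded_operators_D(2)[OF S g])
    define M where "M = ?K * ell2_norm X g + ell2_norm X (S g) + 1"
    have M: "0 < M" using operator_norm_nonneg[OF T] ell2_norm_nonneg[of X g] ell2_norm_nonneg[of X "S g"]
      by (simp add: M_def add_nonneg_pos)
    have "cmod (ell2_inner X (T f) g - ell2_inner X f (S g)) \<le> 0 + e" if e: "0 < e" for e
    proof -
      obtain F where F: "finite F" "F \<subseteq> X" and d: "ell2_norm X (\<lambda>x. f x - cut_off F f x) < e / M"
        using cut_off_approx[OF f, of "e / M"] e M by auto
      let ?t = "cut_off F f" and ?d = "\<lambda>x. f x - cut_off F f x"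
      have t: "?t \<in> ell2 X" by (rule cut_off_ell2(1)[OF F])
      have dl: "?d \<in> ell2 X" by (rule ell2_diff[OF f t])
      have "ell2_inner X ?t (S g) = (\<Sum>x\<in>F. f x * cnj (S g x))"
      proof -
        have "ell2_inner X ?t (S g) = (\<Sum>\<^sub>\<infinity>x\<in>F. f x * cnj (S g x))"
          unfolding ell2_inner_def by (rule infsum_cong_neutral) (use F in \<open>auto simp: cut_off_def\<close>)
        then show ?thesis using F by simp
      qed
      also have "\<dots> = ell2_inner X (T ?t) g"
        unfolding bounded_operator_cut_off_inner[OF T F g]
        by (rule sum.cong) (use F S_cnj[OF g] in auto)
      finally have eq: "ell2_inner X (T ?t) g = ell2_inner X ?t (S g)" by simp
      have "ell2_inner X (T f) g - ell2_inner X f (S g) = ell2_inner X (T ?d) g - ell2_inner X ?d (S g)"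
        using ell2_inner_diff[OF bounded_operators_D(2)[OF T f] bounded_operators_D(2)[OF T t] g]
          ell2_inner_diff[OF f t Sg] eq unfolding bounded_operators_diff[OF T f t] by simp
      then have "cmod (ell2_inner X (T f) g - ell2_inner X f (S g))
          \<le> cmod (ell2_inner X (T ?d) g) + cmod (ell2_inner X ?d (S g))"
        using norm_triangle_ineq4[of "ell2_inner X (T ?d) g" "ell2_inner X ?d (S g)"] by simp
      also have "\<dots> \<le> ell2_norm X (T ?d) * ell2_norm X g + ell2_norm X ?d * ell2_norm X (S g)"
        by (intro add_mono ell2_inner_summable(2) bounded_operators_D(2)[OF T dl] dl g Sg)
      also have "\<dots> \<le> (?K * ell2_norm X ?d) * ell2_norm X g + ell2_norm X ?d * ell2_norm X (S g)"
        by (intro add_mono mult_right_mono operator_norm_bound[OF T dl] ell2_norm_nonneg order_refl)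
      also have "\<dots> \<le> M * ell2_norm X ?d"
        using ell2_norm_nonneg[of X ?d] by (simp add: M_def algebra_simps)
      also have "\<dots> \<le> M * (e / M)" using d M by (intro mult_left_mono) auto
      finally show ?thesis using M by simp
    qed
    then have "cmod (ell2_inner X (T f) g - ell2_inner X f (S g)) \<le> 0" by (rule field_le_epsilon)
    then show ?thesis by simp
  qed
  with S show ?thesis by blast
qed

lemma adjoint_unique:
  assumes S: "S \<in> bounded_operators X" and S': "S' \<in> bounded_operators X"
    and "\<And>f g. f \<in> ell2 X \<Longrightarrow> g \<in> ell2 X \<Longrightarrow> ell2_inner X f (S g) = ell2_inner X f (S' g)"
  shows "S = S'"
proof (rule bounded_operator_ext[OF S S'])
  fix g assume g: "g \<in> ell2 X"
  show "S g = S' g"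
  proof
    fix x
    show "S g x = S' g x"
    proof (cases "x \<in> X")
      case True
      then show ?thesis using assms(3)[of "point_mass x" g] g by (simp add: ell2_inner_point_mass_left)
    next
      case False
      then show ?thesis using ell2_vanish[OF bounded_operators_D(2)[OF S g]]
        ell2_vanish[OF bounded_operators_D(2)[OF S' g]] by simp
    qed
  qed
qed

lemma operator_star:
  assumes T: "T \<in> bounded_operators X"
  shows operator_star_bounded: "star (operator_cstar X) T \<in> bounded_operators X"
    and operator_star_inner: "f \<in> ell2 X \<Longrightarrow> g \<in> ell2 X \<Longrightarrow>
      ell2_inner X (T f) g = ell2_inner X f (star (operator_cstar X) T g)"
proof -
  let ?P = "\<lambda>S. S \<in> bounded_operators X \<and>
    (\<forall>f\<in>ell2 X. \<forall>g\<in>ell2 X. ell2_inner X (T f) g = ell2_inner X f (S g))"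
  have st: "star (operator_cstar X) T = (THE S. ?P S)" by (simp add: operator_cstar_def)
  obtain S where S: "?P S" using adjoint_exists[OF T] by blast
  have "?P (THE S. ?P S)"
  proof (rule theI[of ?P, OF S])
    fix S' assume S': "?P S'"
    show "S' = S" by (rule adjoint_unique[of S' X S]) (use S S' in auto)
  qed
  then show "star (operator_cstar X) T \<in> bounded_operators X"
    and "f \<in> ell2 X \<Longrightarrow> g \<in> ell2 X \<Longrightarrow>
      ell2_inner X (T f) g = ell2_inner X f (star (operator_cstar X) T g)"
    unfolding st by auto
qed

lemma operator_star_eqI:
  assumes T: "T \<in> bounded_operators X" and S: "S \<in> bounded_operators X"
    and "\<And>f g. f \<in> ell2 X \<Longrightarrow> g \<in> ell2 X \<Longrightarrow> ell2_inner X (T f) g = ell2_inner X f (S g)"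
  shows "star (operator_cstar X) T = S"
  by (rule adjoint_unique[OF operator_star_bounded[OF T] S])
     (use assms(3) operator_star_inner[OF T] in auto)

section \<open>The C*-algebra of bounded operators\<close>

lemma abelian_group_operator: "abelian_group (operator_cstar X)"
proof (rule abelian_groupI)
  fix T assume "T \<in> carrier (operator_cstar X)"
  then have T: "T \<in> bounded_operators X" by simp
  show "\<exists>S\<in>carrier (operator_cstar X). S \<oplus>\<^bsub>operator_cstar X\<^esub> T = \<zero>\<^bsub>operator_cstar X\<^esub>"
    using bounded_operators_scale(1)[OF T, of "-1"]
    by (intro bexI[of _ "\<lambda>f x. - 1 * T f x"]) auto
qed (auto simp: bounded_operators_add bounded_operators_zero algebra_simps)

lemma operator_uminus:
  assumes "T \<in> bounded_operators X" shows "\<ominus>\<^bsub>operator_cstar X\<^esub> T = (\<lambda>f x. - T f x)"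
proof -
  interpret abelian_group "operator_cstar X" by (rule abelian_group_operator)
  have "(\<lambda>f x. - T f x) \<in> bounded_operators X"
    using bounded_operators_scale(1)[OF assms, of "-1"] by simp
  then show ?thesis using minus_equality[of "\<lambda>f x. - T f x" T] assms by simp
qed

lemma operator_minus:
  "T \<in> bounded_operators X \<Longrightarrow> S \<ominus>\<^bsub>operator_cstar X\<^esub> T = (\<lambda>f x. S f x - T f x)"
  by (simp add: a_minus_def operator_uminus)

lemma bounded_operators_minus:
  "S \<in> bounded_operators X \<Longrightarrow> T \<in> bounded_operators X \<Longrightarrow> (\<lambda>f x. S f x - T f x) \<in> bounded_operators X"
  using bounded_operators_add(1)[OF _ bounded_operators_scale(1)[of T X "-1"], of S] by simp

text \<open>The limit is taken pointwise; the estimates on finite sets pass to the limit, so that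
  completeness of \<open>\<ell>\<^sup>2\<close> is obtained along the way.\<close>
lemma operator_complete:
  fixes \<sigma> :: "nat \<Rightarrow> ('x \<Rightarrow> complex) \<Rightarrow> ('x \<Rightarrow> complex)"
  assumes \<sigma>: "\<And>n. \<sigma> n \<in> bounded_operators X"
    and cau: "\<And>e. e > 0 \<Longrightarrow> \<exists>N. \<forall>m\<ge>N. \<forall>n\<ge>N. nrm (operator_cstar X) (\<lambda>f x. \<sigma> m f x - \<sigma> n f x) < e"
  shows "\<exists>T\<in>bounded_operators X. (\<lambda>n. nrm (operator_cstar X) (\<lambda>f x. \<sigma> n f x - T f x)) \<longlonglongrightarrow> 0"
proof -
  have d: "ell2_norm X (\<lambda>x. \<sigma> m f x - \<sigma> n f x)
      \<le> nrm (operator_cstar X) (\<lambda>f x. \<sigma> m f x - \<sigma> n f x) * ell2_norm X f" if "f \<in> ell2 X" for f m n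
    by (rule operator_norm_bound[OF bounded_operators_minus[OF \<sigma> \<sigma>] that])
  have conv: "convergent (\<lambda>n. \<sigma> n f x)" for f x
  proof (cases "f \<in> ell2 X")
    case True
    have "Cauchy (\<lambda>n. \<sigma> n f x)"
    proof (rule CauchyI)
      fix e :: real assume e: "0 < e"
      have "0 < e / (ell2_norm X f + 1)" using e ell2_norm_nonneg[of X f] by simp
      from cau[OF this] obtain N where N: "\<And>m n. m \<ge> N \<Longrightarrow> n \<ge> N \<Longrightarrow>
          nrm (operator_cstar X) (\<lambda>f x. \<sigma> m f x - \<sigma> n f x) < e / (ell2_norm X f + 1)" by blast
      have "norm (\<sigma> m f x - \<sigma> n f x) < e" if mn: "m \<ge> N" "n \<ge> N" for m n
      proof -
        have "norm (\<sigma> m f x - \<sigma> n f x) \<le> ell2_norm X (\<lambda>x. \<sigma> m f x - \<sigma> n f x)"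
          using cmod_le_ell2_norm[OF ell2_diff[OF bounded_operators_in_ell2[OF \<sigma>] bounded_operators_in_ell2[OF \<sigma>]]] .
        also have "\<dots> \<le> e / (ell2_norm X f + 1) * ell2_norm X f"
          by (rule order_trans[OF d[OF True] mult_right_mono[OF less_imp_le[OF N[OF mn]] ell2_norm_nonneg]])
        also have "\<dots> < e" using e ell2_norm_nonneg[of X f] by (simp add: divide_less_eq)
        finally show ?thesis .
      qed
      then show "\<exists>M. \<forall>m\<ge>M. \<forall>n\<ge>M. norm (\<sigma> m f x - \<sigma> n f x) < e" by blast
    qed
    then show ?thesis by (simp add: Cauchy_convergent_iff)
  next
    case False
    then show ?thesis using bounded_operators_D(1)[OF \<sigma> False] by (simp add: convergent_const)
  qed
  define T where "T f x = lim (\<lambda>n. \<sigma> n f x)" for f x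
  have lim: "(\<lambda>n. \<sigma> n f x) \<longlonglongrightarrow> T f x" for f x
    using conv unfolding T_def by (simp add: convergent_LIMSEQ_iff)
  have Tv: "T f x = 0" if "x \<notin> X" for f x
    using LIMSEQ_unique[OF lim[of f x]] ell2_vanish[OF bounded_operators_in_ell2[OF \<sigma>] that] by simp
  have tail: "(\<lambda>x. \<sigma> n f x - T f x) \<in> ell2 X \<and> ell2_norm X (\<lambda>x. \<sigma> n f x - T f x) \<le> e * ell2_norm X f"
    if f: "f \<in> ell2 X" and N: "\<And>m. m \<ge> N \<Longrightarrow> nrm (operator_cstar X) (\<lambda>f x. \<sigma> n f x - \<sigma> m f x) \<le> e" for f n N e
  proof -
    have "L2_set (\<lambda>x. cmod (\<sigma> n f x - T f x)) F \<le> e * ell2_norm X f" if F: "finite F" "F \<subseteq> X" for F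
    proof (rule LIMSEQ_le_const2)
      show "(\<lambda>m. L2_set (\<lambda>x. cmod (\<sigma> n f x - \<sigma> m f x)) F) \<longlonglongrightarrow> L2_set (\<lambda>x. cmod (\<sigma> n f x - T f x)) F"
        unfolding L2_set_def by (intro tendsto_intros lim)
      have "L2_set (\<lambda>x. cmod (\<sigma> n f x - \<sigma> m f x)) F \<le> e * ell2_norm X f" if "m \<ge> N" for m
      proof -
        have "L2_set (\<lambda>x. cmod (\<sigma> n f x - \<sigma> m f x)) F \<le> ell2_norm X (\<lambda>x. \<sigma> n f x - \<sigma> m f x)"
          by (rule L2_set_le_ell2_norm[OF ell2_diff[OF bounded_operators_in_ell2[OF \<sigma>] bounded_operators_in_ell2[OF \<sigma>]] F])
        also have "\<dots> \<le> e * ell2_norm X f"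
          by (rule order_trans[OF d[OF f] mult_right_mono[OF N[OF that] ell2_norm_nonneg]])
        finally show ?thesis .
      qed
      then show "\<exists>N. \<forall>m\<ge>N. L2_set (\<lambda>x. cmod (\<sigma> n f x - \<sigma> m f x)) F \<le> e * ell2_norm X f" by blast
    qed
    note * = ell2_bounded[of X "\<lambda>x. \<sigma> n f x - T f x", OF _ this]
    have v: "\<sigma> n f x - T f x = 0" if "x \<notin> X" for x
      using Tv[OF that] ell2_vanish[OF bounded_operators_in_ell2[OF \<sigma>] that] by simp
    show ?thesis using *[OF v] by blast
  qed
  obtain N1 where N1: "\<And>m n. m \<ge> N1 \<Longrightarrow> n \<ge> N1 \<Longrightarrow> nrm (operator_cstar X) (\<lambda>f x. \<sigma> m f x - \<sigma> n f x) < 1"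
    using cau[of 1] by auto
  note t1 = tail[where n = N1 and N = N1 and e = 1, OF _ less_imp_le[OF N1[OF order_refl]]]
  have TB: "T \<in> bounded_operators X"
  proof (rule bounded_operators_I)
    have Teq: "T f = (\<lambda>x. \<sigma> N1 f x - (\<sigma> N1 f x - T f x))" for f by simp
    show Tin: "T f \<in> ell2 X" if f: "f \<in> ell2 X" for f
      using ell2_diff[OF bounded_operators_D(2)[OF \<sigma>[of N1] f] conjunct1[OF t1[OF f]]] by simp
    show "T f = (\<lambda>x. 0)" if "f \<notin> ell2 X" for f
      using LIMSEQ_unique[OF lim] bounded_operators_D(1)[OF \<sigma> that] by (intro ext) simp
    show "T (\<lambda>x. f x + g x) = (\<lambda>x. T f x + T g x)" if fg: "f \<in> ell2 X" "g \<in> ell2 X" for f g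
    proof
      fix x
      show "T (\<lambda>x. f x + g x) x = T f x + T g x"
        using LIMSEQ_unique[OF lim[of "\<lambda>x. f x + g x" x], unfolded bounded_operators_D(3)[OF \<sigma> fg],
          OF tendsto_add[OF lim[of f x] lim[of g x]]] .
    qed
    show "T (\<lambda>x. c * f x) = (\<lambda>x. c * T f x)" if f: "f \<in> ell2 X" for c f
    proof
      fix x
      show "T (\<lambda>x. c * f x) x = c * T f x"
        using LIMSEQ_unique[OF lim[of "\<lambda>x. c * f x" x], unfolded bounded_operators_D(4)[OF \<sigma> f],
          OF tendsto_mult_left[OF lim[of f x]]] .
    qed
    show "ell2_norm X (T f) \<le> (nrm (operator_cstar X) (\<sigma> N1) + 1) * ell2_norm X f" if f: "f \<in> ell2 X" for f
    proof -
      have "ell2_norm X (\<lambda>x. -1 * (\<sigma> N1 f x - T f x)) = ell2_norm X (\<lambda>x. \<sigma> N1 f x - T f x)"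
        using ell2_scale(2)[OF conjunct1[OF t1[OF f]], of "-1"] by simp
      then have "ell2_norm X (T f) \<le> ell2_norm X (\<sigma> N1 f) + ell2_norm X (\<lambda>x. \<sigma> N1 f x - T f x)"
        using ell2_norm_diff_le[OF Tin[OF f] bounded_operators_D(2)[OF \<sigma>[of N1] f]] by simp
      then show ?thesis using operator_norm_bound[OF \<sigma>[of N1] f] conjunct2[OF t1[OF f]]
        by (simp add: distrib_right)
    qed
  qed
  have "(\<lambda>n. nrm (operator_cstar X) (\<lambda>f x. \<sigma> n f x - T f x)) \<longlonglongrightarrow> 0"
  proof (rule LIMSEQ_I)
    fix e :: real assume e: "0 < e"
    then obtain N where N: "\<And>m n. m \<ge> N \<Longrightarrow> n \<ge> N \<Longrightarrow>
        nrm (operator_cstar X) (\<lambda>f x. \<sigma> m f x - \<sigma> n f x) < e / 2" using cau[of "e/2"] by auto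
    have "nrm (operator_cstar X) (\<lambda>f x. \<sigma> n f x - T f x) \<le> e / 2" if n: "n \<ge> N" for n
    proof (rule operator_norm_le[OF bounded_operators_minus[OF \<sigma> TB]])
      show "ell2_norm X (\<lambda>x. \<sigma> n f x - T f x) \<le> e / 2 * ell2_norm X f" if "f \<in> ell2 X" for f
        using conjunct2[OF tail[OF that less_imp_le[OF N[OF n]]]] .
    qed (use e in simp)
    moreover have "0 \<le> nrm (operator_cstar X) (\<lambda>f x. \<sigma> n f x - T f x)" for n
      by (rule operator_norm_nonneg[OF bounded_operators_minus[OF \<sigma> TB]])
    ultimately have "norm (nrm (operator_cstar X) (\<lambda>f x. \<sigma> n f x - T f x) - 0) < e" if "n \<ge> N" for n
      using that e by (simp add: order.strict_trans1[of _ "e/2" e])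
    then show "\<exists>N. \<forall>n\<ge>N. norm (nrm (operator_cstar X) (\<lambda>f x. \<sigma> n f x - T f x) - 0) < e" by blast
  qed
  with TB show ?thesis by blast
qed

lemma operator_star_norm_le:
  assumes T: "T \<in> bounded_operators X"
  shows "nrm (operator_cstar X) (star (operator_cstar X) T) \<le> nrm (operator_cstar X) T"
proof (rule operator_norm_le[OF operator_star_bounded[OF T] operator_norm_nonneg[OF T]])
  fix g assume g: "g \<in> ell2 X"
  let ?s = "star (operator_cstar X) T g"
  have s: "?s \<in> ell2 X" by (rule bounded_operators_D(2)[OF operator_star_bounded[OF T] g])
  have "(ell2_norm X ?s)\<^sup>2 = cmod (ell2_inner X (T ?s) g)"
    unfolding operator_star_inner[OF T s g] ell2_inner_self[OF s] by (simp add: norm_power)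
  also have "\<dots> \<le> ell2_norm X (T ?s) * ell2_norm X g"
    by (rule ell2_inner_summable(2)[OF bounded_operators_D(2)[OF T s] g])
  also have "\<dots> \<le> (nrm (operator_cstar X) T * ell2_norm X ?s) * ell2_norm X g"
    by (intro mult_right_mono operator_norm_bound[OF T s] ell2_norm_nonneg)
  finally have le: "ell2_norm X ?s * ell2_norm X ?s \<le> (nrm (operator_cstar X) T * ell2_norm X g) * ell2_norm X ?s"
    by (simp add: power2_eq_square ac_simps)
  show "ell2_norm X ?s \<le> nrm (operator_cstar X) T * ell2_norm X g"
  proof (cases "ell2_norm X ?s = 0")
    case True then show ?thesis using operator_norm_nonneg[OF T] ell2_norm_nonneg[of X g] by simp
  next
    case False
    then have "0 < ell2_norm X ?s" using ell2_norm_nonneg[of X ?s] by simp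
    with le show ?thesis by (rule mult_right_le_imp_le)
  qed
qed

lemma operator_star_star:
  assumes T: "T \<in> bounded_operators X"
  shows "star (operator_cstar X) (star (operator_cstar X) T) = T"
proof (rule operator_star_eqI[OF operator_star_bounded[OF T] T])
  fix f g assume fg: "f \<in> ell2 X" "g \<in> ell2 X"
  show "ell2_inner X (star (operator_cstar X) T f) g = ell2_inner X f (T g)"
    using operator_star_inner[OF T fg(2,1)] ell2_inner_cnj[of X "T g" f]
      ell2_inner_cnj[of X g "star (operator_cstar X) T f"] by simp
qed

lemma ell2_inner_add_right:
  assumes "f \<in> ell2 X" "g \<in> ell2 X" "h \<in> ell2 X"
  shows "ell2_inner X h (\<lambda>x. f x + g x) = ell2_inner X h f + ell2_inner X h g"
  using ell2_inner_add[OF assms] ell2_inner_cnj[of X h] by simp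

lemma ell2_inner_scale_right: "ell2_inner X h (\<lambda>x. c * f x) = cnj c * ell2_inner X h f"
  using ell2_inner_scale[of X c f h] ell2_inner_cnj[of X h] by simp

theorem operator_unital_cstar_algebra: "unital_cstar_algebra (operator_cstar X)"
proof -
  let ?A = "operator_cstar X"
  note B = bounded_operators_D(2) operator_star_bounded
  interpret abelian_group ?A by (rule abelian_group_operator)
  interpret M: module complex_ring ?A
    by (rule moduleI[OF cring_complex_ring abelian_group_operator])
       (auto simp: bounded_operators_scale algebra_simps)
  interpret C: cstar_algebra ?A
  proof unfold_locales
    fix S T assume "S \<in> carrier ?A" "T \<in> carrier ?A"
    then have S: "S \<in> bounded_operators X" and T: "T \<in> bounded_operators X" by simp_all
    show "S \<otimes>\<^bsub>?A\<^esub> T \<in> carrier ?A" by (simp add: bounded_operators_comp S T)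
    show "nrm ?A (S \<oplus>\<^bsub>?A\<^esub> T) \<le> nrm ?A S + nrm ?A T" by (simp add: bounded_operators_add S T)
    show "nrm ?A (S \<otimes>\<^bsub>?A\<^esub> T) \<le> nrm ?A S * nrm ?A T" using bounded_operators_comp(2)[OF S T] by simp
    show "star ?A (S \<oplus>\<^bsub>?A\<^esub> T) = star ?A S \<oplus>\<^bsub>?A\<^esub> star ?A T"
      unfolding operator_cstar_simps
      by (rule operator_star_eqI)
        (simp_all add: S T B bounded_operators_add ell2_inner_add ell2_inner_add_right operator_star_inner)
    show "star ?A (S \<otimes>\<^bsub>?A\<^esub> T) = star ?A T \<otimes>\<^bsub>?A\<^esub> star ?A S"
      unfolding operator_cstar_simps
      by (rule operator_star_eqI)
        (simp_all add: S T B bounded_operators_comp operator_star_inner bounded_operators_D(2)[OF operator_star_bounded])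
    fix R assume "R \<in> carrier ?A"
    then have R: "R \<in> bounded_operators X" by simp
    show "(S \<oplus>\<^bsub>?A\<^esub> T) \<otimes>\<^bsub>?A\<^esub> R = S \<otimes>\<^bsub>?A\<^esub> R \<oplus>\<^bsub>?A\<^esub> T \<otimes>\<^bsub>?A\<^esub> R" by (simp add: fun_eq_iff)
    show "R \<otimes>\<^bsub>?A\<^esub> (S \<oplus>\<^bsub>?A\<^esub> T) = R \<otimes>\<^bsub>?A\<^esub> S \<oplus>\<^bsub>?A\<^esub> R \<otimes>\<^bsub>?A\<^esub> T"
      using bounded_operators_D(3)[OF R bounded_operators_in_ell2[OF S] bounded_operators_in_ell2[OF T]]
      by (simp add: fun_eq_iff)
    show "S \<otimes>\<^bsub>?A\<^esub> T \<otimes>\<^bsub>?A\<^esub> R = S \<otimes>\<^bsub>?A\<^esub> (T \<otimes>\<^bsub>?A\<^esub> R)" by (simp add: comp_assoc)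
  next
    fix c S T assume "S \<in> carrier ?A" "T \<in> carrier ?A"
    then have S: "S \<in> bounded_operators X" and T: "T \<in> bounded_operators X" by simp_all
    show "c \<odot>\<^bsub>?A\<^esub> S \<otimes>\<^bsub>?A\<^esub> T = c \<odot>\<^bsub>?A\<^esub> (S \<otimes>\<^bsub>?A\<^esub> T)" by (simp add: fun_eq_iff)
    show "S \<otimes>\<^bsub>?A\<^esub> (c \<odot>\<^bsub>?A\<^esub> T) = c \<odot>\<^bsub>?A\<^esub> (S \<otimes>\<^bsub>?A\<^esub> T)"
      using bounded_operators_D(4)[OF S bounded_operators_in_ell2[OF T]] by (simp add: fun_eq_iff)
  next
    fix T assume "T \<in> carrier ?A"
    then have T: "T \<in> bounded_operators X" by simp
    show "star ?A T \<in> carrier ?A" by (simp add: operator_star_bounded T)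
    show "star ?A (star ?A T) = T" by (rule operator_star_star[OF T])
    show "star ?A (c \<odot>\<^bsub>?A\<^esub> T) = cnj c \<odot>\<^bsub>?A\<^esub> star ?A T" for c
      unfolding operator_cstar_simps
      by (rule operator_star_eqI)
        (simp_all add: T B bounded_operators_scale ell2_inner_scale ell2_inner_scale_right operator_star_inner)
    show "0 \<le> nrm ?A T" by (rule operator_norm_nonneg[OF T])
    show "nrm ?A (c \<odot>\<^bsub>?A\<^esub> T) = cmod c * nrm ?A T" for c by (simp add: bounded_operators_scale T)
    show "nrm ?A T = 0 \<longleftrightarrow> T = \<zero>\<^bsub>?A\<^esub>"
    proof
      assume 0: "nrm ?A T = 0"
      have "T f = (\<lambda>x. 0)" for f
      proof (cases "f \<in> ell2 X")
        case True
        then have "ell2_norm X (T f) = 0"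
          using operator_norm_bound[OF T True] 0 ell2_norm_nonneg[of X "T f"] by simp
        then show ?thesis by (rule ell2_norm_eq_0[OF bounded_operators_D(2)[OF T True]])
      next
        case False then show ?thesis by (rule bounded_operators_D(1)[OF T])
      qed
      then show "T = \<zero>\<^bsub>?A\<^esub>" by (simp add: fun_eq_iff)
    next
      assume "T = \<zero>\<^bsub>?A\<^esub>"
      then have "nrm ?A T \<le> 0" by (intro operator_norm_le[OF T]) simp_all
      then show "nrm ?A T = 0" using operator_norm_nonneg[OF T] by simp
    qed
    show "nrm ?A (star ?A T \<otimes>\<^bsub>?A\<^esub> T) = (nrm ?A T)\<^sup>2"
    proof (rule antisym)
      show "nrm ?A (star ?A T \<otimes>\<^bsub>?A\<^esub> T) \<le> (nrm ?A T)\<^sup>2"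
        using bounded_operators_comp(2)[OF operator_star_bounded[OF T] T]
          mult_right_mono[OF operator_star_norm_le[OF T] operator_norm_nonneg[OF T]]
        by (simp add: power2_eq_square)
      let ?R = "star ?A T \<circ> T"
      have R: "?R \<in> bounded_operators X" by (rule bounded_operators_comp(1)[OF operator_star_bounded[OF T] T])
      have "ell2_norm X (T f) \<le> sqrt (nrm ?A ?R) * ell2_norm X f" if f: "f \<in> ell2 X" for f
      proof -
        have Tf: "T f \<in> ell2 X" by (rule bounded_operators_D(2)[OF T f])
        have "(ell2_norm X (T f))\<^sup>2 = cmod (ell2_inner X f (?R f))"
          unfolding comp_apply operator_star_inner[OF T f Tf, symmetric] ell2_inner_self[OF Tf]
          by (simp add: norm_power)
        also have "\<dots> \<le> ell2_norm X f * ell2_norm X (?R f)"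
          by (rule ell2_inner_summable(2)[OF f bounded_operators_D(2)[OF R f]])
        also have "\<dots> \<le> ell2_norm X f * (nrm ?A ?R * ell2_norm X f)"
          by (intro mult_left_mono operator_norm_bound[OF R f] ell2_norm_nonneg)
        also have "\<dots> = (sqrt (nrm ?A ?R) * ell2_norm X f)\<^sup>2"
          using operator_norm_nonneg[OF R] by (simp add: power2_eq_square)
        finally show ?thesis
          by (rule power2_le_imp_le) (simp add: operator_norm_nonneg[OF R] ell2_norm_nonneg)
      qed
      then have "nrm ?A T \<le> sqrt (nrm ?A ?R)"
        by (intro operator_norm_le[OF T]) (simp_all add: operator_norm_nonneg[OF R])
      then have "(nrm ?A T)\<^sup>2 \<le> (sqrt (nrm ?A ?R))\<^sup>2"
        by (rule power_mono) (rule operator_norm_nonneg[OF T])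
      then show "(nrm ?A T)\<^sup>2 \<le> nrm ?A (star ?A T \<otimes>\<^bsub>?A\<^esub> T)"
        using operator_norm_nonneg[OF R] by simp
    qed
  next
    fix \<sigma> :: "nat \<Rightarrow> ('a \<Rightarrow> complex) \<Rightarrow> ('a \<Rightarrow> complex)"
    assume r: "range \<sigma> \<subseteq> carrier ?A"
      and c: "\<forall>e>0. \<exists>N. \<forall>m\<ge>N. \<forall>n\<ge>N. nrm ?A (\<sigma> m \<ominus>\<^bsub>?A\<^esub> \<sigma> n) < e"
    from r have \<sigma>: "\<sigma> n \<in> bounded_operators X" for n by auto
    have c': "\<exists>N. \<forall>m\<ge>N. \<forall>n\<ge>N. nrm ?A (\<lambda>f x. \<sigma> m f x - \<sigma> n f x) < e" if "e > 0" for e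
      using spec[OF c, of e] that by (simp only: operator_minus[OF \<sigma>] simp_thms)
    obtain T where "T \<in> bounded_operators X" "(\<lambda>n. nrm ?A (\<lambda>f x. \<sigma> n f x - T f x)) \<longlonglongrightarrow> 0"
      using operator_complete[OF \<sigma> c'] by auto
    then show "\<exists>T\<in>carrier ?A. (\<lambda>n. nrm ?A (\<sigma> n \<ominus>\<^bsub>?A\<^esub> T)) \<longlonglongrightarrow> 0"
      by (intro bexI[of _ T]) (simp_all add: operator_minus)
  qed
  show ?thesis
  proof unfold_locales
    show "\<one>\<^bsub>?A\<^esub> \<in> carrier ?A" by (simp add: bounded_operators_one)
    fix T assume "T \<in> carrier ?A"
    then have T: "T \<in> bounded_operators X" by simp
    show "\<one>\<^bsub>?A\<^esub> \<otimes>\<^bsub>?A\<^esub> T = T" using bounded_operators_in_ell2[OF T] by (auto simp: fun_eq_iff)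
    show "T \<otimes>\<^bsub>?A\<^esub> \<one>\<^bsub>?A\<^esub> = T"
      using bounded_operators_D(1)[OF T] bounded_operators_zero_arg[OF T] by (auto simp: fun_eq_iff)
  qed
qed

section \<open>Continuous functions and the dual group\<close>

lemma continuous_functions_simps [simp]:
  "f \<in> carrier (continuous_functions X) \<longleftrightarrow> continuous_on X f \<and> (\<forall>x. x \<notin> X \<longrightarrow> f x = 0)"
  "mult (continuous_functions X) = (\<lambda>f g x. f x * g x)"
  "one (continuous_functions X) = (\<lambda>x. if x \<in> X then 1 else 0)"
  "zero (continuous_functions X) = (\<lambda>x. 0)"
  "add (continuous_functions X) = (\<lambda>f g x. f x + g x)"
  "smult (continuous_functions X) = (\<lambda>c f x. c * f x)"
  "star (continuous_functions X) = (\<lambda>f x. cnj (f x))"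
  by (simp_all add: continuous_functions_def function_cstar_def)

lemma sup_norm_le:
  assumes "X \<noteq> {}" "\<And>x. x \<in> X \<Longrightarrow> cmod (f x) \<le> K"
  shows "nrm (continuous_functions X) f \<le> K"
  unfolding continuous_functions_def function_cstar_def using assms by (simp add: cSUP_least)

lemma le_sup_norm:
  assumes "compact X" "X \<noteq> {}" "f \<in> carrier (continuous_functions X)"
  shows "cmod (f x) \<le> nrm (continuous_functions X) f"
proof -
  have "compact ((\<lambda>x. cmod (f x)) ` X)"
    using assms by (intro compact_continuous_image continuous_intros) auto
  then have bdd: "bdd_above ((\<lambda>x. cmod (f x)) ` X)"
    by (intro bounded_imp_bdd_above compact_imp_bounded)
  have up: "cmod (f y) \<le> nrm (continuous_functions X) f" if "y \<in> X" for y
    unfolding continuous_functions_def function_cstar_def using cSUP_upper[OF that bdd] by simp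
  show ?thesis
  proof (cases "x \<in> X")
    case False
    obtain y where "y \<in> X" using assms(2) by blast
    then have "0 \<le> nrm (continuous_functions X) f" using order_trans[OF norm_ge_zero up] by blast
    then show ?thesis using False assms(3) by simp
  qed (rule up)
qed

lemma abelian_group_continuous_functions: "abelian_group (continuous_functions X)"
proof (rule abelian_groupI)
  fix f assume "f \<in> carrier (continuous_functions X)"
  then show "\<exists>g\<in>carrier (continuous_functions X). g \<oplus>\<^bsub>continuous_functions X\<^esub> f = \<zero>\<^bsub>continuous_functions X\<^esub>"
    by (intro bexI[of _ "\<lambda>x. - f x"]) (auto intro: continuous_intros)
qed (auto intro: continuous_intros simp: algebra_simps)

lemma continuous_functions_minus:
  assumes "g \<in> carrier (continuous_functions X)"
  shows "f \<ominus>\<^bsub>continuous_functions X\<^esub> g = (\<lambda>x. f x - g x)"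
proof -
  interpret abelian_group "continuous_functions X" by (rule abelian_group_continuous_functions)
  have "\<ominus>\<^bsub>continuous_functions X\<^esub> g = (\<lambda>x. - g x)"
    using minus_equality[of "\<lambda>x. - g x" g] assms by (simp add: continuous_on_minus)
  then show ?thesis by (simp add: a_minus_def)
qed

theorem continuous_functions_unital_cstar_algebra:
  fixes X :: "'x::topological_space set"
  assumes X: "compact X" "X \<noteq> {}"
  shows "unital_cstar_algebra (continuous_functions X)"
proof -
  let ?A = "continuous_functions X"
  interpret abelian_group ?A by (rule abelian_group_continuous_functions)
  interpret M: module complex_ring ?A
    by (rule moduleI[OF cring_complex_ring abelian_group_continuous_functions])
       (auto intro: continuous_intros simp: algebra_simps)
  note le = le_sup_norm[OF X] and least = sup_norm_le[OF X(2)]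
  have nonneg: "0 \<le> nrm ?A f" if "f \<in> carrier ?A" for f
    using order_trans[OF norm_ge_zero le[OF that]] .
  interpret C: cstar_algebra ?A
  proof unfold_locales
    fix f g assume fg: "f \<in> carrier ?A" "g \<in> carrier ?A"
    show "f \<otimes>\<^bsub>?A\<^esub> g \<in> carrier ?A" using fg by (auto intro: continuous_intros)
    show "nrm ?A (f \<oplus>\<^bsub>?A\<^esub> g) \<le> nrm ?A f + nrm ?A g"
    proof (rule least)
      fix x show "cmod ((f \<oplus>\<^bsub>?A\<^esub> g) x) \<le> nrm ?A f + nrm ?A g"
        using order_trans[OF norm_triangle_ineq add_mono[OF le[OF fg(1), of x] le[OF fg(2), of x]]] by simp
    qed
    show "nrm ?A (f \<otimes>\<^bsub>?A\<^esub> g) \<le> nrm ?A f * nrm ?A g"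
    proof (rule least)
      fix x show "cmod ((f \<otimes>\<^bsub>?A\<^esub> g) x) \<le> nrm ?A f * nrm ?A g"
        using mult_mono[OF le[OF fg(1), of x] le[OF fg(2), of x] nonneg[OF fg(1)] norm_ge_zero]
        by (simp add: norm_mult)
    qed
  next
    fix f assume f: "f \<in> carrier ?A"
    show "star ?A f \<in> carrier ?A" using f by (auto intro: continuous_intros)
    show "0 \<le> nrm ?A f" by (rule nonneg[OF f])
    have cf: "c \<odot>\<^bsub>?A\<^esub> f \<in> carrier ?A" for c using f by (auto intro: continuous_intros)
    show "nrm ?A (c \<odot>\<^bsub>?A\<^esub> f) = cmod c * nrm ?A f" for c
    proof (rule antisym)
      show "nrm ?A (c \<odot>\<^bsub>?A\<^esub> f) \<le> cmod c * nrm ?A f"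
        by (rule least) (use le[OF f] in \<open>simp add: norm_mult mult_left_mono\<close>)
      show "cmod c * nrm ?A f \<le> nrm ?A (c \<odot>\<^bsub>?A\<^esub> f)"
      proof (cases "c = 0")
        case True then show ?thesis using nonneg[OF cf[of c]] by (simp only: norm_zero mult_zero_left)
      next
        case False
        have "nrm ?A f \<le> nrm ?A (c \<odot>\<^bsub>?A\<^esub> f) / cmod c"
        proof (rule least)
          fix x
          show "cmod (f x) \<le> nrm ?A (c \<odot>\<^bsub>?A\<^esub> f) / cmod c"
            using le[OF cf, of c x] False by (simp add: norm_mult field_simps)
        qed
        then show ?thesis using False by (simp add: field_simps)
      qed
    qed
    show "nrm ?A f = 0 \<longleftrightarrow> f = \<zero>\<^bsub>?A\<^esub>"
    proof
      assume "nrm ?A f = 0"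
      then show "f = \<zero>\<^bsub>?A\<^esub>" using le[OF f] by (auto simp: fun_eq_iff)
    next
      assume "f = \<zero>\<^bsub>?A\<^esub>"
      then have "nrm ?A f \<le> 0" by (intro least) simp
      then show "nrm ?A f = 0" using nonneg[OF f] by simp
    qed
    show "nrm ?A (star ?A f \<otimes>\<^bsub>?A\<^esub> f) = (nrm ?A f)\<^sup>2"
    proof (rule antisym)
      let ?g = "star ?A f \<otimes>\<^bsub>?A\<^esub> f"
      have g: "?g \<in> carrier ?A" using f by (auto intro: continuous_intros)
      have gx: "cmod (?g x) = (cmod (f x))\<^sup>2" for x by (simp add: norm_mult power2_eq_square)
      show "nrm ?A ?g \<le> (nrm ?A f)\<^sup>2"
        by (rule least) (simp only: gx power_mono[OF le[OF f] norm_ge_zero])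
      have "nrm ?A f \<le> sqrt (nrm ?A ?g)"
        by (rule least, rule real_le_rsqrt) (use le[OF g] in \<open>simp only: gx[symmetric]\<close>)
      then have "(nrm ?A f)\<^sup>2 \<le> (sqrt (nrm ?A ?g))\<^sup>2" by (rule power_mono) (rule nonneg[OF f])
      then show "(nrm ?A f)\<^sup>2 \<le> nrm ?A ?g" using nonneg[OF g] by simp
    qed
  next
    fix \<sigma> :: "nat \<Rightarrow> 'x \<Rightarrow> complex"
    assume r: "range \<sigma> \<subseteq> carrier ?A"
      and c: "\<forall>e>0. \<exists>N. \<forall>m\<ge>N. \<forall>n\<ge>N. nrm ?A (\<sigma> m \<ominus>\<^bsub>?A\<^esub> \<sigma> n) < e"
    from r have \<sigma>: "\<sigma> n \<in> carrier ?A" for n by blast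
    have "uniformly_Cauchy_on X \<sigma>"
      unfolding uniformly_Cauchy_on_def
    proof (intro allI impI)
      fix e :: real assume "e > 0"
      with c obtain N where N: "\<And>m n. m \<ge> N \<Longrightarrow> n \<ge> N \<Longrightarrow> nrm ?A (\<sigma> m \<ominus>\<^bsub>?A\<^esub> \<sigma> n) < e" by blast
      have "dist (\<sigma> m x) (\<sigma> n x) < e" if "m \<ge> N" "n \<ge> N" for m n x
      proof -
        have "\<sigma> m \<ominus>\<^bsub>?A\<^esub> \<sigma> n \<in> carrier ?A" by (rule minus_closed[OF \<sigma> \<sigma>])
        from le[OF this, of x] N[OF that] show ?thesis
          by (simp add: continuous_functions_minus[OF \<sigma>] dist_norm)
      qed
      then show "\<exists>M. \<forall>x\<in>X. \<forall>m\<ge>M. \<forall>n\<ge>M. dist (\<sigma> m x) (\<sigma> n x) < e" by blast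
    qed
    then have "uniformly_convergent_on X \<sigma>" by (rule Cauchy_uniformly_convergent)
    then obtain l where l: "uniform_limit X \<sigma> l sequentially" unfolding uniformly_convergent_on_def by blast
    have lc: "continuous_on X l"
      by (rule uniform_limit_theorem[OF always_eventually l]) (use \<sigma> in auto)
    define g where "g x = (if x \<in> X then l x else 0)" for x
    have "continuous_on X g" using lc by (simp add: g_def cong: continuous_on_cong)
    then have g: "g \<in> carrier ?A" by (simp add: g_def)
    have "(\<lambda>n. nrm ?A (\<sigma> n \<ominus>\<^bsub>?A\<^esub> g)) \<longlonglongrightarrow> 0"
    proof (rule LIMSEQ_I)
      fix e :: real assume e: "0 < e"
      then have "eventually (\<lambda>n. \<forall>x\<in>X. dist (\<sigma> n x) (l x) < e / 2) sequentially"
        using uniform_limitD[OF l, of "e/2"] by simp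
      then obtain N where N: "\<And>n x. n \<ge> N \<Longrightarrow> x \<in> X \<Longrightarrow> dist (\<sigma> n x) (l x) < e / 2"
        by (auto simp: eventually_sequentially)
      have "norm (nrm ?A (\<sigma> n \<ominus>\<^bsub>?A\<^esub> g) - 0) < e" if "n \<ge> N" for n
      proof -
        have "nrm ?A (\<sigma> n \<ominus>\<^bsub>?A\<^esub> g) \<le> e / 2"
          by (rule least) (use N[OF that] in \<open>auto simp: continuous_functions_minus[OF g] g_def dist_norm intro: less_imp_le\<close>)
        moreover have "0 \<le> nrm ?A (\<sigma> n \<ominus>\<^bsub>?A\<^esub> g)" by (rule nonneg[OF minus_closed[OF \<sigma> g]])
        ultimately show ?thesis using e by simp
      qed
      then show "\<exists>N. \<forall>n\<ge>N. norm (nrm ?A (\<sigma> n \<ominus>\<^bsub>?A\<^esub> g) - 0) < e" by blast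
    qed
    with g show "\<exists>x\<in>carrier ?A. (\<lambda>n. nrm ?A (\<sigma> n \<ominus>\<^bsub>?A\<^esub> x)) \<longlonglongrightarrow> 0" by blast
  qed (auto simp: algebra_simps)
  show ?thesis
    by unfold_locales (auto simp: fun_eq_iff)
qed

lemma dual_group_nonempty: "(\<lambda>x. 1) \<in> dual_group"
  by (simp add: dual_group_def)

text \<open>The dual group is a closed subset of a product of circles.\<close>
lemma compact_dual_group: "compact (dual_group :: ('g::ab_group_add \<Rightarrow> complex) set)"
proof -
  have "compactin (product_topology (\<lambda>x::'g. euclidean :: complex topology) UNIV) (PiE UNIV (\<lambda>x. sphere 0 1))"
    unfolding compactin_PiE by (simp add: compactin_euclidean_iff)
  then have comp: "compact (PiE (UNIV :: 'g set) (\<lambda>x. sphere (0::complex) 1))"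
    by (simp add: euclidean_product_topology compactin_euclidean_iff)
  have eq: "dual_group = (PiE UNIV (\<lambda>x. sphere 0 1)) \<inter> (\<Inter>x. \<Inter>y. {\<xi> :: 'g \<Rightarrow> complex. \<xi> (x + y) = \<xi> x * \<xi> y})"
    by (auto simp: dual_group_def PiE_iff)
  have cl: "closed (\<Inter>x. \<Inter>y. {\<xi> :: 'g \<Rightarrow> complex. \<xi> (x + y) = \<xi> x * \<xi> y})"
    by (intro closed_INT ballI closed_Collect_eq continuous_intros) auto
  show ?thesis unfolding eq by (rule compact_Int_closed[OF comp cl])
qed

lemma dual_group_not_empty [simp]: "dual_group \<noteq> {}"
  using dual_group_nonempty by blast

lemma C_dual_unital_cstar_algebra:
  "unital_cstar_algebra (C_dual :: (('g::ab_group_add \<Rightarrow> complex) \<Rightarrow> complex) cstar)"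
  by (rule continuous_functions_unital_cstar_algebra[OF compact_dual_group dual_group_not_empty])

lemmas C_dual_norm_le = sup_norm_le[OF dual_group_not_empty]
lemmas le_C_dual_norm = le_sup_norm[OF compact_dual_group dual_group_not_empty]

lemma dual_group_D:
  assumes "\<xi> \<in> dual_group"
  shows "\<xi> (x + y) = \<xi> x * \<xi> y" "cmod (\<xi> x) = 1" "\<xi> 0 = 1" "\<xi> (- x) = cnj (\<xi> x)"
proof -
  show 1: "\<xi> (x + y) = \<xi> x * \<xi> y" "cmod (\<xi> x) = 1" for x y using assms by (auto simp: dual_group_def)
  have "\<xi> 0 * \<xi> 0 = \<xi> 0 * 1" using 1(1)[of 0 0] by simp
  moreover have "\<xi> 0 \<noteq> 0" using 1(2)[of 0] by auto
  ultimately show z: "\<xi> 0 = 1" by (metis mult_cancel_left)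
  have "\<xi> (- x) * \<xi> x = 1" using 1(1)[of "-x" x] z by simp
  moreover have "cnj (\<xi> x) * \<xi> x = 1"
    using complex_norm_square[of "\<xi> x"] 1(2)[of x] by (simp add: mult.commute)
  ultimately show "\<xi> (- x) = cnj (\<xi> x)" using 1(2)[of x] by (metis mult_cancel_right norm_zero zero_neq_one)
qed

lemma dual_group_cnj: "\<xi> \<in> dual_group \<Longrightarrow> (\<lambda>x. cnj (\<xi> x)) \<in> dual_group"
  by (simp add: dual_group_def)

section \<open>The group algebra\<close>

lemma group_algebra_induct [case_names single add]:
  fixes c :: "'g \<Rightarrow>\<^sub>0 'b::comm_monoid_add"
  assumes single: "\<And>k v. P (Poly_Mapping.single k v)"
    and add: "\<And>f g. P f \<Longrightarrow> P g \<Longrightarrow> P (f + g)"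
  shows "P c"
proof (induction c rule: update_induct)
  case const
  show ?case using single[of undefined 0] by simp
next
  case (update f a b)
  have "Poly_Mapping.update a b f = Poly_Mapping.single a b + f"
    by (rule poly_mapping_eqI)
       (use update in \<open>auto simp: lookup_update lookup_add lookup_single when_def in_keys_iff\<close>)
  then show ?case using add single update by metis
qed

text \<open>Finitely supported functions on the group form the group algebra, with convolution as
  product. This is the Fourier transform of such a function at \<open>\<xi>\<close>.\<close>
definition char_sum :: "('g \<Rightarrow> complex) \<Rightarrow> ('g \<Rightarrow>\<^sub>0 complex) \<Rightarrow> complex" where
  "char_sum \<xi> c = (\<Sum>x\<in>Poly_Mapping.keys c. Poly_Mapping.lookup c x * \<xi> x)"

lemma char_sum_superset:
  assumes "finite K" "Poly_Mapping.keys c \<subseteq> K"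
  shows "char_sum \<xi> c = (\<Sum>x\<in>K. Poly_Mapping.lookup c x * \<xi> x)"
  unfolding char_sum_def by (rule sum.mono_neutral_left) (use assms in \<open>auto simp: in_keys_iff\<close>)

lemma char_sum_add: "char_sum \<xi> (c + d) = char_sum \<xi> c + char_sum \<xi> d"
proof -
  let ?K = "Poly_Mapping.keys c \<union> Poly_Mapping.keys d"
  have "Poly_Mapping.keys (c + d) \<subseteq> ?K" by (rule keys_add)
  then show ?thesis
    by (simp add: char_sum_superset[of ?K] lookup_add distrib_right sum.distrib)
qed

lemma char_sum_single [simp]: "char_sum \<xi> (Poly_Mapping.single k v) = v * \<xi> k"
  by (simp add: char_sum_def)

lemma char_sum_mult:
  assumes "\<And>x y. \<xi> (x + y) = \<xi> x * \<xi> y"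
  shows "char_sum \<xi> (c * d) = char_sum \<xi> c * char_sum \<xi> (d :: 'g::ab_group_add \<Rightarrow>\<^sub>0 complex)"
proof (induction c rule: group_algebra_induct)
  case (single k v)
  show ?case
    by (induction d rule: group_algebra_induct)
       (simp_all add: mult_single assms distrib_left char_sum_add)
qed (simp add: distrib_right char_sum_add)

lemma char_sum_one: "\<xi> 0 = 1 \<Longrightarrow> char_sum \<xi> 1 = 1"
  by (simp flip: single_one)

lemma char_sum_power:
  assumes "\<And>x y. \<xi> (x + y) = \<xi> x * \<xi> y" "\<xi> 0 = 1"
  shows "char_sum \<xi> (c ^ n) = char_sum \<xi> (c :: 'g::ab_group_add \<Rightarrow>\<^sub>0 complex) ^ n"
  by (induction n) (simp_all add: char_sum_one assms char_sum_mult[OF assms(1)])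

lemma lookup_times_single:
  "Poly_Mapping.lookup (Poly_Mapping.single a b * g) k = b * Poly_Mapping.lookup (g :: 'g::ab_group_add \<Rightarrow>\<^sub>0 complex) (k - a)"
proof (induction g rule: group_algebra_induct)
  case (single l v)
  have "(k = a + l) = (k - a = l)" by (auto simp: algebra_simps)
  then show ?case by (auto simp: mult_single lookup_single when_def)
qed (simp add: distrib_left lookup_add)

lemma lookup_times_superset:
  fixes f g :: "'g::ab_group_add \<Rightarrow>\<^sub>0 complex"
  assumes "finite K" "Poly_Mapping.keys f \<subseteq> K"
  shows "Poly_Mapping.lookup (f * g) k = (\<Sum>x\<in>K. Poly_Mapping.lookup f x * Poly_Mapping.lookup g (k - x))"
proof -
  have "Poly_Mapping.lookup (f * g) k = (\<Sum>x\<in>Poly_Mapping.keys f. Poly_Mapping.lookup f x * Poly_Mapping.lookup g (k - x))"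
  proof (induction f rule: group_algebra_induct)
    case (single a b)
    show ?case by (simp add: lookup_times_single)
  next
    case (add f f')
    let ?K = "Poly_Mapping.keys f \<union> Poly_Mapping.keys f'"
    have sup: "(\<Sum>x\<in>Poly_Mapping.keys h. Poly_Mapping.lookup h x * Poly_Mapping.lookup g (k - x)) = (\<Sum>x\<in>?K. Poly_Mapping.lookup h x * Poly_Mapping.lookup g (k - x))"
      if "Poly_Mapping.keys h \<subseteq> ?K" for h
      by (rule sum.mono_neutral_left) (use that in \<open>auto simp: in_keys_iff\<close>)
    have "Poly_Mapping.lookup ((f + f') * g) k =
        (\<Sum>x\<in>?K. Poly_Mapping.lookup f x * Poly_Mapping.lookup g (k - x)) +
        (\<Sum>x\<in>?K. Poly_Mapping.lookup f' x * Poly_Mapping.lookup g (k - x))"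
      using add sup[of f] sup[of f'] by (simp add: distrib_right lookup_add)
    also have "\<dots> = (\<Sum>x\<in>?K. Poly_Mapping.lookup (f + f') x * Poly_Mapping.lookup g (k - x))"
      by (simp add: lookup_add distrib_right sum.distrib)
    finally show ?case using sup[OF keys_add] by simp
  qed
  also have "\<dots> = (\<Sum>x\<in>K. Poly_Mapping.lookup f x * Poly_Mapping.lookup g (k - x))"
    by (rule sum.mono_neutral_left) (use assms in \<open>auto simp: in_keys_iff\<close>)
  finally show ?thesis .
qed

lemmas lookup_times_group = lookup_times_superset[OF finite_keys order_refl]

text \<open>The involution of the group algebra.\<close>
definition adj :: "('g::ab_group_add \<Rightarrow>\<^sub>0 complex) \<Rightarrow> 'g \<Rightarrow>\<^sub>0 complex" where
  "adj c = Abs_poly_mapping (\<lambda>x. cnj (Poly_Mapping.lookup c (- x)))"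

lemma lookup_adj [simp]: "Poly_Mapping.lookup (adj c) x = cnj (Poly_Mapping.lookup c (- x))"
proof -
  have "{x. cnj (Poly_Mapping.lookup c (- x)) \<noteq> 0} \<subseteq> uminus ` Poly_Mapping.keys c"
    by (force simp: in_keys_iff)
  then have "finite {x. cnj (Poly_Mapping.lookup c (- x)) \<noteq> 0}" by (rule finite_subset) simp
  then show ?thesis unfolding adj_def by (simp add: Abs_poly_mapping_inverse)
qed

lemma adj_adj [simp]: "adj (adj c) = c"
  by (rule poly_mapping_eqI) simp

lemma adj_add: "adj (c + d) = adj c + adj d"
  by (rule poly_mapping_eqI) (simp add: lookup_add)

lemma adj_single [simp]: "adj (Poly_Mapping.single k v) = Poly_Mapping.single (- k) (cnj v)"
proof (rule poly_mapping_eqI)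
  fix x have "(k = - x) = (- k = x)" by auto
  then show "Poly_Mapping.lookup (adj (Poly_Mapping.single k v)) x = Poly_Mapping.lookup (Poly_Mapping.single (- k) (cnj v)) x"
    by (auto simp: lookup_single when_def)
qed

lemma adj_mult: "adj (c * d) = adj c * adj d"
proof (induction c rule: group_algebra_induct)
  case (single k v)
  show ?case
    by (induction d rule: group_algebra_induct) (simp_all add: mult_single distrib_left adj_add)
qed (simp add: distrib_right adj_add)

lemma adj_one [simp]: "adj 1 = 1"
  by (simp flip: single_one)

lemma adj_power: "adj (c ^ n) = adj c ^ n"
  by (induction n) (simp_all add: adj_mult)

lemma char_sum_adj:
  assumes "\<xi> \<in> dual_group" shows "char_sum \<xi> (adj c) = cnj (char_sum \<xi> c)"
  by (induction c rule: group_algebra_induct)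
     (simp_all add: adj_add char_sum_add dual_group_D[OF assms])

definition coeff_norm :: "('g \<Rightarrow>\<^sub>0 complex) \<Rightarrow> real" where
  "coeff_norm c = L2_set (\<lambda>x. cmod (Poly_Mapping.lookup c x)) (Poly_Mapping.keys c)"

lemma coeff_norm_superset:
  assumes "finite K" "Poly_Mapping.keys c \<subseteq> K"
  shows "coeff_norm c = L2_set (\<lambda>x. cmod (Poly_Mapping.lookup c x)) K"
proof -
  have "(\<Sum>x\<in>Poly_Mapping.keys c. (cmod (Poly_Mapping.lookup c x))\<^sup>2) = (\<Sum>x\<in>K. (cmod (Poly_Mapping.lookup c x))\<^sup>2)"
    by (rule sum.mono_neutral_left) (use assms in \<open>auto simp: in_keys_iff\<close>)
  then show ?thesis by (simp add: coeff_norm_def L2_set_def)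
qed

lemma coeff_norm_nonneg: "0 \<le> coeff_norm c"
  by (simp add: coeff_norm_def L2_set_nonneg)

lemma cmod_lookup_le: "cmod (Poly_Mapping.lookup c x) \<le> coeff_norm c"
proof (cases "x \<in> Poly_Mapping.keys c")
  case True
  then show ?thesis unfolding coeff_norm_def by (intro member_le_L2_set) auto
next
  case False then show ?thesis by (simp add: in_keys_iff coeff_norm_nonneg)
qed

text \<open>The coefficient of \<open>f g\<^sup>*\<close> at \<open>0\<close> is the inner product of \<open>f\<close> and \<open>g\<close>.\<close>
lemma coeff_inner:
  "cmod (Poly_Mapping.lookup (f * adj g) 0) \<le> coeff_norm f * coeff_norm (g :: 'g::ab_group_add \<Rightarrow>\<^sub>0 complex)"
proof -
  let ?K = "Poly_Mapping.keys f \<union> Poly_Mapping.keys g"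
  have "Poly_Mapping.lookup (f * adj g) 0 = (\<Sum>x\<in>?K. Poly_Mapping.lookup f x * cnj (Poly_Mapping.lookup g x))"
    by (subst lookup_times_superset[of ?K]) auto
  then have "cmod (Poly_Mapping.lookup (f * adj g) 0) \<le> (\<Sum>x\<in>?K. cmod (Poly_Mapping.lookup f x * cnj (Poly_Mapping.lookup g x)))"
    by (simp only: norm_sum)
  also have "\<dots> = (\<Sum>x\<in>?K. \<bar>cmod (Poly_Mapping.lookup f x)\<bar> * \<bar>cmod (Poly_Mapping.lookup g x)\<bar>)" by (simp add: norm_mult)
  also have "\<dots> \<le> L2_set (\<lambda>x. cmod (Poly_Mapping.lookup f x)) ?K * L2_set (\<lambda>x. cmod (Poly_Mapping.lookup g x)) ?K"
    by (rule L2_set_mult_ineq)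
  also have "\<dots> = coeff_norm f * coeff_norm g"
    by (simp add: coeff_norm_superset[of ?K])
  finally show ?thesis .
qed

lemma coeff_norm_power2:
  "(coeff_norm f)\<^sup>2 = cmod (Poly_Mapping.lookup (f * adj f) (0 :: 'g::ab_group_add))"
proof -
  have "Poly_Mapping.lookup (f * adj f) 0 = (\<Sum>x\<in>Poly_Mapping.keys f. of_real ((cmod (Poly_Mapping.lookup f x))\<^sup>2))"
    unfolding lookup_times_group by (rule sum.cong) (simp_all add: complex_norm_square[symmetric])
  also have "\<dots> = of_real ((coeff_norm f)\<^sup>2)"
    by (simp add: coeff_norm_def L2_set_def sum_nonneg)
  finally show ?thesis by (simp add: norm_power)
qed

text \<open>Powers in the group algebra of an abelian group have supports of polynomial growth:
  an \<open>n\<close>-fold sum of elements of the support is determined by how often each of them occurs.\<close>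
lemma card_keys_power:
  "card (Poly_Mapping.keys (c ^ n)) \<le> (n + 1) ^ card (Poly_Mapping.keys (c :: 'g::ab_group_add \<Rightarrow>\<^sub>0 complex))"
proof -
  let ?K = "Poly_Mapping.keys c"
  define s where "s \<alpha> = (\<Sum>x\<in>?K. \<Sum>i<\<alpha> x. x)" for \<alpha> :: "'g \<Rightarrow> nat"
  have sub: "Poly_Mapping.keys (c ^ n) \<subseteq> s ` (?K \<rightarrow>\<^sub>E {..n})" for n
  proof (induction n)
    case 0
    have "s (\<lambda>x\<in>?K. 0) = 0" by (simp add: s_def)
    moreover have "s (\<lambda>x\<in>?K. 0) \<in> s ` (?K \<rightarrow>\<^sub>E {..0})" by (rule imageI) auto
    ultimately have "0 \<in> s ` (?K \<rightarrow>\<^sub>E {..0})" by (simp only:)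
    moreover have "Poly_Mapping.keys (c ^ 0) = {0}" by (simp flip: single_one)
    ultimately show ?case by (simp only: insert_subset empty_subsetI simp_thms)
  next
    case (Suc n)
    show ?case
    proof
      fix z assume "z \<in> Poly_Mapping.keys (c ^ Suc n)"
      then have "z \<in> {a + b |a b. a \<in> ?K \<and> b \<in> Poly_Mapping.keys (c ^ n)}"
        using keys_mult[of c "c ^ n"] by auto
      then obtain a b where ab: "z = a + b" "a \<in> ?K" "b \<in> Poly_Mapping.keys (c ^ n)" by blast
      then obtain \<alpha> where \<alpha>: "\<alpha> \<in> ?K \<rightarrow>\<^sub>E {..n}" "b = s \<alpha>" using Suc by blast
      let ?\<beta> = "\<alpha>(a := Suc (\<alpha> a))"
      have "?\<beta> \<in> ?K \<rightarrow>\<^sub>E {..Suc n}"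
      proof (rule PiE_I)
        show "?\<beta> x \<in> {..Suc n}" if "x \<in> ?K" for x
          using PiE_mem[OF \<alpha>(1) that] ab(2) PiE_mem[OF \<alpha>(1), of a] by auto
        show "?\<beta> x = undefined" if "x \<notin> ?K" for x
          using PiE_arb[OF \<alpha>(1) that] ab(2) that by auto
      qed
      moreover have "s ?\<beta> = a + s \<alpha>"
      proof -
        have "s ?\<beta> = (\<Sum>i<?\<beta> a. a) + (\<Sum>x\<in>?K - {a}. \<Sum>i<?\<beta> x. x)"
          unfolding s_def by (rule sum.remove) (use ab in auto)
        also have "(\<Sum>x\<in>?K - {a}. \<Sum>i<?\<beta> x. x) = (\<Sum>x\<in>?K - {a}. \<Sum>i<\<alpha> x. x)"
          by (rule sum.cong) auto
        also have "(\<Sum>i<?\<beta> a. a) = a + (\<Sum>i<\<alpha> a. a)" by (simp add: add.commute)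
        finally show ?thesis
          unfolding s_def by (subst (2) sum.remove[of _ a]) (use ab in \<open>auto simp: add.assoc\<close>)
      qed
      ultimately show "z \<in> s ` (?K \<rightarrow>\<^sub>E {..Suc n})" using ab \<alpha> by (metis image_eqI)
    qed
  qed
  have fin: "finite (?K \<rightarrow>\<^sub>E {..n})" by (rule finite_PiE) auto
  have "card (Poly_Mapping.keys (c ^ n)) \<le> card (s ` (?K \<rightarrow>\<^sub>E {..n}))"
    by (rule card_mono) (use fin sub in auto)
  also have "\<dots> \<le> card (?K \<rightarrow>\<^sub>E {..n})" by (rule card_image_le[OF fin])
  also have "\<dots> = (n + 1) ^ card ?K" by (simp add: card_PiE)
  finally show ?thesis .
qed

lemma card_keys_times:
  "card (Poly_Mapping.keys (c * f)) \<le> card (Poly_Mapping.keys c) * card (Poly_Mapping.keys (f :: 'g::ab_group_add \<Rightarrow>\<^sub>0 complex))"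
proof -
  let ?S = "(\<lambda>(a, b). a + b) ` (Poly_Mapping.keys c \<times> Poly_Mapping.keys f)"
  have "Poly_Mapping.keys (c * f) \<subseteq> ?S" using keys_mult[of c f] by auto
  then have "card (Poly_Mapping.keys (c * f)) \<le> card ?S" by (intro card_mono) auto
  also have "\<dots> \<le> card (Poly_Mapping.keys c \<times> Poly_Mapping.keys f)" by (rule card_image_le) auto
  finally show ?thesis by (simp add: card_cartesian_product)
qed

text \<open>Polynomial factors disappear when roots of high order are taken. The exponents are
  powers of two because the estimates below are obtained by repeated squaring.\<close>
lemma le_of_polynomial_growth:
  fixes a b :: real
  assumes a: "0 \<le> a" and b: "0 \<le> b"
    and growth: "\<And>k. a ^ (2 ^ k) \<le> D * (real (2 ^ k) + 1) ^ m * b ^ (2 ^ k)"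
  shows "a \<le> b"
proof (rule ccontr)
  assume "\<not> a \<le> b"
  then have ab: "b < a" by simp
  define q where "q = b / a"
  have q: "0 \<le> q" "q < 1" using a b ab by (auto simp: q_def)
  have lim: "(\<lambda>n. D * (real n + 1) ^ m * q ^ n) \<longlonglongrightarrow> 0"
  proof (cases "q = 0")
    case True
    have "eventually (\<lambda>n. 0 = D * (real n + 1) ^ m * q ^ n) sequentially"
      by (rule eventually_mono[OF eventually_gt_at_top[of 0]]) (use True in simp)
    then show ?thesis by (rule Lim_transform_eventually[OF tendsto_const])
  next
    case False
    then have "0 < q" using q by simp
    with q(2) show ?thesis by real_asymp
  qed
  have "filterlim (\<lambda>k::nat. 2 ^ k :: nat) at_top sequentially"
    by (rule filterlim_subseq) (simp add: strict_mono_def)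
  from filterlim_compose[OF lim this]
  have "(\<lambda>k. D * (real (2 ^ k) + 1) ^ m * q ^ (2 ^ k)) \<longlonglongrightarrow> 0" .
  then have "eventually (\<lambda>k. D * (real (2 ^ k) + 1) ^ m * q ^ (2 ^ k) < 1) sequentially"
    by (rule order_tendstoD) simp
  then obtain k where k: "D * (real (2 ^ k) + 1) ^ m * q ^ (2 ^ k) < 1"
    by (auto simp: eventually_sequentially)
  have "0 < a" using b ab by simp
  then have "0 < a ^ (2 ^ k)" by simp
  have "b ^ (2 ^ k) = q ^ (2 ^ k) * a ^ (2 ^ k)"
    using \<open>0 < a\<close> by (simp add: q_def power_divide)
  then have "a ^ (2 ^ k) \<le> (D * (real (2 ^ k) + 1) ^ m * q ^ (2 ^ k)) * a ^ (2 ^ k)"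
    using growth[of k] by (simp add: mult.assoc)
  also have "\<dots> < 1 * a ^ (2 ^ k)" using k \<open>0 < a ^ (2 ^ k)\<close> by (rule mult_strict_right_mono)
  finally show False by simp
qed

lemma cmod_char_sum_le: 
  assumes "\<And>x. cmod (\<xi> x) = 1"
  shows "cmod (char_sum \<xi> c) \<le> real (card (Poly_Mapping.keys c)) * coeff_norm c"
proof -
  have "cmod (char_sum \<xi> c) \<le> (\<Sum>x\<in>Poly_Mapping.keys c. cmod (Poly_Mapping.lookup c x * \<xi> x))"
    unfolding char_sum_def by (rule norm_sum)
  also have "\<dots> \<le> (\<Sum>x\<in>Poly_Mapping.keys c. coeff_norm c)"
    by (rule sum_mono) (simp add: norm_mult assms cmod_lookup_le)
  finally show ?thesis by simp
qed

text \<open>The powers of the Fourier coefficient are bounded by the sums of the coefficients of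
  \<open>c\<^sup>n\<close>, of which there are only polynomially many.\<close>
lemma char_sum_le_of_powers:
  assumes \<xi>: "\<xi> \<in> dual_group" and K: "0 \<le> K" and le: "\<And>n. coeff_norm (c ^ n) \<le> K ^ n"
  shows "cmod (char_sum \<xi> (c :: 'g::ab_group_add \<Rightarrow>\<^sub>0 complex)) \<le> K"
proof (rule le_of_polynomial_growth[where D = 1])
  fix k :: nat
  let ?n = "2 ^ k :: nat"
  have "cmod (char_sum \<xi> c) ^ ?n = cmod (char_sum \<xi> (c ^ ?n))"
    using char_sum_power[of \<xi> c ?n] dual_group_D[OF \<xi>] by (simp add: norm_power)
  also have "\<dots> \<le> real (card (Poly_Mapping.keys (c ^ ?n))) * coeff_norm (c ^ ?n)"
    by (rule cmod_char_sum_le) (rule dual_group_D(2)[OF \<xi>])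
  also have "\<dots> \<le> real ((?n + 1) ^ card (Poly_Mapping.keys c)) * K ^ ?n"
    using card_keys_power[of c ?n] by (intro mult_mono le) (simp_all add: coeff_norm_nonneg del: of_nat_power)
  finally show "cmod (char_sum \<xi> c) ^ ?n \<le> 1 * (real ?n + 1) ^ card (Poly_Mapping.keys c) * K ^ ?n"
    by (simp add: add.commute)
qed (use K in auto)

section \<open>Convolution operators and the supremum over characters\<close>

text \<open>On \<open>\<ell>\<^sup>2\<close> of the group, convolution by \<open>c\<close> is bounded by the supremum \<open>s\<close> of its Fourier
  transform. Put \<open>d = c\<^sup>* c\<close>. By the Cauchy-Schwarz inequality, \<open>\<parallel>cf\<parallel>\<close> larger than \<open>s\<parallel>f\<parallel>\<close> makes
  \<open>\<parallel>d\<^sup>n f\<parallel>\<close> grow faster than \<open>s\<close> to the power \<open>2n\<close>; but \<open>d\<^sup>n f\<close> has polynomially many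
  coefficients, each of them bounded by a constant times that power. The bound of coefficients by
  the supremum over characters is proved below for ordered groups and enters as a hypothesis.\<close>
lemma coeff_norm_mult_le:
  fixes c f :: "'g::ab_group_add \<Rightarrow>\<^sub>0 complex"
  assumes s: "0 \<le> s" "\<And>\<xi>. \<xi> \<in> dual_group \<Longrightarrow> cmod (char_sum \<xi> c) \<le> s"
    and coeff: "\<And>(h :: 'g \<Rightarrow>\<^sub>0 complex) K x. (\<And>\<xi>. \<xi> \<in> dual_group \<Longrightarrow> cmod (char_sum \<xi> h) \<le> K) \<Longrightarrow>
      cmod (Poly_Mapping.lookup h x) \<le> K"
  shows "coeff_norm (c * f) \<le> s * coeff_norm f"
proof (cases "coeff_norm f = 0")
  case True
  have "f = 0"
  proof (rule poly_mapping_eqI)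
    fix x show "Poly_Mapping.lookup f x = Poly_Mapping.lookup 0 x"
      using cmod_lookup_le[of f x] True by simp
  qed
  then show ?thesis by (simp add: coeff_norm_def)
next
  case False
  then have f: "0 < coeff_norm f" using coeff_norm_nonneg[of f] by simp
  define d where "d = adj c * c"
  have adj_d: "adj d = d" by (simp add: d_def adj_mult mult.commute)
  define a where "a = (coeff_norm (c * f) / coeff_norm f)\<^sup>2"
  have a0: "0 \<le> a" by (simp add: a_def)
  have base: "a * coeff_norm f \<le> coeff_norm (d * f)"
  proof -
    have "(coeff_norm (c * f))\<^sup>2 = cmod (Poly_Mapping.lookup ((d * f) * adj f) 0)"
      unfolding coeff_norm_power2 by (simp add: d_def adj_mult ac_simps)
    also have "\<dots> \<le> coeff_norm (d * f) * coeff_norm f" by (rule coeff_inner)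
    finally show ?thesis using f by (simp add: a_def power_divide power2_eq_square field_simps)
  qed
  have double: "(coeff_norm (d ^ n * f))\<^sup>2 \<le> coeff_norm (d ^ (2 * n) * f) * coeff_norm f" for n
  proof -
    have "d ^ (2 * n) = d ^ n * d ^ n" by (simp add: mult_2 power_add)
    then have "(coeff_norm (d ^ n * f))\<^sup>2 = cmod (Poly_Mapping.lookup ((d ^ (2 * n) * f) * adj f) 0)"
      unfolding coeff_norm_power2 adj_mult adj_power adj_d by (simp only: ac_simps)
    also have "\<dots> \<le> coeff_norm (d ^ (2 * n) * f) * coeff_norm f" by (rule coeff_inner)
    finally show ?thesis .
  qed
  have lower: "a ^ (2 ^ k) * coeff_norm f \<le> coeff_norm (d ^ (2 ^ k) * f)" for k
  proof (induction k)
    case 0 show ?case using base by simp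
  next
    case (Suc k)
    have "(a ^ (2 ^ k) * coeff_norm f)\<^sup>2 \<le> (coeff_norm (d ^ (2 ^ k) * f))\<^sup>2"
      by (rule power_mono[OF Suc]) (simp add: a0 coeff_norm_nonneg)
    also have "\<dots> \<le> coeff_norm (d ^ (2 ^ Suc k) * f) * coeff_norm f" using double[of "2 ^ k"] by simp
    finally have "(a ^ (2 ^ Suc k) * coeff_norm f) * coeff_norm f \<le> coeff_norm (d ^ (2 ^ Suc k) * f) * coeff_norm f"
      by (simp add: power2_eq_square power_mult_distrib power_add mult_2 ac_simps)
    then show ?case using f by (rule mult_right_le_imp_le)
  qed
  define C where "C = (\<Sum>x\<in>Poly_Mapping.keys f. cmod (Poly_Mapping.lookup f x))"
  have C0: "0 \<le> C" by (simp add: C_def sum_nonneg)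
  have coef: "cmod (Poly_Mapping.lookup (d ^ n * f) x) \<le> (s\<^sup>2) ^ n * C" for n x
  proof (rule coeff)
    fix \<xi> :: "'g \<Rightarrow> complex" assume \<xi>: "\<xi> \<in> dual_group"
    note D = dual_group_D[OF \<xi>]
    have "cmod (char_sum \<xi> f) \<le> C"
      unfolding char_sum_def C_def by (rule order_trans[OF norm_sum]) (simp add: norm_mult D)
    moreover have "cmod (char_sum \<xi> d) \<le> s\<^sup>2"
    proof -
      have "cmod (char_sum \<xi> d) = (cmod (char_sum \<xi> c))\<^sup>2"
        by (simp add: d_def char_sum_mult[OF D(1)] char_sum_adj[OF \<xi>] norm_mult power2_eq_square)
      also have "\<dots> \<le> s\<^sup>2" by (rule power_mono[OF s(2)[OF \<xi>] norm_ge_zero])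
      finally show ?thesis .
    qed
    ultimately show "cmod (char_sum \<xi> (d ^ n * f)) \<le> (s\<^sup>2) ^ n * C"
      unfolding char_sum_mult[OF D(1)] char_sum_power[OF D(1,3)] norm_mult norm_power
      by (intro mult_mono power_mono) auto
  qed
  define E where "E = real (card (Poly_Mapping.keys f)) * C\<^sup>2 / (coeff_norm f)\<^sup>2"
  have "a\<^sup>2 \<le> s ^ 4"
  proof (rule le_of_polynomial_growth[where D = E and m = "card (Poly_Mapping.keys d)"])
    fix k :: nat
    let ?n = "2 ^ k :: nat"
    let ?K = "Poly_Mapping.keys (d ^ ?n * f)"
    have "(a ^ ?n * coeff_norm f)\<^sup>2 \<le> (coeff_norm (d ^ ?n * f))\<^sup>2"
      by (rule power_mono[OF lower]) (simp add: a0 coeff_norm_nonneg)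
    also have "\<dots> = (\<Sum>x\<in>?K. (cmod (Poly_Mapping.lookup (d ^ ?n * f) x))\<^sup>2)"
      by (simp add: coeff_norm_def L2_set_def sum_nonneg)
    also have "\<dots> \<le> (\<Sum>x\<in>?K. ((s\<^sup>2) ^ ?n * C)\<^sup>2)"
      by (intro sum_mono power_mono coef) simp
    also have "\<dots> = real (card ?K) * ((s\<^sup>2) ^ ?n * C)\<^sup>2" by simp
    also have "\<dots> \<le> ((real ?n + 1) ^ card (Poly_Mapping.keys d) * real (card (Poly_Mapping.keys f))) * ((s\<^sup>2) ^ ?n * C)\<^sup>2"
    proof (rule mult_right_mono)
      have "card ?K \<le> (?n + 1) ^ card (Poly_Mapping.keys d) * card (Poly_Mapping.keys f)"
        by (rule order_trans[OF card_keys_times mult_right_mono[OF card_keys_power]]) simp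
      then have "real (card ?K) \<le> real ((?n + 1) ^ card (Poly_Mapping.keys d) * card (Poly_Mapping.keys f))"
        by (rule of_nat_mono)
      also have "\<dots> = (real ?n + 1) ^ card (Poly_Mapping.keys d) * real (card (Poly_Mapping.keys f))"
        by (simp only: of_nat_mult of_nat_power of_nat_add of_nat_1)
      finally show "real (card ?K) \<le> (real ?n + 1) ^ card (Poly_Mapping.keys d) * real (card (Poly_Mapping.keys f))" .
    qed simp
    finally have le: "(a ^ ?n * coeff_norm f)\<^sup>2
      \<le> ((real ?n + 1) ^ card (Poly_Mapping.keys d) * real (card (Poly_Mapping.keys f))) * ((s\<^sup>2) ^ ?n * C)\<^sup>2" .
    have p1: "(a ^ ?n * coeff_norm f)\<^sup>2 = (a\<^sup>2) ^ ?n * (coeff_norm f)\<^sup>2"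
      by (simp add: power_mult_distrib power_mult[symmetric] mult.commute)
    have p2: "((s\<^sup>2) ^ ?n * C)\<^sup>2 = (s ^ 4) ^ ?n * C\<^sup>2"
      by (simp add: power_mult_distrib power_mult[symmetric] mult.commute)
    have f2: "0 < (coeff_norm f)\<^sup>2" using f by simp
    have "(a\<^sup>2) ^ ?n \<le> (((real ?n + 1) ^ card (Poly_Mapping.keys d) * real (card (Poly_Mapping.keys f))) * ((s ^ 4) ^ ?n * C\<^sup>2)) / (coeff_norm f)\<^sup>2"
      using le unfolding p1 p2 pos_le_divide_eq[OF f2] .
    then show "(a\<^sup>2) ^ ?n \<le> E * (real ?n + 1) ^ card (Poly_Mapping.keys d) * (s ^ 4) ^ ?n"
      by (simp add: E_def ac_simps)
  qed (use s in auto)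
  then have "a\<^sup>2 \<le> (s\<^sup>2)\<^sup>2" by (simp add: power_mult[symmetric])
  then have "a \<le> s\<^sup>2" by (rule power2_le_imp_le) simp
  then have "coeff_norm (c * f) / coeff_norm f \<le> s"
    unfolding a_def by (rule power2_le_imp_le) (rule s(1))
  then show ?thesis using f by (simp add: divide_le_eq)
qed

definition nat_mult :: "nat \<Rightarrow> 'g::ab_group_add \<Rightarrow> 'g" where
  "nat_mult n x = (\<Sum>i<n. x)"

lemma nat_mult_simps [simp]: "nat_mult 0 x = 0" "nat_mult (Suc n) x = x + nat_mult n x"
  by (simp_all add: nat_mult_def add.commute)

lemma nat_mult_add: "nat_mult (m + n) x = nat_mult m x + nat_mult n x"
  by (induction m) (simp_all add: ac_simps)

lemma nat_mult_mult: "nat_mult (m * n) x = nat_mult m (nat_mult n x)"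
  by (induction m) (simp_all add: nat_mult_add)

lemma nat_mult_diff: "n \<le> m \<Longrightarrow> nat_mult m x - nat_mult n x = nat_mult (m - n) x"
  using nat_mult_add[of "m - n" n x] by simp

lemma nat_mult_eq_0:
  fixes x :: "'g::linordered_ab_group_add"
  assumes "x \<noteq> 0" "nat_mult n x = 0" shows "n = 0"
proof -
  have pos: "0 < nat_mult (Suc n) y" if "0 < y" for y :: 'g and n
    by (induction n) (use that in \<open>auto intro: add_pos_pos\<close>)
  have neg: "nat_mult n (- y) = - nat_mult n y" for y :: 'g and n
    by (induction n) simp_all
  show ?thesis
  proof (cases n)
    case (Suc k)
    show ?thesis
    proof (cases "0 < x")
      case True then show ?thesis using pos[OF True, of k] assms Suc by simp
    next
      case False
      then have "0 < - x" using assms(1) by simp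
      from pos[OF this, of k] have "0 < - nat_mult (Suc k) x" by (simp only: neg)
      then show ?thesis using assms(2) unfolding Suc by (simp del: nat_mult_simps)
    qed
  qed simp
qed

text \<open>Graphs of characters of subgroups. The last clause makes the graph single-valued.\<close>
definition partial_character :: "('g::ab_group_add \<times> complex) set \<Rightarrow> bool" where
  "partial_character G \<longleftrightarrow> (0, 1) \<in> G \<and>
    (\<forall>x a y b. (x, a) \<in> G \<longrightarrow> (y, b) \<in> G \<longrightarrow> (x + y, a * b) \<in> G) \<and>
    (\<forall>x a. (x, a) \<in> G \<longrightarrow> (- x, cnj a) \<in> G) \<and>
    (\<forall>x a. (x, a) \<in> G \<longrightarrow> cmod a = 1) \<and> (\<forall>a. (0, a) \<in> G \<longrightarrow> a = 1)"

lemma unit_mult_cnj: "cmod w = 1 \<Longrightarrow> w * cnj w = 1"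
  using complex_norm_square[of w] by simp

lemma partial_characterD:
  assumes "partial_character G"
  shows "(0, 1) \<in> G" "(x, a) \<in> G \<Longrightarrow> (y, b) \<in> G \<Longrightarrow> (x + y, a * b) \<in> G"
    "(x, a) \<in> G \<Longrightarrow> (- x, cnj a) \<in> G" "(x, a) \<in> G \<Longrightarrow> cmod a = 1" "(0, a) \<in> G \<Longrightarrow> a = 1"
  using assms by (simp_all add: partial_character_def)

lemma partial_character_unique:
  assumes G: "partial_character G" and "(x, a) \<in> G" "(x, b) \<in> G" shows "a = b"
proof -
  have "(x + - x, a * cnj b) \<in> G" by (intro partial_characterD(2,3)[OF G] assms)
  then have "a * cnj b = 1" using partial_characterD(5)[OF G] by simp
  moreover have "b * cnj b = 1" by (rule unit_mult_cnj[OF partial_characterD(4)[OF G assms(3)]])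
  ultimately show ?thesis by (metis mult_cancel_right mult_zero_right zero_neq_one)
qed

lemma partial_character_nat_mult:
  assumes G: "partial_character G" and "(x, a) \<in> G" shows "(nat_mult n x, a ^ n) \<in> G"
  by (induction n) (use partial_characterD[OF G] assms(2) in auto)

text \<open>Elements of the subgroup generated by \<open>x\<close> and the domain are written with differences of
  natural multiples of \<open>x\<close>, which avoids integer multiples.\<close>
lemma partial_character_adjoin:
  fixes G :: "('g::ab_group_add \<times> complex) set"
  assumes G: "partial_character G" and w: "cmod w = 1"
    and compat: "\<And>k a. (nat_mult k x, a) \<in> G \<Longrightarrow> a = w ^ k"
  shows "\<exists>G'. partial_character G' \<and> G \<subseteq> G' \<and> (x, w) \<in> G'"
proof -
  define G' where "G' = {(h + nat_mult m x - nat_mult n x, a * w ^ m * cnj w ^ n) | h a m n. (h, a) \<in> G}"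
  have G'I: "(z, b) \<in> G'" if "(h, a) \<in> G" "z = h + nat_mult m x - nat_mult n x" "b = a * w ^ m * cnj w ^ n" for z b h a m n
    using that unfolding G'_def by blast
  have ww: "w ^ m * cnj w ^ m = 1" for m
    using unit_mult_cnj[OF w] by (simp flip: power_mult_distrib)
  have compat': "a = w ^ n * cnj w ^ m" if a: "(nat_mult n x - nat_mult m x, a) \<in> G" for a m n
  proof (cases "m \<le> n")
    case True
    then have "a = w ^ (n - m)" using compat a by (simp add: nat_mult_diff)
    also have "\<dots> = w ^ (n - m) * (w ^ m * cnj w ^ m)" by (simp add: ww)
    also have "\<dots> = w ^ n * cnj w ^ m" using True by (simp flip: mult.assoc power_add)
    finally show ?thesis .
  next
    case False
    have "(- (nat_mult n x - nat_mult m x), cnj a) \<in> G" by (rule partial_characterD(3)[OF G a])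
    then have "(nat_mult (m - n) x, cnj a) \<in> G" using nat_mult_diff[of n m x] False by simp
    then have "cnj a = w ^ (m - n)" by (rule compat)
    then have "a = cnj w ^ (m - n)" by (metis complex_cnj_cnj complex_cnj_power)
    also have "\<dots> = cnj w ^ (m - n) * (w ^ n * cnj w ^ n)" by (simp add: ww)
    also have "\<dots> = w ^ n * cnj w ^ (m - n + n)" by (simp add: power_add ac_simps)
    also have "\<dots> = w ^ n * cnj w ^ m" using False by simp
    finally show ?thesis .
  qed
  have "partial_character G'"
    unfolding partial_character_def
  proof (intro conjI allI impI)
    show "(0, 1) \<in> G'" by (rule G'I[OF partial_characterD(1)[OF G], of _ 0 0]) simp_all
  next
    fix y b z c assume "(y, b) \<in> G'" "(z, c) \<in> G'"
    then obtain h a m n h' a' m' n' where *: "(h, a) \<in> G" "y = h + nat_mult m x - nat_mult n x"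
      "b = a * w ^ m * cnj w ^ n" "(h', a') \<in> G" "z = h' + nat_mult m' x - nat_mult n' x"
      "c = a' * w ^ m' * cnj w ^ n'" unfolding G'_def by blast
    show "(y + z, b * c) \<in> G'"
      by (rule G'I[OF partial_characterD(2)[OF G *(1,4)], of _ "m + m'" "n + n'"])
         (simp_all add: * nat_mult_add power_add ac_simps)
  next
    fix y b assume "(y, b) \<in> G'"
    then obtain h a m n where *: "(h, a) \<in> G" "y = h + nat_mult m x - nat_mult n x"
      "b = a * w ^ m * cnj w ^ n" unfolding G'_def by blast
    show "(- y, cnj b) \<in> G'"
      by (rule G'I[OF partial_characterD(3)[OF G *(1)], of _ n m]) (simp_all add: *)
    show "cmod b = 1"
      using partial_characterD(4)[OF G *(1)] w by (simp add: * norm_mult norm_power)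
  next
    fix b assume "(0, b) \<in> G'"
    then obtain h a m n where *: "(h, a) \<in> G" "0 = h + nat_mult m x - nat_mult n x"
      "b = a * w ^ m * cnj w ^ n" unfolding G'_def by blast
    have "h = nat_mult n x - nat_mult m x" using *(2) by (simp add: algebra_simps)
    then have "a = w ^ n * cnj w ^ m" using compat' *(1) by simp
    then have "b = (w ^ n * cnj w ^ n) * (w ^ m * cnj w ^ m)" by (simp add: * ac_simps)
    then show "b = 1" by (simp add: ww)
  qed
  moreover have "G \<subseteq> G'"
  proof (clarify)
    fix h a assume "(h, a) \<in> G"
    then show "(h, a) \<in> G'" by (rule G'I[of _ _ _ 0 0]) simp_all
  qed
  moreover have "(x, w) \<in> G'"
    by (rule G'I[OF partial_characterD(1)[OF G], of _ 1 0]) simp_all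
  ultimately show ?thesis by blast
qed

text \<open>The circle is divisible: if \<open>d\<close> is the order of \<open>x\<close> modulo the domain, then the value at
  \<open>x\<close> may be any \<open>d\<close>-th root of the value at \<open>dx\<close>; if no positive multiple of \<open>x\<close> lies in the
  domain, the value \<open>1\<close> will do.\<close>
lemma partial_character_extend:
  fixes G :: "('g::ab_group_add \<times> complex) set"
  assumes G: "partial_character G"
  shows "\<exists>w G'. partial_character G' \<and> G \<subseteq> G' \<and> (x, w) \<in> G'"
proof -
  have "\<exists>w. cmod w = 1 \<and> (\<forall>k a. (nat_mult k x, a) \<in> G \<longrightarrow> a = w ^ k)"
  proof (cases "\<exists>k>0. \<exists>a. (nat_mult k x, a) \<in> G")
    case False
    have "a = 1 ^ k" if "(nat_mult k x, a) \<in> G" for k a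
    proof (cases "k = 0")
      case True then show ?thesis using that partial_characterD(5)[OF G] by simp
    next
      case False
      then show ?thesis using that \<open>\<not> (\<exists>k>0. \<exists>a. (nat_mult k x, a) \<in> G)\<close> by blast
    qed
    then show ?thesis by (intro exI[of _ 1]) simp
  next
    case True
    define d where "d = (LEAST k. 0 < k \<and> (\<exists>a. (nat_mult k x, a) \<in> G))"
    have d: "0 < d" "\<exists>a. (nat_mult d x, a) \<in> G" using LeastI_ex[OF True] by (simp_all add: d_def)
    have least: "d \<le> k" if "0 < k" "(nat_mult k x, a) \<in> G" for k a
      unfolding d_def by (rule Least_le) (use that in blast)
    obtain a0 where a0: "(nat_mult d x, a0) \<in> G" using d(2) by blast
    have n0: "cmod a0 = 1" by (rule partial_characterD(4)[OF G a0])
    define w where "w = cis (Arg a0 / real d)"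
    have wd: "w ^ d = a0"
    proof -
      have "w ^ d = cis (Arg a0)" unfolding w_def Complex.DeMoivre using d(1) by simp
      also have "\<dots> = a0" using n0 cis_Arg[of a0] by (cases "a0 = 0") (simp_all add: sgn_eq)
      finally show ?thesis .
    qed
    have "a = w ^ k" if ka: "(nat_mult k x, a) \<in> G" for k a
    proof -
      define q r where "q = k div d" and "r = k mod d"
      have k: "k = q * d + r" by (simp add: q_def r_def)
      have q: "(nat_mult (q * d) x, a0 ^ q) \<in> G"
        using partial_character_nat_mult[OF G a0, of q] by (simp add: nat_mult_mult)
      have "(nat_mult k x + - nat_mult (q * d) x, a * cnj (a0 ^ q)) \<in> G"
        by (intro partial_characterD(2,3)[OF G] ka q)
      then have "(nat_mult r x, a * cnj (a0 ^ q)) \<in> G" by (simp add: k nat_mult_add)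
      then have "d \<le> r" if "0 < r" using least[OF that] by blast
      moreover have "r < d" using d(1) by (simp add: r_def)
      ultimately have "r = 0" by (cases "r = 0") auto
      then have "(nat_mult k x, a0 ^ q) \<in> G" using q k by simp
      then have "a = a0 ^ q" using partial_character_unique[OF G ka] by blast
      also have "\<dots> = w ^ k" using \<open>r = 0\<close> k by (simp add: wd[symmetric] power_mult[symmetric] mult.commute)
      finally show ?thesis .
    qed
    then show ?thesis by (intro exI[of _ w]) (simp add: w_def)
  qed
  then obtain w where "cmod w = 1" "\<And>k a. (nat_mult k x, a) \<in> G \<Longrightarrow> a = w ^ k" by blast
  from partial_character_adjoin[OF G this] show ?thesis by blast
qed

lemma partial_character_extends_to_dual:
  fixes G :: "('g::ab_group_add \<times> complex) set"
  assumes G: "partial_character G" and yb: "(y, b) \<in> G"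
  shows "\<exists>\<xi>\<in>dual_group. \<xi> y = b"
proof -
  let ?\<G> = "{G :: ('g \<times> complex) set. partial_character G \<and> (y, b) \<in> G}"
  have "\<exists>M\<in>?\<G>. \<forall>X\<in>?\<G>. M \<subseteq> X \<longrightarrow> X = M"
  proof (rule subset_Zorn_nonempty)
    show "?\<G> \<noteq> {}" using G yb by blast
    fix C assume C: "C \<noteq> {}" "subset.chain ?\<G> C"
    then have mem: "partial_character X" "(y, b) \<in> X" if "X \<in> C" for X
      using that by (auto simp: subset_chain_def)
    have two: "\<exists>X\<in>C. p \<in> X \<and> q \<in> X" if pq: "p \<in> \<Union>C" "q \<in> \<Union>C" for p q
    proof -
      obtain X Y where XY: "X \<in> C" "p \<in> X" "Y \<in> C" "q \<in> Y" using pq by blast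
      then have "X \<subseteq> Y \<or> Y \<subseteq> X" using C(2) by (simp add: subset_chain_def)
      with XY show ?thesis by blast
    qed
    have "partial_character (\<Union>C)"
      unfolding partial_character_def
    proof (intro conjI allI impI)
      show "(0, 1) \<in> \<Union>C" using C(1) mem(1) partial_characterD(1) by blast
      show "(x + z, a * c) \<in> \<Union>C" if "(x, a) \<in> \<Union>C" "(z, c) \<in> \<Union>C" for x a z c
      proof -
        note ac = that
        obtain X where X: "X \<in> C" "(x, a) \<in> X" "(z, c) \<in> X" using two[OF ac] by blast
        from partial_characterD(2)[OF mem(1)[OF X(1)] X(2,3)] X(1) show ?thesis by blast
      qed
      show "(- x, cnj a) \<in> \<Union>C" if "(x, a) \<in> \<Union>C" for x a
        using that mem(1) partial_characterD(3) by blast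
      show "cmod a = 1" if "(x, a) \<in> \<Union>C" for x a
        using that mem(1) partial_characterD(4) by blast
      show "a = 1" if "(0, a) \<in> \<Union>C" for a
        using that mem(1) partial_characterD(5) by blast
    qed
    then show "\<Union>C \<in> ?\<G>" using C(1) mem(2) by blast
  qed
  then obtain M where M: "partial_character M" "(y, b) \<in> M"
    and max: "\<And>X. partial_character X \<Longrightarrow> (y, b) \<in> X \<Longrightarrow> M \<subseteq> X \<Longrightarrow> X = M" by blast
  have total: "\<exists>w. (x, w) \<in> M" for x
  proof -
    obtain w X where X: "partial_character X" "M \<subseteq> X" "(x, w) \<in> X"
      using partial_character_extend[OF M(1)] by blast
    then have "X = M" using max M(2) by blast
    with X(3) show ?thesis by blast
  qed
  define \<xi> where "\<xi> x = (SOME w. (x, w) \<in> M)" for x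
  have \<xi>: "(x, \<xi> x) \<in> M" for x unfolding \<xi>_def by (rule someI_ex[OF total])
  have "\<xi> (x + z) = \<xi> x * \<xi> z" for x z
    by (rule partial_character_unique[OF M(1) \<xi> partial_characterD(2)[OF M(1) \<xi> \<xi>]])
  moreover have "cmod (\<xi> x) = 1" for x by (rule partial_characterD(4)[OF M(1) \<xi>])
  moreover have "\<xi> y = b" by (rule partial_character_unique[OF M(1) \<xi> M(2)])
  ultimately show ?thesis unfolding dual_group_def by blast
qed

text \<open>An ordered group has no torsion, so \<open>y \<mapsto> -1\<close> defines a character of the subgroup
  generated by \<open>y\<close>.\<close>
lemma exists_character_minus_one:
  fixes y :: "'g::linordered_ab_group_add"
  assumes y: "y \<noteq> 0" shows "\<exists>\<xi>\<in>dual_group. \<xi> y = - 1"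
proof -
  have triv: "partial_character {(0 :: 'g, 1)}" by (simp add: partial_character_def)
  have "a = (- 1) ^ k" if "(nat_mult k y, a) \<in> {(0, 1)}" for k a
  proof -
    have "k = 0" using that nat_mult_eq_0[OF y, of k] by simp
    then show ?thesis using that by simp
  qed
  from partial_character_adjoin[OF triv _ this] obtain G where "partial_character G" "(y, - 1) \<in> G"
    by auto
  then show ?thesis by (rule partial_character_extends_to_dual)
qed

text \<open>Let \<open>\<zeta>\<close> be a character with \<open>\<zeta>(y - x\<^sub>0) = -1\<close>. The mean of the sum at \<open>\<xi>\<close> and
  \<open>\<zeta>(-x\<^sub>0)\<close> times the sum at \<open>\<xi>\<zeta>\<close> has no term at \<open>y\<close>, the same term at \<open>x\<^sub>0\<close> and no larger
  supremum. Repeating this leaves the coefficient at \<open>x\<^sub>0\<close> alone.\<close>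
lemma coefficient_le_sup:
  fixes c :: "'g::linordered_ab_group_add \<Rightarrow> complex"
  assumes "finite K" "x0 \<in> K" "\<And>\<xi>. \<xi> \<in> dual_group \<Longrightarrow> cmod (\<Sum>x\<in>K. c x * \<xi> x) \<le> s"
  shows "cmod (c x0) \<le> s"
  using assms
proof (induction "card K" arbitrary: K c)
  case 0 then show ?case by simp
next
  case (Suc n)
  show ?case
  proof (cases "K = {x0}")
    case True
    then show ?thesis using Suc.prems(3)[OF dual_group_nonempty] by simp
  next
    case False
    then obtain y where y: "y \<in> K" "y \<noteq> x0" using Suc.prems(2) by blast
    obtain \<zeta> where \<zeta>: "\<zeta> \<in> dual_group" "\<zeta> (y - x0) = - 1"
      using exists_character_minus_one[of "y - x0"] y by auto
    note Z = dual_group_D[OF \<zeta>(1)]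
    define c' where "c' x = c x * (1 + \<zeta> (x - x0)) / 2" for x
    have "cmod (c' x0) \<le> s"
    proof (rule Suc.hyps(1))
      show "n = card (K - {y})" using Suc.hyps(2) Suc.prems(1) y by (simp add: card_Diff_singleton)
      show "finite (K - {y})" "x0 \<in> K - {y}" using Suc.prems y by auto
      fix \<xi> :: "'g \<Rightarrow> complex" assume \<xi>: "\<xi> \<in> dual_group"
      define \<eta> where "\<eta> x = \<xi> x * \<zeta> x" for x
      have \<eta>: "\<eta> \<in> dual_group"
        using \<xi> \<zeta>(1) by (simp add: dual_group_def \<eta>_def norm_mult)
      have c'y: "c' y = 0" by (simp add: c'_def \<zeta>)
      have "(\<Sum>x\<in>K - {y}. c' x * \<xi> x) = (\<Sum>x\<in>K. c' x * \<xi> x)"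
        by (rule sum.mono_neutral_left) (use Suc.prems c'y in auto)
      also have "\<dots> = ((\<Sum>x\<in>K. c x * \<xi> x) + \<zeta> (- x0) * (\<Sum>x\<in>K. c x * \<eta> x)) / 2"
        unfolding sum_distrib_left sum.distrib[symmetric] sum_divide_distrib
      proof (rule sum.cong[OF refl])
        fix x
        have "\<zeta> (x - x0) = \<zeta> x * \<zeta> (- x0)" using Z(1)[of x "- x0"] by simp
        then show "c' x * \<xi> x = (c x * \<xi> x + \<zeta> (- x0) * (c x * \<eta> x)) / 2"
          by (simp add: c'_def \<eta>_def algebra_simps)
      qed
      finally have "cmod (\<Sum>x\<in>K - {y}. c' x * \<xi> x) =
          cmod ((\<Sum>x\<in>K. c x * \<xi> x) + \<zeta> (- x0) * (\<Sum>x\<in>K. c x * \<eta> x)) / 2"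
        by (simp only: norm_divide norm_numeral)
      also have "\<dots> \<le> (cmod (\<Sum>x\<in>K. c x * \<xi> x) + cmod (\<Sum>x\<in>K. c x * \<eta> x)) / 2"
        using norm_triangle_ineq[of "\<Sum>x\<in>K. c x * \<xi> x" "\<zeta> (- x0) * (\<Sum>x\<in>K. c x * \<eta> x)"]
        by (simp add: norm_mult Z(2))
      finally have "cmod (\<Sum>x\<in>K - {y}. c' x * \<xi> x) \<le> (cmod (\<Sum>x\<in>K. c x * \<xi> x) + cmod (\<Sum>x\<in>K. c x * \<eta> x)) / 2" .
      then show "cmod (\<Sum>x\<in>K - {y}. c' x * \<xi> x) \<le> s"
        using Suc.prems(3)[OF \<xi>] Suc.prems(3)[OF \<eta>] by simp
    qed
    then show ?thesis by (simp add: c'_def Z(3))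
  qed
qed

lemma lookup_le_sup:
  fixes c :: "'g::linordered_ab_group_add \<Rightarrow>\<^sub>0 complex"
  assumes "\<And>\<xi>. \<xi> \<in> dual_group \<Longrightarrow> cmod (char_sum \<xi> c) \<le> s"
  shows "cmod (Poly_Mapping.lookup c x) \<le> s"
proof (rule coefficient_le_sup[of "insert x (Poly_Mapping.keys c)"])
  fix \<xi> :: "'g \<Rightarrow> complex" assume "\<xi> \<in> dual_group"
  moreover have "char_sum \<xi> c = (\<Sum>y\<in>insert x (Poly_Mapping.keys c). Poly_Mapping.lookup c y * \<xi> y)"
    by (rule char_sum_superset) auto
  ultimately show "cmod (\<Sum>y\<in>insert x (Poly_Mapping.keys c). Poly_Mapping.lookup c y * \<xi> y) \<le> s"
    using assms by metis
qed simp_all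

section \<open>Toeplitz operators\<close>

abbreviation cone_ops :: "(('g::linordered_ab_group_add \<Rightarrow> complex) \<Rightarrow> 'g \<Rightarrow> complex) cstar" where
  "cone_ops \<equiv> operator_cstar {0..}"

text \<open>The adjoint of \<open>T\<^sub>s\<close>. Since functions vanish off the cone, cutting off at \<open>0\<close> is the only
  case distinction.\<close>
definition back_shift :: "'g::linordered_ab_group_add \<Rightarrow> ('g \<Rightarrow> complex) \<Rightarrow> ('g \<Rightarrow> complex)" where
  "back_shift s = (\<lambda>f. if f \<in> ell2 {0..} then (\<lambda>y. if 0 \<le> y then f (y + s) else 0) else (\<lambda>y. 0))"

lemma shift_ell2:
  fixes f :: "'g::linordered_ab_group_add \<Rightarrow> complex"
  assumes f: "f \<in> ell2 {0..}" and h: "\<And>y. cmod (h y) \<le> cmod (f (y + s))" and v: "\<And>y. y < 0 \<Longrightarrow> h y = 0"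
  shows "h \<in> ell2 {0..}" "ell2_norm {0..} h \<le> ell2_norm {0..} f"
proof -
  have "L2_set (\<lambda>y. cmod (h y)) F \<le> ell2_norm {0..} f" if F: "finite F" "F \<subseteq> {0..}" for F
  proof -
    let ?G = "(\<lambda>y. y + s) ` F"
    have "(\<Sum>y\<in>F. (cmod (h y))\<^sup>2) \<le> (\<Sum>y\<in>F. (cmod (f (y + s)))\<^sup>2)"
      by (intro sum_mono power_mono h) simp
    also have "\<dots> = (\<Sum>x\<in>?G. (cmod (f x))\<^sup>2)" by (simp add: sum.reindex)
    also have "\<dots> = (\<Sum>x\<in>?G \<inter> {0..}. (cmod (f x))\<^sup>2)"
      by (rule sum.mono_neutral_right) (use F ell2_vanish[OF f] in auto)
    finally have "L2_set (\<lambda>y. cmod (h y)) F \<le> L2_set (\<lambda>x. cmod (f x)) (?G \<inter> {0..})"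
      unfolding L2_set_def by (rule real_sqrt_le_mono)
    also have "\<dots> \<le> ell2_norm {0..} f" by (rule L2_set_le_ell2_norm[OF f]) (use F in auto)
    finally show ?thesis .
  qed
  note * = ell2_bounded[of "{0..}" h, OF _ this]
  show "h \<in> ell2 {0..}" by (rule *(1)) (use v in auto)
  show "ell2_norm {0..} h \<le> ell2_norm {0..} f" by (rule *(2)) (use v in auto)
qed

lemma toeplitz_op_bounded:
  assumes s: "0 \<le> (s :: 'g::linordered_ab_group_add)"
  shows "toeplitz_op s \<in> bounded_operators {0..}"
proof (rule bounded_operators_I[where K = 1])
  have v: "f (y - s) = 0" if "f \<in> ell2 {0..}" "y < 0" for f :: "'g \<Rightarrow> complex" and y
    using ell2_vanish[OF that(1), of "y - s"] that(2) s by simp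
  show "toeplitz_op s f \<in> ell2 {0..}" "ell2_norm {0..} (toeplitz_op s f) \<le> 1 * ell2_norm {0..} f"
    if "f \<in> ell2 {0..}" for f
    using shift_ell2[OF that, of "\<lambda>y. f (y - s)" "- s"] v[OF that] that by (simp_all add: toeplitz_op_def)
qed (simp_all add: toeplitz_op_def ell2_add ell2_scale)

lemma back_shift_bounded:
  assumes s: "0 \<le> (s :: 'g::linordered_ab_group_add)"
  shows "back_shift s \<in> bounded_operators {0..}"
proof (rule bounded_operators_I[where K = 1])
  show "back_shift s f \<in> ell2 {0..}" "ell2_norm {0..} (back_shift s f) \<le> 1 * ell2_norm {0..} f"
    if "f \<in> ell2 {0..}" for f
    using shift_ell2[OF that, of "\<lambda>y. if 0 \<le> y then f (y + s) else 0" s] that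
    by (simp_all add: back_shift_def)
qed (auto simp: back_shift_def ell2_add ell2_scale)

lemma star_toeplitz_op:
  assumes s: "0 \<le> (s :: 'g::linordered_ab_group_add)"
  shows "star cone_ops (toeplitz_op s) = back_shift s"
proof (rule operator_star_eqI[OF toeplitz_op_bounded[OF s] back_shift_bounded[OF s]])
  fix f g :: "'g \<Rightarrow> complex" assume f: "f \<in> ell2 {0..}" and g: "g \<in> ell2 {0..}"
  have "ell2_inner {0..} (toeplitz_op s f) g = (\<Sum>\<^sub>\<infinity>y\<in>{0..}. f (y - s) * cnj (g y))"
    using f by (simp add: ell2_inner_def toeplitz_op_def)
  also have "\<dots> = (\<Sum>\<^sub>\<infinity>y\<in>(\<lambda>x. x + s) ` {0..}. f (y - s) * cnj (g y))"
  proof (rule infsum_cong_neutral)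
    fix y assume "y \<in> {0..} - (\<lambda>x. x + s) ` {0..}"
    then have y: "y \<notin> (\<lambda>x. x + s) ` {0..}" by simp
    have "\<not> 0 \<le> y - s"
    proof
      assume "0 \<le> y - s"
      then have "y - s + s \<in> (\<lambda>x. x + s) ` {0..}" by (intro imageI) simp
      with y show False by simp
    qed
    then show "f (y - s) * cnj (g y) = 0" using ell2_vanish[OF f, of "y - s"] by simp
  qed (use s in auto)
  also have "\<dots> = (\<Sum>\<^sub>\<infinity>x\<in>{0..}. f x * cnj (g (x + s)))"
    by (subst infsum_reindex) (auto simp: o_def)
  also have "\<dots> = ell2_inner {0..} f (back_shift s g)"
    unfolding ell2_inner_def by (rule infsum_cong) (use g in \<open>simp add: back_shift_def\<close>)
  finally show "ell2_inner {0..} (toeplitz_op s f) g = ell2_inner {0..} f (back_shift s g)" .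
qed

lemma back_shift_toeplitz_op:
  assumes s: "0 \<le> (s :: 'g::linordered_ab_group_add)"
  shows "back_shift s \<circ> toeplitz_op s = \<one>\<^bsub>cone_ops\<^esub>"
proof
  fix f :: "'g \<Rightarrow> complex"
  show "(back_shift s \<circ> toeplitz_op s) f = \<one>\<^bsub>cone_ops\<^esub> f"
  proof (cases "f \<in> ell2 {0..}")
    case True
    have "toeplitz_op s f \<in> ell2 {0..}" by (rule bounded_operators_D(2)[OF toeplitz_op_bounded[OF s] True])
    then show ?thesis using True ell2_vanish[OF True]
      by (auto simp: back_shift_def toeplitz_op_def fun_eq_iff)
  next
    case False
    then show ?thesis by (simp add: back_shift_def toeplitz_op_def fun_eq_iff)
  qed
qed

lemma toeplitz_op_add:
  assumes x: "0 \<le> (x :: 'g::linordered_ab_group_add)" and y: "0 \<le> y"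
  shows "toeplitz_op (x + y) = toeplitz_op x \<circ> toeplitz_op y"
proof
  fix f :: "'g \<Rightarrow> complex"
  show "toeplitz_op (x + y) f = (toeplitz_op x \<circ> toeplitz_op y) f"
  proof (cases "f \<in> ell2 {0..}")
    case True
    have "toeplitz_op y f \<in> ell2 {0..}" by (rule bounded_operators_D(2)[OF toeplitz_op_bounded[OF y] True])
    then show ?thesis using True by (auto simp: toeplitz_op_def fun_eq_iff algebra_simps)
  next
    case False
    then show ?thesis by (simp add: toeplitz_op_def fun_eq_iff)
  qed
qed

lemma toeplitz_op_zero: "toeplitz_op 0 = \<one>\<^bsub>cone_ops\<^esub>"
  by (simp add: toeplitz_op_def fun_eq_iff)

lemma toeplitz_algebra_simps [simp]:
  "mult toeplitz_algebra = (\<lambda>S T. S \<circ> T)"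
  "one toeplitz_algebra = \<one>\<^bsub>cone_ops\<^esub>"
  "zero toeplitz_algebra = (\<lambda>f x. 0)"
  "add toeplitz_algebra = (\<lambda>S T f x. S f x + T f x)"
  "smult toeplitz_algebra = (\<lambda>c T f x. c * T f x)"
  "star toeplitz_algebra = star cone_ops"
  "nrm toeplitz_algebra = nrm cone_ops"
  by (simp_all add: toeplitz_algebra_def)

lemma toeplitz_subalgebra:
  "cstar_subalgebra (carrier (toeplitz_algebra :: (('g::linordered_ab_group_add \<Rightarrow> complex) \<Rightarrow> 'g \<Rightarrow> complex) cstar)) cone_ops"
proof -
  interpret O: unital_cstar_algebra "cone_ops :: (('g \<Rightarrow> complex) \<Rightarrow> 'g \<Rightarrow> complex) cstar"
    by (rule operator_unital_cstar_algebra)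
  show ?thesis unfolding toeplitz_algebra_def partial_object.simps
    by simp (rule O.cstar_generated_subalgebra, use toeplitz_op_bounded in auto)
qed

lemma toeplitz_op_in_algebra:
  assumes "0 \<le> s" shows "toeplitz_op s \<in> carrier toeplitz_algebra"
  using assms cstar_generated_superset[of "{toeplitz_op s | s. 0 \<le> s}" cone_ops]
  by (auto simp: toeplitz_algebra_def)

lemma toeplitz_algebra_bounded: "S \<in> carrier toeplitz_algebra \<Longrightarrow> S \<in> bounded_operators {0..}"
  using unital_cstar_algebra.cstar_subalgebra_subset[OF operator_unital_cstar_algebra toeplitz_subalgebra] by auto

lemma toeplitz_unital_cstar_algebra:
  "unital_cstar_algebra (toeplitz_algebra :: (('g::linordered_ab_group_add \<Rightarrow> complex) \<Rightarrow> 'g \<Rightarrow> complex) cstar)"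
proof -
  interpret O: unital_cstar_algebra "cone_ops :: (('g \<Rightarrow> complex) \<Rightarrow> 'g \<Rightarrow> complex) cstar"
    by (rule operator_unital_cstar_algebra)
  have eq: "toeplitz_algebra = cone_ops\<lparr>carrier := carrier toeplitz_algebra\<rparr>"
    by (simp add: toeplitz_algebra_def)
  have "\<one>\<^bsub>cone_ops\<^esub> \<in> carrier toeplitz_algebra"
    using toeplitz_op_in_algebra[of 0] unfolding toeplitz_op_zero by simp
  from O.subalgebra_unital[OF toeplitz_subalgebra this] show ?thesis unfolding eq[symmetric] .
qed

lemma toeplitz_minus:
  assumes "S \<in> carrier toeplitz_algebra" "T \<in> carrier toeplitz_algebra"
  shows "S \<ominus>\<^bsub>toeplitz_algebra\<^esub> T = (\<lambda>f x. S f x - T f x)"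
proof -
  interpret A: unital_cstar_algebra toeplitz_algebra by (rule toeplitz_unital_cstar_algebra)
  show ?thesis using A.uminus_smult[OF assms(2)] by (simp add: a_minus_def)
qed

section \<open>Symbols of Toeplitz operators\<close>

text \<open>Far out in the cone, \<open>S\<close> acts as convolution by \<open>c\<close>. The condition ignores what \<open>S\<close> does
  near \<open>0\<close>, which is where the commutator ideal lives.\<close>
definition has_symbol ::
  "(('g::linordered_ab_group_add \<Rightarrow> complex) \<Rightarrow> 'g \<Rightarrow> complex) \<Rightarrow> ('g \<Rightarrow>\<^sub>0 complex) \<Rightarrow> bool" where
  "has_symbol S c \<longleftrightarrow> (\<exists>z0\<ge>0. \<forall>z\<ge>z0. S (point_mass z) = (\<lambda>y. Poly_Mapping.lookup c (y - z)))"

lemma has_symbolE: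
  assumes "has_symbol S c"
  obtains z0 where "0 \<le> z0" "\<And>z. z0 \<le> z \<Longrightarrow> S (point_mass z) = (\<lambda>y. Poly_Mapping.lookup c (y - z))"
  using assms unfolding has_symbol_def by blast

lemma has_symbolI:
  assumes "0 \<le> z0" "\<And>z. 0 \<le> z \<Longrightarrow> z0 \<le> z \<Longrightarrow> S (point_mass z) = (\<lambda>y. Poly_Mapping.lookup c (y - z))"
  shows "has_symbol S c"
  unfolding has_symbol_def using assms by (intro exI[of _ z0]) auto

lemma has_symbol_unique:
  assumes "has_symbol S c" "has_symbol S d" shows "c = d"
proof (rule poly_mapping_eqI)
  fix x
  obtain z0 where z0: "\<And>z. z0 \<le> z \<Longrightarrow> S (point_mass z) = (\<lambda>y. Poly_Mapping.lookup c (y - z))"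
    using has_symbolE[OF assms(1)] by blast
  obtain z1 where z1: "\<And>z. z1 \<le> z \<Longrightarrow> S (point_mass z) = (\<lambda>y. Poly_Mapping.lookup d (y - z))"
    using has_symbolE[OF assms(2)] by blast
  let ?z = "max z0 z1"
  have "S (point_mass ?z) (x + ?z) = Poly_Mapping.lookup c x" using z0[of ?z] by simp
  moreover have "S (point_mass ?z) (x + ?z) = Poly_Mapping.lookup d x" using z1[of ?z] by simp
  ultimately show "Poly_Mapping.lookup c x = Poly_Mapping.lookup d x" by simp
qed

lemma has_symbol_add:
  assumes "has_symbol S c" "has_symbol R d" shows "has_symbol (\<lambda>f x. S f x + R f x) (c + d)"
proof -
  obtain z0 where z0: "0 \<le> z0" "\<And>z. z0 \<le> z \<Longrightarrow> S (point_mass z) = (\<lambda>y. Poly_Mapping.lookup c (y - z))"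
    using has_symbolE[OF assms(1)] by blast
  obtain z1 where z1: "0 \<le> z1" "\<And>z. z1 \<le> z \<Longrightarrow> R (point_mass z) = (\<lambda>y. Poly_Mapping.lookup d (y - z))"
    using has_symbolE[OF assms(2)] by blast
  show ?thesis
    by (rule has_symbolI[of "max z0 z1"]) (use z0 z1 in \<open>auto simp: lookup_add le_max_iff_disj\<close>)
qed

lemma has_symbol_scale:
  assumes "has_symbol S c" shows "has_symbol (\<lambda>f x. k * S f x) (Poly_Mapping.single 0 k * c)"
proof -
  obtain z0 where z0: "0 \<le> z0" "\<And>z. z0 \<le> z \<Longrightarrow> S (point_mass z) = (\<lambda>y. Poly_Mapping.lookup c (y - z))"
    using has_symbolE[OF assms(1)] by blast
  show ?thesis by (rule has_symbolI[OF z0(1)]) (use z0 in \<open>simp add: lookup_times_single\<close>)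
qed

lemma bounded_operator_cut_off:
  assumes T: "T \<in> bounded_operators X" and F: "finite F" "F \<subseteq> X"
  shows "T (cut_off F f) y = (\<Sum>x\<in>F. f x * T (point_mass x) y)"
proof (cases "y \<in> X")
  case True
  from bounded_operator_cut_off_inner[OF T F point_mass_ell2(1)[OF True]]
  show ?thesis by (simp add: ell2_inner_point_mass[OF True])
next
  case False
  then show ?thesis using ell2_vanish[OF bounded_operators_in_ell2[OF T]] by simp
qed

lemma shifted_symbol:
  fixes c :: "'g::linordered_ab_group_add \<Rightarrow>\<^sub>0 complex"
  assumes "(\<lambda>y. Poly_Mapping.lookup c (y - z)) \<in> ell2 {0..}"
  shows "\<And>x. x \<in> Poly_Mapping.keys c \<Longrightarrow> 0 \<le> x + z"
    and "ell2_norm {0..} (\<lambda>y. Poly_Mapping.lookup c (y - z)) = coeff_norm c"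
proof -
  show 1: "0 \<le> x + z" if "x \<in> Poly_Mapping.keys c" for x
  proof (rule ccontr)
    assume "\<not> 0 \<le> x + z"
    then have "Poly_Mapping.lookup c x = 0" using ell2_vanish[OF assms, of "x + z"] by simp
    with that show False by (simp add: in_keys_iff)
  qed
  let ?F = "(\<lambda>x. x + z) ` Poly_Mapping.keys c"
  have "ell2_norm {0..} (\<lambda>y. Poly_Mapping.lookup c (y - z)) = L2_set (\<lambda>y. cmod (Poly_Mapping.lookup c (y - z))) ?F"
  proof (rule ell2_finite_support)
    fix y assume y: "y \<notin> ?F"
    show "Poly_Mapping.lookup c (y - z) = 0"
    proof (rule ccontr)
      assume "Poly_Mapping.lookup c (y - z) \<noteq> 0"
      then have "y - z \<in> Poly_Mapping.keys c" by (simp add: in_keys_iff)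
      then have "y - z + z \<in> ?F" by (rule imageI)
      with y show False by simp
    qed
  qed (use 1 in auto)
  also have "\<dots> = coeff_norm c"
    by (simp add: coeff_norm_def L2_set_def sum.reindex inj_on_def)
  finally show "ell2_norm {0..} (\<lambda>y. Poly_Mapping.lookup c (y - z)) = coeff_norm c" .
qed

text \<open>The vector \<open>R \<delta>\<^sub>z\<close> is a finite combination of the \<open>\<delta>\<^bsub>x + z\<^esub>\<close> with \<open>x\<close> in the support of
  \<open>d\<close>, so for large \<open>z\<close> all of them lie in the region where \<open>S\<close> acts by \<open>c\<close>.\<close>
lemma has_symbol_comp:
  assumes S: "S \<in> bounded_operators {0..}" and R: "R \<in> bounded_operators {0..}"
    and "has_symbol S c" "has_symbol R d"
  shows "has_symbol (S \<circ> R) (c * d)"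
proof -
  obtain z0 where z0: "0 \<le> z0" "\<And>z. z0 \<le> z \<Longrightarrow> S (point_mass z) = (\<lambda>y. Poly_Mapping.lookup c (y - z))"
    using has_symbolE[OF assms(3)] by blast
  obtain z1 where z1: "0 \<le> z1" "\<And>z. z1 \<le> z \<Longrightarrow> R (point_mass z) = (\<lambda>y. Poly_Mapping.lookup d (y - z))"
    using has_symbolE[OF assms(4)] by blast
  let ?K = "Poly_Mapping.keys d"
  define z2 where "z2 = Max (insert 0 ((\<lambda>x. z0 - x) ` ?K))"
  have z2: "0 \<le> z2" "\<And>x. x \<in> ?K \<Longrightarrow> z0 - x \<le> z2" unfolding z2_def by (auto intro: Max_ge)
  show ?thesis
  proof (rule has_symbolI[of "max z1 z2"])
    show "0 \<le> max z1 z2" using z1(1) by (simp add: le_max_iff_disj)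
    fix z assume z: "0 \<le> z" "max z1 z2 \<le> z"
    have big: "z0 \<le> x + z" if "x \<in> ?K" for x
    proof -
      have "z0 - x \<le> z" using order_trans[OF z2(2)[OF that]] z(2) by simp
      then show ?thesis by (simp add: diff_le_eq add.commute)
    qed
    let ?F = "(\<lambda>x. x + z) ` ?K"
    let ?h = "\<lambda>y. Poly_Mapping.lookup d (y - z)"
    have F: "finite ?F" "?F \<subseteq> {0..}" using big z0(1) by (auto intro: order_trans)
    have h: "cut_off ?F ?h = ?h"
    proof
      fix y
      have "y \<in> ?F" if "?h y \<noteq> 0"
      proof -
        have "y - z + z \<in> ?F" using that by (intro imageI) (simp add: in_keys_iff)
        then show ?thesis by simp
      qed
      then show "cut_off ?F ?h y = ?h y" by (auto simp: cut_off_def)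
    qed
    have "(S \<circ> R) (point_mass z) = S (cut_off ?F ?h)" using z1(2)[of z] z(2) h by simp
    also have "\<dots> = (\<lambda>y. Poly_Mapping.lookup (c * d) (y - z))"
    proof
      fix y
      have "S (cut_off ?F ?h) y = (\<Sum>u\<in>?F. ?h u * S (point_mass u) y)"
        by (rule bounded_operator_cut_off[OF S F])
      also have "\<dots> = (\<Sum>x\<in>?K. Poly_Mapping.lookup d x * S (point_mass (x + z)) y)"
        by (simp add: sum.reindex inj_on_def)
      also have "\<dots> = (\<Sum>x\<in>?K. Poly_Mapping.lookup d x * Poly_Mapping.lookup c (y - z - x))"
        by (rule sum.cong) (use z0(2)[OF big] in \<open>auto simp: algebra_simps\<close>)
      also have "\<dots> = Poly_Mapping.lookup (c * d) (y - z)"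
        by (simp add: lookup_times_group[of d c] mult.commute[of c d])
      finally show "S (cut_off ?F ?h) y = Poly_Mapping.lookup (c * d) (y - z)" .
    qed
    finally show "(S \<circ> R) (point_mass z) = (\<lambda>y. Poly_Mapping.lookup (c * d) (y - z))" .
  qed
qed

lemma has_symbol_toeplitz_op:
  assumes s: "0 \<le> s" shows "has_symbol (toeplitz_op s) (Poly_Mapping.single s 1)"
proof (rule has_symbolI[of 0])
  fix z :: 'a assume z: "0 \<le> z"
  have "(s = y - z) = (y = z + s)" for y by (auto simp: algebra_simps)
  then show "toeplitz_op s (point_mass z) = (\<lambda>y. Poly_Mapping.lookup (Poly_Mapping.single s 1) (y - z))"
    unfolding toeplitz_op_point_mass[OF z] by (simp add: point_mass_def lookup_single when_def fun_eq_iff)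
qed simp

lemma has_symbol_back_shift:
  assumes s: "0 \<le> s" shows "has_symbol (back_shift s) (Poly_Mapping.single (- s) 1)"
proof (rule has_symbolI[OF s])
  fix z assume z: "0 \<le> z" "s \<le> z"
  have "0 \<le> y" if "y + s = z" for y
  proof -
    have "y = z - s" using that by (simp add: algebra_simps)
    then show ?thesis using z by simp
  qed
  moreover have "(- s = y - z) = (y + s = z)" for y by (auto simp: algebra_simps)
  ultimately show "back_shift s (point_mass z) = (\<lambda>y. Poly_Mapping.lookup (Poly_Mapping.single (- s) 1) (y - z))"
    using z by (auto simp: back_shift_def point_mass_def lookup_single when_def fun_eq_iff)
       (simp add: point_mass_def[symmetric])+
qed

lemma has_symbol_one: "has_symbol \<one>\<^bsub>cone_ops\<^esub> 1"
  using has_symbol_toeplitz_op[of 0] by (simp add: toeplitz_op_zero del: operator_cstar_simps)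

text \<open>The vector \<open>S\<^sup>n \<delta>\<^sub>z\<close> is a translate of \<open>c\<^sup>n\<close>, so the coefficients of \<open>c\<^sup>n\<close> are bounded
  by \<open>\<parallel>S\<parallel>\<^sup>n\<close>. This is what makes the passage to symbols continuous.\<close>
lemma char_sum_le_norm:
  fixes S :: "('g::linordered_ab_group_add \<Rightarrow> complex) \<Rightarrow> 'g \<Rightarrow> complex"
  assumes S: "S \<in> bounded_operators {0..}" and c: "has_symbol S c" and \<xi>: "\<xi> \<in> dual_group"
  shows "cmod (char_sum \<xi> c) \<le> nrm cone_ops S"
proof (rule char_sum_le_of_powers[OF \<xi> operator_norm_nonneg[OF S]])
  fix n
  define R where "R = rec_nat \<one>\<^bsub>cone_ops\<^esub> (\<lambda>_ T. S \<circ> T)"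
  have R: "R 0 = \<one>\<^bsub>cone_ops\<^esub>" "\<And>n. R (Suc n) = S \<circ> R n" by (simp_all add: R_def)
  interpret O: unital_cstar_algebra "cone_ops :: (('g \<Rightarrow> complex) \<Rightarrow> 'g \<Rightarrow> complex) cstar"
    by (rule operator_unital_cstar_algebra)
  have RB: "R n \<in> bounded_operators {0..}" for n
  proof (induction n)
    case 0 show ?case using O.one_closed unfolding R by (simp only: operator_cstar_simps(1))
  next
    case (Suc n) show ?case unfolding R by (rule bounded_operators_comp(1)[OF S Suc])
  qed
  have Rn: "nrm cone_ops (R n) \<le> nrm cone_ops S ^ n" for n
  proof (induction n)
    case 0 then show ?case using O.nrm_one_le by (simp add: R del: operator_cstar_simps)
  next
    case (Suc n)
    have "nrm cone_ops (S \<circ> R n) \<le> nrm cone_ops S * nrm cone_ops (R n)"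
      by (rule bounded_operators_comp(2)[OF S RB])
    also have "\<dots> \<le> nrm cone_ops S * nrm cone_ops S ^ n"
      by (rule mult_left_mono[OF Suc operator_norm_nonneg[OF S]])
    finally show ?case unfolding R power_Suc .
  qed
  have Rc: "has_symbol (R n) (c ^ n)" for n
  proof (induction n)
    case 0 show ?case unfolding R power_0 by (rule has_symbol_one)
  next
    case (Suc n) show ?case unfolding R power_Suc by (rule has_symbol_comp[OF S RB c Suc])
  qed
  obtain z0 where z0: "0 \<le> z0" "\<And>z. z0 \<le> z \<Longrightarrow> R n (point_mass z) = (\<lambda>y. Poly_Mapping.lookup (c ^ n) (y - z))"
    using has_symbolE[OF Rc[of n]] by blast
  have pm: "point_mass z0 \<in> ell2 {0..}" "ell2_norm {0..} (point_mass z0 :: 'g \<Rightarrow> complex) = 1" using z0(1) by simp_all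
  have eq: "R n (point_mass z0) = (\<lambda>y. Poly_Mapping.lookup (c ^ n) (y - z0))" by (rule z0(2)) simp
  have "coeff_norm (c ^ n) = ell2_norm {0..} (R n (point_mass z0))"
    unfolding eq
    by (rule shifted_symbol(2)[symmetric]) (use bounded_operators_D(2)[OF RB pm(1), of n] in \<open>simp add: eq\<close>)
  also have "\<dots> \<le> nrm cone_ops (R n)" using operator_norm_bound[OF RB pm(1), of n] pm(2) by simp
  also have "\<dots> \<le> nrm cone_ops S ^ n" by (rule Rn)
  finally show "coeff_norm (c ^ n) \<le> nrm cone_ops S ^ n" .
qed

lemma operator_norm_le_cut_off:
  assumes R: "R \<in> bounded_operators X" and K: "0 \<le> K"
    and fin: "\<And>f F. f \<in> ell2 X \<Longrightarrow> finite F \<Longrightarrow> F \<subseteq> X \<Longrightarrow> ell2_norm X (R (cut_off F f)) \<le> K * ell2_norm X (cut_off F f)"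
  shows "nrm (operator_cstar X) R \<le> K"
proof (rule operator_norm_le[OF R K])
  fix f assume f: "f \<in> ell2 X"
  let ?N = "nrm (operator_cstar X) R"
  have N: "0 \<le> ?N" by (rule operator_norm_nonneg[OF R])
  show "ell2_norm X (R f) \<le> K * ell2_norm X f"
  proof (rule field_le_epsilon)
    fix e :: real assume e: "0 < e"
    have "0 < e / (?N + 1)" using e N by simp
    then obtain F where F: "finite F" "F \<subseteq> X" and d: "ell2_norm X (\<lambda>x. f x - cut_off F f x) < e / (?N + 1)"
      using cut_off_approx[OF f] by blast
    let ?t = "cut_off F f"
    have t: "?t \<in> ell2 X" by (rule cut_off_ell2(1)[OF F])
    have dl: "(\<lambda>x. f x - ?t x) \<in> ell2 X" by (rule ell2_diff[OF f t])
    have "ell2_norm X (R f) \<le> ell2_norm X (R ?t) + ell2_norm X (\<lambda>x. R f x - R ?t x)"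
      by (rule ell2_norm_diff_le[OF bounded_operators_D(2)[OF R f] bounded_operators_D(2)[OF R t]])
    also have "(\<lambda>x. R f x - R ?t x) = R (\<lambda>x. f x - ?t x)" by (rule bounded_operators_diff[OF R f t, symmetric])
    also have "ell2_norm X (R ?t) + ell2_norm X (R (\<lambda>x. f x - ?t x)) \<le> K * ell2_norm X f + e"
    proof (rule add_mono)
      have "ell2_norm X ?t \<le> ell2_norm X f"
        unfolding cut_off_ell2(2)[OF F] by (rule L2_set_le_ell2_norm[OF f F])
      then show "ell2_norm X (R ?t) \<le> K * ell2_norm X f"
        using fin[OF f F] mult_left_mono[OF _ K] by (meson order_trans)
      have "ell2_norm X (R (\<lambda>x. f x - ?t x)) \<le> ?N * (e / (?N + 1))"
        by (rule order_trans[OF operator_norm_bound[OF R dl] mult_left_mono[OF less_imp_le[OF d] N]])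
      also have "\<dots> \<le> e" using e N by (simp add: divide_le_eq)
      finally show "ell2_norm X (R (\<lambda>x. f x - ?t x)) \<le> e" .
    qed
    finally show "ell2_norm X (R f) \<le> K * ell2_norm X f + e" .
  qed
qed

text \<open>The operator \<open>S T\<^sub>z\<close> with large \<open>z\<close> only sees the region where \<open>S\<close> is convolution by its
  symbol.\<close>
lemma symbol_norm_le:
  fixes S :: "('g::linordered_ab_group_add \<Rightarrow> complex) \<Rightarrow> 'g \<Rightarrow> complex"
  assumes S: "S \<in> bounded_operators {0..}" and c: "has_symbol S c" and s: "0 \<le> s"
    and le: "\<And>\<xi>. \<xi> \<in> dual_group \<Longrightarrow> cmod (char_sum \<xi> c) \<le> s"
  shows "\<exists>z\<ge>0. nrm cone_ops (S \<circ> toeplitz_op z) \<le> s"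
proof -
  obtain z where z: "0 \<le> z" "\<And>u. z \<le> u \<Longrightarrow> S (point_mass u) = (\<lambda>y. Poly_Mapping.lookup c (y - u))"
    using has_symbolE[OF c] by blast
  let ?R = "S \<circ> toeplitz_op z"
  have R: "?R \<in> bounded_operators {0..}" by (rule bounded_operators_comp(1)[OF S toeplitz_op_bounded[OF z(1)]])
  have "nrm cone_ops ?R \<le> s"
  proof (rule operator_norm_le_cut_off[OF R s])
    fix f :: "'g \<Rightarrow> complex" and F :: "'g set"
    assume f: "f \<in> ell2 {0..}" and F: "finite F" "F \<subseteq> {0..}"
    define p where "p = (\<Sum>x\<in>F. Poly_Mapping.single x (f x))"
    have lookup_p: "Poly_Mapping.lookup p x = (if x \<in> F then f x else 0)" for x
      using F(1) by (simp add: p_def lookup_sum lookup_single when_def)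
    have keys_p: "Poly_Mapping.keys p \<subseteq> F" by (auto simp: in_keys_iff lookup_p split: if_splits)
    have eq: "?R (cut_off F f) = (\<lambda>y. Poly_Mapping.lookup (c * p) (y - z))"
    proof
      fix y
      have "?R (cut_off F f) y = (\<Sum>x\<in>F. f x * ?R (point_mass x) y)"
        by (rule bounded_operator_cut_off[OF R F])
      also have "\<dots> = (\<Sum>x\<in>F. Poly_Mapping.lookup p x * Poly_Mapping.lookup c (y - z - x))"
      proof (rule sum.cong[OF refl])
        fix x assume x: "x \<in> F"
        then have "0 \<le> x" using F(2) by auto
        then have "?R (point_mass x) y = Poly_Mapping.lookup c (y - (x + z))"
          using z(2)[of "x + z"] by (simp add: toeplitz_op_point_mass)
        then show "f x * ?R (point_mass x) y = Poly_Mapping.lookup p x * Poly_Mapping.lookup c (y - z - x)"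
          using x by (simp add: lookup_p algebra_simps)
      qed
      also have "\<dots> = Poly_Mapping.lookup (c * p) (y - z)"
        by (simp add: lookup_times_superset[OF F(1) keys_p] mult.commute[of c p])
      finally show "?R (cut_off F f) y = Poly_Mapping.lookup (c * p) (y - z)" .
    qed
    have t: "cut_off F f \<in> ell2 {0..}" by (rule cut_off_ell2(1)[OF F])
    have "ell2_norm {0..} (?R (cut_off F f)) = coeff_norm (c * p)"
      unfolding eq by (rule shifted_symbol(2)) (use bounded_operators_D(2)[OF R t] in \<open>simp only: eq\<close>)
    also have "\<dots> \<le> s * coeff_norm p"
      by (rule coeff_norm_mult_le[OF s le lookup_le_sup])
    also have "coeff_norm p = ell2_norm {0..} (cut_off F f)"
      unfolding cut_off_ell2(2)[OF F] coeff_norm_superset[OF F(1) keys_p]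
      by (rule L2_set_cong) (simp_all add: lookup_p)
    finally show "ell2_norm {0..} (?R (cut_off F f)) \<le> s * ell2_norm {0..} (cut_off F f)" .
  qed
  with z(1) show ?thesis by blast
qed

section \<open>The homomorphism from the Toeplitz algebra to the dual group\<close>

lemma cstar_hom_extension:
  fixes A :: "'a cstar" and B :: "'b cstar"
  assumes "unital_cstar_algebra A" "unital_cstar_algebra B"
    and P: "P \<subseteq> carrier A" "\<And>x y. x \<in> P \<Longrightarrow> y \<in> P \<Longrightarrow> x \<oplus>\<^bsub>A\<^esub> y \<in> P"
      "\<And>c x. x \<in> P \<Longrightarrow> c \<odot>\<^bsub>A\<^esub> x \<in> P" "\<And>x y. x \<in> P \<Longrightarrow> y \<in> P \<Longrightarrow> x \<otimes>\<^bsub>A\<^esub> y \<in> P"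
      "\<And>x. x \<in> P \<Longrightarrow> star A x \<in> P"
    and dense: "\<And>x e. x \<in> carrier A \<Longrightarrow> e > 0 \<Longrightarrow> \<exists>p\<in>P. nrm A (p \<ominus>\<^bsub>A\<^esub> x) < e"
    and \<rho>: "\<And>x. x \<in> P \<Longrightarrow> \<rho> x \<in> carrier B" "\<And>x y. x \<in> P \<Longrightarrow> y \<in> P \<Longrightarrow> \<rho> (x \<oplus>\<^bsub>A\<^esub> y) = \<rho> x \<oplus>\<^bsub>B\<^esub> \<rho> y"
      "\<And>c x. x \<in> P \<Longrightarrow> \<rho> (c \<odot>\<^bsub>A\<^esub> x) = c \<odot>\<^bsub>B\<^esub> \<rho> x"
      "\<And>x y. x \<in> P \<Longrightarrow> y \<in> P \<Longrightarrow> \<rho> (x \<otimes>\<^bsub>A\<^esub> y) = \<rho> x \<otimes>\<^bsub>B\<^esub> \<rho> y"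
      "\<And>x. x \<in> P \<Longrightarrow> \<rho> (star A x) = star B (\<rho> x)"
    and contr: "\<And>x. x \<in> P \<Longrightarrow> nrm B (\<rho> x) \<le> nrm A x"
  shows "\<exists>\<psi>\<in>cstar_hom A B. \<forall>x\<in>P. \<psi> x = \<rho> x"
proof -
  interpret A: unital_cstar_algebra A by (rule assms(1))
  interpret B: unital_cstar_algebra B by (rule assms(2))
  have PA: "x \<in> carrier A" if "x \<in> P" for x using P(1) that by blast
  have diff: "x \<ominus>\<^bsub>A\<^esub> y \<in> P \<and> \<rho> (x \<ominus>\<^bsub>A\<^esub> y) = \<rho> x \<ominus>\<^bsub>B\<^esub> \<rho> y" if "x \<in> P" "y \<in> P" for x y
  proof -
    have "x \<ominus>\<^bsub>A\<^esub> y = x \<oplus>\<^bsub>A\<^esub> (-1) \<odot>\<^bsub>A\<^esub> y" using PA[OF that(2)] by (simp add: a_minus_def A.uminus_smult)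
    moreover have "\<rho> x \<ominus>\<^bsub>B\<^esub> \<rho> y = \<rho> x \<oplus>\<^bsub>B\<^esub> (-1) \<odot>\<^bsub>B\<^esub> \<rho> y"
      using \<rho>(1)[OF that(2)] by (simp add: a_minus_def B.uminus_smult)
    ultimately show ?thesis using that P(2,3) \<rho>(2,3) by simp
  qed
  have contr': "nrm B (\<rho> x \<ominus>\<^bsub>B\<^esub> \<rho> y) \<le> nrm A (x \<ominus>\<^bsub>A\<^esub> y)" if "x \<in> P" "y \<in> P" for x y
    using contr[OF conjunct1[OF diff[OF that]]] conjunct2[OF diff[OF that]] by simp
  define L where "L x y \<longleftrightarrow> y \<in> carrier B \<and> (\<exists>\<sigma>. (\<forall>n. \<sigma> n \<in> P) \<and> norm_lim A \<sigma> x \<and> norm_lim B (\<lambda>n. \<rho> (\<sigma> n)) y)" for x y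
  have LI: "L x y" if "y \<in> carrier B" "\<And>n. \<sigma> n \<in> P" "norm_lim A \<sigma> x" "norm_lim B (\<lambda>n. \<rho> (\<sigma> n)) y" for x y \<sigma>
    unfolding L_def using that by (intro conjI exI[of _ \<sigma>] allI)
  have L_ex: "\<exists>y. L x y" if x: "x \<in> carrier A" for x
  proof -
    obtain \<sigma> where \<sigma>: "\<forall>n. \<sigma> n \<in> P" "norm_lim A \<sigma> x"
      using A.norm_lim_ex[OF x P(1) dense[OF x]] by auto
    have \<sigma>P: "\<sigma> n \<in> P" for n using \<sigma>(1) by simp
    have "\<forall>e>0. \<exists>N. \<forall>m\<ge>N. \<forall>n\<ge>N. nrm B (\<rho> (\<sigma> m) \<ominus>\<^bsub>B\<^esub> \<rho> (\<sigma> n)) < e"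
    proof (intro allI impI)
      fix e :: real assume "e > 0"
      then have "0 < e / 2" by simp
      then obtain N where N: "\<forall>n\<ge>N. \<bar>nrm A (\<sigma> n \<ominus>\<^bsub>A\<^esub> x)\<bar> < e / 2"
        using \<sigma>(2) unfolding A.norm_lim_iff by blast
      have "nrm B (\<rho> (\<sigma> m) \<ominus>\<^bsub>B\<^esub> \<rho> (\<sigma> n)) < e" if mn: "m \<ge> N" "n \<ge> N" for m n
      proof -
        have "nrm A (\<sigma> m \<ominus>\<^bsub>A\<^esub> \<sigma> n) \<le> nrm A (\<sigma> m \<ominus>\<^bsub>A\<^esub> x) + nrm A (\<sigma> n \<ominus>\<^bsub>A\<^esub> x)"
          using A.nrm_minus_triangle[OF PA[OF \<sigma>P] x PA[OF \<sigma>P]] A.nrm_minus_commute[OF x PA[OF \<sigma>P]] by metis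
        moreover have "nrm A (\<sigma> m \<ominus>\<^bsub>A\<^esub> x) < e / 2" "nrm A (\<sigma> n \<ominus>\<^bsub>A\<^esub> x) < e / 2"
          using N mn by force+
        ultimately show ?thesis using contr'[OF \<sigma>P[of m] \<sigma>P[of n]] by linarith
      qed
      then show "\<exists>N. \<forall>m\<ge>N. \<forall>n\<ge>N. nrm B (\<rho> (\<sigma> m) \<ominus>\<^bsub>B\<^esub> \<rho> (\<sigma> n)) < e" by blast
    qed
    moreover have "range (\<lambda>n. \<rho> (\<sigma> n)) \<subseteq> carrier B" using \<rho>(1)[OF \<sigma>P] by auto
    ultimately obtain y where "y \<in> carrier B" "norm_lim B (\<lambda>n. \<rho> (\<sigma> n)) y"
      using B.nrm_complete[of "\<lambda>n. \<rho> (\<sigma> n)"] unfolding norm_lim_def by auto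
    then show ?thesis using LI[OF _ \<sigma>P \<sigma>(2)] by auto
  qed
  have L_unique: "y = y'" if x: "x \<in> carrier A" and L: "L x y" and L': "L x y'" for x y y'
  proof -
    obtain \<sigma> where \<sigma>: "\<forall>n. \<sigma> n \<in> P" "norm_lim A \<sigma> x" "norm_lim B (\<lambda>n. \<rho> (\<sigma> n)) y" and y: "y \<in> carrier B"
      using L unfolding L_def by auto
    obtain \<tau> where \<tau>: "\<forall>n. \<tau> n \<in> P" "norm_lim A \<tau> x" "norm_lim B (\<lambda>n. \<rho> (\<tau> n)) y'" and y': "y' \<in> carrier B"
      using L' unfolding L_def by auto
    have \<sigma>P: "\<sigma> n \<in> P" and \<tau>P: "\<tau> n \<in> P" for n using \<sigma>(1) \<tau>(1) by simp_all
    have "norm_lim B (\<lambda>n. \<rho> (\<sigma> n)) y'"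
    proof (rule B.norm_limI[OF _ _ \<rho>(1)[OF \<sigma>P] y'])
      show "nrm B (\<rho> (\<sigma> n) \<ominus>\<^bsub>B\<^esub> y') \<le> nrm A (\<sigma> n \<ominus>\<^bsub>A\<^esub> x) + nrm A (\<tau> n \<ominus>\<^bsub>A\<^esub> x) + nrm B (\<rho> (\<tau> n) \<ominus>\<^bsub>B\<^esub> y')" for n
        using B.nrm_minus_triangle[OF \<rho>(1)[OF \<sigma>P] \<rho>(1)[OF \<tau>P] y', of n n] contr'[OF \<sigma>P \<tau>P, of n n]
          A.nrm_minus_triangle[OF PA[OF \<sigma>P] x PA[OF \<tau>P], of n n] A.nrm_minus_commute[OF x PA[OF \<tau>P], of n]
        by linarith
      show "(\<lambda>n. nrm A (\<sigma> n \<ominus>\<^bsub>A\<^esub> x) + nrm A (\<tau> n \<ominus>\<^bsub>A\<^esub> x) + nrm B (\<rho> (\<tau> n) \<ominus>\<^bsub>B\<^esub> y')) \<longlonglongrightarrow> 0"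
        using tendsto_add[OF tendsto_add[OF \<sigma>(2)[unfolded norm_lim_def] \<tau>(2)[unfolded norm_lim_def]] \<tau>(3)[unfolded norm_lim_def]]
        by simp
    qed
    then show ?thesis by (rule B.norm_lim_unique[OF \<sigma>(3) _ \<rho>(1)[OF \<sigma>P] y y'])
  qed
  define \<psi> where "\<psi> x = (SOME y. L x y)" for x
  have \<psi>: "L x (\<psi> x)" if "x \<in> carrier A" for x
    unfolding \<psi>_def by (rule someI_ex[OF L_ex[OF that]])
  have \<psi>_eq: "\<psi> x = y" if "x \<in> carrier A" "L x y" for x y by (rule L_unique[OF that(1) \<psi>[OF that(1)] that(2)])
  have \<psi>B: "\<psi> x \<in> carrier B" if "x \<in> carrier A" for x using \<psi>[OF that] by (simp add: L_def)
  have two: "\<psi> (x \<oplus>\<^bsub>A\<^esub> y) = \<psi> x \<oplus>\<^bsub>B\<^esub> \<psi> y \<and> \<psi> (x \<otimes>\<^bsub>A\<^esub> y) = \<psi> x \<otimes>\<^bsub>B\<^esub> \<psi> y"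
    if x: "x \<in> carrier A" and y: "y \<in> carrier A" for x y
  proof -
    obtain \<sigma> where \<sigma>: "\<forall>n. \<sigma> n \<in> P" "norm_lim A \<sigma> x" "norm_lim B (\<lambda>n. \<rho> (\<sigma> n)) (\<psi> x)"
      using \<psi>[OF x] unfolding L_def by auto
    obtain \<tau> where \<tau>: "\<forall>n. \<tau> n \<in> P" "norm_lim A \<tau> y" "norm_lim B (\<lambda>n. \<rho> (\<tau> n)) (\<psi> y)"
      using \<psi>[OF y] unfolding L_def by auto
    have \<sigma>P: "\<sigma> n \<in> P" and \<tau>P: "\<tau> n \<in> P" for n using \<sigma>(1) \<tau>(1) by simp_all
    have "L (x \<oplus>\<^bsub>A\<^esub> y) (\<psi> x \<oplus>\<^bsub>B\<^esub> \<psi> y)"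
    proof (rule LI[OF _ P(2)[OF \<sigma>P \<tau>P] A.norm_lim_add[OF \<sigma>(2) \<tau>(2) PA[OF \<sigma>P] PA[OF \<tau>P] x y]])
      show "norm_lim B (\<lambda>n. \<rho> (\<sigma> n \<oplus>\<^bsub>A\<^esub> \<tau> n)) (\<psi> x \<oplus>\<^bsub>B\<^esub> \<psi> y)"
        unfolding \<rho>(2)[OF \<sigma>P \<tau>P]
        by (rule B.norm_lim_add[OF \<sigma>(3) \<tau>(3) \<rho>(1)[OF \<sigma>P] \<rho>(1)[OF \<tau>P] \<psi>B[OF x] \<psi>B[OF y]])
    qed (use \<psi>B x y in auto)
    moreover have "L (x \<otimes>\<^bsub>A\<^esub> y) (\<psi> x \<otimes>\<^bsub>B\<^esub> \<psi> y)"
    proof (rule LI[OF _ P(4)[OF \<sigma>P \<tau>P] A.norm_lim_mult[OF \<sigma>(2) \<tau>(2) PA[OF \<sigma>P] PA[OF \<tau>P] x y]])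
      show "norm_lim B (\<lambda>n. \<rho> (\<sigma> n \<otimes>\<^bsub>A\<^esub> \<tau> n)) (\<psi> x \<otimes>\<^bsub>B\<^esub> \<psi> y)"
        unfolding \<rho>(4)[OF \<sigma>P \<tau>P]
        by (rule B.norm_lim_mult[OF \<sigma>(3) \<tau>(3) \<rho>(1)[OF \<sigma>P] \<rho>(1)[OF \<tau>P] \<psi>B[OF x] \<psi>B[OF y]])
    qed (use \<psi>B x y in auto)
    ultimately show ?thesis using \<psi>_eq x y by simp
  qed
  have one: "\<psi> (c \<odot>\<^bsub>A\<^esub> x) = c \<odot>\<^bsub>B\<^esub> \<psi> x \<and> \<psi> (star A x) = star B (\<psi> x)" if x: "x \<in> carrier A" for x c
  proof -
    obtain \<sigma> where \<sigma>: "\<forall>n. \<sigma> n \<in> P" "norm_lim A \<sigma> x" "norm_lim B (\<lambda>n. \<rho> (\<sigma> n)) (\<psi> x)"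
      using \<psi>[OF x] unfolding L_def by auto
    have \<sigma>P: "\<sigma> n \<in> P" for n using \<sigma>(1) by simp
    have "L (c \<odot>\<^bsub>A\<^esub> x) (c \<odot>\<^bsub>B\<^esub> \<psi> x)"
    proof (rule LI[OF _ P(3)[OF \<sigma>P] A.norm_lim_smult[OF \<sigma>(2) PA[OF \<sigma>P] x]])
      show "norm_lim B (\<lambda>n. \<rho> (c \<odot>\<^bsub>A\<^esub> \<sigma> n)) (c \<odot>\<^bsub>B\<^esub> \<psi> x)"
        unfolding \<rho>(3)[OF \<sigma>P] by (rule B.norm_lim_smult[OF \<sigma>(3) \<rho>(1)[OF \<sigma>P] \<psi>B[OF x]])
    qed (use \<psi>B x in auto)
    moreover have "L (star A x) (star B (\<psi> x))"
    proof (rule LI[OF _ P(5)[OF \<sigma>P] A.norm_lim_star[OF \<sigma>(2) PA[OF \<sigma>P] x]])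
      show "norm_lim B (\<lambda>n. \<rho> (star A (\<sigma> n))) (star B (\<psi> x))"
        unfolding \<rho>(5)[OF \<sigma>P] by (rule B.norm_lim_star[OF \<sigma>(3) \<rho>(1)[OF \<sigma>P] \<psi>B[OF x]])
    qed (use \<psi>B x in auto)
    ultimately show ?thesis using \<psi>_eq x by simp
  qed
  have "\<psi> x = \<rho> x" if x: "x \<in> P" for x
    by (rule \<psi>_eq[OF PA[OF x] LI[of _ "\<lambda>n. x"]]) (use x \<rho>(1)[OF x] PA[OF x] in auto)
  moreover have "\<psi> \<in> cstar_hom A B"
    unfolding cstar_hom_def using \<psi>B two one by auto
  ultimately show ?thesis by (intro bexI[of _ \<psi>] ballI)
qed

lemma (in unital_cstar_algebra) subalgebra_trans:
  assumes S: "cstar_subalgebra S A" "\<one> \<in> S" and R: "cstar_subalgebra R (A\<lparr>carrier := S\<rparr>)"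
  shows "cstar_subalgebra R A"
proof -
  interpret S: unital_cstar_algebra "A\<lparr>carrier := S\<rparr>" by (rule subalgebra_unital[OF S])
  have SA: "S \<subseteq> carrier A" "submodule S complex_ring A" "norm_closed S A"
    using S(1) by (auto simp: cstar_subalgebra_def submodule_iff)
  have RS: "R \<subseteq> S" using S.cstar_subalgebra_subset[OF R] by simp
  have "submodule R complex_ring A"
    using R SA(1) unfolding cstar_subalgebra_def S.submodule_iff submodule_iff by auto
  moreover have "norm_closed R A"
    unfolding norm_closed_iff
  proof (intro allI impI)
    fix \<sigma> x assume x: "x \<in> carrier A" and \<sigma>: "\<forall>n. \<sigma> n \<in> R" and lim: "norm_lim A \<sigma> x"
    have \<sigma>S: "\<sigma> n \<in> S" for n using \<sigma> RS by blast
    have xS: "x \<in> S" by (rule norm_closed_limD[OF SA(3) lim x \<sigma>S])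
    have cl: "norm_closed R (A\<lparr>carrier := S\<rparr>)" using R by (simp add: cstar_subalgebra_def)
    show "x \<in> R"
      by (rule norm_closed_limD[OF cl, of \<sigma>]) (use norm_lim_subalgebra[OF SA(2) \<sigma>S xS] lim xS \<sigma> in auto)
  qed
  ultimately show ?thesis using R by (simp add: cstar_subalgebra_def)
qed

lemma toeplitz_one_closed: "\<one>\<^bsub>cone_ops\<^esub> \<in> carrier toeplitz_algebra"
  using toeplitz_op_in_algebra[of 0] unfolding toeplitz_op_zero by simp

lemma toeplitz_algebra_generated:
  fixes R :: "(('g::linordered_ab_group_add \<Rightarrow> complex) \<Rightarrow> 'g \<Rightarrow> complex) set"
  assumes R: "cstar_subalgebra R toeplitz_algebra" and T: "\<And>s. 0 \<le> s \<Longrightarrow> toeplitz_op s \<in> R"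
  shows "R = carrier toeplitz_algebra"
proof -
  interpret O: unital_cstar_algebra "cone_ops :: (('g \<Rightarrow> complex) \<Rightarrow> 'g \<Rightarrow> complex) cstar"
    by (rule operator_unital_cstar_algebra)
  have eq: "toeplitz_algebra = cone_ops\<lparr>carrier := carrier toeplitz_algebra\<rparr>"
    by (simp add: toeplitz_algebra_def)
  have "cstar_subalgebra R cone_ops"
    by (rule O.subalgebra_trans[OF toeplitz_subalgebra toeplitz_one_closed]) (unfold eq[symmetric], rule R)
  then have "cstar_generated cone_ops {toeplitz_op s | s. 0 \<le> s} \<subseteq> R"
    by (rule cstar_generated_least) (use T in auto)
  then have "carrier toeplitz_algebra \<subseteq> R" by (simp add: toeplitz_algebra_def)
  moreover have "R \<subseteq> carrier toeplitz_algebra"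
    by (rule unital_cstar_algebra.cstar_subalgebra_subset[OF toeplitz_unital_cstar_algebra R])
  ultimately show ?thesis by simp
qed

text \<open>Acting as a convolution far out does not pass to adjoints, so it is required of both
  \<open>S\<close> and \<open>S\<^sup>*\<close>.\<close>
definition symbol_algebra :: "(('g::linordered_ab_group_add \<Rightarrow> complex) \<Rightarrow> 'g \<Rightarrow> complex) set" where
  "symbol_algebra = {S \<in> carrier toeplitz_algebra. \<exists>c. has_symbol S c \<and> has_symbol (star cone_ops S) (adj c)}"

definition fourier :: "('g::ab_group_add \<Rightarrow>\<^sub>0 complex) \<Rightarrow> ('g \<Rightarrow> complex) \<Rightarrow> complex" where
  "fourier c = (\<lambda>\<xi>. if \<xi> \<in> dual_group then char_sum \<xi> c else 0)"

definition symbol :: "(('g::linordered_ab_group_add \<Rightarrow> complex) \<Rightarrow> 'g \<Rightarrow> complex) \<Rightarrow> 'g \<Rightarrow>\<^sub>0 complex" where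
  "symbol S = (THE c. has_symbol S c)"

lemma symbol_eq: "has_symbol S c \<Longrightarrow> symbol S = c"
  unfolding symbol_def by (rule the_equality) (auto intro: has_symbol_unique)

lemma fourier_in_C_dual: "fourier c \<in> carrier C_dual"
proof -
  have "continuous_on dual_group (\<lambda>\<xi>. char_sum \<xi> c)"
    unfolding char_sum_def
    by (intro continuous_on_sum continuous_on_mult continuous_on_const
        continuous_on_subset[OF continuous_on_product_coordinates subset_UNIV])
  then have "continuous_on dual_group (fourier c)"
    by (simp add: fourier_def cong: continuous_on_cong)
  then show ?thesis by (simp add: fourier_def)
qed

lemma symbol_algebra_props:
  assumes S: "S \<in> symbol_algebra"
  shows "S \<in> carrier toeplitz_algebra" "has_symbol S (symbol S)" "has_symbol (star cone_ops S) (adj (symbol S))"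
  using S symbol_eq[of S] by (auto simp: symbol_algebra_def)

lemma symbol_algebraI:
  assumes "S \<in> carrier toeplitz_algebra" "has_symbol S c" "has_symbol (star cone_ops S) (adj c)"
  shows "S \<in> symbol_algebra" "symbol S = c"
  using assms symbol_eq[OF assms(2)] by (auto simp: symbol_algebra_def)

lemma symbol_algebra_closed:
  fixes S R :: "('g::linordered_ab_group_add \<Rightarrow> complex) \<Rightarrow> 'g \<Rightarrow> complex"
  assumes S: "S \<in> symbol_algebra"
  shows "R \<in> symbol_algebra \<Longrightarrow> (\<lambda>f x. S f x + R f x) \<in> symbol_algebra \<and> symbol (\<lambda>f x. S f x + R f x) = symbol S + symbol R"
    and "(\<lambda>f x. k * S f x) \<in> symbol_algebra \<and> symbol (\<lambda>f x. k * S f x) = Poly_Mapping.single 0 k * symbol S"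
    and "R \<in> symbol_algebra \<Longrightarrow> S \<circ> R \<in> symbol_algebra \<and> symbol (S \<circ> R) = symbol S * symbol R"
    and "star cone_ops S \<in> symbol_algebra \<and> symbol (star cone_ops S) = adj (symbol S)"
proof -
  interpret A: unital_cstar_algebra "toeplitz_algebra :: (('g \<Rightarrow> complex) \<Rightarrow> 'g \<Rightarrow> complex) cstar"
    by (rule toeplitz_unital_cstar_algebra)
  note s = symbol_algebra_props[OF S]
  note sB = toeplitz_algebra_bounded[OF s(1)]
  show "(\<lambda>f x. k * S f x) \<in> symbol_algebra \<and> symbol (\<lambda>f x. k * S f x) = Poly_Mapping.single 0 k * symbol S"
  proof (rule conjI; rule symbol_algebraI)
    show "(\<lambda>f x. k * S f x) \<in> carrier toeplitz_algebra" using A.smult_carrier[OF s(1), of k] by simp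
    then show "(\<lambda>f x. k * S f x) \<in> carrier toeplitz_algebra" .
    show "has_symbol (\<lambda>f x. k * S f x) (Poly_Mapping.single 0 k * symbol S)" by (rule has_symbol_scale[OF s(2)])
    then show "has_symbol (\<lambda>f x. k * S f x) (Poly_Mapping.single 0 k * symbol S)" .
    have "star cone_ops (\<lambda>f x. k * S f x) = (\<lambda>f x. cnj k * star cone_ops S f x)"
      using A.star_smult[OF s(1), of k] by simp
    then show "has_symbol (star cone_ops (\<lambda>f x. k * S f x)) (adj (Poly_Mapping.single 0 k * symbol S))"
      using has_symbol_scale[OF s(3), of "cnj k"] by (simp add: adj_mult)
    then show "has_symbol (star cone_ops (\<lambda>f x. k * S f x)) (adj (Poly_Mapping.single 0 k * symbol S))" .
  qed
  show "star cone_ops S \<in> symbol_algebra \<and> symbol (star cone_ops S) = adj (symbol S)"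
    using symbol_algebraI[of "star cone_ops S" "adj (symbol S)"] A.star_closed[OF s(1)] s A.star_star[OF s(1)]
    by simp
  assume R: "R \<in> symbol_algebra"
  note r = symbol_algebra_props[OF R]
  note rB = toeplitz_algebra_bounded[OF r(1)]
  have add: "(\<lambda>f x. S f x + R f x) \<in> carrier toeplitz_algebra" "S \<circ> R \<in> carrier toeplitz_algebra"
    using A.M.a_closed[OF s(1) r(1)] A.mult_closed[OF s(1) r(1)] by simp_all
  have st: "star cone_ops (\<lambda>f x. S f x + R f x) = (\<lambda>f x. star cone_ops S f x + star cone_ops R f x)"
    "star cone_ops (S \<circ> R) = star cone_ops R \<circ> star cone_ops S"
    using A.star_add[OF s(1) r(1)] A.star_mult[OF s(1) r(1)] by simp_all
  show "(\<lambda>f x. S f x + R f x) \<in> symbol_algebra \<and> symbol (\<lambda>f x. S f x + R f x) = symbol S + symbol R"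
    using symbol_algebraI[OF add(1) has_symbol_add[OF s(2) r(2)]] has_symbol_add[OF s(3) r(3)]
    unfolding st adj_add by blast
  have "has_symbol (star cone_ops (S \<circ> R)) (adj (symbol S * symbol R))"
    unfolding st adj_mult mult.commute[of "adj (symbol S)"]
    by (rule has_symbol_comp[OF operator_star_bounded[OF rB] operator_star_bounded[OF sB] r(3) s(3)])
  then show "S \<circ> R \<in> symbol_algebra \<and> symbol (S \<circ> R) = symbol S * symbol R"
    using symbol_algebraI[OF add(2) has_symbol_comp[OF sB rB s(2) r(2)]] by blast
qed

lemma toeplitz_op_symbol_algebra:
  assumes s: "0 \<le> s"
  shows "toeplitz_op s \<in> symbol_algebra" "symbol (toeplitz_op s) = Poly_Mapping.single s 1"
  by (rule symbol_algebraI[OF toeplitz_op_in_algebra[OF s] has_symbol_toeplitz_op[OF s]];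
      use has_symbol_back_shift[OF s] star_toeplitz_op[OF s] in simp)+

lemma symbol_algebra_dense:
  fixes S :: "('g::linordered_ab_group_add \<Rightarrow> complex) \<Rightarrow> 'g \<Rightarrow> complex"
  assumes "S \<in> carrier toeplitz_algebra" "e > 0"
  shows "\<exists>p\<in>symbol_algebra. nrm toeplitz_algebra (p \<ominus>\<^bsub>toeplitz_algebra\<^esub> S) < e"
proof -
  interpret A: unital_cstar_algebra "toeplitz_algebra :: (('g \<Rightarrow> complex) \<Rightarrow> 'g \<Rightarrow> complex) cstar"
    by (rule toeplitz_unital_cstar_algebra)
  let ?P = "symbol_algebra :: (('g \<Rightarrow> complex) \<Rightarrow> 'g \<Rightarrow> complex) set"
  let ?C = "{x \<in> carrier toeplitz_algebra. \<forall>e>0. \<exists>p\<in>?P. nrm toeplitz_algebra (p \<ominus>\<^bsub>toeplitz_algebra\<^esub> x) < e}"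
  have sub: "?P \<subseteq> carrier toeplitz_algebra" by (auto simp: symbol_algebra_def)
  have zero: "\<zero>\<^bsub>toeplitz_algebra\<^esub> \<in> ?P"
    using symbol_algebra_closed(2)[OF toeplitz_op_symbol_algebra(1)[of "0 :: 'g"], of 0] by simp
  have "cstar_subalgebra ?C toeplitz_algebra"
  proof (rule A.closure_subalgebra[OF sub zero])
    fix x y k assume x: "x \<in> ?P"
    show "k \<odot>\<^bsub>toeplitz_algebra\<^esub> x \<in> ?P" using symbol_algebra_closed(2)[OF x] by simp
    show "star toeplitz_algebra x \<in> ?P" using symbol_algebra_closed(4)[OF x] by simp
    assume y: "y \<in> ?P"
    show "x \<oplus>\<^bsub>toeplitz_algebra\<^esub> y \<in> ?P" using symbol_algebra_closed(1)[OF x y] by simp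
    show "x \<otimes>\<^bsub>toeplitz_algebra\<^esub> y \<in> ?P" using symbol_algebra_closed(3)[OF x y] by simp
  qed
  moreover have "toeplitz_op s \<in> ?C" if "0 \<le> s" for s
  proof -
    have T: "toeplitz_op s \<in> carrier toeplitz_algebra" by (rule toeplitz_op_in_algebra[OF that])
    have "nrm toeplitz_algebra (toeplitz_op s \<ominus>\<^bsub>toeplitz_algebra\<^esub> toeplitz_op s) = 0"
      using A.nrm_zero A.M.r_neg[OF T] unfolding a_minus_def by simp
    then have "\<forall>e>0. \<exists>p\<in>?P. nrm toeplitz_algebra (p \<ominus>\<^bsub>toeplitz_algebra\<^esub> toeplitz_op s) < e"
      using toeplitz_op_symbol_algebra(1)[OF that] by (intro allI impI bexI[of _ "toeplitz_op s"]) auto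
    with T show ?thesis by blast
  qed
  ultimately have "?C = carrier toeplitz_algebra" by (rule toeplitz_algebra_generated)
  then have "S \<in> ?C" using assms(1) by simp
  then show ?thesis using assms(2) by blast
qed

lemma exists_symbol_hom:
  "\<exists>\<psi>\<in>cstar_hom (toeplitz_algebra :: (('g::linordered_ab_group_add \<Rightarrow> complex) \<Rightarrow> 'g \<Rightarrow> complex) cstar) C_dual.
    \<forall>S\<in>symbol_algebra. \<psi> S = fourier (symbol S)"
proof (rule cstar_hom_extension[OF toeplitz_unital_cstar_algebra C_dual_unital_cstar_algebra])
  fix S R :: "('g \<Rightarrow> complex) \<Rightarrow> 'g \<Rightarrow> complex" and k :: complex
  assume S: "S \<in> symbol_algebra"
  show "k \<odot>\<^bsub>toeplitz_algebra\<^esub> S \<in> symbol_algebra" using symbol_algebra_closed(2)[OF S] by simp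
  show "star toeplitz_algebra S \<in> symbol_algebra" using symbol_algebra_closed(4)[OF S] by simp
  show "fourier (symbol (k \<odot>\<^bsub>toeplitz_algebra\<^esub> S)) = k \<odot>\<^bsub>C_dual\<^esub> fourier (symbol S)"
    using symbol_algebra_closed(2)[OF S]
    by (auto simp: fourier_def fun_eq_iff char_sum_mult dual_group_D)
  show "fourier (symbol (star toeplitz_algebra S)) = star C_dual (fourier (symbol S))"
    using symbol_algebra_closed(4)[OF S] by (auto simp: fourier_def fun_eq_iff char_sum_adj)
  show "nrm C_dual (fourier (symbol S)) \<le> nrm toeplitz_algebra S"
  proof (rule C_dual_norm_le)
    fix \<xi> :: "'g \<Rightarrow> complex" assume "\<xi> \<in> dual_group"
    then show "cmod (fourier (symbol S) \<xi>) \<le> nrm toeplitz_algebra S"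
      using char_sum_le_norm[OF toeplitz_algebra_bounded[OF symbol_algebra_props(1)[OF S]] symbol_algebra_props(2)[OF S]]
      by (simp add: fourier_def)
  qed
  assume R: "R \<in> symbol_algebra"
  show "S \<oplus>\<^bsub>toeplitz_algebra\<^esub> R \<in> symbol_algebra" "S \<otimes>\<^bsub>toeplitz_algebra\<^esub> R \<in> symbol_algebra"
    using symbol_algebra_closed(1,3)[OF S R] by simp_all
  show "fourier (symbol (S \<oplus>\<^bsub>toeplitz_algebra\<^esub> R)) = fourier (symbol S) \<oplus>\<^bsub>C_dual\<^esub> fourier (symbol R)"
    using symbol_algebra_closed(1)[OF S R] by (auto simp: fourier_def fun_eq_iff char_sum_add)
  show "fourier (symbol (S \<otimes>\<^bsub>toeplitz_algebra\<^esub> R)) = fourier (symbol S) \<otimes>\<^bsub>C_dual\<^esub> fourier (symbol R)"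
    using symbol_algebra_closed(3)[OF S R] by (auto simp: fourier_def fun_eq_iff char_sum_mult dual_group_D)
next
  show "symbol_algebra \<subseteq> carrier (toeplitz_algebra :: (('g \<Rightarrow> complex) \<Rightarrow> 'g \<Rightarrow> complex) cstar)"
    by (auto simp: symbol_algebra_def)
qed (simp_all only: fourier_in_C_dual symbol_algebra_dense)

text \<open>The map \<open>\<psi>\<^sub>T\<close>: the continuous extension of the Fourier transform of the symbol. The
  choice is unique, since operators with symbols are dense in the Toeplitz algebra.\<close>
definition toeplitz_symbol_hom ::
  "(('g::linordered_ab_group_add \<Rightarrow> complex) \<Rightarrow> 'g \<Rightarrow> complex) \<Rightarrow> ('g \<Rightarrow> complex) \<Rightarrow> complex" where
  "toeplitz_symbol_hom = (SOME \<psi>. \<psi> \<in> cstar_hom toeplitz_algebra C_dual \<and>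
    (\<forall>S\<in>symbol_algebra. \<psi> S = fourier (symbol S)))"

lemma toeplitz_symbol_hom:
  fixes S :: "('g::linordered_ab_group_add \<Rightarrow> complex) \<Rightarrow> 'g \<Rightarrow> complex"
  shows "(toeplitz_symbol_hom :: (('g \<Rightarrow> complex) \<Rightarrow> 'g \<Rightarrow> complex) \<Rightarrow> _) \<in> cstar_hom toeplitz_algebra C_dual"
    and "S \<in> symbol_algebra \<Longrightarrow> toeplitz_symbol_hom S = fourier (symbol S)"
proof -
  have "\<exists>\<psi>. \<psi> \<in> cstar_hom (toeplitz_algebra :: (('g \<Rightarrow> complex) \<Rightarrow> 'g \<Rightarrow> complex) cstar) C_dual \<and>
    (\<forall>S\<in>symbol_algebra. \<psi> S = fourier (symbol S))"
    using exists_symbol_hom by blast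
  from someI_ex[OF this]
  have *: "(toeplitz_symbol_hom :: (('g \<Rightarrow> complex) \<Rightarrow> 'g \<Rightarrow> complex) \<Rightarrow> _) \<in> cstar_hom toeplitz_algebra C_dual \<and>
    (\<forall>S\<in>symbol_algebra. (toeplitz_symbol_hom :: (('g \<Rightarrow> complex) \<Rightarrow> 'g \<Rightarrow> complex) \<Rightarrow> _) S = fourier (symbol S))"
    unfolding toeplitz_symbol_hom_def .
  show "(toeplitz_symbol_hom :: (('g \<Rightarrow> complex) \<Rightarrow> 'g \<Rightarrow> complex) \<Rightarrow> _) \<in> cstar_hom toeplitz_algebra C_dual"
    by (rule conjunct1[OF *])
  show "S \<in> symbol_algebra \<Longrightarrow> toeplitz_symbol_hom S = fourier (symbol S)"
    using conjunct2[OF *] by simp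
qed

section \<open>The kernel and the range of the symbol homomorphism\<close>

text \<open>The function topology inherits the separation properties of the range type; the
  Hausdorff property is what the Stone-Weierstrass theorem asks for on the dual group.\<close>
lemma open_evaluation_vimage:
  fixes W :: "'b::topological_space set"
  assumes "open W" shows "open ((\<lambda>h :: 'a \<Rightarrow> 'b. h x) -` W)"
  by (rule open_vimage[OF assms continuous_on_product_coordinates])

instance "fun" :: (type, t0_space) t0_space
proof
  fix f g :: "'a \<Rightarrow> 'b" assume "f \<noteq> g"
  then obtain x where x: "f x \<noteq> g x" by (auto simp: fun_eq_iff)
  obtain U where U: "open U" "(f x \<in> U) \<noteq> (g x \<in> U)" using t0_space_class.t0_space[OF x] by blast
  show "\<exists>U. open U \<and> \<not> (f \<in> U \<longleftrightarrow> g \<in> U)"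
    using U by (intro exI[of _ "(\<lambda>h. h x) -` U"]) (simp add: open_evaluation_vimage)
qed

instance "fun" :: (type, t1_space) t1_space
proof
  fix f g :: "'a \<Rightarrow> 'b" assume "f \<noteq> g"
  then obtain x where x: "f x \<noteq> g x" by (auto simp: fun_eq_iff)
  obtain U where U: "open U" "f x \<in> U" "g x \<notin> U" using t1_space_class.t1_space[OF x] by blast
  show "\<exists>U. open U \<and> f \<in> U \<and> g \<notin> U"
    using U by (intro exI[of _ "(\<lambda>h. h x) -` U"]) (simp add: open_evaluation_vimage)
qed

instance "fun" :: (type, t2_space) t2_space
proof
  fix f g :: "'a \<Rightarrow> 'b" assume "f \<noteq> g"
  then obtain x where x: "f x \<noteq> g x" by (auto simp: fun_eq_iff)
  obtain U V where UV: "open U" "open V" "f x \<in> U" "g x \<in> V" "U \<inter> V = {}"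
    using hausdorff[OF x] by blast
  show "\<exists>U V. open U \<and> open V \<and> f \<in> U \<and> g \<in> V \<and> U \<inter> V = {}"
    using UV by (intro exI[of _ "(\<lambda>h. h x) -` U"] exI[of _ "(\<lambda>h. h x) -` V"])
      (simp add: open_evaluation_vimage flip: vimage_Int)
qed

lemma toeplitz_symbol_hom_toeplitz_op:
  assumes "0 \<le> s" shows "toeplitz_symbol_hom (toeplitz_op s) = dual_eval s"
  unfolding toeplitz_symbol_hom(2)[OF toeplitz_op_symbol_algebra(1)[OF assms]]
    toeplitz_op_symbol_algebra(2)[OF assms]
  by (auto simp: fourier_def dual_eval_def fun_eq_iff)

lemma cstar_morphism_toeplitz_symbol_hom:
  "cstar_morphism (toeplitz_algebra :: (('g::linordered_ab_group_add \<Rightarrow> complex) \<Rightarrow> 'g \<Rightarrow> complex) cstar)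
    C_dual toeplitz_symbol_hom"
proof (intro cstar_morphism.intro toeplitz_unital_cstar_algebra C_dual_unital_cstar_algebra
    cstar_morphism_axioms.intro toeplitz_symbol_hom(1))
  have "toeplitz_symbol_hom (toeplitz_op (0 :: 'g)) = dual_eval 0"
    by (rule toeplitz_symbol_hom_toeplitz_op) simp
  then show "toeplitz_symbol_hom \<one>\<^bsub>toeplitz_algebra :: (('g \<Rightarrow> complex) \<Rightarrow> 'g \<Rightarrow> complex) cstar\<^esub> = \<one>\<^bsub>C_dual\<^esub>"
    unfolding toeplitz_op_zero toeplitz_algebra_simps
    by (auto simp: dual_eval_def dual_group_D fun_eq_iff)
qed

text \<open>Fixing the group as a type variable keeps the constants below, which are indexed by nothing
  else, at one type.\<close>
locale toeplitz_context =
  fixes group_type :: "'g::linordered_ab_group_add itself"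
begin

abbreviation TA :: "(('g \<Rightarrow> complex) \<Rightarrow> 'g \<Rightarrow> complex) cstar" where "TA \<equiv> toeplitz_algebra"
abbreviation CD :: "(('g \<Rightarrow> complex) \<Rightarrow> complex) cstar" where "CD \<equiv> C_dual"

sublocale M: cstar_morphism TA CD toeplitz_symbol_hom
  by (rule cstar_morphism_toeplitz_symbol_hom)

lemma star_mult_toeplitz_op:
  assumes "0 \<le> (s::'g)" shows "star TA (toeplitz_op s) \<otimes>\<^bsub>TA\<^esub> toeplitz_op s = \<one>\<^bsub>TA\<^esub>"
  using back_shift_toeplitz_op[OF assms] star_toeplitz_op[OF assms] by simp

lemma nrm_toeplitz_op_le:
  assumes s: "0 \<le> (s::'g)" shows "nrm TA (toeplitz_op s) \<le> 1"
proof -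
  have "(nrm TA (toeplitz_op s))\<^sup>2 \<le> 1"
    using M.A.nrm_cstar[OF toeplitz_op_in_algebra[OF s]] M.A.nrm_one_le
    unfolding star_mult_toeplitz_op[OF s] by simp
  then show ?thesis using M.A.nrm_nonneg[OF toeplitz_op_in_algebra[OF s]]
    by (simp add: abs_square_le_1)
qed

text \<open>The projection \<open>1 - T\<^sub>z T\<^sub>z\<^sup>*\<close> onto the functions supported in the interval from \<open>0\<close> to
  \<open>z\<close>, with \<open>z\<close> excluded.\<close>
definition range_defect :: "'g \<Rightarrow> ('g \<Rightarrow> complex) \<Rightarrow> 'g \<Rightarrow> complex" where
  "range_defect z = \<one>\<^bsub>TA\<^esub> \<ominus>\<^bsub>TA\<^esub> toeplitz_op z \<otimes>\<^bsub>TA\<^esub> star TA (toeplitz_op z)"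

lemma symbol_hom_range_projection:
  assumes z: "0 \<le> z" shows "toeplitz_symbol_hom (toeplitz_op z \<otimes>\<^bsub>TA\<^esub> star TA (toeplitz_op z)) = \<one>\<^bsub>CD\<^esub>"
proof -
  have T: "toeplitz_op z \<in> carrier TA" by (rule toeplitz_op_in_algebra[OF z])
  have "toeplitz_symbol_hom (toeplitz_op z \<otimes>\<^bsub>TA\<^esub> star TA (toeplitz_op z))
      = toeplitz_symbol_hom (star TA (toeplitz_op z) \<otimes>\<^bsub>TA\<^esub> toeplitz_op z)"
    unfolding M.hom_mult[OF T M.A.star_carrier[OF T]] M.hom_mult[OF M.A.star_carrier[OF T] T]
    by (simp add: mult.commute)
  then show ?thesis unfolding star_mult_toeplitz_op[OF z] M.hom_one .
qed

text \<open>The quotient norm modulo the commutator ideal is approached along \<open>S T\<^sub>z\<close>: compressing to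
  the far part of the cone brings the norm of \<open>S\<close> down to that of its symbol.\<close>
lemma symbol_hom_lift:
  assumes S: "S \<in> carrier TA" and e: "0 < e"
  shows "\<exists>z\<ge>0. nrm TA (S \<otimes>\<^bsub>TA\<^esub> toeplitz_op z) \<le> nrm CD (toeplitz_symbol_hom S) + e"
proof -
  have "0 < e / 2" using e by simp
  from symbol_algebra_dense[OF S this]
  obtain p where p: "p \<in> symbol_algebra" and d: "nrm TA (p \<ominus>\<^bsub>TA\<^esub> S) < e / 2" by blast
  note P = symbol_algebra_props[OF p]
  let ?s = "nrm CD (toeplitz_symbol_hom p)"
  have "\<exists>z\<ge>0. nrm cone_ops (p \<circ> toeplitz_op z) \<le> ?s"
  proof (rule symbol_norm_le[OF toeplitz_algebra_bounded[OF P(1)] P(2)])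
    show "0 \<le> ?s" by (rule M.B.nrm_nonneg[OF M.hom_closed[OF P(1)]])
    fix \<xi> :: "'g \<Rightarrow> complex" assume "\<xi> \<in> dual_group"
    then show "cmod (char_sum \<xi> (symbol p)) \<le> ?s"
      using le_C_dual_norm[OF M.hom_closed[OF P(1)], of \<xi>] toeplitz_symbol_hom(2)[OF p]
      by (simp add: fourier_def)
  qed
  then obtain z where z: "0 \<le> z" "nrm TA (p \<otimes>\<^bsub>TA\<^esub> toeplitz_op z) \<le> ?s" by auto
  have T: "toeplitz_op z \<in> carrier TA" by (rule toeplitz_op_in_algebra[OF z(1)])
  have "?s \<le> nrm CD (toeplitz_symbol_hom S) + e / 2"
  proof -
    have "nrm CD (toeplitz_symbol_hom p \<ominus>\<^bsub>CD\<^esub> toeplitz_symbol_hom S) \<le> e / 2"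
      using M.hom_contractive[OF M.A.M.minus_closed[OF P(1) S]] d
      unfolding M.hom_minus[OF P(1) S] by linarith
    then show ?thesis using M.B.nrm_le_minus[OF M.hom_closed[OF P(1)] M.hom_closed[OF S]] by linarith
  qed
  moreover have "nrm TA (S \<otimes>\<^bsub>TA\<^esub> toeplitz_op z) \<le> nrm TA (p \<otimes>\<^bsub>TA\<^esub> toeplitz_op z) + e / 2"
  proof -
    have "S \<otimes>\<^bsub>TA\<^esub> toeplitz_op z \<ominus>\<^bsub>TA\<^esub> p \<otimes>\<^bsub>TA\<^esub> toeplitz_op z = (S \<ominus>\<^bsub>TA\<^esub> p) \<otimes>\<^bsub>TA\<^esub> toeplitz_op z"
      using S P(1) T by algebra
    then have "nrm TA (S \<otimes>\<^bsub>TA\<^esub> toeplitz_op z \<ominus>\<^bsub>TA\<^esub> p \<otimes>\<^bsub>TA\<^esub> toeplitz_op z)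
        \<le> nrm TA (S \<ominus>\<^bsub>TA\<^esub> p) * nrm TA (toeplitz_op z)"
      using M.A.nrm_mult[OF M.A.M.minus_closed[OF S P(1)] T] by (simp only:)
    also have "\<dots> \<le> nrm TA (S \<ominus>\<^bsub>TA\<^esub> p) * 1"
      by (rule mult_left_mono[OF nrm_toeplitz_op_le[OF z(1)] M.A.nrm_nonneg[OF M.A.M.minus_closed[OF S P(1)]]])
    also have "\<dots> \<le> e / 2" using d M.A.nrm_minus_commute[OF S P(1)] by simp
    finally show ?thesis
      using M.A.nrm_le_minus[OF M.A.mult_closed[OF S T] M.A.mult_closed[OF P(1) T]] by linarith
  qed
  ultimately show ?thesis using z by (intro exI[of _ z]) auto
qed

lemma nrm_range_projection_le:
  assumes S: "S \<in> carrier TA" and z: "0 \<le> z"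
  shows "nrm TA (S \<otimes>\<^bsub>TA\<^esub> (toeplitz_op z \<otimes>\<^bsub>TA\<^esub> star TA (toeplitz_op z))) \<le> nrm TA (S \<otimes>\<^bsub>TA\<^esub> toeplitz_op z)"
proof -
  have T: "toeplitz_op z \<in> carrier TA" by (rule toeplitz_op_in_algebra[OF z])
  have "nrm TA (S \<otimes>\<^bsub>TA\<^esub> toeplitz_op z \<otimes>\<^bsub>TA\<^esub> star TA (toeplitz_op z))
      \<le> nrm TA (S \<otimes>\<^bsub>TA\<^esub> toeplitz_op z) * nrm TA (star TA (toeplitz_op z))"
    by (rule M.A.nrm_mult[OF M.A.mult_closed[OF S T] M.A.star_carrier[OF T]])
  also have "\<dots> \<le> nrm TA (S \<otimes>\<^bsub>TA\<^esub> toeplitz_op z) * 1"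
    by (rule mult_left_mono[OF _ M.A.nrm_nonneg[OF M.A.mult_closed[OF S T]]])
       (simp only: M.A.nrm_star[OF T] nrm_toeplitz_op_le[OF z])
  finally show ?thesis using M.A.mult_assoc[OF S T M.A.star_carrier[OF T]] by simp
qed

text \<open>If the symbol of \<open>S\<close> vanishes, then \<open>S T\<^sub>z\<close> becomes small, so \<open>S\<close> is the limit of the
  elements \<open>S (1 - T\<^sub>z T\<^sub>z\<^sup>*)\<close>. It is used both for ideals of the Toeplitz algebra and for images of
  kernels.\<close>
lemma kernel_symbol_hom_approx:
  assumes S: "S \<in> carrier TA" and S0: "toeplitz_symbol_hom S = \<zero>\<^bsub>CD\<^esub>"
    and J: "norm_closed J TA" "J \<subseteq> carrier TA" "\<And>z. 0 \<le> z \<Longrightarrow> S \<otimes>\<^bsub>TA\<^esub> range_defect z \<in> J"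
  shows "S \<in> J"
proof (rule M.A.norm_closedD[OF J(1) S J(2)])
  fix e :: real assume e: "0 < e"
  then have "0 < e / 2" by simp
  from symbol_hom_lift[OF S this] obtain z where z: "0 \<le> z" "nrm TA (S \<otimes>\<^bsub>TA\<^esub> toeplitz_op z) \<le> e / 2"
    unfolding S0 by (auto simp only: M.B.nrm_zero add_0)
  have T: "toeplitz_op z \<in> carrier TA" by (rule toeplitz_op_in_algebra[OF z(1)])
  let ?p = "toeplitz_op z \<otimes>\<^bsub>TA\<^esub> star TA (toeplitz_op z)"
  have p: "?p \<in> carrier TA" by (rule M.A.mult_closed[OF T M.A.star_carrier[OF T]])
  have "S \<otimes>\<^bsub>TA\<^esub> range_defect z \<ominus>\<^bsub>TA\<^esub> S = \<ominus>\<^bsub>TA\<^esub> (S \<otimes>\<^bsub>TA\<^esub> ?p)"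
  proof -
    have "S \<otimes>\<^bsub>TA\<^esub> (\<one>\<^bsub>TA\<^esub> \<ominus>\<^bsub>TA\<^esub> ?p) = S \<otimes>\<^bsub>TA\<^esub> \<one>\<^bsub>TA\<^esub> \<ominus>\<^bsub>TA\<^esub> S \<otimes>\<^bsub>TA\<^esub> ?p"
      using S p M.A.one_closed by algebra
    then have "S \<otimes>\<^bsub>TA\<^esub> range_defect z = S \<ominus>\<^bsub>TA\<^esub> S \<otimes>\<^bsub>TA\<^esub> ?p"
      unfolding range_defect_def M.A.one_right[OF S] .
    moreover have "S \<otimes>\<^bsub>TA\<^esub> ?p \<in> carrier TA" by (rule M.A.mult_closed[OF S p])
    then have "S \<ominus>\<^bsub>TA\<^esub> S \<otimes>\<^bsub>TA\<^esub> ?p \<ominus>\<^bsub>TA\<^esub> S = \<ominus>\<^bsub>TA\<^esub> (S \<otimes>\<^bsub>TA\<^esub> ?p)"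
      using S by algebra
    ultimately show ?thesis by (simp only:)
  qed
  then have "nrm TA (S \<otimes>\<^bsub>TA\<^esub> range_defect z \<ominus>\<^bsub>TA\<^esub> S) = nrm TA (S \<otimes>\<^bsub>TA\<^esub> ?p)"
    by (simp only: M.A.nrm_uminus[OF M.A.mult_closed[OF S p]])
  also have "\<dots> \<le> e / 2" by (rule order_trans[OF nrm_range_projection_le[OF S z(1)] z(2)])
  finally have "nrm TA (S \<otimes>\<^bsub>TA\<^esub> range_defect z \<ominus>\<^bsub>TA\<^esub> S) < e" using e by simp
  with J(3)[OF z(1)] show "\<exists>y\<in>J. nrm TA (y \<ominus>\<^bsub>TA\<^esub> S) < e" by blast
qed

lemma ideal_kernel:
  assumes "cstar_morphism TA B \<phi>"
  shows "ideal (a_kernel TA B \<phi>) TA"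
proof -
  interpret F: cstar_morphism TA B \<phi> by (rule assms)
  have "submodule (a_kernel TA B \<phi>) complex_ring TA"
    using F.kernel_subalgebra by (simp add: cstar_subalgebra_def)
  then have "subgroup (a_kernel TA B \<phi>) (add_monoid TA)" by (rule submodule.axioms(1))
  then show ?thesis
    by (rule idealI[OF M.A.U.ring_axioms]) (rule F.kernel_mult_left F.kernel_mult_right; assumption)+
qed

text \<open>One inclusion holds because functions commute; the other because
  \<open>1 - T\<^sub>z T\<^sub>z\<^sup>*\<close> is the commutator of \<open>T\<^sub>z\<^sup>*\<close> and \<open>T\<^sub>z\<close>.\<close>
lemma kernel_symbol_hom: "a_kernel TA CD toeplitz_symbol_hom = commutator_ideal TA"
proof
  have "norm_closed (a_kernel TA CD toeplitz_symbol_hom) TA"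
    using M.kernel_subalgebra by (simp add: cstar_subalgebra_def)
  moreover have "(x \<otimes>\<^bsub>TA\<^esub> y) \<ominus>\<^bsub>TA\<^esub> (y \<otimes>\<^bsub>TA\<^esub> x) \<in> a_kernel TA CD toeplitz_symbol_hom"
    if x: "x \<in> carrier TA" and y: "y \<in> carrier TA" for x y
  proof -
    have "toeplitz_symbol_hom ((x \<otimes>\<^bsub>TA\<^esub> y) \<ominus>\<^bsub>TA\<^esub> (y \<otimes>\<^bsub>TA\<^esub> x))
        = toeplitz_symbol_hom (x \<otimes>\<^bsub>TA\<^esub> y) \<ominus>\<^bsub>CD\<^esub> toeplitz_symbol_hom (y \<otimes>\<^bsub>TA\<^esub> x)"
      by (rule M.hom_minus[OF M.A.mult_closed[OF x y] M.A.mult_closed[OF y x]])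
    also have "toeplitz_symbol_hom (x \<otimes>\<^bsub>TA\<^esub> y) = toeplitz_symbol_hom (y \<otimes>\<^bsub>TA\<^esub> x)"
      unfolding M.hom_mult[OF x y] M.hom_mult[OF y x] by (simp add: mult.commute)
    also have "toeplitz_symbol_hom (y \<otimes>\<^bsub>TA\<^esub> x) \<ominus>\<^bsub>CD\<^esub> toeplitz_symbol_hom (y \<otimes>\<^bsub>TA\<^esub> x) = \<zero>\<^bsub>CD\<^esub>"
      unfolding a_minus_def by (rule M.B.M.r_neg[OF M.hom_closed[OF M.A.mult_closed[OF y x]]])
    finally show ?thesis
      unfolding M.kernel_iff using M.A.M.minus_closed[OF M.A.mult_closed[OF x y] M.A.mult_closed[OF y x]] by blast
  qed
  ultimately show "commutator_ideal TA \<subseteq> a_kernel TA CD toeplitz_symbol_hom"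
    unfolding commutator_ideal_def using ideal_kernel[OF cstar_morphism_toeplitz_symbol_hom] by blast
next
  show "a_kernel TA CD toeplitz_symbol_hom \<subseteq> commutator_ideal TA"
    unfolding commutator_ideal_def
  proof (intro Inter_greatest subsetI)
    fix I S assume "I \<in> {I. ideal I TA \<and> norm_closed I TA \<and>
      (\<forall>x\<in>carrier TA. \<forall>y\<in>carrier TA. (x \<otimes>\<^bsub>TA\<^esub> y) \<ominus>\<^bsub>TA\<^esub> (y \<otimes>\<^bsub>TA\<^esub> x) \<in> I)}"
    then have I: "ideal I TA" "norm_closed I TA"
      and comm: "\<And>x y. x \<in> carrier TA \<Longrightarrow> y \<in> carrier TA \<Longrightarrow> (x \<otimes>\<^bsub>TA\<^esub> y) \<ominus>\<^bsub>TA\<^esub> (y \<otimes>\<^bsub>TA\<^esub> x) \<in> I" by auto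
    assume "S \<in> a_kernel TA CD toeplitz_symbol_hom"
    then have S: "S \<in> carrier TA" "toeplitz_symbol_hom S = \<zero>\<^bsub>CD\<^esub>" by (simp_all only: M.kernel_iff)
    show "S \<in> I"
    proof (rule kernel_symbol_hom_approx[OF S I(2)])
      show "I \<subseteq> carrier TA" by (rule additive_subgroup.a_subset[OF ideal.axioms(1)[OF I(1)]])
      fix z :: 'g assume z: "0 \<le> z"
      have T: "toeplitz_op z \<in> carrier TA" by (rule toeplitz_op_in_algebra[OF z])
      have "range_defect z \<in> I"
        using comm[OF M.A.star_carrier[OF T] T] unfolding star_mult_toeplitz_op[OF z] range_defect_def .
      then show "S \<otimes>\<^bsub>TA\<^esub> range_defect z \<in> I" by (rule ideal.I_l_closed[OF I(1) _ S(1)])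
    qed
  qed
qed

text \<open>Replacing \<open>S\<close> by \<open>S T\<^sub>z T\<^sub>z\<^sup>*\<close> preserves the symbol and brings the norm close to that of
  the symbol.\<close>
lemma norm_closed_range_symbol_hom: "norm_closed (toeplitz_symbol_hom ` carrier TA) CD"
proof (rule M.norm_closed_image[where K = 2])
  show "submodule (carrier TA) complex_ring TA" "norm_closed (carrier TA) TA"
    using M.A.cstar_subalgebra_carrier by (simp_all add: cstar_subalgebra_def)
  fix S assume S: "S \<in> carrier TA"
  let ?s = "nrm CD (toeplitz_symbol_hom S)"
  have s0: "0 \<le> ?s" by (rule M.B.nrm_nonneg[OF M.hom_closed[OF S]])
  have zero: "nrm CD (x \<ominus>\<^bsub>CD\<^esub> x) = 0" if "x \<in> carrier CD" for x
    unfolding a_minus_def M.B.M.r_neg[OF that] by (rule M.B.nrm_zero)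
  show "\<exists>a\<in>carrier TA. nrm TA a \<le> 2 * ?s \<and> nrm CD (toeplitz_symbol_hom S \<ominus>\<^bsub>CD\<^esub> toeplitz_symbol_hom a) \<le> ?s / 2"
  proof (cases "?s = 0")
    case True
    then have "toeplitz_symbol_hom S = \<zero>\<^bsub>CD\<^esub>" using M.B.nrm_eq_0[OF M.hom_closed[OF S]] by blast
    then have "nrm CD (toeplitz_symbol_hom S \<ominus>\<^bsub>CD\<^esub> toeplitz_symbol_hom \<zero>\<^bsub>TA\<^esub>) = 0"
      using zero[OF M.B.M.zero_closed] by (simp only: M.hom_zero)
    then show ?thesis using s0 M.A.nrm_zero M.A.M.zero_closed by (intro bexI[of _ "\<zero>\<^bsub>TA\<^esub>"]) auto
  next
    case False
    then have "0 < ?s" using s0 by simp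
    from symbol_hom_lift[OF S this] obtain z where z: "0 \<le> z" "nrm TA (S \<otimes>\<^bsub>TA\<^esub> toeplitz_op z) \<le> ?s + ?s" by blast
    have T: "toeplitz_op z \<in> carrier TA" by (rule toeplitz_op_in_algebra[OF z(1)])
    let ?p = "toeplitz_op z \<otimes>\<^bsub>TA\<^esub> star TA (toeplitz_op z)"
    have p: "?p \<in> carrier TA" by (rule M.A.mult_closed[OF T M.A.star_carrier[OF T]])
    have "toeplitz_symbol_hom (S \<otimes>\<^bsub>TA\<^esub> ?p) = toeplitz_symbol_hom S"
      unfolding M.hom_mult[OF S p] symbol_hom_range_projection[OF z(1)] by (rule M.B.one_right[OF M.hom_closed[OF S]])
    then have "nrm CD (toeplitz_symbol_hom S \<ominus>\<^bsub>CD\<^esub> toeplitz_symbol_hom (S \<otimes>\<^bsub>TA\<^esub> ?p)) \<le> ?s / 2"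
      using zero[OF M.hom_closed[OF S]] s0 by (simp only:)
    moreover have "nrm TA (S \<otimes>\<^bsub>TA\<^esub> ?p) \<le> 2 * ?s"
      using order_trans[OF nrm_range_projection_le[OF S z(1)] z(2)] by simp
    ultimately show ?thesis using M.A.mult_closed[OF S p] by blast
  qed
qed simp

text \<open>Symbols are functions that vanish off the dual group; the values of real functions off
  the dual group are left arbitrary, as the Stone-Weierstrass theorem needs all constants.\<close>
definition real_symbols :: "(('g \<Rightarrow> complex) \<Rightarrow> real) set" where
  "real_symbols = {g. (\<lambda>\<xi>. if \<xi> \<in> dual_group then of_real (g \<xi>) else 0) \<in> toeplitz_symbol_hom ` carrier TA}"

lemma real_symbolsI:
  assumes "S \<in> carrier TA" "\<And>\<xi>. \<xi> \<in> dual_group \<Longrightarrow> toeplitz_symbol_hom S \<xi> = of_real (g \<xi>)"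
  shows "g \<in> real_symbols"
proof -
  have "toeplitz_symbol_hom S \<xi> = (if \<xi> \<in> dual_group then of_real (g \<xi>) else 0)" for \<xi>
    using assms(2) M.hom_closed[OF assms(1)] by simp
  then have "(\<lambda>\<xi>. if \<xi> \<in> dual_group then of_real (g \<xi>) else 0) = toeplitz_symbol_hom S" by (simp add: fun_eq_iff)
  then show ?thesis unfolding real_symbols_def using assms(1) by blast
qed

lemma real_symbolsE:
  assumes "g \<in> real_symbols"
  obtains S where "S \<in> carrier TA" "\<And>\<xi>. \<xi> \<in> dual_group \<Longrightarrow> toeplitz_symbol_hom S \<xi> = of_real (g \<xi>)"
proof -
  obtain S where "S \<in> carrier TA" "(\<lambda>\<xi>. if \<xi> \<in> dual_group then of_real (g \<xi>) else 0) = toeplitz_symbol_hom S"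
    using assms unfolding real_symbols_def by blast
  then show ?thesis by (intro that[of S]) (auto simp: fun_eq_iff split: if_splits)
qed

lemma exists_symbol_dual_eval: "\<exists>S\<in>carrier TA. toeplitz_symbol_hom S = dual_eval (x :: 'g)"
proof (cases "0 \<le> x")
  case True
  then show ?thesis using toeplitz_op_in_algebra[OF True] toeplitz_symbol_hom_toeplitz_op[OF True] by blast
next
  case False
  then have x: "0 \<le> - x" by simp
  have T: "toeplitz_op (- x) \<in> carrier TA" by (rule toeplitz_op_in_algebra[OF x])
  have "toeplitz_symbol_hom (star TA (toeplitz_op (- x))) = dual_eval x"
    unfolding M.hom_star[OF T] toeplitz_symbol_hom_toeplitz_op[OF x]
    by (auto simp: dual_eval_def dual_group_D fun_eq_iff)
  then show ?thesis using M.A.star_carrier[OF T] by blast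
qed

lemma function_ring_real_symbols: "function_ring_on real_symbols (dual_group :: ('g \<Rightarrow> complex) set)"
proof
  show "compact (dual_group :: ('g \<Rightarrow> complex) set)" by (rule compact_dual_group)
next
  fix f :: "('g \<Rightarrow> complex) \<Rightarrow> real" assume f: "f \<in> real_symbols"
  obtain S where S: "S \<in> carrier TA" "\<And>\<xi>. \<xi> \<in> dual_group \<Longrightarrow> toeplitz_symbol_hom S \<xi> = of_real (f \<xi>)"
    using real_symbolsE[OF f] by blast
  have "continuous_on dual_group (\<lambda>\<xi>. Re (toeplitz_symbol_hom S \<xi>))"
    using M.hom_closed[OF S(1)] by (intro continuous_intros) simp
  then show "continuous_on dual_group f" by (rule continuous_on_eq) (simp add: S(2))
  fix g :: "('g \<Rightarrow> complex) \<Rightarrow> real" assume g: "g \<in> real_symbols"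
  obtain R where R: "R \<in> carrier TA" "\<And>\<xi>. \<xi> \<in> dual_group \<Longrightarrow> toeplitz_symbol_hom R \<xi> = of_real (g \<xi>)"
    using real_symbolsE[OF g] by blast
  show "(\<lambda>x. f x + g x) \<in> real_symbols"
  proof (rule real_symbolsI[OF M.A.M.a_closed[OF S(1) R(1)]])
    fix \<xi> :: "'g \<Rightarrow> complex" assume "\<xi> \<in> dual_group"
    then show "toeplitz_symbol_hom (S \<oplus>\<^bsub>TA\<^esub> R) \<xi> = of_real (f \<xi> + g \<xi>)"
      unfolding M.hom_add[OF S(1) R(1)] by (simp add: S(2) R(2))
  qed
  show "(\<lambda>x. f x * g x) \<in> real_symbols"
  proof (rule real_symbolsI[OF M.A.mult_closed[OF S(1) R(1)]])
    fix \<xi> :: "'g \<Rightarrow> complex" assume "\<xi> \<in> dual_group"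
    then show "toeplitz_symbol_hom (S \<otimes>\<^bsub>TA\<^esub> R) \<xi> = of_real (f \<xi> * g \<xi>)"
      unfolding M.hom_mult[OF S(1) R(1)] by (simp add: S(2) R(2))
  qed
next
  fix c :: real
  show "(\<lambda>_ :: 'g \<Rightarrow> complex. c) \<in> real_symbols"
  proof (rule real_symbolsI[OF M.A.smult_carrier[OF M.A.one_closed, of "of_real c"]])
    fix \<xi> :: "'g \<Rightarrow> complex" assume "\<xi> \<in> dual_group"
    then show "toeplitz_symbol_hom (of_real c \<odot>\<^bsub>TA\<^esub> \<one>\<^bsub>TA\<^esub>) \<xi> = of_real c"
      unfolding M.hom_smult[OF M.A.one_closed] M.hom_one by simp
  qed
next
  fix \<xi> \<eta> :: "'g \<Rightarrow> complex" assume \<xi>: "\<xi> \<in> dual_group" and \<eta>: "\<eta> \<in> dual_group" and "\<xi> \<noteq> \<eta>"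
  then obtain x where x: "\<xi> x \<noteq> \<eta> x" by (auto simp: fun_eq_iff)
  obtain S where S: "S \<in> carrier TA" "toeplitz_symbol_hom S = dual_eval x" using exists_symbol_dual_eval by blast
  note Ss = M.A.star_carrier[OF S(1)]
  have Re: "(\<lambda>\<zeta>. Re (\<zeta> x)) \<in> real_symbols"
  proof (rule real_symbolsI[OF M.A.smult_carrier[OF M.A.M.a_closed[OF S(1) Ss], of "1/2"]])
    fix \<zeta> :: "'g \<Rightarrow> complex" assume "\<zeta> \<in> dual_group"
    then show "toeplitz_symbol_hom ((1/2) \<odot>\<^bsub>TA\<^esub> (S \<oplus>\<^bsub>TA\<^esub> star TA S)) \<zeta> = of_real (Re (\<zeta> x))"
      unfolding M.hom_smult[OF M.A.M.a_closed[OF S(1) Ss]] M.hom_add[OF S(1) Ss] M.hom_star[OF S(1)] S(2)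
      by (simp add: dual_eval_def complex_add_cnj)
  qed
  have Im: "(\<lambda>\<zeta>. Im (\<zeta> x)) \<in> real_symbols"
  proof (rule real_symbolsI[OF M.A.smult_carrier[OF M.A.M.minus_closed[OF S(1) Ss], of "- \<i>/2"]])
    fix \<zeta> :: "'g \<Rightarrow> complex" assume "\<zeta> \<in> dual_group"
    then show "toeplitz_symbol_hom ((- \<i>/2) \<odot>\<^bsub>TA\<^esub> (S \<ominus>\<^bsub>TA\<^esub> star TA S)) \<zeta> = of_real (Im (\<zeta> x))"
      unfolding M.hom_smult[OF M.A.M.minus_closed[OF S(1) Ss]] M.hom_minus[OF S(1) Ss]
        continuous_functions_minus[OF M.hom_closed[OF Ss]]
      unfolding M.hom_star[OF S(1)] S(2)
      by (simp add: dual_eval_def complex_eq_iff)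
  qed
  have "Re (\<xi> x) \<noteq> Re (\<eta> x) \<or> Im (\<xi> x) \<noteq> Im (\<eta> x)" using x by (auto simp: complex_eq_iff)
  then show "\<exists>f\<in>real_symbols. f \<xi> \<noteq> f \<eta>"
    using bexI[OF _ Re, of "\<lambda>f. f \<xi> \<noteq> f \<eta>"] bexI[OF _ Im, of "\<lambda>f. f \<xi> \<noteq> f \<eta>"] by auto
qed

lemma symbol_hom_surj: "toeplitz_symbol_hom ` carrier TA = carrier CD"
proof
  show "toeplitz_symbol_hom ` carrier TA \<subseteq> carrier CD" using M.hom_closed by blast
  let ?R = "toeplitz_symbol_hom ` carrier TA"
  interpret F: function_ring_on real_symbols "dual_group :: ('g \<Rightarrow> complex) set"
    by (rule function_ring_real_symbols)
  have real: "(\<lambda>\<xi>. if \<xi> \<in> dual_group then of_real (g \<xi>) else 0) \<in> ?R" (is "?g \<in> ?R")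
    if g: "continuous_on dual_group g" for g :: "('g \<Rightarrow> complex) \<Rightarrow> real"
  proof (rule M.B.norm_closedD[OF norm_closed_range_symbol_hom])
    have "continuous_on dual_group ?g \<longleftrightarrow> continuous_on dual_group (\<lambda>\<xi>. complex_of_real (g \<xi>))"
      by (rule continuous_on_cong) auto
    then show gC: "?g \<in> carrier CD" using g by (simp add: continuous_on_of_real)
    show "?R \<subseteq> carrier CD" using M.hom_closed by blast
    fix e :: real assume e: "0 < e"
    then have "0 < e / 2" by simp
    from F.Stone_Weierstrass_basic[OF g this]
    obtain h where h: "h \<in> real_symbols" "\<forall>\<xi>\<in>dual_group. \<bar>g \<xi> - h \<xi>\<bar> < e / 2" by blast
    obtain S where S: "S \<in> carrier TA" "\<And>\<xi>. \<xi> \<in> dual_group \<Longrightarrow> toeplitz_symbol_hom S \<xi> = of_real (h \<xi>)"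
      using real_symbolsE[OF h(1)] by blast
    have "nrm CD (toeplitz_symbol_hom S \<ominus>\<^bsub>CD\<^esub> ?g) \<le> e / 2"
      unfolding continuous_functions_minus[OF gC]
    proof (rule C_dual_norm_le)
      fix \<xi> :: "'g \<Rightarrow> complex" assume \<xi>: "\<xi> \<in> dual_group"
      have "cmod (of_real (h \<xi>) - of_real (g \<xi>)) = \<bar>h \<xi> - g \<xi>\<bar>" by (simp flip: of_real_diff)
      also have "\<dots> \<le> e / 2" using h(2) \<xi> by (force simp: abs_minus_commute)
      finally show "cmod (toeplitz_symbol_hom S \<xi> - ?g \<xi>) \<le> e / 2" using S(2)[OF \<xi>] \<xi> by simp
    qed
    then show "\<exists>y\<in>?R. nrm CD (y \<ominus>\<^bsub>CD\<^esub> ?g) < e" using S(1) e by (intro bexI[of _ "toeplitz_symbol_hom S"]) auto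
  qed
  show "carrier CD \<subseteq> ?R"
  proof
    fix f assume f: "f \<in> carrier CD"
    have cR: "continuous_on dual_group (\<lambda>\<xi>. Re (f \<xi>))" and cI: "continuous_on dual_group (\<lambda>\<xi>. Im (f \<xi>))"
      using f by (auto intro: continuous_intros)
    obtain S where S: "S \<in> carrier TA" "(\<lambda>\<xi>. if \<xi> \<in> dual_group then of_real (Re (f \<xi>)) else 0) = toeplitz_symbol_hom S"
      using real[OF cR] by blast
    obtain R where R: "R \<in> carrier TA" "(\<lambda>\<xi>. if \<xi> \<in> dual_group then of_real (Im (f \<xi>)) else 0) = toeplitz_symbol_hom R"
      using real[OF cI] by blast
    note iR = M.A.smult_carrier[OF R(1), of \<i>]
    have "toeplitz_symbol_hom (S \<oplus>\<^bsub>TA\<^esub> \<i> \<odot>\<^bsub>TA\<^esub> R) = f"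
      unfolding M.hom_add[OF S(1) iR] M.hom_smult[OF R(1)] S(2)[symmetric] R(2)[symmetric]
      using f by (auto simp: fun_eq_iff complex_eq_iff)
    then show "f \<in> ?R" using M.A.M.a_closed[OF S(1) iR] by blast
  qed
qed

end

section \<open>Short exact sequences of kernels\<close>

context cstar_morphism
begin

lemma image_subalgebra: "cstar_subalgebra (\<phi> ` carrier A) B"
proof -
  have "norm_closed (\<phi> ` carrier A) B"
    by (rule norm_closed_image_ideal[OF A.cstar_subalgebra_carrier]) simp
  moreover have "submodule (\<phi> ` carrier A) complex_ring B"
    unfolding B.submodule_iff
  proof (intro conjI ballI allI)
    show "\<phi> ` carrier A \<subseteq> carrier B" by blast
    show "\<zero>\<^bsub>B\<^esub> \<in> \<phi> ` carrier A" using imageI[OF A.M.zero_closed, of \<phi>] by simp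
    fix x y c assume "x \<in> \<phi> ` carrier A" 
    then obtain a where a: "a \<in> carrier A" "x = \<phi> a" by blast
    show "c \<odot>\<^bsub>B\<^esub> x \<in> \<phi> ` carrier A"
      using imageI[OF A.smult_carrier[OF a(1)], of \<phi> c] a by (simp add: hom_smult)
    assume "y \<in> \<phi> ` carrier A"
    then obtain b where b: "b \<in> carrier A" "y = \<phi> b" by blast
    show "x \<oplus>\<^bsub>B\<^esub> y \<in> \<phi> ` carrier A"
      using imageI[OF A.M.a_closed[OF a(1) b(1)], of \<phi>] a b by (simp add: hom_add)
  qed
  moreover have "x \<otimes>\<^bsub>B\<^esub> y \<in> \<phi> ` carrier A" if xy: "x \<in> \<phi> ` carrier A" "y \<in> \<phi> ` carrier A" for x y
  proof -
    obtain a b where ab: "a \<in> carrier A" "x = \<phi> a" "b \<in> carrier A" "y = \<phi> b" using xy by blast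
    show ?thesis using imageI[OF A.mult_closed[OF ab(1,3)], of \<phi>] ab by (simp add: hom_mult)
  qed
  moreover have "star B x \<in> \<phi> ` carrier A" if x: "x \<in> \<phi> ` carrier A" for x
  proof -
    obtain a where a: "a \<in> carrier A" "x = \<phi> a" using x by blast
    show ?thesis using imageI[OF A.star_closed[OF a(1)], of \<phi>] a by (simp add: hom_star)
  qed
  ultimately show ?thesis by (simp add: cstar_subalgebra_def)
qed

lemma short_exact_restrict:
  assumes K: "cstar_subalgebra K A" and J: "cstar_subalgebra J B" and img: "\<phi> ` K = J"
  shows "cstar_short_exact (A\<lparr>carrier := a_kernel A B \<phi> \<inter> K\<rparr>) id (A\<lparr>carrier := K\<rparr>) \<phi> (B\<lparr>carrier := J\<rparr>)"
proof -
  have KA: "K \<subseteq> carrier A" by (rule A.cstar_subalgebra_subset[OF K])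
  have "cstar_subalgebra (\<Inter>{a_kernel A B \<phi>, K}) A"
    by (rule A.cstar_subalgebra_Inter) (use K kernel_subalgebra in auto)
  then have "cstar_algebra (A\<lparr>carrier := a_kernel A B \<phi> \<inter> K\<rparr>)"
    by (intro A.subalgebra_cstar_algebra) simp
  moreover have "\<phi> \<in> cstar_hom (A\<lparr>carrier := K\<rparr>) (B\<lparr>carrier := J\<rparr>)"
    unfolding cstar_hom_def using KA img by (auto simp: hom_add hom_smult hom_mult hom_star subset_iff)
  moreover have "id \<in> cstar_hom (A\<lparr>carrier := a_kernel A B \<phi> \<inter> K\<rparr>) (A\<lparr>carrier := K\<rparr>)"
    unfolding cstar_hom_def by auto
  moreover have "a_kernel (A\<lparr>carrier := K\<rparr>) (B\<lparr>carrier := J\<rparr>) \<phi> = a_kernel A B \<phi> \<inter> K"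
    using KA by (auto simp: a_kernel_def')
  ultimately show ?thesis
    unfolding cstar_short_exact_def
    using A.subalgebra_cstar_algebra[OF K] B.subalgebra_cstar_algebra[OF J] img by simp
qed

lemma short_exact_kernel:
  assumes "\<phi> ` carrier A = carrier B"
  shows "cstar_short_exact (A\<lparr>carrier := a_kernel A B \<phi>\<rparr>) id A \<phi> B"
proof -
  have "a_kernel A B \<phi> \<inter> carrier A = a_kernel A B \<phi>" by (auto simp: a_kernel_def')
  then show ?thesis
    using short_exact_restrict[OF A.cstar_subalgebra_carrier B.cstar_subalgebra_carrier assms] by simp
qed

lemma equalizer_subalgebra:
  assumes "cstar_morphism A B \<phi>'"
  shows "cstar_subalgebra {x \<in> carrier A. \<phi> x = \<phi>' x} A"
proof -
  interpret F: cstar_morphism A B \<phi>' by (rule assms)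
  have "norm_closed {x \<in> carrier A. \<phi> x = \<phi>' x} A"
    unfolding norm_closed_iff
  proof (intro allI impI)
    fix \<sigma> x assume x: "x \<in> carrier A" and \<sigma>: "\<forall>n. \<sigma> n \<in> {x \<in> carrier A. \<phi> x = \<phi>' x}" and lim: "norm_lim A \<sigma> x"
    have \<sigma>A: "\<sigma> n \<in> carrier A" and eq: "\<phi> (\<sigma> n) = \<phi>' (\<sigma> n)" for n using \<sigma> by simp_all
    have "norm_lim B (\<lambda>n. \<phi> (\<sigma> n)) (\<phi>' x)" using F.norm_lim_hom[OF lim \<sigma>A x] by (simp only: eq)
    from B.norm_lim_unique[OF norm_lim_hom[OF lim \<sigma>A x] this] \<sigma>A x
    show "x \<in> {x \<in> carrier A. \<phi> x = \<phi>' x}" by simp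
  qed
  then show ?thesis
    unfolding cstar_subalgebra_def A.submodule_iff
    by (auto simp: hom_add hom_smult hom_mult hom_star F.hom_add F.hom_smult F.hom_mult F.hom_star)
qed

end

lemma cstar_morphism_comp:
  assumes "cstar_morphism A B \<phi>" "cstar_morphism B C \<psi>"
  shows "cstar_morphism A C (\<lambda>x. \<psi> (\<phi> x))"
proof -
  interpret F: cstar_morphism A B \<phi> by (rule assms(1))
  interpret G: cstar_morphism B C \<psi> by (rule assms(2))
  have "(\<lambda>x. \<psi> (\<phi> x)) \<in> cstar_hom A C"
    unfolding cstar_hom_def
    by (auto simp: F.hom_add F.hom_smult F.hom_mult F.hom_star G.hom_add G.hom_smult G.hom_mult G.hom_star)
  then show ?thesis by unfold_locales (simp_all add: F.hom_one G.hom_one)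
qed

text \<open>Inversion in the dual group. The map \<open>\<psi>\<close> belonging to \<open>T\<^sup>*\<close> is \<open>\<psi>\<^sub>T\<close> followed by it, which
  gives both the same kernel and the same range.\<close>
definition conjugate_dual :: "(('g::ab_group_add \<Rightarrow> complex) \<Rightarrow> complex) \<Rightarrow> ('g \<Rightarrow> complex) \<Rightarrow> complex" where
  "conjugate_dual f = (\<lambda>\<xi>. if \<xi> \<in> dual_group then f (\<lambda>x. cnj (\<xi> x)) else 0)"

lemma conjugate_dual_involution:
  assumes "f \<in> carrier C_dual" shows "conjugate_dual (conjugate_dual f) = f"
  using assms by (auto simp: conjugate_dual_def dual_group_cnj fun_eq_iff)

lemma conjugate_dual_closed:
  assumes f: "f \<in> carrier (C_dual :: (('g::ab_group_add \<Rightarrow> complex) \<Rightarrow> complex) cstar)"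
  shows "conjugate_dual f \<in> carrier C_dual"
proof -
  have "continuous_on dual_group (\<lambda>\<xi> :: 'g \<Rightarrow> complex. \<lambda>x. cnj (\<xi> x))"
    by (intro continuous_on_coordinatewise_then_product continuous_on_cnj
        continuous_on_subset[OF continuous_on_product_coordinates subset_UNIV])
  moreover have "(\<lambda>\<xi> :: 'g \<Rightarrow> complex. \<lambda>x. cnj (\<xi> x)) ` dual_group \<subseteq> dual_group"
    using dual_group_cnj by blast
  ultimately have "continuous_on dual_group (\<lambda>\<xi>. f (\<lambda>x. cnj (\<xi> x)))"
    using f continuous_on_compose2[of dual_group f] by auto
  then have "continuous_on dual_group (conjugate_dual f)"
    by (simp add: conjugate_dual_def cong: continuous_on_cong)
  then show ?thesis by (simp add: conjugate_dual_def)
qed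

lemma cstar_morphism_conjugate_dual:
  "cstar_morphism C_dual C_dual (conjugate_dual :: (('g::ab_group_add \<Rightarrow> complex) \<Rightarrow> complex) \<Rightarrow> _)"
proof (intro cstar_morphism.intro C_dual_unital_cstar_algebra cstar_morphism_axioms.intro)
  have "\<forall>f\<in>carrier (C_dual :: (('g \<Rightarrow> complex) \<Rightarrow> complex) cstar). conjugate_dual f \<in> carrier C_dual"
    using conjugate_dual_closed by blast
  then show "(conjugate_dual :: (('g \<Rightarrow> complex) \<Rightarrow> complex) \<Rightarrow> _) \<in> cstar_hom C_dual C_dual"
    unfolding cstar_hom_def by (auto simp: conjugate_dual_def fun_eq_iff simp del: continuous_functions_simps(1))
  show "conjugate_dual \<one>\<^bsub>C_dual :: (('g \<Rightarrow> complex) \<Rightarrow> complex) cstar\<^esub> = \<one>\<^bsub>C_dual\<^esub>"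
    by (auto simp: conjugate_dual_def dual_group_cnj fun_eq_iff)
qed

context toeplitz_context
begin

definition conjugate_symbol_hom :: "(('g \<Rightarrow> complex) \<Rightarrow> 'g \<Rightarrow> complex) \<Rightarrow> ('g \<Rightarrow> complex) \<Rightarrow> complex" where
  "conjugate_symbol_hom S = conjugate_dual (toeplitz_symbol_hom S)"

lemma conjugate_symbol_morphism: "cstar_morphism TA CD conjugate_symbol_hom"
  unfolding conjugate_symbol_hom_def[abs_def]
  by (rule cstar_morphism_comp[OF cstar_morphism_toeplitz_symbol_hom cstar_morphism_conjugate_dual])

lemma conjugate_symbol_hom_toeplitz_op:
  "0 \<le> s \<Longrightarrow> conjugate_symbol_hom (toeplitz_op s) = dual_eval (- s)"
  by (auto simp: conjugate_symbol_hom_def toeplitz_symbol_hom_toeplitz_op conjugate_dual_def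
      dual_eval_def dual_group_cnj dual_group_D fun_eq_iff)

lemma conjugate_symbol_hom_surj: "conjugate_symbol_hom ` carrier TA = carrier CD"
proof
  show "conjugate_symbol_hom ` carrier TA \<subseteq> carrier CD"
    using M.hom_closed conjugate_dual_closed unfolding conjugate_symbol_hom_def by blast
  show "carrier CD \<subseteq> conjugate_symbol_hom ` carrier TA"
  proof
    fix f assume f: "f \<in> carrier CD"
    obtain S where S: "S \<in> carrier TA" "conjugate_dual f = toeplitz_symbol_hom S"
      using conjugate_dual_closed[OF f] symbol_hom_surj by blast
    have "f = conjugate_symbol_hom S"
      unfolding conjugate_symbol_hom_def S(2)[symmetric] by (rule conjugate_dual_involution[OF f, symmetric])
    with S(1) show "f \<in> conjugate_symbol_hom ` carrier TA" by blast
  qed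
qed

lemma conjugate_symbol_hom_eq_zero:
  assumes S: "S \<in> carrier TA"
  shows "conjugate_symbol_hom S = \<zero>\<^bsub>CD\<^esub> \<longleftrightarrow> toeplitz_symbol_hom S = \<zero>\<^bsub>CD\<^esub>"
proof -
  have z: "conjugate_dual \<zero>\<^bsub>CD\<^esub> = \<zero>\<^bsub>CD\<^esub>" by (simp add: conjugate_dual_def fun_eq_iff)
  show ?thesis
    using conjugate_dual_involution[OF M.hom_closed[OF S]] z unfolding conjugate_symbol_hom_def by metis
qed

lemma kernel_conjugate_symbol_hom: "a_kernel TA CD conjugate_symbol_hom = commutator_ideal TA"
  unfolding kernel_symbol_hom[symmetric] a_kernel_def' using conjugate_symbol_hom_eq_zero by blast

lemma commutator_ideal_subalgebra: "cstar_subalgebra (commutator_ideal TA) TA"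
  using M.kernel_subalgebra unfolding kernel_symbol_hom .

lemma toeplitz_commutator_ideal_eq: "toeplitz_commutator_ideal = TA\<lparr>carrier := commutator_ideal TA\<rparr>"
  by (simp add: toeplitz_commutator_ideal_def)

lemma symbol_rows_exact:
  "cstar_short_exact toeplitz_commutator_ideal id TA toeplitz_symbol_hom CD"
  "cstar_short_exact toeplitz_commutator_ideal id TA conjugate_symbol_hom CD"
  using M.short_exact_kernel[OF symbol_hom_surj]
    cstar_morphism.short_exact_kernel[OF conjugate_symbol_morphism conjugate_symbol_hom_surj]
  unfolding kernel_symbol_hom kernel_conjugate_symbol_hom toeplitz_commutator_ideal_eq .

section \<open>Multiplication operators and their limits\<close>

definition mult_op :: "('g \<Rightarrow> complex) \<Rightarrow> ('g \<Rightarrow> complex) \<Rightarrow> 'g \<Rightarrow> complex" where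
  "mult_op f = (\<lambda>h. if h \<in> ell2 {0..} then (\<lambda>y. f y * h y) else (\<lambda>y. 0))"

abbreviation EL :: "('g \<Rightarrow> complex) cstar" where "EL \<equiv> ell_infinity {0..}"

lemma ell_infinity_simps [simp]:
  "f \<in> carrier EL \<longleftrightarrow> bounded (f ` {0..}) \<and> (\<forall>x. x \<notin> {0..} \<longrightarrow> f x = 0)"
  "mult EL = (\<lambda>f g x. f x * g x)"
  "zero EL = (\<lambda>x. 0)"
  "add EL = (\<lambda>f g x. f x + g x)"
  "smult EL = (\<lambda>c f x. c * f x)"
  "star EL = (\<lambda>f x. cnj (f x))"
  by (simp_all add: ell_infinity_def function_cstar_def)

lemma carrier_EL_iff: "f \<in> carrier EL \<longleftrightarrow> (\<exists>K. \<forall>x. cmod (f x) \<le> K) \<and> (\<forall>x. x \<notin> {0..} \<longrightarrow> f x = 0)"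
proof
  assume f: "f \<in> carrier EL"
  then have v: "\<forall>x. x \<notin> {0..} \<longrightarrow> f x = 0" and "bounded (f ` {0..})" by auto
  then obtain K where K: "\<And>x. 0 \<le> x \<Longrightarrow> cmod (f x) \<le> K" by (auto simp: bounded_iff)
  have "cmod (f x) \<le> max K 0" for x
    using K[of x] v by (cases "0 \<le> x") (auto simp: le_max_iff_disj)
  with v show "(\<exists>K. \<forall>x. cmod (f x) \<le> K) \<and> (\<forall>x. x \<notin> {0..} \<longrightarrow> f x = 0)" by blast
qed (auto simp: bounded_iff)

lemma EL_closed:
  assumes "f \<in> carrier EL" "g \<in> carrier EL"
  shows "(\<lambda>x. f x + g x) \<in> carrier EL"
proof -
  obtain K L where KL: "\<And>x. cmod (f x) \<le> K" "\<And>x. cmod (g x) \<le> L" using assms unfolding carrier_EL_iff by blast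
  have "cmod (f x + g x) \<le> K + L" for x
    by (rule order_trans[OF norm_triangle_ineq add_mono[OF KL]])
  then show ?thesis using assms unfolding carrier_EL_iff by auto
qed

lemma EL_scale:
  assumes "f \<in> carrier EL" shows "(\<lambda>x. c * f x) \<in> carrier EL"
proof -
  obtain K where K: "\<And>x. cmod (f x) \<le> K" using assms unfolding carrier_EL_iff by blast
  have "cmod (c * f x) \<le> cmod c * K" for x using K by (simp add: norm_mult mult_left_mono)
  then show ?thesis using assms unfolding carrier_EL_iff by auto
qed

lemma EL_zero: "(\<lambda>x. 0) \<in> carrier EL"
  unfolding carrier_EL_iff by (auto intro: exI[of _ 0])

lemma abelian_group_EL: "abelian_group EL"
proof (rule abelian_groupI)
  fix f assume "f \<in> carrier EL"
  then show "\<exists>g\<in>carrier EL. g \<oplus>\<^bsub>EL\<^esub> f = \<zero>\<^bsub>EL\<^esub>"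
    using EL_scale[of f "-1"] by (intro bexI[of _ "\<lambda>x. -1 * f x"]) simp_all
qed (use EL_closed EL_zero in \<open>simp_all add: algebra_simps del: ell_infinity_simps(1)\<close>)

lemma EL_minus:
  assumes "g \<in> carrier EL" shows "f \<ominus>\<^bsub>EL\<^esub> g = (\<lambda>x. f x - g x)"
proof -
  interpret abelian_group EL by (rule abelian_group_EL)
  have "\<ominus>\<^bsub>EL\<^esub> g = (\<lambda>x. - g x)"
    using minus_equality[of "\<lambda>x. - g x" g] EL_scale[OF assms, of "-1"] assms
    by (simp del: ell_infinity_simps(1))
  then show ?thesis by (simp add: a_minus_def)
qed

lemma module_EL: "module complex_ring EL"
  by (rule moduleI[OF cring_complex_ring abelian_group_EL])
     (use EL_scale in \<open>simp_all add: algebra_simps del: ell_infinity_simps(1)\<close>)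

lemma le_EL_norm:
  assumes f: "f \<in> carrier EL" shows "cmod (f x) \<le> nrm EL f"
proof -
  obtain K where "\<And>x. cmod (f x) \<le> K" using f unfolding carrier_EL_iff by blast
  then have bdd: "bdd_above ((\<lambda>x. cmod (f x)) ` {0..})" by (intro bdd_aboveI2)
  have n: "nrm EL f = (SUP x\<in>{0..}. cmod (f x))" by (simp add: ell_infinity_def function_cstar_def)
  have up: "cmod (f y) \<le> nrm EL f" if "0 \<le> y" for y unfolding n by (rule cSUP_upper[OF _ bdd]) (use that in simp)
  show ?thesis
  proof (cases "0 \<le> x")
    case False
    then have "f x = 0" using f by simp
    then show ?thesis using order_trans[OF norm_ge_zero up[of 0]] by simp
  qed (rule up)
qed

lemma B_cone_simps [simp]:
  "mult B_cone = (\<lambda>f g (x :: 'g). f x * g x)"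
  "add B_cone = (\<lambda>f g (x :: 'g). f x + g x)"
  "smult B_cone = (\<lambda>c f (x :: 'g). c * f x)"
  "star B_cone = (\<lambda>f (x :: 'g). cnj (f x))"
  by (simp_all add: B_cone_def)

lemma B_cone_induct:
  assumes Q: "Q \<subseteq> carrier EL" "(\<lambda>x. 0) \<in> Q" "\<And>f g. f \<in> Q \<Longrightarrow> g \<in> Q \<Longrightarrow> (\<lambda>x. f x + g x) \<in> Q"
      "\<And>c f. f \<in> Q \<Longrightarrow> (\<lambda>x. c * f x) \<in> Q"
    and closed: "\<And>\<sigma> f. (\<And>n::nat. \<sigma> n \<in> Q) \<Longrightarrow> f \<in> carrier EL \<Longrightarrow>
      (\<lambda>n. nrm EL (\<lambda>x. \<sigma> n x - f x)) \<longlonglongrightarrow> 0 \<Longrightarrow> f \<in> Q"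
    and ind: "\<And>s. 0 \<le> s \<Longrightarrow> cone_indicator s \<in> Q"
  shows "carrier B_cone \<subseteq> Q"
proof -
  have "submodule Q complex_ring EL"
  proof (rule module.submoduleI[OF module_EL])
    interpret abelian_group EL by (rule abelian_group_EL)
    show "\<ominus>\<^bsub>EL\<^esub> f \<in> Q" if f: "f \<in> Q" for f
    proof -
      have "f \<in> carrier EL" using f Q(1) by blast
      from EL_minus[OF this, of "\<zero>\<^bsub>EL\<^esub>"] have "\<ominus>\<^bsub>EL\<^esub> f = (\<lambda>x. - f x)"
        using a_inv_closed[OF \<open>f \<in> carrier EL\<close>] unfolding a_minus_def
        by (simp del: ell_infinity_simps(1))
      then show ?thesis using Q(4)[OF f, of "-1"] by simp
    qed
  qed (use Q in auto)
  moreover have "norm_closed Q EL"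
    unfolding norm_closed_def
  proof (intro allI ballI impI)
    fix \<sigma> :: "nat \<Rightarrow> 'g \<Rightarrow> complex" and f
    assume f: "f \<in> carrier EL" and *: "range \<sigma> \<subseteq> Q \<and> (\<lambda>n. nrm EL (\<sigma> n \<ominus>\<^bsub>EL\<^esub> f)) \<longlonglongrightarrow> 0"
    have "\<sigma> n \<in> Q" for n using * by blast
    moreover have "(\<lambda>n. nrm EL (\<lambda>x. \<sigma> n x - f x)) \<longlonglongrightarrow> 0" using conjunct2[OF *] unfolding EL_minus[OF f] .
    ultimately show "f \<in> Q" using closed[OF _ f] by blast
  qed
  moreover have "{cone_indicator s |s. 0 \<le> s} \<subseteq> Q" using ind by blast
  ultimately have "closed_span EL {cone_indicator s |s. 0 \<le> s} \<subseteq> Q"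
    unfolding closed_span_def by blast
  then show ?thesis by (simp add: B_cone_def)
qed

lemma cone_indicator_B_cone: "0 \<le> (s::'g) \<Longrightarrow> cone_indicator s \<in> carrier B_cone"
  by (auto simp: B_cone_def closed_span_def)

lemma mult_op_bounded:
  assumes f: "f \<in> carrier EL"
  shows "mult_op f \<in> bounded_operators {0..}" "nrm cone_ops (mult_op f) \<le> nrm EL f"
proof -
  have b: "(\<lambda>y. f y * h y) \<in> ell2 {0..} \<and> ell2_norm {0..} (\<lambda>y. f y * h y) \<le> nrm EL f * ell2_norm {0..} h"
    if h: "h \<in> ell2 {0..}" for h
  proof -
    have "L2_set (\<lambda>y. cmod (f y * h y)) F \<le> nrm EL f * ell2_norm {0..} h" if F: "finite F" "F \<subseteq> {0..}" for F
    proof -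
      have n: "0 \<le> nrm EL f" using order_trans[OF norm_ge_zero le_EL_norm[OF f]] .
      have "L2_set (\<lambda>y. cmod (f y * h y)) F \<le> L2_set (\<lambda>y. nrm EL f * cmod (h y)) F"
        by (intro L2_set_mono) (simp_all add: norm_mult mult_right_mono le_EL_norm[OF f])
      also have "\<dots> = nrm EL f * L2_set (\<lambda>y. cmod (h y)) F" by (rule L2_set_right_distrib[OF n, symmetric])
      also have "\<dots> \<le> nrm EL f * ell2_norm {0..} h" by (rule mult_left_mono[OF L2_set_le_ell2_norm[OF h F] n])
      finally show ?thesis .
    qed
    note * = ell2_bounded[of "{0..}" "\<lambda>y. f y * h y", OF _ this]
    show ?thesis using * ell2_vanish[OF h] by auto
  qed
  show B: "mult_op f \<in> bounded_operators {0..}"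
    by (rule bounded_operators_I[where K = "nrm EL f"])
       (use b in \<open>auto simp: mult_op_def ell2_add ell2_scale algebra_simps\<close>)
  show "nrm cone_ops (mult_op f) \<le> nrm EL f"
    by (rule operator_norm_le[OF B order_trans[OF norm_ge_zero le_EL_norm[OF f]]]) (use b in \<open>simp add: mult_op_def\<close>)
qed

lemma mult_op_add: "mult_op (\<lambda>x. f x + g x) = (\<lambda>h x. mult_op f h x + mult_op g h x)"
  and mult_op_diff: "mult_op (\<lambda>x. f x - g x) = (\<lambda>h x. mult_op f h x - mult_op g h x)"
  and mult_op_scale: "mult_op (\<lambda>x. c * f x) = (\<lambda>h x. c * mult_op f h x)"
  by (auto simp: mult_op_def fun_eq_iff algebra_simps)

lemma mult_op_conjugate:
  assumes f: "f \<in> carrier EL" and x: "0 \<le> x"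
  shows "mult_op (tau x f) = toeplitz_op x \<circ> mult_op f \<circ> back_shift x"
proof
  fix h :: "'g \<Rightarrow> complex"
  show "mult_op (tau x f) h = (toeplitz_op x \<circ> mult_op f \<circ> back_shift x) h"
  proof (cases "h \<in> ell2 {0..}")
    case True
    have 1: "back_shift x h \<in> ell2 {0..}" by (rule bounded_operators_in_ell2[OF back_shift_bounded[OF x]])
    have 2: "mult_op f (back_shift x h) \<in> ell2 {0..}" by (rule bounded_operators_in_ell2[OF mult_op_bounded(1)[OF f]])
    have v: "f y = 0" if "\<not> 0 \<le> y" for y using f that by simp
    have "(toeplitz_op x \<circ> mult_op f \<circ> back_shift x) h = (\<lambda>y. f (y - x) * back_shift x h (y - x))"
      using 1 2 by (simp add: toeplitz_op_def mult_op_def)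
    also have "\<dots> = (\<lambda>y. f (y - x) * h y)"
      using True v by (auto simp: back_shift_def fun_eq_iff)
    finally show ?thesis using True by (simp add: mult_op_def tau_def)
  next
    case False
    then show ?thesis by (simp add: mult_op_def back_shift_def toeplitz_op_def)
  qed
qed

lemma cone_indicator_EL: "cone_indicator s \<in> carrier EL"
  unfolding carrier_EL_iff by (auto simp: cone_indicator_def intro: exI[of _ 1])

lemma mult_op_cone_indicator_zero: "mult_op (cone_indicator 0) = \<one>\<^bsub>TA\<^esub>"
  using ell2_vanish[of _ "{0 :: 'g..}"] by (force simp: mult_op_def cone_indicator_def fun_eq_iff)

lemma mult_op_cone_indicator:
  assumes s: "0 \<le> s"
  shows "mult_op (cone_indicator s) = toeplitz_op s \<otimes>\<^bsub>TA\<^esub> star TA (toeplitz_op s)"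
proof -
  have "mult_op (cone_indicator s) = toeplitz_op s \<circ> mult_op (cone_indicator 0) \<circ> back_shift s"
    using mult_op_conjugate[OF cone_indicator_EL[of 0] s] tau_cone_indicator[OF s, of 0] by simp
  also have "\<dots> = toeplitz_op s \<circ> back_shift s"
  proof -
    have "toeplitz_op s \<otimes>\<^bsub>TA\<^esub> \<one>\<^bsub>TA\<^esub> = toeplitz_op s" by (rule M.A.one_right[OF toeplitz_op_in_algebra[OF s]])
    then show ?thesis unfolding mult_op_cone_indicator_zero by (simp only: toeplitz_algebra_simps)
  qed
  finally show ?thesis using star_toeplitz_op[OF s] by simp
qed

text \<open>All three properties are inherited by closed spans and hold for \<open>1\<^sub>s\<close>, whose
  multiplication operator is \<open>T\<^sub>s T\<^sub>s\<^sup>*\<close>. In the limit, the symbols of the approximating functions,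
  which are constant, provide the limit at infinity.\<close>
lemma B_cone_limit:
  assumes b: "b \<in> carrier B_cone"
  shows "b \<in> carrier EL" "mult_op b \<in> carrier TA"
    "\<exists>L. (b \<longlongrightarrow> L) at_top \<and> toeplitz_symbol_hom (mult_op b) = L \<odot>\<^bsub>CD\<^esub> \<one>\<^bsub>CD\<^esub>"
proof -
  define Q where "Q = {f \<in> carrier EL. mult_op f \<in> carrier TA \<and>
    (\<exists>L. (f \<longlongrightarrow> L) at_top \<and> toeplitz_symbol_hom (mult_op f) = L \<odot>\<^bsub>CD\<^esub> \<one>\<^bsub>CD\<^esub>)}"
  have QI: "f \<in> Q" if "f \<in> carrier EL" "mult_op f \<in> carrier TA" "(f \<longlongrightarrow> L) at_top"
    "toeplitz_symbol_hom (mult_op f) = L \<odot>\<^bsub>CD\<^esub> \<one>\<^bsub>CD\<^esub>" for f L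
    unfolding Q_def using that by blast
  have QE: "\<exists>L. f \<in> carrier EL \<and> mult_op f \<in> carrier TA \<and> (f \<longlongrightarrow> L) at_top \<and>
    toeplitz_symbol_hom (mult_op f) = L \<odot>\<^bsub>CD\<^esub> \<one>\<^bsub>CD\<^esub>" if "f \<in> Q" for f
    using that unfolding Q_def by blast
  have Qscale: "(\<lambda>x. c * f x) \<in> Q" if f: "f \<in> Q" for c f
  proof -
    obtain L where L: "f \<in> carrier EL" "mult_op f \<in> carrier TA" "(f \<longlongrightarrow> L) at_top"
      "toeplitz_symbol_hom (mult_op f) = L \<odot>\<^bsub>CD\<^esub> \<one>\<^bsub>CD\<^esub>" using QE[OF f] by blast
    have eq: "mult_op (\<lambda>x. c * f x) = c \<odot>\<^bsub>TA\<^esub> mult_op f" by (simp add: mult_op_scale)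
    show ?thesis
    proof (rule QI[OF EL_scale[OF L(1)] _ tendsto_mult_left[OF L(3)]])
      show "mult_op (\<lambda>x. c * f x) \<in> carrier TA" unfolding eq by (rule M.A.smult_carrier[OF L(2)])
      show "toeplitz_symbol_hom (mult_op (\<lambda>x. c * f x)) = (c * L) \<odot>\<^bsub>CD\<^esub> \<one>\<^bsub>CD\<^esub>"
        unfolding eq M.hom_smult[OF L(2)] L(4) by (simp add: fun_eq_iff)
    qed
  qed
  have Qind: "cone_indicator s \<in> Q" if s: "0 \<le> s" for s
  proof (rule QI[OF cone_indicator_EL])
    have T: "toeplitz_op s \<in> carrier TA" by (rule toeplitz_op_in_algebra[OF s])
    show "mult_op (cone_indicator s) \<in> carrier TA"
      unfolding mult_op_cone_indicator[OF s] by (rule M.A.mult_closed[OF T M.A.star_carrier[OF T]])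
    show "(cone_indicator s \<longlongrightarrow> 1) at_top"
    proof (rule tendsto_eventually)
      show "eventually (\<lambda>x. cone_indicator s x = 1) at_top"
        by (rule eventually_mono[OF eventually_ge_at_top[of s]]) (use s in \<open>auto simp: cone_indicator_def\<close>)
    qed
    show "toeplitz_symbol_hom (mult_op (cone_indicator s)) = 1 \<odot>\<^bsub>CD\<^esub> \<one>\<^bsub>CD\<^esub>"
      unfolding mult_op_cone_indicator[OF s] symbol_hom_range_projection[OF s] by (simp add: fun_eq_iff)
  qed
  have Qadd: "(\<lambda>x. f x + g x) \<in> Q" if fg: "f \<in> Q" "g \<in> Q" for f g
  proof -
    obtain L where L: "f \<in> carrier EL" "mult_op f \<in> carrier TA" "(f \<longlongrightarrow> L) at_top"
      "toeplitz_symbol_hom (mult_op f) = L \<odot>\<^bsub>CD\<^esub> \<one>\<^bsub>CD\<^esub>" using QE[OF fg(1)] by blast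
    obtain K where K: "g \<in> carrier EL" "mult_op g \<in> carrier TA" "(g \<longlongrightarrow> K) at_top"
      "toeplitz_symbol_hom (mult_op g) = K \<odot>\<^bsub>CD\<^esub> \<one>\<^bsub>CD\<^esub>" using QE[OF fg(2)] by blast
    have eq: "mult_op (\<lambda>x. f x + g x) = mult_op f \<oplus>\<^bsub>TA\<^esub> mult_op g" by (simp add: mult_op_add)
    show ?thesis
    proof (rule QI[OF EL_closed[OF L(1) K(1)] _ tendsto_add[OF L(3) K(3)]])
      show "mult_op (\<lambda>x. f x + g x) \<in> carrier TA" unfolding eq by (rule M.A.M.a_closed[OF L(2) K(2)])
      show "toeplitz_symbol_hom (mult_op (\<lambda>x. f x + g x)) = (L + K) \<odot>\<^bsub>CD\<^esub> \<one>\<^bsub>CD\<^esub>"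
        unfolding eq M.hom_add[OF L(2) K(2)] L(4) K(4) by (simp add: fun_eq_iff algebra_simps)
    qed
  qed
  have Qclosed: "f \<in> Q" if \<sigma>: "\<And>n::nat. \<sigma> n \<in> Q" and f: "f \<in> carrier EL"
    and lim: "(\<lambda>n. nrm EL (\<lambda>x. \<sigma> n x - f x)) \<longlonglongrightarrow> 0" for \<sigma> f
  proof -
    have "\<forall>n. \<exists>L. \<sigma> n \<in> carrier EL \<and> mult_op (\<sigma> n) \<in> carrier TA \<and> (\<sigma> n \<longlongrightarrow> L) at_top \<and>
      toeplitz_symbol_hom (mult_op (\<sigma> n)) = L \<odot>\<^bsub>CD\<^esub> \<one>\<^bsub>CD\<^esub>" using QE[OF \<sigma>] by blast
    from choice[OF this] obtain L where L': "\<forall>n. \<sigma> n \<in> carrier EL \<and> mult_op (\<sigma> n) \<in> carrier TA \<and>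
      (\<sigma> n \<longlongrightarrow> L n) at_top \<and> toeplitz_symbol_hom (mult_op (\<sigma> n)) = L n \<odot>\<^bsub>CD\<^esub> \<one>\<^bsub>CD\<^esub>" ..
    have L: "\<sigma> n \<in> carrier EL" "mult_op (\<sigma> n) \<in> carrier TA" "(\<sigma> n \<longlongrightarrow> L n) at_top"
      "toeplitz_symbol_hom (mult_op (\<sigma> n)) = L n \<odot>\<^bsub>CD\<^esub> \<one>\<^bsub>CD\<^esub>" for n using spec[OF L', of n] by blast+
    have dEL: "(\<lambda>x. \<sigma> n x - f x) \<in> carrier EL" for n
      using EL_closed[OF L(1) EL_scale[OF f, of "-1"], of n] by (simp del: ell_infinity_simps(1))
    interpret O: unital_cstar_algebra "cone_ops :: (('g \<Rightarrow> complex) \<Rightarrow> 'g \<Rightarrow> complex) cstar" by (rule operator_unital_cstar_algebra)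
    have fB: "mult_op f \<in> bounded_operators {0..}" and \<sigma>B: "mult_op (\<sigma> n) \<in> bounded_operators {0..}" for n
      using mult_op_bounded(1)[OF f] mult_op_bounded(1)[OF L(1)] by auto
    have limO: "norm_lim cone_ops (\<lambda>n. mult_op (\<sigma> n)) (mult_op f)"
    proof (rule O.norm_limI[OF _ lim])
      show "nrm cone_ops (mult_op (\<sigma> n) \<ominus>\<^bsub>cone_ops\<^esub> mult_op f) \<le> nrm EL (\<lambda>x. \<sigma> n x - f x)" for n
        using mult_op_bounded(2)[OF dEL[of n]] unfolding operator_minus[OF fB] mult_op_diff .
    qed (simp_all only: operator_cstar_simps(1) fB \<sigma>B)
    have clTA: "norm_closed (carrier TA) cone_ops" using toeplitz_subalgebra[where 'g = 'g] by (simp add: cstar_subalgebra_def)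
    have fTA: "mult_op f \<in> carrier TA"
      by (rule norm_closed_limD[OF clTA limO _ L(2)]) (use fB in simp)
    have limTA: "norm_lim TA (\<lambda>n. mult_op (\<sigma> n)) (mult_op f)"
      using limO unfolding norm_lim_def operator_minus[OF fB] toeplitz_minus[OF L(2) fTA] by simp
    have limCD: "norm_lim CD (\<lambda>n. L n \<odot>\<^bsub>CD\<^esub> \<one>\<^bsub>CD\<^esub>) (toeplitz_symbol_hom (mult_op f))"
      using M.norm_lim_hom[OF limTA L(2) fTA] unfolding L(4) .
    have hC: "toeplitz_symbol_hom (mult_op f) \<in> carrier CD" by (rule M.hom_closed[OF fTA])
    have LL: "L \<longlonglongrightarrow> toeplitz_symbol_hom (mult_op f) \<xi>" if \<xi>: "\<xi> \<in> dual_group" for \<xi>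
    proof -
      have "cmod (L n - toeplitz_symbol_hom (mult_op f) \<xi>) \<le> nrm CD (L n \<odot>\<^bsub>CD\<^esub> \<one>\<^bsub>CD\<^esub> \<ominus>\<^bsub>CD\<^esub> toeplitz_symbol_hom (mult_op f))" for n
      proof -
        have "L n \<odot>\<^bsub>CD\<^esub> \<one>\<^bsub>CD\<^esub> \<ominus>\<^bsub>CD\<^esub> toeplitz_symbol_hom (mult_op f) \<in> carrier CD"
          by (rule M.B.M.minus_closed[OF M.B.smult_carrier[OF M.B.one_closed] hC])
        from le_C_dual_norm[OF this, of \<xi>] show ?thesis
          unfolding continuous_functions_minus[OF hC] using \<xi> by simp
      qed
      then have "(\<lambda>n. L n - toeplitz_symbol_hom (mult_op f) \<xi>) \<longlonglongrightarrow> 0"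
        by (intro Lim_null_comparison[OF _ limCD[unfolded norm_lim_def]] always_eventually) simp
      then show ?thesis by (rule LIM_zero_cancel)
    qed
    define l where "l = toeplitz_symbol_hom (mult_op f) (\<lambda>x. 1)"
    have Ll: "L \<longlonglongrightarrow> l" unfolding l_def by (rule LL[OF dual_group_nonempty])
    show ?thesis
    proof (rule QI[OF f fTA])
      have "toeplitz_symbol_hom (mult_op f) \<xi> = l" if "\<xi> \<in> dual_group" for \<xi>
        by (rule LIMSEQ_unique[OF LL[OF that] Ll])
      then show "toeplitz_symbol_hom (mult_op f) = l \<odot>\<^bsub>CD\<^esub> \<one>\<^bsub>CD\<^esub>"
        using hC by (simp add: fun_eq_iff)
      show "(f \<longlongrightarrow> l) at_top"
      proof (rule tendstoI)
        fix e :: real assume e: "0 < e"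
        then have e3: "0 < e / 3" by simp
        have "eventually (\<lambda>n. nrm EL (\<lambda>x. \<sigma> n x - f x) < e / 3 \<and> dist (L n) l < e / 3) sequentially"
          by (intro eventually_conj order_tendstoD(2)[OF lim e3] tendstoD[OF Ll e3])
        then obtain n where n: "nrm EL (\<lambda>x. \<sigma> n x - f x) < e / 3" "dist (L n) l < e / 3"
          by (auto simp: eventually_sequentially)
        have "eventually (\<lambda>x. dist (\<sigma> n x) (L n) < e / 3) at_top" by (rule tendstoD[OF L(3) e3])
        then show "eventually (\<lambda>x. dist (f x) l < e) at_top"
        proof (rule eventually_mono)
          fix x assume x: "dist (\<sigma> n x) (L n) < e / 3"
          have "dist (\<sigma> n x) (f x) < e / 3"
            using le_EL_norm[OF dEL[of n], of x] n(1) by (simp add: dist_norm)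
          then show "dist (f x) l < e"
            using dist_triangle[of "f x" l "\<sigma> n x"] dist_triangle[of "\<sigma> n x" l "L n"] x n(2)
              dist_commute[of "f x" "\<sigma> n x"] by linarith
        qed
      qed
    qed
  qed
  have Qzero: "(\<lambda>x. 0) \<in> Q" using Qscale[OF Qind[of 0], of 0] by simp
  have "Q \<subseteq> carrier EL" unfolding Q_def by blast
  then have "carrier B_cone \<subseteq> Q"
  proof (rule B_cone_induct[OF _ Qzero])
    show "(\<lambda>x. f x + g x) \<in> Q" if "f \<in> Q" "g \<in> Q" for f g by (rule Qadd[OF that])
    show "(\<lambda>x. c * f x) \<in> Q" if "f \<in> Q" for c f by (rule Qscale[OF that])
    show "f \<in> Q" if "\<And>n::nat. \<sigma> n \<in> Q" "f \<in> carrier EL" "(\<lambda>n. nrm EL (\<lambda>x. \<sigma> n x - f x)) \<longlonglongrightarrow> 0" for \<sigma> f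
      by (rule Qclosed[OF that])
    show "cone_indicator s \<in> Q" if "0 \<le> s" for s by (rule Qind[OF that])
  qed
  with b have "b \<in> Q" by blast
  then show "b \<in> carrier EL" "mult_op b \<in> carrier TA"
    "\<exists>L. (b \<longlongrightarrow> L) at_top \<and> toeplitz_symbol_hom (mult_op b) = L \<odot>\<^bsub>CD\<^esub> \<one>\<^bsub>CD\<^esub>"
    unfolding Q_def by blast+
qed

end

section \<open>Covariant pairs in the Toeplitz algebra\<close>

lemma nondegenerate_of_unit:
  assumes D: "unital_cstar_algebra D" and \<pi>: "\<pi> \<in> cstar_hom B D" and e: "e \<in> carrier B" "\<pi> e = \<one>\<^bsub>D\<^esub>"
  shows "nondegenerate_rep B D \<pi>"
proof -
  interpret D: unital_cstar_algebra D by (rule D)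
  have \<pi>c: "\<pi> b \<in> carrier D" if "b \<in> carrier B" for b using \<pi> that by (auto simp: cstar_hom_def)
  let ?X = "{\<pi> b \<otimes>\<^bsub>D\<^esub> d | b d. b \<in> carrier B \<and> d \<in> carrier D}"
  have "d \<in> ?X" if d: "d \<in> carrier D" for d
  proof -
    have "d = \<pi> e \<otimes>\<^bsub>D\<^esub> d" unfolding e(2) by (rule D.one_left[OF d, symmetric])
    with e(1) d show ?thesis by blast
  qed
  then have "carrier D \<subseteq> ?X" by blast
  moreover have "?X \<subseteq> carrier D" using \<pi>c by auto
  ultimately have "closed_span D ?X = carrier D"
    by (intro D.closed_span_carrier) auto
  then show ?thesis using \<pi> by (simp add: nondegenerate_rep_def)
qed

lemma unit_of_nondegenerate:
  assumes D: "unital_cstar_algebra D" and \<pi>: "nondegenerate_rep B D \<pi>"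
    and e: "e \<in> carrier B" "\<And>b. b \<in> carrier B \<Longrightarrow> e \<otimes>\<^bsub>B\<^esub> b = b"
  shows "\<pi> e = \<one>\<^bsub>D\<^esub>"
proof -
  interpret D: unital_cstar_algebra D by (rule D)
  have hom: "\<pi> \<in> cstar_hom B D"
    and span: "closed_span D {\<pi> b \<otimes>\<^bsub>D\<^esub> d | b d. b \<in> carrier B \<and> d \<in> carrier D} = carrier D"
    using \<pi> by (simp_all add: nondegenerate_rep_def)
  have \<pi>c: "\<pi> b \<in> carrier D" if "b \<in> carrier B" for b using hom that by (auto simp: cstar_hom_def)
  have \<pi>m: "\<pi> e \<otimes>\<^bsub>D\<^esub> \<pi> b = \<pi> b" if b: "b \<in> carrier B" for b
  proof -
    have "\<pi> (e \<otimes>\<^bsub>B\<^esub> b) = \<pi> e \<otimes>\<^bsub>D\<^esub> \<pi> b" using hom e(1) b by (simp add: cstar_hom_def)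
    then show ?thesis using e(2)[OF b] by simp
  qed
  let ?S = "{d \<in> carrier D. \<pi> e \<otimes>\<^bsub>D\<^esub> d = d}"
  note pe = \<pi>c[OF e(1)]
  have "submodule ?S complex_ring D"
    unfolding D.submodule_iff using pe by (auto simp: D.distr_right D.smult_mult_right)
  moreover have "norm_closed ?S D"
    unfolding norm_closed_iff
  proof (intro allI impI)
    fix \<sigma> x assume x: "x \<in> carrier D" and \<sigma>: "\<forall>n. \<sigma> n \<in> ?S" and lim: "norm_lim D \<sigma> x"
    have \<sigma>D: "\<sigma> n \<in> carrier D" and eq: "\<pi> e \<otimes>\<^bsub>D\<^esub> \<sigma> n = \<sigma> n" for n using \<sigma> by simp_all
    have "norm_lim D \<sigma> (\<pi> e \<otimes>\<^bsub>D\<^esub> x)"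
      using D.norm_lim_mult[OF D.norm_lim_const[OF pe] lim pe \<sigma>D pe x] unfolding eq .
    from D.norm_lim_unique[OF this lim \<sigma>D D.mult_closed[OF pe x] x] show "x \<in> ?S" using x by simp
  qed
  moreover have "{\<pi> b \<otimes>\<^bsub>D\<^esub> d | b d. b \<in> carrier B \<and> d \<in> carrier D} \<subseteq> ?S"
  proof clarify
    fix b d assume bd: "b \<in> carrier B" "d \<in> carrier D"
    show "\<pi> b \<otimes>\<^bsub>D\<^esub> d \<in> carrier D \<and> \<pi> e \<otimes>\<^bsub>D\<^esub> (\<pi> b \<otimes>\<^bsub>D\<^esub> d) = \<pi> b \<otimes>\<^bsub>D\<^esub> d"
      using D.mult_assoc[OF pe \<pi>c[OF bd(1)] bd(2)] \<pi>m[OF bd(1)] D.mult_closed[OF \<pi>c[OF bd(1)] bd(2)] by simp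
  qed
  ultimately have "closed_span D {\<pi> b \<otimes>\<^bsub>D\<^esub> d | b d. b \<in> carrier B \<and> d \<in> carrier D} \<subseteq> ?S"
    unfolding closed_span_def by blast
  then have "\<one>\<^bsub>D\<^esub> \<in> ?S" unfolding span using D.one_closed by blast
  then show ?thesis using D.one_right[OF pe] by simp
qed

context toeplitz_context
begin

text \<open>For \<open>V\<^sub>x = T\<^sub>x\<^sup>*\<close> the range projections \<open>V\<^sub>x V\<^sub>x\<^sup>*\<close> are all \<open>1\<close>, so the representation of the
  function algebra has to send each \<open>1\<^sub>s\<close> to \<open>1\<close>; on its closed span this is the limit at infinity.\<close>
definition limit_rep :: "('g \<Rightarrow> complex) \<Rightarrow> ('g \<Rightarrow> complex) \<Rightarrow> 'g \<Rightarrow> complex" where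
  "limit_rep b = Lim at_top b \<odot>\<^bsub>TA\<^esub> \<one>\<^bsub>TA\<^esub>"

lemma limit_rep_eq:
  assumes "(b \<longlongrightarrow> L) at_top" shows "limit_rep b = L \<odot>\<^bsub>TA\<^esub> \<one>\<^bsub>TA\<^esub>"
  using tendsto_Lim[OF _ assms] by (simp add: limit_rep_def trivial_limit_at_top_linorder)

lemma mult_op_comp: "mult_op (\<lambda>x. f x * g x) = mult_op f \<circ> mult_op g" if g: "g \<in> carrier EL"
proof
  fix h :: "'g \<Rightarrow> complex"
  have "mult_op g h \<in> ell2 {0..}" by (rule bounded_operators_in_ell2[OF mult_op_bounded(1)[OF g]])
  then show "mult_op (\<lambda>x. f x * g x) h = (mult_op f \<circ> mult_op g) h"
    by (simp add: mult_op_def fun_eq_iff)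
qed

lemma EL_cnj: "f \<in> carrier EL \<Longrightarrow> (\<lambda>x. cnj (f x)) \<in> carrier EL"
  unfolding carrier_EL_iff by simp

lemma star_mult_op:
  assumes f: "f \<in> carrier EL" shows "star TA (mult_op f) = mult_op (\<lambda>x. cnj (f x))"
  unfolding toeplitz_algebra_simps
proof (rule operator_star_eqI[OF mult_op_bounded(1)[OF f] mult_op_bounded(1)[OF EL_cnj[OF f]]])
  fix h k :: "'g \<Rightarrow> complex" assume "h \<in> ell2 {0..}" "k \<in> ell2 {0..}"
  then show "ell2_inner {0..} (mult_op f h) k = ell2_inner {0..} h (mult_op (\<lambda>x. cnj (f x)) k)"
    by (simp add: ell2_inner_def mult_op_def ac_simps)
qed

lemma mult_op_hom: "mult_op \<in> cstar_hom B_cone TA"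
  unfolding cstar_hom_def
  by (auto simp: B_cone_limit mult_op_add mult_op_scale mult_op_comp star_mult_op[unfolded toeplitz_algebra_simps]
      simp del: ell_infinity_simps(1))

lemma limit_rep_hom: "limit_rep \<in> cstar_hom B_cone TA"
proof -
  have lim: "\<exists>L. (b \<longlongrightarrow> L) at_top \<and> limit_rep b = L \<odot>\<^bsub>TA\<^esub> \<one>\<^bsub>TA\<^esub>" if "b \<in> carrier B_cone" for b
    using B_cone_limit(3)[OF that] limit_rep_eq by blast
  note one = M.A.one_closed
  show ?thesis
    unfolding cstar_hom_def
  proof (intro CollectI conjI ballI allI)
    show "limit_rep \<in> carrier B_cone \<rightarrow> carrier TA"
      unfolding limit_rep_def using M.A.smult_carrier[OF one] by blast
    fix f :: "'g \<Rightarrow> complex" and c assume f: "f \<in> carrier B_cone"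
    obtain L where L: "(f \<longlongrightarrow> L) at_top" "limit_rep f = L \<odot>\<^bsub>TA\<^esub> \<one>\<^bsub>TA\<^esub>" using lim[OF f] by blast
    show "limit_rep (c \<odot>\<^bsub>B_cone\<^esub> f) = c \<odot>\<^bsub>TA\<^esub> limit_rep f"
      unfolding L(2) M.A.smult_smult[OF one] B_cone_simps by (rule limit_rep_eq[OF tendsto_mult_left[OF L(1)]])
    show "limit_rep (star B_cone f) = star TA (limit_rep f)"
      unfolding L(2) M.A.star_smult[OF one] M.A.star_one B_cone_simps by (rule limit_rep_eq[OF tendsto_cnj[OF L(1)]])
    fix g :: "'g \<Rightarrow> complex" assume g: "g \<in> carrier B_cone"
    obtain K where K: "(g \<longlongrightarrow> K) at_top" "limit_rep g = K \<odot>\<^bsub>TA\<^esub> \<one>\<^bsub>TA\<^esub>" using lim[OF g] by blast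
    show "limit_rep (f \<oplus>\<^bsub>B_cone\<^esub> g) = limit_rep f \<oplus>\<^bsub>TA\<^esub> limit_rep g"
      unfolding L(2) K(2) M.A.smult_add_left[OF one, symmetric] B_cone_simps
      by (rule limit_rep_eq[OF tendsto_add[OF L(1) K(1)]])
    have "L \<odot>\<^bsub>TA\<^esub> \<one>\<^bsub>TA\<^esub> \<otimes>\<^bsub>TA\<^esub> (K \<odot>\<^bsub>TA\<^esub> \<one>\<^bsub>TA\<^esub>) = (L * K) \<odot>\<^bsub>TA\<^esub> \<one>\<^bsub>TA\<^esub>"
      unfolding M.A.smult_mult_left[OF one M.A.smult_carrier[OF one]] M.A.one_left[OF M.A.smult_carrier[OF one]]
        M.A.smult_smult[OF one] ..
    then show "limit_rep (f \<otimes>\<^bsub>B_cone\<^esub> g) = limit_rep f \<otimes>\<^bsub>TA\<^esub> limit_rep g"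
      unfolding L(2) K(2) B_cone_simps by (simp only: limit_rep_eq[OF tendsto_mult[OF L(1) K(1)]])
  qed
qed

lemma toeplitz_covariant_pair: "covariant_pair TA mult_op toeplitz_op"
  unfolding covariant_pair_def
proof (intro conjI allI impI ballI)
  show "unital_cstar_algebra TA" by (rule toeplitz_unital_cstar_algebra)
  show "nondegenerate_rep B_cone TA mult_op"
    by (rule nondegenerate_of_unit[where \<pi> = mult_op and e = "cone_indicator 0",
        OF toeplitz_unital_cstar_algebra mult_op_hom
        cone_indicator_B_cone[OF order_refl] mult_op_cone_indicator_zero])
  show "piso_rep TA toeplitz_op"
    unfolding piso_rep_def partial_isometry_def
  proof (intro conjI allI impI)
    fix x :: 'g assume x: "0 \<le> x"
    note T = toeplitz_op_in_algebra[OF x]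
    show "toeplitz_op x \<in> carrier TA" by (rule T)
    show "toeplitz_op x \<otimes>\<^bsub>TA\<^esub> star TA (toeplitz_op x) \<otimes>\<^bsub>TA\<^esub> toeplitz_op x = toeplitz_op x"
      unfolding M.A.mult_assoc[OF T M.A.star_carrier[OF T] T] star_mult_toeplitz_op[OF x]
      by (rule M.A.one_right[OF T])
    fix y :: 'g assume y: "0 \<le> y"
    show "toeplitz_op (x + y) = toeplitz_op x \<otimes>\<^bsub>TA\<^esub> toeplitz_op y"
      unfolding toeplitz_algebra_simps by (rule toeplitz_op_add[OF x y])
  qed
  fix x :: 'g and b :: "'g \<Rightarrow> complex" assume x: "0 \<le> x" and b: "b \<in> carrier B_cone"
  show "mult_op (tau x b) = toeplitz_op x \<otimes>\<^bsub>TA\<^esub> mult_op b \<otimes>\<^bsub>TA\<^esub> star TA (toeplitz_op x)"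
    unfolding toeplitz_algebra_simps star_toeplitz_op[OF x] by (rule mult_op_conjugate[OF B_cone_limit(1)[OF b] x])
qed

lemma toeplitz_star_covariant_pair: "covariant_pair TA limit_rep (\<lambda>x. star TA (toeplitz_op x))"
  unfolding covariant_pair_def
proof (intro conjI allI impI ballI)
  show "unital_cstar_algebra TA" by (rule toeplitz_unital_cstar_algebra)
  have "(cone_indicator (0 :: 'g) \<longlongrightarrow> 1) at_top"
    by (rule tendsto_eventually, rule eventually_mono[OF eventually_ge_at_top[of 0]])
       (simp add: cone_indicator_def)
  then have "limit_rep (cone_indicator 0) = \<one>\<^bsub>TA\<^esub>"
    by (simp only: limit_rep_eq M.A.smult_1[OF M.A.one_closed])
  then show "nondegenerate_rep B_cone TA limit_rep"
    by (rule nondegenerate_of_unit[where \<pi> = limit_rep and e = "cone_indicator 0",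
        OF toeplitz_unital_cstar_algebra limit_rep_hom cone_indicator_B_cone[OF order_refl]])
  show "piso_rep TA (\<lambda>x. star TA (toeplitz_op x))"
    unfolding piso_rep_def partial_isometry_def
  proof (intro conjI allI impI)
    fix x :: 'g assume x: "0 \<le> x"
    note T = toeplitz_op_in_algebra[OF x] and Ts = M.A.star_carrier[OF toeplitz_op_in_algebra[OF x]]
    show "star TA (toeplitz_op x) \<in> carrier TA" by (rule Ts)
    show "star TA (toeplitz_op x) \<otimes>\<^bsub>TA\<^esub> star TA (star TA (toeplitz_op x)) \<otimes>\<^bsub>TA\<^esub> star TA (toeplitz_op x)
        = star TA (toeplitz_op x)"
      unfolding M.A.star_star[OF T] star_mult_toeplitz_op[OF x] by (rule M.A.one_left[OF Ts])
    fix y :: 'g assume y: "0 \<le> y"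
    have "toeplitz_op (x + y) = toeplitz_op y \<otimes>\<^bsub>TA\<^esub> toeplitz_op x"
      unfolding toeplitz_algebra_simps add.commute[of x y] by (rule toeplitz_op_add[OF y x])
    then show "star TA (toeplitz_op (x + y)) = star TA (toeplitz_op x) \<otimes>\<^bsub>TA\<^esub> star TA (toeplitz_op y)"
      by (simp only: M.A.star_mult[OF toeplitz_op_in_algebra[OF y] T])
  qed
  fix x :: 'g and b :: "'g \<Rightarrow> complex" assume x: "0 \<le> x" and b: "b \<in> carrier B_cone"
  note T = toeplitz_op_in_algebra[OF x] and Ts = M.A.star_carrier[OF toeplitz_op_in_algebra[OF x]]
  obtain L where L: "(b \<longlongrightarrow> L) at_top" using B_cone_limit(3)[OF b] by blast
  have "filterlim (\<lambda>y. y - x) at_top at_top"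
    unfolding filterlim_at_top
  proof
    fix Z show "eventually (\<lambda>y. Z \<le> y - x) at_top"
      by (rule eventually_mono[OF eventually_ge_at_top[of "Z + x"]]) (simp add: le_diff_eq)
  qed
  from filterlim_compose[OF L this] have "(tau x b \<longlongrightarrow> L) at_top" by (simp add: tau_def)
  then have "limit_rep (tau x b) = L \<odot>\<^bsub>TA\<^esub> \<one>\<^bsub>TA\<^esub>" by (rule limit_rep_eq)
  also have "\<dots> = star TA (toeplitz_op x) \<otimes>\<^bsub>TA\<^esub> (L \<odot>\<^bsub>TA\<^esub> \<one>\<^bsub>TA\<^esub>) \<otimes>\<^bsub>TA\<^esub> toeplitz_op x"
    unfolding M.A.smult_mult_right[OF Ts M.A.one_closed] M.A.one_right[OF Ts] M.A.smult_mult_left[OF Ts T]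
      star_mult_toeplitz_op[OF x] ..
  finally show "limit_rep (tau x b) = star TA (toeplitz_op x) \<otimes>\<^bsub>TA\<^esub> limit_rep b \<otimes>\<^bsub>TA\<^esub> star TA (star TA (toeplitz_op x))"
    unfolding limit_rep_eq[OF L] M.A.star_star[OF T] .
qed

text \<open>Both sides are the scalar function given by the limit of \<open>b\<close> at infinity.\<close>
lemma symbol_homs_agree:
  assumes b: "b \<in> carrier B_cone"
  shows "conjugate_symbol_hom (mult_op b) = toeplitz_symbol_hom (limit_rep b)"
proof -
  obtain L where L: "(b \<longlongrightarrow> L) at_top" "toeplitz_symbol_hom (mult_op b) = L \<odot>\<^bsub>CD\<^esub> \<one>\<^bsub>CD\<^esub>"
    using B_cone_limit(3)[OF b] by blast
  have "conjugate_symbol_hom (mult_op b) = L \<odot>\<^bsub>CD\<^esub> \<one>\<^bsub>CD\<^esub>"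
    unfolding conjugate_symbol_hom_def L(2) by (auto simp: conjugate_dual_def dual_group_cnj fun_eq_iff)
  then show ?thesis
    unfolding limit_rep_eq[OF L(1)] M.hom_smult[OF M.A.one_closed] M.hom_one .
qed

end

section \<open>The kernels in the crossed product\<close>

text \<open>The two homomorphisms are those that the universal property provides for the covariant
  pairs above.\<close>
locale piso_crossed_product = toeplitz_context group_type
  for group_type :: "'g::linordered_ab_group_add itself" +
  fixes A :: "'a cstar" and iB :: "('g \<Rightarrow> complex) \<Rightarrow> 'a" and v :: "'g \<Rightarrow> 'a"
    and \<phi>T \<phi>Ts :: "'a \<Rightarrow> ('g \<Rightarrow> complex) \<Rightarrow> 'g \<Rightarrow> complex"
  assumes covariant: "covariant_pair A iB v"
    and generated: "cstar_generated A (iB ` carrier B_cone \<union> v ` {0..}) = carrier A"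
    and \<phi>T: "\<phi>T \<in> cstar_hom A TA" "\<And>b. b \<in> carrier B_cone \<Longrightarrow> \<phi>T (iB b) = mult_op b"
      "\<And>x. 0 \<le> x \<Longrightarrow> \<phi>T (v x) = toeplitz_op x"
    and \<phi>Ts: "\<phi>Ts \<in> cstar_hom A TA" "\<And>b. b \<in> carrier B_cone \<Longrightarrow> \<phi>Ts (iB b) = limit_rep b"
      "\<And>x. 0 \<le> x \<Longrightarrow> \<phi>Ts (v x) = star TA (toeplitz_op x)"
begin

lemma A_unital: "unital_cstar_algebra A"
  using covariant by (simp add: covariant_pair_def)

lemma iB_one: "iB (cone_indicator 0) = \<one>\<^bsub>A\<^esub>"
proof (rule unit_of_nondegenerate[where \<pi> = iB and e = "cone_indicator 0" and B = B_cone, OF A_unital])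
  show "nondegenerate_rep B_cone A iB" using covariant by (simp add: covariant_pair_def)
  show "cone_indicator (0 :: 'g) \<in> carrier B_cone" by (rule cone_indicator_B_cone) simp
  fix b :: "'g \<Rightarrow> complex" assume "b \<in> carrier B_cone"
  then have "b \<in> carrier EL" by (rule B_cone_limit(1))
  then show "cone_indicator 0 \<otimes>\<^bsub>B_cone\<^esub> b = b" by (auto simp: cone_indicator_def fun_eq_iff)
qed

sublocale T: cstar_morphism A TA \<phi>T
proof (intro cstar_morphism.intro A_unital toeplitz_unital_cstar_algebra cstar_morphism_axioms.intro \<phi>T(1))
  show "\<phi>T \<one>\<^bsub>A\<^esub> = \<one>\<^bsub>TA\<^esub>"
    unfolding iB_one[symmetric] \<phi>T(2)[OF cone_indicator_B_cone[OF order_refl]] by (rule mult_op_cone_indicator_zero)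
qed

sublocale Ts: cstar_morphism A TA \<phi>Ts
proof (intro cstar_morphism.intro A_unital toeplitz_unital_cstar_algebra cstar_morphism_axioms.intro \<phi>Ts(1))
  have "(cone_indicator (0 :: 'g) \<longlongrightarrow> 1) at_top"
    by (rule tendsto_eventually, rule eventually_mono[OF eventually_ge_at_top[of 0]])
       (simp add: cone_indicator_def)
  then show "\<phi>Ts \<one>\<^bsub>A\<^esub> = \<one>\<^bsub>TA\<^esub>"
    unfolding iB_one[symmetric] \<phi>Ts(2)[OF cone_indicator_B_cone[OF order_refl]]
    by (simp only: limit_rep_eq M.A.smult_1[OF M.A.one_closed])
qed

lemma v_closed: "0 \<le> x \<Longrightarrow> v x \<in> carrier A"
  using covariant by (simp add: covariant_pair_def piso_rep_def partial_isometry_def)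

lemma iB_closed: "b \<in> carrier B_cone \<Longrightarrow> iB b \<in> carrier A"
  using covariant by (auto simp: covariant_pair_def nondegenerate_rep_def cstar_hom_def)

lemma \<phi>T_surj: "\<phi>T ` carrier A = carrier TA"
proof (rule toeplitz_algebra_generated[OF T.image_subalgebra])
  fix s :: 'g assume s: "0 \<le> s"
  show "toeplitz_op s \<in> \<phi>T ` carrier A" using imageI[OF v_closed[OF s], of \<phi>T] \<phi>T(3)[OF s] by simp
qed

lemma \<phi>Ts_surj: "\<phi>Ts ` carrier A = carrier TA"
proof (rule toeplitz_algebra_generated[OF Ts.image_subalgebra])
  fix s :: 'g assume s: "0 \<le> s"
  have "\<phi>Ts (star A (v s)) = toeplitz_op s"
    unfolding Ts.hom_star[OF v_closed[OF s]] \<phi>Ts(3)[OF s] by (rule M.A.star_star[OF toeplitz_op_in_algebra[OF s]])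
  then show "toeplitz_op s \<in> \<phi>Ts ` carrier A"
    using imageI[OF T.A.star_closed[OF v_closed[OF s]], of \<phi>Ts] by simp
qed

text \<open>Both composites are homomorphisms into the functions on the dual group, so it is
  enough to compare them on generators.\<close>
lemma diagonal_agree:
  assumes a: "a \<in> carrier A" shows "conjugate_symbol_hom (\<phi>T a) = toeplitz_symbol_hom (\<phi>Ts a)"
proof -
  interpret D: cstar_morphism A CD "\<lambda>a. conjugate_symbol_hom (\<phi>T a)"
    by (rule cstar_morphism_comp[OF T.cstar_morphism_axioms conjugate_symbol_morphism])
  have D': "cstar_morphism A CD (\<lambda>a. toeplitz_symbol_hom (\<phi>Ts a))"
    by (rule cstar_morphism_comp[OF Ts.cstar_morphism_axioms cstar_morphism_toeplitz_symbol_hom])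
  let ?E = "{a \<in> carrier A. conjugate_symbol_hom (\<phi>T a) = toeplitz_symbol_hom (\<phi>Ts a)}"
  have "cstar_generated A (iB ` carrier B_cone \<union> v ` {0..}) \<subseteq> ?E"
  proof (rule cstar_generated_least[OF D.equalizer_subalgebra[OF D']], rule Un_least)
    show "iB ` carrier B_cone \<subseteq> ?E"
      using iB_closed symbol_homs_agree by (auto simp: \<phi>T(2) \<phi>Ts(2))
    show "v ` {0..} \<subseteq> ?E"
    proof
      fix a assume "a \<in> v ` {0..}"
      then obtain x where x: "0 \<le> x" and ax: "a = v x" by auto
      have "conjugate_symbol_hom (\<phi>T (v x)) = toeplitz_symbol_hom (\<phi>Ts (v x))"
        unfolding \<phi>T(3)[OF x] \<phi>Ts(3)[OF x] conjugate_symbol_hom_toeplitz_op[OF x]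
          M.hom_star[OF toeplitz_op_in_algebra[OF x]] toeplitz_symbol_hom_toeplitz_op[OF x]
        by (auto simp: dual_eval_def dual_group_D fun_eq_iff)
      with v_closed[OF x] show "a \<in> ?E" unfolding ax by blast
    qed
  qed
  then show ?thesis using a unfolding generated by blast
qed

text \<open>The situation is symmetric in the two homomorphisms. An element of the kernel of \<open>G\<close> has
  trivial symbol under \<open>F\<close>. Conversely, the image is closed, it absorbs multiplication by \<open>F r\<close>,
  and it contains all \<open>1 - T\<^sub>z T\<^sub>z\<^sup>*\<close>, so the approximation of operators with trivial symbol applies.\<close>
lemma image_kernel:
  assumes F: "cstar_morphism A TA F" and G: "cstar_morphism A TA G"
    and F_surj: "F ` carrier A = carrier TA"
    and symbols: "\<And>a. a \<in> carrier A \<Longrightarrow> toeplitz_symbol_hom (F a) = \<zero>\<^bsub>CD\<^esub> \<longleftrightarrow> toeplitz_symbol_hom (G a) = \<zero>\<^bsub>CD\<^esub>"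
    and defect: "\<And>z. 0 \<le> z \<Longrightarrow> \<exists>p\<in>carrier A. F p = range_defect z \<and> G p = \<zero>\<^bsub>TA\<^esub>"
  shows "F ` a_kernel A TA G = commutator_ideal TA"
proof -
  interpret F: cstar_morphism A TA F by (rule F)
  interpret G: cstar_morphism A TA G by (rule G)
  show ?thesis
  proof
    show "F ` a_kernel A TA G \<subseteq> commutator_ideal TA"
    proof (rule image_subsetI)
      fix a assume "a \<in> a_kernel A TA G"
      then have a: "a \<in> carrier A" "G a = \<zero>\<^bsub>TA\<^esub>" unfolding G.kernel_iff by blast+
      have "toeplitz_symbol_hom (G a) = \<zero>\<^bsub>CD\<^esub>" unfolding a(2) by (rule M.hom_zero)
      then have "toeplitz_symbol_hom (F a) = \<zero>\<^bsub>CD\<^esub>" using symbols[OF a(1)] by blast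
      then show "F a \<in> commutator_ideal TA"
        unfolding kernel_symbol_hom[symmetric] M.kernel_iff using F.hom_closed[OF a(1)] by blast
    qed
    show "commutator_ideal TA \<subseteq> F ` a_kernel A TA G"
    proof
      fix S assume "S \<in> commutator_ideal TA"
      then have "S \<in> a_kernel TA CD toeplitz_symbol_hom" by (simp only: kernel_symbol_hom)
      then have S: "S \<in> carrier TA" "toeplitz_symbol_hom S = \<zero>\<^bsub>CD\<^esub>"
        by (simp_all only: M.kernel_iff)
      show "S \<in> F ` a_kernel A TA G"
      proof (rule kernel_symbol_hom_approx[OF S])
        show "norm_closed (F ` a_kernel A TA G) TA"
          by (rule F.norm_closed_image_ideal[OF G.kernel_subalgebra G.kernel_mult_right])
        show "F ` a_kernel A TA G \<subseteq> carrier TA"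
        proof (rule image_subsetI)
          fix a assume "a \<in> a_kernel A TA G"
          then have "a \<in> carrier A" by (simp only: G.kernel_iff)
          then show "F a \<in> carrier TA" by (rule F.hom_closed)
        qed
        fix z :: 'g assume z: "0 \<le> z"
        obtain p where p: "p \<in> carrier A" "F p = range_defect z" "G p = \<zero>\<^bsub>TA\<^esub>" using defect[OF z] by blast
        have "S \<in> F ` carrier A" using S(1) by (simp only: F_surj)
        then obtain r where r: "r \<in> carrier A" "F r = S" by (elim imageE) simp
        have "p \<in> a_kernel A TA G" using p(1,3) by (simp only: G.kernel_iff)
        then have "r \<otimes>\<^bsub>A\<^esub> p \<in> a_kernel A TA G" using r(1) by (rule G.kernel_mult_left)
        then have "F (r \<otimes>\<^bsub>A\<^esub> p) \<in> F ` a_kernel A TA G" by (rule imageI)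
        then show "S \<otimes>\<^bsub>TA\<^esub> range_defect z \<in> F ` a_kernel A TA G"
          unfolding F.hom_mult[OF r(1) p(1)] r(2) p(2) .
      qed
    qed
  qed
qed

lemma symbols_vanish_iff:
  assumes "a \<in> carrier A"
  shows "toeplitz_symbol_hom (\<phi>T a) = \<zero>\<^bsub>CD\<^esub> \<longleftrightarrow> toeplitz_symbol_hom (\<phi>Ts a) = \<zero>\<^bsub>CD\<^esub>"
  using conjugate_symbol_hom_eq_zero[OF T.hom_closed[OF assms]] unfolding diagonal_agree[OF assms] by blast

text \<open>The element \<open>1 - v\<^sub>z v\<^sub>z\<^sup>*\<close> goes to \<open>1 - T\<^sub>z T\<^sub>z\<^sup>*\<close> under one homomorphism and to
  \<open>1 - T\<^sub>z\<^sup>* T\<^sub>z = 0\<close> under the other; for \<open>1 - v\<^sub>z\<^sup>* v\<^sub>z\<close> the roles are interchanged.\<close>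
lemma image_kernel_\<phi>Ts: "\<phi>T ` a_kernel A TA \<phi>Ts = commutator_ideal TA"
proof (rule image_kernel[OF T.cstar_morphism_axioms Ts.cstar_morphism_axioms \<phi>T_surj symbols_vanish_iff])
  fix z :: 'g assume z: "0 \<le> z"
  note V = v_closed[OF z] and T = toeplitz_op_in_algebra[OF z]
  note Vs = T.A.star_carrier[OF V]
  note VV = T.A.mult_closed[OF V Vs]
  let ?p = "\<one>\<^bsub>A\<^esub> \<ominus>\<^bsub>A\<^esub> v z \<otimes>\<^bsub>A\<^esub> star A (v z)"
  have "\<phi>T ?p = range_defect z"
    unfolding T.hom_minus[OF T.A.one_closed VV] T.hom_mult[OF V Vs] T.hom_star[OF V] T.hom_one \<phi>T(3)[OF z]
      range_defect_def ..
  moreover have "\<phi>Ts ?p = \<zero>\<^bsub>TA\<^esub>"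
    unfolding Ts.hom_minus[OF T.A.one_closed VV] Ts.hom_mult[OF V Vs] Ts.hom_star[OF V] Ts.hom_one \<phi>Ts(3)[OF z]
      M.A.star_star[OF T] star_mult_toeplitz_op[OF z]
    unfolding a_minus_def by (rule M.A.M.r_neg[OF M.A.one_closed])
  ultimately show "\<exists>p\<in>carrier A. \<phi>T p = range_defect z \<and> \<phi>Ts p = \<zero>\<^bsub>TA\<^esub>"
    using T.A.M.minus_closed[OF T.A.one_closed VV] by blast
qed assumption

lemma image_kernel_\<phi>T: "\<phi>Ts ` a_kernel A TA \<phi>T = commutator_ideal TA"
proof (rule image_kernel[OF Ts.cstar_morphism_axioms T.cstar_morphism_axioms \<phi>Ts_surj symbols_vanish_iff[symmetric]])
  fix z :: 'g assume z: "0 \<le> z"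
  note V = v_closed[OF z] and T = toeplitz_op_in_algebra[OF z]
  note Vs = T.A.star_carrier[OF V]
  note VV = T.A.mult_closed[OF Vs V]
  let ?p = "\<one>\<^bsub>A\<^esub> \<ominus>\<^bsub>A\<^esub> star A (v z) \<otimes>\<^bsub>A\<^esub> v z"
  have "\<phi>Ts ?p = range_defect z"
    unfolding Ts.hom_minus[OF T.A.one_closed VV] Ts.hom_mult[OF Vs V] Ts.hom_star[OF V] Ts.hom_one \<phi>Ts(3)[OF z]
      M.A.star_star[OF T] range_defect_def ..
  moreover have "\<phi>T ?p = \<zero>\<^bsub>TA\<^esub>"
    unfolding T.hom_minus[OF T.A.one_closed VV] T.hom_mult[OF Vs V] T.hom_star[OF V] T.hom_one \<phi>T(3)[OF z]
      star_mult_toeplitz_op[OF z]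
    unfolding a_minus_def by (rule M.A.M.r_neg[OF M.A.one_closed])
  ultimately show "\<exists>p\<in>carrier A. \<phi>Ts p = range_defect z \<and> \<phi>T p = \<zero>\<^bsub>TA\<^esub>"
    using T.A.M.minus_closed[OF T.A.one_closed VV] by blast
qed assumption

lemma kernel_rows_exact:
  "cstar_short_exact (A\<lparr>carrier := a_kernel A TA \<phi>T \<inter> a_kernel A TA \<phi>Ts\<rparr>) id
     (A\<lparr>carrier := a_kernel A TA \<phi>Ts\<rparr>) \<phi>T toeplitz_commutator_ideal"
  "cstar_short_exact (A\<lparr>carrier := a_kernel A TA \<phi>T \<inter> a_kernel A TA \<phi>Ts\<rparr>) id
     (A\<lparr>carrier := a_kernel A TA \<phi>T\<rparr>) \<phi>Ts toeplitz_commutator_ideal"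
  using T.short_exact_restrict[OF Ts.kernel_subalgebra commutator_ideal_subalgebra image_kernel_\<phi>Ts]
    Ts.short_exact_restrict[OF T.kernel_subalgebra commutator_ideal_subalgebra image_kernel_\<phi>T]
  unfolding toeplitz_commutator_ideal_eq Int_commute[of "a_kernel A TA \<phi>Ts"] .

lemma diagonal_generator:
  assumes x: "0 \<le> x"
  shows "conjugate_symbol_hom (\<phi>T (v x)) = star CD (fourier_transform (point_mass x))"
  unfolding \<phi>T(3)[OF x] conjugate_symbol_hom_toeplitz_op[OF x] fourier_transform_point_mass
  by (auto simp: dual_eval_def dual_group_D fun_eq_iff)

lemma diagonal_hom: "(\<lambda>a. conjugate_symbol_hom (\<phi>T a)) \<in> cstar_hom A CD"
  by (rule cstar_morphism.hom[OF cstar_morphism_comp[OF T.cstar_morphism_axioms conjugate_symbol_morphism]])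

end

theorem proposition4p1:
  fixes A :: "'a cstar"
    and iB :: "('g::linordered_ab_group_add \<Rightarrow> complex) \<Rightarrow> 'a"
    and v :: "'g \<Rightarrow> 'a"
  assumes "is_piso_crossed_product TYPE(('g \<Rightarrow> complex) \<Rightarrow> ('g \<Rightarrow> complex)) A iB v"
  shows "\<exists>(\<phi>T :: 'a \<Rightarrow> ('g \<Rightarrow> complex) \<Rightarrow> ('g \<Rightarrow> complex)) \<phi>Ts
           (\<psi>T :: (('g \<Rightarrow> complex) \<Rightarrow> ('g \<Rightarrow> complex)) \<Rightarrow> ('g \<Rightarrow> complex) \<Rightarrow> complex) \<psi>Ts
           (\<Psi> :: 'a \<Rightarrow> ('g \<Rightarrow> complex) \<Rightarrow> complex).
     let kerT = a_kernel A toeplitz_algebra \<phi>T;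
         kerTs = a_kernel A toeplitz_algebra \<phi>Ts
     in
     \<phi>T \<in> cstar_hom A toeplitz_algebra \<and>
     (\<forall>x\<ge>0. \<phi>T (v x) = toeplitz_op x) \<and>
     \<phi>Ts \<in> cstar_hom A toeplitz_algebra \<and>
     (\<forall>x\<ge>0. \<phi>Ts (v x) = star toeplitz_algebra (toeplitz_op x)) \<and>
     \<psi>T \<in> cstar_hom toeplitz_algebra C_dual \<and>
     (\<forall>x\<ge>0. \<psi>T (toeplitz_op x) = dual_eval x) \<and>
     \<psi>Ts \<in> cstar_hom toeplitz_algebra C_dual \<and>
     (\<forall>x\<ge>0. \<psi>Ts (toeplitz_op x) = dual_eval (- x)) \<and>
     cstar_short_exact (A\<lparr>carrier := kerT \<inter> kerTs\<rparr>) id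
       (A\<lparr>carrier := kerTs\<rparr>) \<phi>T toeplitz_commutator_ideal \<and>
     cstar_short_exact (A\<lparr>carrier := kerT\<rparr>) id A \<phi>T toeplitz_algebra \<and>
     cstar_short_exact toeplitz_commutator_ideal id toeplitz_algebra \<psi>T C_dual \<and>
     cstar_short_exact (A\<lparr>carrier := kerT \<inter> kerTs\<rparr>) id
       (A\<lparr>carrier := kerT\<rparr>) \<phi>Ts toeplitz_commutator_ideal \<and>
     cstar_short_exact (A\<lparr>carrier := kerTs\<rparr>) id A \<phi>Ts toeplitz_algebra \<and>
     cstar_short_exact toeplitz_commutator_ideal id toeplitz_algebra \<psi>Ts C_dual \<and>
     \<Psi> \<in> cstar_hom A C_dual \<and>
     (\<forall>a\<in>carrier A. \<Psi> a = \<psi>Ts (\<phi>T a) \<and> \<Psi> a = \<psi>T (\<phi>Ts a)) \<and>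
     (\<forall>x\<ge>0. \<Psi> (v x) = star C_dual (fourier_transform (point_mass x)))"
proof -
  interpret T: toeplitz_context "TYPE('g)" .
  have cov: "covariant_pair A iB v"
    and gen: "cstar_generated A (iB ` carrier B_cone \<union> v ` {0..}) = carrier A"
    and univ: "\<And>(D :: (('g \<Rightarrow> complex) \<Rightarrow> 'g \<Rightarrow> complex) cstar) \<pi> V. covariant_pair D \<pi> V \<Longrightarrow>
      \<exists>\<phi>\<in>cstar_hom A D. (\<forall>b\<in>carrier B_cone. \<phi> (iB b) = \<pi> b) \<and> (\<forall>x\<ge>0. \<phi> (v x) = V x)"
    using assms unfolding is_piso_crossed_product_def by simp_all
  from univ[OF T.toeplitz_covariant_pair]
  obtain \<phi>T where \<phi>T: "\<phi>T \<in> cstar_hom A T.TA" "\<forall>b\<in>carrier B_cone. \<phi>T (iB b) = T.mult_op b"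
    "\<forall>x\<ge>0. \<phi>T (v x) = toeplitz_op x" by (elim bexE conjE)
  from univ[OF T.toeplitz_star_covariant_pair]
  obtain \<phi>Ts where \<phi>Ts: "\<phi>Ts \<in> cstar_hom A T.TA" "\<forall>b\<in>carrier B_cone. \<phi>Ts (iB b) = T.limit_rep b"
    "\<forall>x\<ge>0. \<phi>Ts (v x) = star T.TA (toeplitz_op x)" by (elim bexE conjE)
  interpret P: piso_crossed_product "TYPE('g)" A iB v \<phi>T \<phi>Ts
    by (intro piso_crossed_product.intro cov gen \<phi>T(1) \<phi>Ts(1) bspec[OF \<phi>T(2)] bspec[OF \<phi>Ts(2)])
      (simp_all only: \<phi>T(3) \<phi>Ts(3))
  show ?thesis
    unfolding Let_def
    apply (rule exI[of _ \<phi>T])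
    apply (rule exI[of _ \<phi>Ts])
    apply (rule exI[of _ toeplitz_symbol_hom])
    apply (rule exI[of _ T.conjugate_symbol_hom])
    apply (rule exI[of _ "\<lambda>a. T.conjugate_symbol_hom (\<phi>T a)"])
    apply (intro conjI)
    subgoal by (rule \<phi>T(1))
    subgoal by (rule \<phi>T(3))
    subgoal by (rule \<phi>Ts(1))
    subgoal by (rule \<phi>Ts(3))
    subgoal by (rule toeplitz_symbol_hom(1))
    subgoal by (intro allI impI toeplitz_symbol_hom_toeplitz_op)
    subgoal by (rule cstar_morphism.hom[OF T.conjugate_symbol_morphism])
    subgoal by (intro allI impI T.conjugate_symbol_hom_toeplitz_op)
    subgoal by (rule P.kernel_rows_exact(1))
    subgoal by (rule P.T.short_exact_kernel[OF P.\<phi>T_surj])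
    subgoal by (rule T.symbol_rows_exact(1))
    subgoal by (rule P.kernel_rows_exact(2))
    subgoal by (rule P.Ts.short_exact_kernel[OF P.\<phi>Ts_surj])
    subgoal by (rule T.symbol_rows_exact(2))
    subgoal by (rule P.diagonal_hom)
    subgoal by (intro ballI conjI refl P.diagonal_agree)
    subgoal by (intro allI impI P.diagonal_generator)
    done
qed

end
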